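(* Let $\theta\in C^1(\mathbb{R})$ and suppose that $\dot\theta$ has compact support. Let $c_S>0$ be the constant (depending on $\dot\theta$ and $\omega$) in the Sobolev-type inequality $$\|\nabla\Psi\|_{L^2(\Omega_\theta)}^2-E_1\|\Psi\|_{L^2(\Omega_\theta)}^2\ \ge\ c_S\,\frac{\|\Psi\|_{L^2(\Omega_\theta)}^6}{\|\Psi\|_1^4}\qquad\text{for all non-zero }\Psi\in H_0^1(\Omega_\theta)\cap L^2(\Omega_\theta,\rho^{-2}).$$ Then for each time $t\ge0$ we have $$\|S(t)\|_{L^2(\Omega_\theta,\rho^{-2})\to L^2(\Omega_\theta)}\ \le\ \Big(1+\frac{4\,c_S}{\pi^2}\,t\Big)^{-1/4}.$$
   Context: Let $\omega\subset\mathbb{R}^2$ be a nonempty bounded open connected set (no regularity assumed) and $\Omega_0:=\mathbb{R}\times\omega$. For a $C^1$ function $\theta:\mathbb{R}\to\mathbb{R}$ with bounded derivative $\dot\theta$, let $$\mathcal{L}_\theta(x):=\big(x_1,\;x_2\cos\theta(x_1)+x_3\sin\theta(x_1),\;-x_2\sin\theta(x_1)+x_3\cos\theta(x_1)\big),\quad x\in\mathbb{R}^3,$$ and $\Omega_\theta:=\mathcal{L}_\theta(\Omega_0)$, an open set. $-\Delta_D^{\Omega_\theta}$ is the Dirichlet Laplacian in $L^2(\Omega_\theta)$, i.e. the self-adjoint operator associated with the form $\|\nabla\Psi\|^2_{L^2(\Omega_\theta)}$, $\Psi\in H_0^1(\Omega_\theta)$. $E_1$ is the first eigenvalue of the Dirichlet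 Laplacian in $\omega$. $S(t):=e^{(\Delta_D^{\Omega_\theta}+E_1)t}$, $t\ge0$. $\rho(x):=1/\sqrt{1+x_1^2}$, and $L^2(\Omega_\theta,\rho^{-2})$ is the weighted space with norm $\|\rho^{-1}\Psi\|_{L^2(\Omega_\theta)}$. Finally, $$\|\Psi\|_1:=\sqrt{\int_\omega dx_2\,dx_3\left(\int_{\mathbb{R}}dx_1\,|(\Psi\circ\mathcal{L}_\theta)(x)|\right)^2}.$$ The paper shows that a positive constant $c_S$ with the stated property exists. *)

theory Defs
  imports "HOL-Analysis.Analysis"
begin

text \<open>
  \<open>\<real>\<^sup>2\<close> and \<open>\<real>\<^sup>3\<close> are the Euclidean spaces \<^typ>\<open>real \<times> real\<close> and \<^typ>\<open>real \<times> real \<times> real\<close>.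
  Elements of \<open>L\<^sup>2(\<Omega>)\<close> are represented by complex-valued functions on the ambient space of
  which only the values on \<open>\<Omega>\<close> matter; representatives are Borel measurable on \<open>\<Omega>\<close>, and
  equality is equality almost everywhere on \<open>\<Omega>\<close>.
\<close>

section \<open>Lebesgue and Sobolev spaces on an open set\<close>

definition L2 :: "'a::euclidean_space set \<Rightarrow> ('a \<Rightarrow> complex) set" where
  "L2 \<Omega> = {f. set_borel_measurable lborel \<Omega> f \<and> set_integrable lborel \<Omega> (\<lambda>x. (norm (f x))\<^sup>2)}"

definition L2_norm :: "'a::euclidean_space set \<Rightarrow> ('a \<Rightarrow> complex) \<Rightarrow> real" where
  "L2_norm \<Omega> f = sqrt (LINT x:\<Omega>|lborel. (norm (f x))\<^sup>2)"

abbreviation zero_ae :: "'a::euclidean_space set \<Rightarrow> ('a \<Rightarrow> complex) \<Rightarrow> bool" where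
  "zero_ae \<Omega> f \<equiv> (AE x\<in>\<Omega> in lborel. f x = 0)"

definition partial :: "'a::euclidean_space \<Rightarrow> ('a \<Rightarrow> complex) \<Rightarrow> 'a \<Rightarrow> complex" where
  "partial b f = (\<lambda>x. frechet_derivative f (at x) b)"

text \<open>\<open>C\<^sup>\<infinity>\<close>: every iterated partial derivative (of any order, in any sequence of coordinate
  directions) is differentiable everywhere, hence also continuous.\<close>

definition smooth :: "('a::euclidean_space \<Rightarrow> complex) \<Rightarrow> bool" where
  "smooth f \<longleftrightarrow> (\<forall>bs\<in>lists Basis. \<forall>x. foldr partial bs f differentiable (at x))"

definition test_functions :: "'a::euclidean_space set \<Rightarrow> ('a \<Rightarrow> complex) set" where
  "test_functions \<Omega> = {\<phi>. smooth \<phi> \<and> compact (closure {x. \<phi> x \<noteq> 0}) \<and> closure {x. \<phi> x \<noteq> 0} \<subseteq> \<Omega>}"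

definition has_weak_partial ::
    "'a::euclidean_space set \<Rightarrow> 'a \<Rightarrow> ('a \<Rightarrow> complex) \<Rightarrow> ('a \<Rightarrow> complex) \<Rightarrow> bool" where
  "has_weak_partial \<Omega> b f g \<longleftrightarrow> f \<in> L2 \<Omega> \<and> g \<in> L2 \<Omega> \<and>
     (\<forall>\<phi>\<in>test_functions \<Omega>. (LINT x:\<Omega>|lborel. f x * partial b \<phi> x) = - (LINT x:\<Omega>|lborel. g x * \<phi> x))"

text \<open>A representative of the weak partial derivative, which is unique almost everywhere.\<close>

definition weak_partial :: "'a::euclidean_space set \<Rightarrow> 'a \<Rightarrow> ('a \<Rightarrow> complex) \<Rightarrow> 'a \<Rightarrow> complex" where
  "weak_partial \<Omega> b f = (SOME g. has_weak_partial \<Omega> b f g)"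

definition H1 :: "'a::euclidean_space set \<Rightarrow> ('a \<Rightarrow> complex) set" where
  "H1 \<Omega> = {f \<in> L2 \<Omega>. \<forall>b\<in>Basis. \<exists>g. has_weak_partial \<Omega> b f g}"

definition grad_norm :: "'a::euclidean_space set \<Rightarrow> ('a \<Rightarrow> complex) \<Rightarrow> real" where
  "grad_norm \<Omega> f = sqrt (LINT x:\<Omega>|lborel. (\<Sum>b\<in>Basis. (norm (weak_partial \<Omega> b f x))\<^sup>2))"

definition H1_norm :: "'a::euclidean_space set \<Rightarrow> ('a \<Rightarrow> complex) \<Rightarrow> real" where
  "H1_norm \<Omega> f = sqrt ((L2_norm \<Omega> f)\<^sup>2 + (grad_norm \<Omega> f)\<^sup>2)"

text \<open>The closure of the test functions in \<open>H\<^sup>1\<close>.\<close>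

definition H10 :: "'a::euclidean_space set \<Rightarrow> ('a \<Rightarrow> complex) set" where
  "H10 \<Omega> = {f \<in> H1 \<Omega>. \<exists>\<phi>::nat \<Rightarrow> 'a \<Rightarrow> complex. (\<forall>n. \<phi> n \<in> test_functions \<Omega>) \<and>
      (\<lambda>n. H1_norm \<Omega> (\<lambda>x. \<phi> n x - f x)) \<longlonglongrightarrow> 0}"

section \<open>The Dirichlet Laplacian\<close>

text \<open>The graph \<open>-\<Delta>\<^sub>D u = f\<close> of the self-adjoint operator associated with the form
  \<open>\<parallel>\<nabla>u\<parallel>\<^sup>2\<close> on \<open>H\<^sup>1\<^sub>0(\<Omega>)\<close> (first representation theorem).\<close>

definition dirichlet_laplacian ::
    "'a::euclidean_space set \<Rightarrow> ('a \<Rightarrow> complex) \<Rightarrow> ('a \<Rightarrow> complex) \<Rightarrow> bool" where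
  "dirichlet_laplacian \<Omega> u f \<longleftrightarrow> u \<in> H10 \<Omega> \<and> f \<in> L2 \<Omega> \<and>
     (\<forall>v\<in>H10 \<Omega>. (LINT x:\<Omega>|lborel. (\<Sum>b\<in>Basis. cnj (weak_partial \<Omega> b v x) * weak_partial \<Omega> b u x))
               = (LINT x:\<Omega>|lborel. cnj (v x) * f x))"

definition dirichlet_eigenvalue :: "'a::euclidean_space set \<Rightarrow> real \<Rightarrow> bool" where
  "dirichlet_eigenvalue \<Omega> \<mu> \<longleftrightarrow>
     (\<exists>u. dirichlet_laplacian \<Omega> u (\<lambda>x. of_real \<mu> * u x) \<and> \<not> zero_ae \<Omega> u)"

definition first_dirichlet_eigenvalue :: "'a::euclidean_space set \<Rightarrow> real" where
  "first_dirichlet_eigenvalue \<Omega> = (LEAST \<mu>. dirichlet_eigenvalue \<Omega> \<mu>)"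

section \<open>Operator semigroups on \<open>L\<^sup>2(\<Omega>)\<close>\<close>

text \<open>A bounded linear operator on \<open>L\<^sup>2(\<Omega>)\<close>; it respects equality almost everywhere because of
  linearity and the norm bound.\<close>

definition L2_bounded_operator ::
    "'a::euclidean_space set \<Rightarrow> (('a \<Rightarrow> complex) \<Rightarrow> ('a \<Rightarrow> complex)) \<Rightarrow> bool" where
  "L2_bounded_operator \<Omega> T \<longleftrightarrow>
     (\<forall>f\<in>L2 \<Omega>. T f \<in> L2 \<Omega>) \<and>
     (\<forall>f\<in>L2 \<Omega>. \<forall>g\<in>L2 \<Omega>. AE x\<in>\<Omega> in lborel. T (\<lambda>y. f y + g y) x = T f x + T g x) \<and>
     (\<forall>c. \<forall>f\<in>L2 \<Omega>. AE x\<in>\<Omega> in lborel. T (\<lambda>y. c * f y) x = c * T f x) \<and>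
     (\<exists>K. \<forall>f\<in>L2 \<Omega>. L2_norm \<Omega> (T f) \<le> K * L2_norm \<Omega> f)"

definition C0_semigroup ::
    "'a::euclidean_space set \<Rightarrow> (real \<Rightarrow> ('a \<Rightarrow> complex) \<Rightarrow> ('a \<Rightarrow> complex)) \<Rightarrow> bool" where
  "C0_semigroup \<Omega> S \<longleftrightarrow>
     (\<forall>t\<ge>0. L2_bounded_operator \<Omega> (S t)) \<and>
     (\<forall>f\<in>L2 \<Omega>. AE x\<in>\<Omega> in lborel. S 0 f x = f x) \<and>
     (\<forall>s\<ge>0. \<forall>t\<ge>0. \<forall>f\<in>L2 \<Omega>. AE x\<in>\<Omega> in lborel. S (s + t) f x = S s (S t f) x) \<and>
     (\<forall>f\<in>L2 \<Omega>. ((\<lambda>t. L2_norm \<Omega> (\<lambda>x. S t f x - f x)) \<longlongrightarrow> 0) (at_right 0))"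

text \<open>The graph of the infinitesimal generator.\<close>

definition generator ::
    "'a::euclidean_space set \<Rightarrow> (real \<Rightarrow> ('a \<Rightarrow> complex) \<Rightarrow> ('a \<Rightarrow> complex)) \<Rightarrow>
     ('a \<Rightarrow> complex) \<Rightarrow> ('a \<Rightarrow> complex) \<Rightarrow> bool" where
  "generator \<Omega> S f g \<longleftrightarrow> f \<in> L2 \<Omega> \<and> g \<in> L2 \<Omega> \<and>
     ((\<lambda>t. L2_norm \<Omega> (\<lambda>x. (S t f x - f x) / of_real t - g x)) \<longlongrightarrow> 0) (at_right 0)"

text \<open>\<open>S t = exp (t A)\<close>, where the operator \<open>A\<close> is given by its graph.\<close>

definition generates ::
    "'a::euclidean_space set \<Rightarrow> (('a \<Rightarrow> complex) \<Rightarrow> ('a \<Rightarrow> complex) \<Rightarrow> bool) \<Rightarrow>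
     (real \<Rightarrow> ('a \<Rightarrow> complex) \<Rightarrow> ('a \<Rightarrow> complex)) \<Rightarrow> bool" where
  "generates \<Omega> A S \<longleftrightarrow> C0_semigroup \<Omega> S \<and> (\<forall>f g. generator \<Omega> S f g \<longleftrightarrow> A f g)"

text \<open>The graph \<open>g = (\<Delta>\<^sub>D + E) f\<close>.\<close>

definition shifted_laplacian ::
    "'a::euclidean_space set \<Rightarrow> real \<Rightarrow> ('a \<Rightarrow> complex) \<Rightarrow> ('a \<Rightarrow> complex) \<Rightarrow> bool" where
  "shifted_laplacian \<Omega> E f g \<longleftrightarrow> dirichlet_laplacian \<Omega> f (\<lambda>x. of_real E * f x - g x)"

section \<open>Twisted tubes\<close>

definition twist :: "(real \<Rightarrow> real) \<Rightarrow> real \<times> real \<times> real \<Rightarrow> real \<times> real \<times> real" where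
  "twist \<theta> = (\<lambda>(x\<^sub>1, x\<^sub>2, x\<^sub>3).
     (x\<^sub>1, x\<^sub>2 * cos (\<theta> x\<^sub>1) + x\<^sub>3 * sin (\<theta> x\<^sub>1), - x\<^sub>2 * sin (\<theta> x\<^sub>1) + x\<^sub>3 * cos (\<theta> x\<^sub>1)))"

definition tube :: "(real \<times> real) set \<Rightarrow> (real \<Rightarrow> real) \<Rightarrow> (real \<times> real \<times> real) set" where
  "tube \<omega> \<theta> = twist \<theta> ` (UNIV \<times> \<omega>)"

definition rho :: "real \<times> real \<times> real \<Rightarrow> real" where
  "rho x = 1 / sqrt (1 + (fst x)\<^sup>2)"

definition L2_weighted :: "(real \<times> real \<times> real) set \<Rightarrow> (real \<times> real \<times> real \<Rightarrow> complex) set" where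
  "L2_weighted \<Omega> = {\<Psi>. (\<lambda>x. of_real (inverse (rho x)) * \<Psi> x) \<in> L2 \<Omega>}"

definition L2_weighted_norm ::
    "(real \<times> real \<times> real) set \<Rightarrow> (real \<times> real \<times> real \<Rightarrow> complex) \<Rightarrow> real" where
  "L2_weighted_norm \<Omega> \<Psi> = L2_norm \<Omega> (\<lambda>x. of_real (inverse (rho x)) * \<Psi> x)"

text \<open>Used only for \<open>\<Psi>\<close> in \<open>L\<^sup>2(\<Omega>\<^sub>\<theta>, \<rho>\<^sup>-\<^sup>2)\<close>, where the inner integral is finite for almost every
  \<open>x'\<close> and the outer one is finite.\<close>

definition norm_1 ::
    "(real \<times> real) set \<Rightarrow> (real \<Rightarrow> real) \<Rightarrow> (real \<times> real \<times> real \<Rightarrow> complex) \<Rightarrow> real" where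
  "norm_1 \<omega> \<theta> \<Psi> =
     sqrt (LINT x':\<omega>|lborel. (LINT x\<^sub>1|lborel. norm ((\<Psi> \<circ> twist \<theta>) (x\<^sub>1, x')))\<^sup>2)"

text \<open>The operator norm \<open>L\<^sup>2(\<Omega>, \<rho>\<^sup>-\<^sup>2) \<rightarrow> L\<^sup>2(\<Omega>)\<close>, with value \<open>\<infinity>\<close> for unbounded \<open>T\<close>.\<close>

definition weighted_operator_norm ::
    "(real \<times> real \<times> real) set \<Rightarrow>
     ((real \<times> real \<times> real \<Rightarrow> complex) \<Rightarrow> (real \<times> real \<times> real \<Rightarrow> complex)) \<Rightarrow> ennreal" where
  "weighted_operator_norm \<Omega> T =
     (SUP \<Psi>\<in>{\<Psi> \<in> L2_weighted \<Omega>. \<not> zero_ae \<Omega> \<Psi>}. ennreal (L2_norm \<Omega> (T \<Psi>) / L2_weighted_norm \<Omega> \<Psi>))"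

end

theory Submission
  imports Defs "HOL-Computational_Algebra.Polynomial"
begin

text \<open>
  Set \<open>u(t) = S(t)\<Psi>\<close>. The substitute for an \<open>L\<^sup>1\<close> contraction is a quadratic functional: if \<open>P(t, x\<^sub>1)\<close> is a
  positive solution of the heat equation on the line, then \<open>\<integral> |u(t)|\<^sup>2 / P(t, x\<^sub>1)\<close> is nonincreasing, because its
  derivative is at most \<open>-2 \<integral> |\<partial>\<^sub>1 u - (\<partial>\<^sub>1 P / P) u|\<^sup>2 / P\<close>. This uses only that every slice of the tube, being a
  rotated copy of \<open>\<omega>\<close>, satisfies the Poincare inequality with constant \<open>E\<^sub>1\<close>; the latter is read off from the
  Sobolev hypothesis by testing it with wide product functions in the end of the tube where \<open>\<theta>\<close> is constant.
  Starting \<open>P\<close> at the Cauchy density \<open>1 / (\<pi> (1 + x\<^sub>1\<^sup>2))\<close>, the Cauchy-Schwarz inequality in \<open>x\<^sub>1\<close> gives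
  \<open>\<parallel>u(t)\<parallel>\<^sub>1\<^sup>2 \<le> \<integral> |u(t)|\<^sup>2 / P \<le> \<pi> \<parallel>\<rho>\<^sup>-\<^sup>1 \<Psi>\<parallel>\<^sup>2\<close>. The Sobolev inequality then turns
  \<open>d/dt \<parallel>u\<parallel>\<^sup>2 = -2 (\<parallel>\<nabla>u\<parallel>\<^sup>2 - E\<^sub>1 \<parallel>u\<parallel>\<^sup>2)\<close> into \<open>y' \<le> -2 c y\<^sup>3 / M\<^sup>2\<close>, which integrates to the claim.

  Three regularisations make this rigorous: \<open>P\<close> is a finite sum of Gaussians plus a small constant, so that
  \<open>1 / P\<close> is bounded and smooth; the norm of \<open>u\<close> is cut off by the weight \<open>1 / (1 + \<eta>\<^sup>2 x\<^sub>1\<^sup>2)\<close>, so that the Sobolev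
  hypothesis applies; and \<open>\<Psi>\<close> is approximated by elements of the generator domain.
\<close>


section \<open>The real Hilbert space of square integrable functions\<close>

text \<open>The norm \<open>norm_1\<close> is L1 along the axis and L2 across it, and in
  straightened coordinates the Laplacian couples the two directions, so the usual proof of an L1
  contraction does not carry over directly. A weight in x1 alone is compatible with the geometry:
  twisting fixes x1 and only rotates the slices. Constants: let w be the weighted norm of the datum
  and y the squared norm of the solution. The square of \<open>norm_1\<close> is at most \<pi> w^2,
  hence y' \<le> - 2 c y^3 / (\<pi>^2 w^4), and y^(-2) grows at rate at least 4 c / (\<pi>^2 w^4).
  It starts at w^(-4) or above, because y(0) \<le> w^2. So y(t)^2 \<le> w^4 / (1 + 4 c t / \<pi>^2),
  and y^2 is the fourth power of the norm, whence the exponent - 1/4. The regularisations share one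
  parameter \<eta>: the constant added to P is \<eta>^2, since its mass against the squared cutoff
  is of order \<eta>^2 / \<eta>.\<close>

definition sq_int :: "('a::euclidean_space \<Rightarrow> complex) \<Rightarrow> bool" where
  "sq_int f \<longleftrightarrow> f \<in> borel_measurable lborel \<and> integrable lborel (\<lambda>x. (norm (f x))\<^sup>2)"

lemma sq_int_measurable [measurable_dest]: "sq_int f \<Longrightarrow> f \<in> borel_measurable lborel"
  by (simp add: sq_int_def)

lemma sq_int_0: "sq_int (\<lambda>x. 0)"
  by (simp add: sq_int_def)

lemma sq_int_bound:
  assumes f: "sq_int f" and g: "g \<in> borel_measurable lborel"
    and le: "AE x in lborel. norm (g x) \<le> C * norm (f x)"
  shows "sq_int g"
proof -
  have "integrable lborel (\<lambda>x. C\<^sup>2 * (norm (f x))\<^sup>2)"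
    using f by (simp add: sq_int_def)
  then have "integrable lborel (\<lambda>x. (norm (g x))\<^sup>2)"
  proof (rule Bochner_Integration.integrable_bound)
    show "(\<lambda>x. (norm (g x))\<^sup>2) \<in> borel_measurable lborel"
      using g by measurable
    show "AE x in lborel. norm ((norm (g x))\<^sup>2) \<le> norm (C\<^sup>2 * (norm (f x))\<^sup>2)"
      using le by eventually_elim
        (use power_mono in \<open>fastforce simp: power_mult_distrib[symmetric]\<close>)
  qed
  with g show ?thesis by (simp add: sq_int_def)
qed

lemma sq_int_add:
  assumes f: "sq_int f" and g: "sq_int g"
  shows "sq_int (\<lambda>x. f x + g x)"
proof -
  have [measurable]: "f \<in> borel_measurable lborel" "g \<in> borel_measurable lborel"
    using f g by (auto simp: sq_int_def)
  have "integrable lborel (\<lambda>x. 2 * (norm (f x))\<^sup>2 + 2 * (norm (g x))\<^sup>2)"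
    using f g by (simp add: sq_int_def)
  then have "integrable lborel (\<lambda>x. (norm (f x + g x))\<^sup>2)"
  proof (rule Bochner_Integration.integrable_bound)
    show "AE x in lborel. norm ((norm (f x + g x))\<^sup>2) \<le> norm (2 * (norm (f x))\<^sup>2 + 2 * (norm (g x))\<^sup>2)"
    proof (rule AE_I2)
      fix x
      have "(norm (f x + g x))\<^sup>2 \<le> (norm (f x) + norm (g x))\<^sup>2"
        by (simp add: norm_triangle_ineq power_mono)
      also have "\<dots> \<le> 2 * (norm (f x))\<^sup>2 + 2 * (norm (g x))\<^sup>2"
        using sum_squares_bound[of "norm (f x)" "norm (g x)"]
        by (simp add: power2_sum)
      finally show "norm ((norm (f x + g x))\<^sup>2) \<le> norm (2 * (norm (f x))\<^sup>2 + 2 * (norm (g x))\<^sup>2)"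
        by simp
    qed
  qed simp
  then show ?thesis by (simp add: sq_int_def)
qed

lemma sq_int_cmult: "sq_int f \<Longrightarrow> sq_int (\<lambda>x. c * f x)"
  by (rule sq_int_bound[where C="norm c"]) (auto simp: norm_mult sq_int_def)

lemma sq_int_scaleR: "sq_int f \<Longrightarrow> sq_int (\<lambda>x. c *\<^sub>R f x)"
  by (rule sq_int_bound[where C="\<bar>c\<bar>"]) (auto simp: sq_int_def)

lemma sq_int_minus: "sq_int f \<Longrightarrow> sq_int (\<lambda>x. - f x)"
  using sq_int_scaleR[of f "-1"] by simp

lemma sq_int_diff: "sq_int f \<Longrightarrow> sq_int g \<Longrightarrow> sq_int (\<lambda>x. f x - g x)"
  using sq_int_add[of f "\<lambda>x. - g x"] sq_int_minus by auto

lemma sq_int_norm: "sq_int f \<Longrightarrow> sq_int (\<lambda>x. complex_of_real (norm (f x)))"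
  by (rule sq_int_bound[where C=1]) (auto simp: sq_int_def)

lemma integrable_sq_int_mult:
  fixes f g :: "'a::euclidean_space \<Rightarrow> complex"
  assumes "sq_int f" "sq_int g"
  shows "integrable lborel (\<lambda>x. f x * g x)"
proof -
  have [measurable]: "f \<in> borel_measurable lborel" "g \<in> borel_measurable lborel"
    using assms by (auto simp: sq_int_def)
  have "integrable lborel (\<lambda>x. (norm (f x))\<^sup>2 + (norm (g x))\<^sup>2)"
    using assms by (simp add: sq_int_def)
  then show ?thesis
  proof (rule Bochner_Integration.integrable_bound)
    show "AE x in lborel. norm (f x * g x) \<le> norm ((norm (f x))\<^sup>2 + (norm (g x))\<^sup>2)"
    proof (rule AE_I2)
      fix x
      have "norm (f x) * norm (g x) \<le> (norm (f x))\<^sup>2 + (norm (g x))\<^sup>2"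
        using sum_squares_bound[of "norm (f x)" "norm (g x)"]
          mult_nonneg_nonneg[OF norm_ge_zero[of "f x"] norm_ge_zero[of "g x"]] by linarith
      then show "norm (f x * g x) \<le> norm ((norm (f x))\<^sup>2 + (norm (g x))\<^sup>2)"
        by (simp add: norm_mult)
    qed
  qed simp
qed

lemma inner_complex_Re: "inner (z::complex) w = Re (cnj z * w)"
  by (simp add: inner_complex_def)

lemma sq_int_cnj: "sq_int f \<Longrightarrow> sq_int (\<lambda>x. cnj (f x))"
  by (rule sq_int_bound[where C=1])
    (auto simp: sq_int_def intro: measurable_compose[OF _ borel_measurable_continuous_onI[OF continuous_on_cnj[OF continuous_on_id]]])

lemma integrable_sq_int_inner:
  assumes "sq_int f" "sq_int g"
  shows "integrable lborel (\<lambda>x. inner (f x) (g x))"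
  unfolding inner_complex_Re
  by (intro integrable_Re integrable_sq_int_mult sq_int_cnj assms)

\<comment> \<open>The relation is reflexive exactly on the square integrable functions, so the
  quotient is partial and every element of \<open>l2\<close> has a square integrable representative.
  The underlying domain is the whole space; functions on \<Omega> enter through extension by
  zero.\<close>
quotient_type (overloaded) 'a l2 = "'a::euclidean_space \<Rightarrow> complex" / partial:
  "\<lambda>f g. sq_int f \<and> sq_int g \<and> (AE x in lborel. f x = g x)"
proof (rule part_equivpI)
  show "\<exists>x::'a \<Rightarrow> complex. sq_int x \<and> sq_int x \<and> (AE xa in lborel. x xa = x xa)"
    by (rule exI[of _ "\<lambda>x. 0"]) (simp add: sq_int_0)
  show "symp (\<lambda>f g. sq_int f \<and> sq_int g \<and> (AE x in lborel. f (x::'a) = g x))"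
    by (auto simp: symp_def eq_commute)
  show "transp (\<lambda>f g. sq_int f \<and> sq_int g \<and> (AE x in lborel. f (x::'a) = g x))"
    unfolding transp_def by (auto elim: AE_mp)
qed

abbreviation cls :: "('a::euclidean_space \<Rightarrow> complex) \<Rightarrow> 'a l2" where "cls \<equiv> abs_l2"

lemma sq_int_rep: "sq_int (rep_l2 F)"
  using Quotient3_rep_reflp[OF Quotient3_l2] by auto

lemma cls_rep [simp]: "cls (rep_l2 F) = F"
  by (rule Quotient3_abs_rep[OF Quotient3_l2])

lemma cls_eq_iff: "sq_int f \<Longrightarrow> sq_int g \<Longrightarrow> cls f = cls g \<longleftrightarrow> (AE x in lborel. f x = g x)"
  using Quotient3_rel[OF Quotient3_l2, of f g] by auto

lemma rep_cls: "sq_int f \<Longrightarrow> AE x in lborel. rep_l2 (cls f) x = f x"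
  using cls_eq_iff[OF sq_int_rep] by (metis cls_rep)

instantiation l2 :: (euclidean_space) real_inner
begin

lift_definition zero_l2 :: "'a l2" is "\<lambda>x. 0"
  by (simp add: sq_int_0)

lift_definition plus_l2 :: "'a l2 \<Rightarrow> 'a l2 \<Rightarrow> 'a l2" is "\<lambda>f g x. f x + g x"
  by (auto intro: sq_int_add)

lift_definition minus_l2 :: "'a l2 \<Rightarrow> 'a l2 \<Rightarrow> 'a l2" is "\<lambda>f g x. f x - g x"
  by (auto intro: sq_int_diff)

lift_definition uminus_l2 :: "'a l2 \<Rightarrow> 'a l2" is "\<lambda>f x. - f x"
  by (auto intro: sq_int_minus)

lift_definition scaleR_l2 :: "real \<Rightarrow> 'a l2 \<Rightarrow> 'a l2" is "\<lambda>c f x. c *\<^sub>R f x"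
  by (auto intro: sq_int_scaleR)

text \<open>On \<open>complex\<close> the operation \<open>inner\<close> is Re (cnj z w), so this is
  the real part of the complex scalar product, and \<open>l2\<close> is a complex space seen as a
  real one.\<close>

lift_definition inner_l2 :: "'a l2 \<Rightarrow> 'a l2 \<Rightarrow> real" is "\<lambda>f g. (LINT x|lborel. inner (f x) (g x))"
proof -
  fix f f' g g' :: "'a \<Rightarrow> complex"
  assume f: "sq_int f \<and> sq_int f' \<and> (AE x in lborel. f x = f' x)"
    and g: "sq_int g \<and> sq_int g' \<and> (AE x in lborel. g x = g' x)"
  have [measurable]: "f \<in> borel_measurable lborel" "f' \<in> borel_measurable lborel"
    "g \<in> borel_measurable lborel" "g' \<in> borel_measurable lborel"
    using f g by (auto simp: sq_int_def)
  have "AE x in lborel. f x = f' x" "AE x in lborel. g x = g' x" using f g by auto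
  then have "AE x in lborel. inner (f x) (g x) = inner (f' x) (g' x)"
    by eventually_elim simp
  then show "(LINT x|lborel. inner (f x) (g x)) = (LINT x|lborel. inner (f' x) (g' x))"
    by (intro integral_cong_AE) auto
qed

definition norm_l2 :: "'a l2 \<Rightarrow> real" where "norm_l2 F = sqrt (inner F F)"
definition dist_l2 :: "'a l2 \<Rightarrow> 'a l2 \<Rightarrow> real" where "dist_l2 F G = norm (F - G)"
definition sgn_l2 :: "'a l2 \<Rightarrow> 'a l2" where "sgn_l2 F = scaleR (inverse (norm F)) F"
definition uniformity_l2 :: "('a l2 \<times> 'a l2) filter"
  where "uniformity_l2 = (INF e\<in>{0<..}. principal {(x, y). dist x y < e})"
definition open_l2 :: "'a l2 set \<Rightarrow> bool"
  where "open_l2 U = (\<forall>x\<in>U. eventually (\<lambda>(x', y). x' = x \<longrightarrow> y \<in> U) uniformity)"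

instance
proof
  fix x y z :: "'a l2" and a b r :: real and U :: "'a l2 set"
  show "dist x y = norm (x - y)" by (rule dist_l2_def)
  show "sgn x = scaleR (inverse (norm x)) x" by (rule sgn_l2_def)
  show "uniformity = (INF e\<in>{0<..}. principal {(x, y). dist x (y::'a l2) < e})" by (rule uniformity_l2_def)
  show "open U = (\<forall>x\<in>U. \<forall>\<^sub>F (x', y) in uniformity. x' = x \<longrightarrow> y \<in> U)" by (rule open_l2_def)
  show "norm x = sqrt (inner x x)" by (rule norm_l2_def)
  show "x + y + z = x + (y + z)" by transfer (auto simp: add.assoc intro!: sq_int_add)
  show "x + y = y + x" by transfer (auto simp: add.commute intro!: sq_int_add)
  show "0 + x = x" by transfer (auto simp: sq_int_def)
  show "- x + x = 0" by transfer (auto simp: sq_int_0)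
  show "x - y = x + - y" by transfer (auto intro!: sq_int_add sq_int_minus sq_int_diff)
  show "a *\<^sub>R (x + y) = a *\<^sub>R x + a *\<^sub>R y"
    by transfer (auto intro!: sq_int_add sq_int_scaleR simp: scaleR_add_right)
  show "(a + b) *\<^sub>R x = a *\<^sub>R x + b *\<^sub>R x"
    by transfer (auto intro!: sq_int_add sq_int_scaleR simp: scaleR_add_left)
  show "a *\<^sub>R b *\<^sub>R x = (a * b) *\<^sub>R x" by transfer (auto intro!: sq_int_scaleR)
  show "1 *\<^sub>R x = x" by transfer (auto simp: sq_int_def)
  show "inner x y = inner y x" by transfer (simp add: inner_commute)
  show "inner (x + y) z = inner x z + inner y z"
    by transfer (simp add: inner_add_left integrable_sq_int_inner)
  show "inner (r *\<^sub>R x) y = r * inner x y" by transfer simp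
  show "0 \<le> inner x x" by transfer simp
  show "(inner x x = 0) = (x = 0)"
  proof transfer
    fix x :: "'a \<Rightarrow> complex"
    assume x: "sq_int x \<and> sq_int x \<and> (AE xa in lborel. x xa = x xa)"
    have "(LINT xa|lborel. inner (x xa) (x xa)) = 0 \<longleftrightarrow> (AE xa in lborel. inner (x xa) (x xa) = 0)"
      using x by (intro integral_nonneg_eq_0_iff_AE integrable_sq_int_inner) auto
    then show "((LINT xa|lborel. inner (x xa) (x xa)) = 0) =
        (sq_int x \<and> sq_int (\<lambda>x. 0) \<and> (AE xa in lborel. x xa = 0))"
      using x by (simp add: sq_int_0)
  qed
qed

end

lemma zero_l2_cls: "0 = cls (\<lambda>x. 0)"
  by (rule zero_l2.abs_eq)

lemma cls_add: "sq_int f \<Longrightarrow> sq_int g \<Longrightarrow> cls (\<lambda>x. f x + g x) = cls f + cls g"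
  by (simp add: plus_l2.abs_eq)

lemma cls_diff: "sq_int f \<Longrightarrow> sq_int g \<Longrightarrow> cls (\<lambda>x. f x - g x) = cls f - cls g"
  by (simp add: minus_l2.abs_eq)

lemma cls_scaleR: "sq_int f \<Longrightarrow> cls (\<lambda>x. c *\<^sub>R f x) = c *\<^sub>R cls f"
  by (simp add: scaleR_l2.abs_eq)

lemma inner_cls: "sq_int f \<Longrightarrow> sq_int g \<Longrightarrow> inner (cls f) (cls g) = (LINT x|lborel. inner (f x) (g x))"
  by (simp add: inner_l2.abs_eq)

lemma norm_cls: "sq_int f \<Longrightarrow> (norm (cls f))\<^sup>2 = (LINT x|lborel. (norm (f x))\<^sup>2)"
  by (simp add: power2_norm_eq_inner inner_cls)

lemma cls_norm_eq_mono:
  assumes "sq_int f" "sq_int g" "AE x in lborel. norm (f x) \<le> norm (g x)"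
  shows "norm (cls f) \<le> norm (cls g)"
proof -
  have "(norm (cls f))\<^sup>2 \<le> (norm (cls g))\<^sup>2"
    unfolding norm_cls[OF assms(1)] norm_cls[OF assms(2)]
  proof (rule integral_mono_AE)
    show "AE x in lborel. (norm (f x))\<^sup>2 \<le> (norm (g x))\<^sup>2"
      using assms(3) by eventually_elim (simp add: power_mono)
  qed (use assms(1,2) in \<open>auto simp: sq_int_def\<close>)
  then show ?thesis by (rule power2_le_imp_le) simp
qed

lemma nn_integral_sq_int:
  assumes "sq_int f"
  shows "(\<integral>\<^sup>+x. ennreal ((norm (f x))\<^sup>2) \<partial>lborel) = ennreal ((norm (cls f))\<^sup>2)"
  unfolding norm_cls[OF assms]
  using assms by (intro nn_integral_eq_integral) (auto simp: sq_int_def)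

lemma sq_int_nnI:
  assumes "f \<in> borel_measurable lborel" "(\<integral>\<^sup>+x. ennreal ((norm (f x))\<^sup>2) \<partial>lborel) \<le> ennreal C"
  shows "sq_int f"
proof -
  have [measurable]: "f \<in> borel_measurable lborel" by fact
  have "(\<integral>\<^sup>+x. ennreal (norm ((norm (f x))\<^sup>2)) \<partial>lborel) < \<infinity>"
    using assms(2) by (simp add: le_less_trans)
  then have "integrable lborel (\<lambda>x. (norm (f x))\<^sup>2)"
    by (intro integrableI_bounded) auto
  with assms show ?thesis by (simp add: sq_int_def)
qed

lemma sq_int_sum: "(\<And>i. i \<in> I \<Longrightarrow> sq_int (f i)) \<Longrightarrow> sq_int (\<lambda>x. \<Sum>i\<in>I. f i x)"
  by (induction I rule: infinite_finite_induct) (auto simp: sq_int_0 sq_int_add)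

lemma cls_sum: "(\<And>i. i \<in> I \<Longrightarrow> sq_int (f i)) \<Longrightarrow> cls (\<lambda>x. \<Sum>i\<in>I. f i x) = (\<Sum>i\<in>I. cls (f i))"
  by (induction I rule: infinite_finite_induct)
    (auto simp: zero_l2_cls[symmetric] cls_add sq_int_sum)

text \<open>Riesz-Fischer. The sum of the moduli of the increments has L2 norm at most 2, so it is
  finite almost everywhere and the representatives converge pointwise; Fatou's lemma then identifies
  the pointwise limit as the limit in norm.\<close>

lemma l2_converges_fast:
  fixes X :: "nat \<Rightarrow> 'a::euclidean_space l2"
  assumes fast: "\<And>k. norm (X (Suc k) - X k) \<le> (1/2)^k"
  shows "\<exists>L. X \<longlonglongrightarrow> L"
proof -
  define f where "f k = rep_l2 (X k)" for k
  have sq: "sq_int (f k)" for k by (simp add: f_def sq_int_rep)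
  have [measurable]: "f k \<in> borel_measurable lborel" for k using sq by (simp add: sq_int_def)
  define d where "d k x = complex_of_real (norm (f (Suc k) x - f k x))" for k x
  have sqd: "sq_int (d k)" for k
    unfolding d_def by (intro sq_int_norm sq_int_diff sq)
  have [measurable]: "d k \<in> borel_measurable lborel" for k using sqd by (simp add: sq_int_def)
  have nd: "norm (cls (d k)) \<le> (1/2)^k" for k
  proof -
    have "norm (cls (d k)) \<le> norm (cls (\<lambda>x. f (Suc k) x - f k x))"
      by (intro cls_norm_eq_mono sqd sq_int_diff sq) (simp add: d_def)
    also have "cls (\<lambda>x. f (Suc k) x - f k x) = X (Suc k) - X k"
      by (subst cls_diff) (simp_all add: sq, simp add: f_def)
    finally show ?thesis using fast[of k] by simp
  qed
  \<comment> \<open>The triangle inequality in \<open>l2\<close>, applied to the moduli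
    \<open>d k\<close> themselves, bounds the norm of their partial sums by a geometric series with
    sum 2; hence the 4.\<close>
  have part: "(\<integral>\<^sup>+x. ennreal ((\<Sum>k<n. norm (f (Suc k) x - f k x))\<^sup>2) \<partial>lborel) \<le> 4" for n
  proof -
    have "norm (cls (\<lambda>x. \<Sum>k<n. d k x)) \<le> (\<Sum>k<n. norm (cls (d k)))"
      by (subst cls_sum) (auto simp: sqd norm_sum)
    also have "\<dots> \<le> (\<Sum>k<n. (1/2)^k)" by (intro sum_mono nd)
    also have "\<dots> \<le> 2" by (simp add: sum_gp_strict)
    finally have "(norm (cls (\<lambda>x. \<Sum>k<n. d k x)))\<^sup>2 \<le> 2\<^sup>2"
      by (intro power_mono) auto
    then have "(\<integral>\<^sup>+x. ennreal ((norm (\<Sum>k<n. d k x))\<^sup>2) \<partial>lborel) \<le> ennreal 4"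
      by (subst nn_integral_sq_int) (simp_all add: sq_int_sum sqd ennreal_leI del: ennreal_numeral)
    moreover have "norm (\<Sum>k<n. d k x) = (\<Sum>k<n. norm (f (Suc k) x - f k x))" for x
      unfolding d_def of_real_sum[symmetric] by (simp add: sum_nonneg del: of_real_sum)
    ultimately show ?thesis by simp
  qed
  have "(\<integral>\<^sup>+x. (SUP n. ennreal ((\<Sum>k<n. norm (f (Suc k) x - f k x))\<^sup>2)) \<partial>lborel) \<le> 4"
  proof (subst nn_integral_monotone_convergence_SUP)
    show "incseq (\<lambda>n x. ennreal ((\<Sum>k<n. norm (f (Suc k) x - f k x))\<^sup>2))"
      by (auto simp: incseq_def le_fun_def intro!: ennreal_leI power_mono sum_mono2 sum_nonneg)
    show "(SUP n. \<integral>\<^sup>+x. ennreal ((\<Sum>k<n. norm (f (Suc k) x - f k x))\<^sup>2) \<partial>lborel) \<le> 4"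
      using part by (auto intro: SUP_least)
  qed auto
  then have "(\<integral>\<^sup>+x. (SUP n. ennreal ((\<Sum>k<n. norm (f (Suc k) x - f k x))\<^sup>2)) \<partial>lborel) \<noteq> \<infinity>"
    by (auto simp: top_unique)
  then have "AE x in lborel. (SUP n. ennreal ((\<Sum>k<n. norm (f (Suc k) x - f k x))\<^sup>2)) \<noteq> \<infinity>"
    by (intro nn_integral_PInf_AE) auto
  then have conv: "AE x in lborel. convergent (\<lambda>k. f k x)"
  proof eventually_elim
    case (elim x)
    then obtain C where C: "C \<ge> 0" "(SUP n. ennreal ((\<Sum>k<n. norm (f (Suc k) x - f k x))\<^sup>2)) = ennreal C"
      by (cases "SUP n. ennreal ((\<Sum>k<n. norm (f (Suc k) x - f k x))\<^sup>2)" rule: ennreal_cases) auto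
    have "(\<Sum>k<n. norm (f (Suc k) x - f k x)) \<le> sqrt C" for n
    proof -
      have "ennreal ((\<Sum>k<n. norm (f (Suc k) x - f k x))\<^sup>2) \<le> ennreal C"
        unfolding C(2)[symmetric] by (rule SUP_upper) simp
      with C(1) show ?thesis by (intro real_le_rsqrt) (simp add: ennreal_le_iff)
    qed
    then have "summable (\<lambda>k. norm (f (Suc k) x - f k x))"
      by (intro bounded_imp_summable[where B="sqrt C"]) (simp_all add: lessThan_Suc_atMost[symmetric] del: sum.lessThan_Suc)
    then have "summable (\<lambda>k. f (Suc k) x - f k x)" by (rule summable_norm_cancel)
    then have "convergent (\<lambda>n. \<Sum>k<n. f (Suc k) x - f k x)" by (simp add: summable_iff_convergent)
    then have "convergent (\<lambda>n. f n x - f 0 x)" using sum_lessThan_telescope[of "\<lambda>k. f k x"] by simp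
    then have "convergent (\<lambda>n. (f n x - f 0 x) + f 0 x)" by (rule convergent_add[OF _ convergent_const])
    then show ?case by simp
  qed
  define g where "g x = lim (\<lambda>k. f k x)" for x
  have [measurable]: "g \<in> borel_measurable lborel" unfolding g_def by measurable
  have lim: "AE x in lborel. (\<lambda>k. f k x) \<longlonglongrightarrow> g x"
    using conv by eventually_elim (simp add: g_def convergent_LIMSEQ_iff)
  have nX: "norm (X (j + k) - X k) \<le> 2 * (1/2)^k" for j k
  proof -
    have "norm (X (j + k) - X k) \<le> (\<Sum>i<j. (1/2)^(i+k))"
    proof (induction j)
      case (Suc j)
      have "norm (X (Suc j + k) - X k) \<le> norm (X (Suc (j + k)) - X (j+k)) + norm (X (j + k) - X k)"
        by (metis (no_types) add_Suc diff_add_cancel norm_triangle_ineq add_diff_eq)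
      with Suc fast[of "j+k"] show ?case by simp
    qed simp
    also have "\<dots> = (\<Sum>i<j. (1/2)^i) * (1/2)^k" by (simp add: power_add sum_distrib_right)
    also have "\<dots> \<le> 2 * (1/2)^k" by (intro mult_right_mono) (auto simp: sum_gp_strict)
    finally show ?thesis .
  qed
  \<comment> \<open>The distance of \<open>X (j + k)\<close> to \<open>X k\<close> is at most twice
    (1/2)^k for every j; Fatou's lemma in j carries the bound over to the limit
    \<open>g\<close>.\<close>
  have tail: "(\<integral>\<^sup>+x. ennreal ((norm (g x - f k x))\<^sup>2) \<partial>lborel) \<le> ennreal ((2 * (1/2)^k)\<^sup>2)" for k
  proof -
    have "(\<integral>\<^sup>+x. ennreal ((norm (g x - f k x))\<^sup>2) \<partial>lborel)
        = (\<integral>\<^sup>+x. liminf (\<lambda>j. ennreal ((norm (f (j+k) x - f k x))\<^sup>2)) \<partial>lborel)"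
    proof (rule nn_integral_cong_AE)
      show "AE x in lborel. ennreal ((norm (g x - f k x))\<^sup>2) = liminf (\<lambda>j. ennreal ((norm (f (j+k) x - f k x))\<^sup>2))"
        using lim
      proof eventually_elim
        case (elim x)
        have "(\<lambda>j. ennreal ((norm (f (j+k) x - f k x))\<^sup>2)) \<longlonglongrightarrow> ennreal ((norm (g x - f k x))\<^sup>2)"
          by (intro tendsto_intros LIMSEQ_ignore_initial_segment elim)
        then show ?case by (metis lim_imp_Liminf sequentially_bot)
      qed
    qed
    also have "\<dots> \<le> liminf (\<lambda>j. \<integral>\<^sup>+x. ennreal ((norm (f (j+k) x - f k x))\<^sup>2) \<partial>lborel)"
      by (rule nn_integral_liminf) auto
    also have "\<dots> \<le> ennreal ((2 * (1/2)^k)\<^sup>2)"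
    proof (rule Liminf_le)
      show "\<forall>\<^sub>F j in sequentially. (\<integral>\<^sup>+x. ennreal ((norm (f (j+k) x - f k x))\<^sup>2) \<partial>lborel) \<le> ennreal ((2 * (1/2)^k)\<^sup>2)"
      proof (rule always_eventually, rule allI)
        fix j
        have "(norm (X (j+k) - X k))\<^sup>2 \<le> (2 * (1/2)^k)\<^sup>2" using nX by (intro power_mono) auto
        moreover have "cls (\<lambda>x. f (j+k) x - f k x) = X (j+k) - X k"
          by (subst cls_diff) (simp_all add: sq, simp add: f_def)
        ultimately show "(\<integral>\<^sup>+x. ennreal ((norm (f (j+k) x - f k x))\<^sup>2) \<partial>lborel) \<le> ennreal ((2 * (1/2)^k)\<^sup>2)"
          by (subst nn_integral_sq_int) (auto simp: sq_int_diff sq intro!: ennreal_leI)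
      qed
    qed simp
    finally show ?thesis .
  qed
  have sqgf: "sq_int (\<lambda>x. g x - f k x)" for k
    by (rule sq_int_nnI[OF _ tail[of k]]) simp
  have sqg: "sq_int g" using sq_int_add[OF sqgf[of 0] sq[of 0]] by simp
  have "norm (cls g - X k) \<le> 2 * (1/2)^k" for k
  proof -
    have "cls (\<lambda>x. g x - f k x) = cls g - X k"
      by (subst cls_diff) (simp_all add: sq sqg, simp add: f_def)
    then have "(norm (cls g - X k))\<^sup>2 \<le> (2 * (1/2)^k)\<^sup>2"
      using tail[of k] by (subst (asm) nn_integral_sq_int[OF sqgf]) (simp add: ennreal_le_iff)
    then show ?thesis by (rule power2_le_imp_le) simp
  qed
  then have "\<forall>k. norm (X k - cls g) \<le> 2 * (1/2)^k" by (simp add: norm_minus_commute)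
  moreover have "(\<lambda>k. 2 * (1/2)^k :: real) \<longlonglongrightarrow> 0"
    by (intro tendsto_mult_right_zero LIMSEQ_power_zero) simp
  ultimately have "(\<lambda>k. X k - cls g) \<longlonglongrightarrow> 0"
    by (rule Lim_null_comparison[OF always_eventually])
  then have "X \<longlonglongrightarrow> cls g" by (rule LIM_zero_cancel)
  then show ?thesis ..
qed

instance l2 :: (euclidean_space) complete_space
proof
  fix X :: "nat \<Rightarrow> 'a l2"
  assume C: "Cauchy X"
  have "\<exists>N. \<forall>m\<ge>N. \<forall>n\<ge>N. norm (X m - X n) < (1/2)^k" for k
    using C[unfolded Cauchy_def dist_norm, rule_format, of "(1/2)^k"] by auto
  then obtain N where N: "\<And>k m n. m \<ge> N k \<Longrightarrow> n \<ge> N k \<Longrightarrow> norm (X m - X n) < (1/2)^k" by metis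
  \<comment> \<open>The sum makes \<open>r\<close> strictly increasing and at least
    \<open>N k\<close> at every index from k on, so the increments of the subsequence are
    geometric.\<close>
  define r where "r k = (\<Sum>i\<le>k. N i) + k" for k
  have r: "strict_mono r" unfolding r_def by (rule strict_monoI_Suc) simp
  have "N k \<le> r j" if "k \<le> j" for k j
  proof -
    have "N k \<le> (\<Sum>i\<le>j. N i)" using that by (intro member_le_sum) auto
    then show ?thesis by (simp add: r_def)
  qed
  then have "norm ((X \<circ> r) (Suc k) - (X \<circ> r) k) \<le> (1/2)^k" for k
    using N[of k "r (Suc k)" "r k"] by fastforce
  from l2_converges_fast[OF this] obtain L where "(X \<circ> r) \<longlonglongrightarrow> L" by blast
  with C r show "convergent X"
    by (metis LIMSEQ_imp_Suc LIMSEQ_Suc Cauchy_converges_subseq convergent_def)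
qed

instance l2 :: (euclidean_space) banach ..


section \<open>Smooth functions\<close>

lemma partial_eqI: "(f has_derivative D) (at x) \<Longrightarrow> partial b f x = D b"
  unfolding partial_def by (metis frechet_derivative_at)

lemma has_derivative_frechet:
  "f differentiable (at x) \<Longrightarrow> (f has_derivative frechet_derivative f (at x)) (at x)"
  using frechet_derivative_works by blast

text \<open>Smooth functions form the largest class of differentiable functions that is stable under
  partial derivatives in coordinate directions, so any such class consists of smooth
  functions.\<close>

lemma smooth_coinduct:
  assumes "f \<in> X"
    and "\<And>g x. g \<in> X \<Longrightarrow> g differentiable (at x)"
    and "\<And>g b. g \<in> X \<Longrightarrow> b \<in> Basis \<Longrightarrow> partial b g \<in> X"
  shows "smooth f"
proof -
  have "foldr partial bs f \<in> X" if "bs \<in> lists Basis" for bs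
    using that by (induction bs) (auto intro: assms)
  then show ?thesis using assms(2) by (auto simp: smooth_def)
qed

lemma smooth_differentiable: "smooth f \<Longrightarrow> f differentiable (at x)"
  unfolding smooth_def by (metis foldr_Nil id_apply lists.Nil)

lemma smooth_partial: "smooth f \<Longrightarrow> b \<in> Basis \<Longrightarrow> smooth (partial b f)"
  unfolding smooth_def
proof (intro ballI allI)
  fix bs :: "'a list" and x :: 'a
  assume f: "\<forall>bs\<in>lists Basis. \<forall>x. foldr partial bs f differentiable at x" and b: "b \<in> Basis" "bs \<in> lists Basis"
  then have "foldr partial (bs @ [b]) f differentiable at x" by (intro f[rule_format]) auto
  then show "foldr partial bs (partial b f) differentiable at x" by simp
qed

lemma smooth_continuous_on: "smooth f \<Longrightarrow> continuous_on S f"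
  by (intro continuous_at_imp_continuous_on ballI differentiable_imp_continuous_within smooth_differentiable)

lemma smooth_measurable: "smooth f \<Longrightarrow> f \<in> borel_measurable borel"
  by (intro borel_measurable_continuous_onI smooth_continuous_on)

lemma partial_add:
  assumes "f differentiable (at x)" "g differentiable (at x)"
  shows "partial b (\<lambda>x. f x + g x) x = partial b f x + partial b g x"
  using partial_eqI[OF has_derivative_add[OF has_derivative_frechet[OF assms(1)] has_derivative_frechet[OF assms(2)]], of b]
  by (simp add: partial_def)

lemma partial_mult:
  assumes "f differentiable (at x)" "g differentiable (at x)"
  shows "partial b (\<lambda>x. f x * g x) x = f x * partial b g x + partial b f x * g x"
  using partial_eqI[OF has_derivative_mult[OF has_derivative_frechet[OF assms(1)] has_derivative_frechet[OF assms(2)]], of b]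
  by (simp add: partial_def)

lemma partial_const: "partial b (\<lambda>x. c) x = 0"
  using partial_eqI[OF has_derivative_const] .

lemma partial_cmult:
  assumes "f differentiable (at x)"
  shows "partial b (\<lambda>x. c * f x) x = c * partial b f x"
  using partial_mult[of "\<lambda>x. c" x f b] assms by (simp add: partial_const)

lemma partial_cnj:
  assumes "f differentiable (at x)"
  shows "partial b (\<lambda>x. cnj (f x)) x = cnj (partial b f x)"
  using partial_eqI[OF bounded_linear.has_derivative[OF bounded_linear_cnj has_derivative_frechet[OF assms]], of b]
  by (simp add: partial_def)

text \<open>The closure of the smooth functions under sums and products is closed under partial derivatives, so it
  consists of smooth functions by coinduction; \<open>affine_alg\<close> below plays the same role for compositions.\<close>

inductive smooth_alg :: "('a::euclidean_space \<Rightarrow> complex) \<Rightarrow> bool" where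
  base: "smooth f \<Longrightarrow> smooth_alg f"
| add: "smooth_alg f \<Longrightarrow> smooth_alg g \<Longrightarrow> smooth_alg (\<lambda>x. f x + g x)"
| mult: "smooth_alg f \<Longrightarrow> smooth_alg g \<Longrightarrow> smooth_alg (\<lambda>x. f x * g x)"

lemma smooth_alg_step:
  "smooth_alg f \<Longrightarrow> (\<forall>x. f differentiable (at x)) \<and> (\<forall>b\<in>Basis. smooth_alg (partial b f))"
proof (induction rule: smooth_alg.induct)
  case (base f)
  then show ?case by (auto intro: smooth_differentiable smooth_partial smooth_alg.base)
next
  case (add f g)
  then have "partial b (\<lambda>x. f x + g x) = (\<lambda>x. partial b f x + partial b g x)" for b
    by (auto simp: partial_add)
  with add show ?case by (auto intro!: differentiable_add smooth_alg.add)
next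
  case (mult f g)
  then have "partial b (\<lambda>x. f x * g x) = (\<lambda>x. f x * partial b g x + partial b f x * g x)" for b
    by (auto simp: partial_mult)
  with mult show ?case by (auto intro!: differentiable_mult smooth_alg.add smooth_alg.mult)
qed

lemma smooth_alg_smooth: "smooth_alg f \<Longrightarrow> smooth f"
  by (rule smooth_coinduct[of f "{f. smooth_alg f}"]) (simp_all add: smooth_alg_step)

lemma smooth_mult: "smooth f \<Longrightarrow> smooth g \<Longrightarrow> smooth (\<lambda>x. f x * g x)"
  by (rule smooth_alg_smooth[OF smooth_alg.mult[OF smooth_alg.base smooth_alg.base]])

lemma smooth_const: "smooth (\<lambda>x. c)"
  by (rule smooth_coinduct[of _ "range (\<lambda>c x. c)"]) (auto simp: partial_const[abs_def])

lemma smooth_cnj: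
  assumes "smooth f" shows "smooth (\<lambda>x. cnj (f x))"
proof (rule smooth_coinduct[of _ "{\<lambda>x. cnj (f x) | f. smooth f}"])
  fix g x assume "g \<in> {\<lambda>x. cnj (f x) | f. smooth (f :: 'a \<Rightarrow> complex)}"
  then obtain f where f: "smooth f" "g = (\<lambda>x. cnj (f x))" by blast
  show "g differentiable (at x)"
    using bounded_linear.has_derivative[OF bounded_linear_cnj has_derivative_frechet[OF smooth_differentiable[OF f(1)]]]
    unfolding f(2) by (rule differentiableI)
  fix b :: 'a assume "b \<in> Basis"
  have "partial b g = (\<lambda>x. cnj (partial b f x))"
    unfolding f(2) by (rule ext, rule partial_cnj, rule smooth_differentiable[OF f(1)])
  with smooth_partial[OF f(1) \<open>b \<in> Basis\<close>] show "partial b g \<in> {\<lambda>x. cnj (f x) | f. smooth f}" by auto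
qed (use assms in auto)

lemma smooth_prod: "finite I \<Longrightarrow> (\<And>i. i \<in> I \<Longrightarrow> smooth (f i)) \<Longrightarrow> smooth (\<lambda>x. \<Prod>i\<in>I. f i x)"
  by (induction I rule: finite_induct) (simp_all add: smooth_const smooth_mult)

lemma frechet_as_partial:
  assumes "f differentiable (at x)"
  shows "frechet_derivative f (at x) h = (\<Sum>i\<in>Basis. of_real (h \<bullet> i) * partial i f x)"
proof -
  interpret bounded_linear "frechet_derivative f (at x)"
    using has_derivative_frechet[OF assms] by (rule has_derivative_bounded_linear)
  have "frechet_derivative f (at x) (\<Sum>i\<in>Basis. (h \<bullet> i) *\<^sub>R i) = (\<Sum>i\<in>Basis. of_real (h \<bullet> i) * partial i f x)"
    by (simp add: sum scaleR partial_def scaleR_conv_of_real)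
  then show ?thesis by (simp add: euclidean_representation)
qed

lemma affine_has_derivative:
  fixes L :: "'b::euclidean_space \<Rightarrow> 'a::euclidean_space"
  assumes "linear L" shows "((\<lambda>z. L z + w) has_derivative L) (at z)"
  using has_derivative_add[OF linear_imp_has_derivative[OF assms, of "at z"] has_derivative_const[of w "at z"]] by simp

lemma partial_affine:
  fixes f :: "'a::euclidean_space \<Rightarrow> complex" and L :: "'b::euclidean_space \<Rightarrow> 'a"
  assumes "f differentiable (at (L z + w))" "linear L"
  shows "partial b (\<lambda>z. f (L z + w)) z = (\<Sum>i\<in>Basis. of_real (L b \<bullet> i) * partial i f (L z + w))"
  using partial_eqI[OF has_derivative_compose[OF affine_has_derivative[OF assms(2)] has_derivative_frechet[OF assms(1)]], of b]
  by (simp add: frechet_as_partial[OF assms(1)])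

inductive affine_alg :: "('b::euclidean_space \<Rightarrow> 'a::euclidean_space) \<Rightarrow> ('b \<Rightarrow> complex) \<Rightarrow> bool" for A where
  comp: "smooth f \<Longrightarrow> affine_alg A (\<lambda>z. c * f (A z))"
| zero: "affine_alg A (\<lambda>z. 0)"
| add: "affine_alg A f \<Longrightarrow> affine_alg A g \<Longrightarrow> affine_alg A (\<lambda>z. f z + g z)"

lemma affine_alg_sum: "finite I \<Longrightarrow> (\<And>i. i \<in> I \<Longrightarrow> affine_alg A (f i)) \<Longrightarrow> affine_alg A (\<lambda>z. \<Sum>i\<in>I. f i z)"
  by (induction I rule: finite_induct) (simp_all add: affine_alg.zero affine_alg.add)

text \<open>The later use composes with a map that sends the whole space to one rotated slice, which
  is why \<open>L\<close> is a general linear map. The chain rule produces linear combinations of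
  partial derivatives at the same affine point, a class stable under differentiation.\<close>

lemma smooth_affine:
  fixes f :: "'a::euclidean_space \<Rightarrow> complex" and L :: "'b::euclidean_space \<Rightarrow> 'a"
  assumes f: "smooth f" and L: "linear L"
  shows "smooth (\<lambda>z. f (L z + w))"
proof (rule smooth_coinduct[of _ "{g. affine_alg (\<lambda>z. L z + w) g}"])
  have step: "(\<forall>x. g differentiable (at x)) \<and> (\<forall>b\<in>Basis. affine_alg (\<lambda>z. L z + w) (partial b g))"
    if "affine_alg (\<lambda>z. L z + w) g" for g
    using that
  proof (induction rule: affine_alg.induct)
    case (comp f c)
    have d: "(\<lambda>z. f (L z + w)) differentiable (at z)" for z
      using has_derivative_compose[OF affine_has_derivative[OF L] has_derivative_frechet[OF smooth_differentiable[OF comp]]]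
      by (rule differentiableI)
    have "partial b (\<lambda>z. c * f (L z + w)) = (\<lambda>z. \<Sum>i\<in>Basis. (c * of_real (L b \<bullet> i)) * partial i f (L z + w))" for b
      by (rule ext, subst partial_cmult[OF d], subst partial_affine[OF smooth_differentiable[OF comp] L])
        (simp add: sum_distrib_left mult.assoc)
    then have "\<forall>b\<in>Basis. affine_alg (\<lambda>z. L z + w) (partial b (\<lambda>z. c * f (L z + w)))"
      by (auto intro!: affine_alg_sum affine_alg.comp smooth_partial comp)
    with d show ?case by (auto intro!: differentiable_mult)
  next
    case zero
    have "partial b (\<lambda>z::'b. 0) = (\<lambda>z. 0)" for b by (auto simp: partial_const)
    then show ?case by (auto intro: affine_alg.zero)
  next
    case (add f g)
    then have "partial b (\<lambda>x. f x + g x) = (\<lambda>x. partial b f x + partial b g x)" for b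
      by (auto simp: partial_add)
    with add show ?case by (auto intro!: differentiable_add affine_alg.add)
  qed
  then show "\<And>g x. g \<in> {g. affine_alg (\<lambda>z. L z + w) g} \<Longrightarrow> g differentiable at x"
    "\<And>g b. g \<in> {g. affine_alg (\<lambda>z. L z + w) g} \<Longrightarrow> b \<in> Basis \<Longrightarrow> partial b g \<in> {g. affine_alg (\<lambda>z. L z + w) g}"
    by auto
  show "(\<lambda>z. f (L z + w)) \<in> {g. affine_alg (\<lambda>z. L z + w) g}"
    using affine_alg.comp[OF f, of "\<lambda>z. L z + w" 1] by simp
qed

text \<open>Encoded by a class K that contains the function and is stable under differentiation: the
  one-variable form of the coinduction above, which spares naming the higher derivatives.\<close>

definition smooth_real :: "(real \<Rightarrow> real) \<Rightarrow> bool" where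
  "smooth_real \<phi> \<longleftrightarrow> (\<exists>K. \<phi> \<in> K \<and> (\<forall>f\<in>K. \<exists>f'\<in>K. \<forall>x. (f has_real_derivative f' x) (at x)))"

text \<open>A partial derivative of a function of one linear coordinate is a constant times the
  derived profile, so the multiples of profiles in K form a stable class.\<close>

lemma smooth_ridge:
  fixes v :: "'a::euclidean_space"
  assumes "smooth_real \<phi>" shows "smooth (\<lambda>x. of_real (\<phi> (x \<bullet> v)))"
proof -
  obtain K where K: "\<phi> \<in> K" "\<And>f. f \<in> K \<Longrightarrow> \<exists>f'\<in>K. \<forall>x. (f has_real_derivative f' x) (at x)"
    using assms by (auto simp: smooth_real_def)
  define X where "X = {\<lambda>x. c * complex_of_real (f (x \<bullet> v)) | c f. f \<in> K}"
  have step: "g differentiable (at x) \<and> (\<forall>b\<in>Basis. partial b g \<in> X)" if g: "g \<in> X" for g x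
  proof -
    obtain c f where f: "f \<in> K" "g = (\<lambda>x. c * complex_of_real (f (x \<bullet> v)))"
      using g by (auto simp: X_def)
    obtain f' where f': "f' \<in> K" "\<And>x. (f has_real_derivative f' x) (at x)" using K(2)[OF f(1)] by blast
    have d: "(g has_derivative (\<lambda>h. (c * of_real (h \<bullet> v)) * of_real (f' (x \<bullet> v)))) (at x)" for x
    proof -
      have "((\<lambda>x. f (x \<bullet> v)) has_derivative (\<lambda>h. f' (x \<bullet> v) * (h \<bullet> v))) (at x)"
        by (rule has_derivative_compose[of "\<lambda>x. x \<bullet> v", OF _ f'(2)[unfolded has_field_derivative_def]])
          (auto intro!: derivative_eq_intros)
      then have "(g has_derivative (\<lambda>h. c * of_real (f' (x \<bullet> v) * (h \<bullet> v)))) (at x)"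
        unfolding f(2) by (intro has_derivative_mult_right has_derivative_of_real)
      then show ?thesis by (simp add: ac_simps)
    qed
    have "partial b g = (\<lambda>x. (c * of_real (b \<bullet> v)) * of_real (f' (x \<bullet> v)))" for b
      by (rule ext, rule partial_eqI[OF d])
    then have "partial b g \<in> X" for b using f'(1) by (auto simp: X_def)
    with d show ?thesis by (auto intro: differentiableI)
  qed
  show ?thesis
  proof (rule smooth_coinduct[of _ X])
    show "(\<lambda>x. complex_of_real (\<phi> (x \<bullet> v))) \<in> X"
      unfolding X_def using K(1) by (auto intro!: exI[of _ 1] exI[of _ \<phi>])
  qed (use step in auto)
qed

lemma partial_ridge:
  assumes "\<And>x. (f has_real_derivative f' x) (at x)"
  shows "partial b (\<lambda>x. complex_of_real (f (x \<bullet> v))) x = of_real (b \<bullet> v) * of_real (f' (x \<bullet> v))"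
proof -
  have "((\<lambda>x. f (x \<bullet> v)) has_derivative (\<lambda>h. f' (x \<bullet> v) * (h \<bullet> v))) (at x)"
    by (rule has_derivative_compose[of "\<lambda>x. x \<bullet> v", OF _ assms[unfolded has_field_derivative_def]])
      (auto intro!: derivative_eq_intros)
  then have "((\<lambda>x. complex_of_real (f (x \<bullet> v))) has_derivative (\<lambda>h. of_real (f' (x \<bullet> v) * (h \<bullet> v)))) (at x)"
    by (rule has_derivative_of_real)
  from partial_eqI[OF this, of b] show ?thesis by simp
qed

text \<open>All weights along the axis lie here: polynomials times Gaussians, reciprocals of
  positive sums of these, and the rational cutoff. Reciprocals are restricted to functions without
  zeros so that the quotient rule stays inside the class.\<close>

inductive_set elementary :: "(real \<Rightarrow> real) set" where
  const: "(\<lambda>x. c) \<in> elementary"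
| ident: "(\<lambda>x. x) \<in> elementary"
| add: "f \<in> elementary \<Longrightarrow> g \<in> elementary \<Longrightarrow> (\<lambda>x. f x + g x) \<in> elementary"
| mult: "f \<in> elementary \<Longrightarrow> g \<in> elementary \<Longrightarrow> (\<lambda>x. f x * g x) \<in> elementary"
| exp: "f \<in> elementary \<Longrightarrow> (\<lambda>x. exp (f x)) \<in> elementary"
| inv: "f \<in> elementary \<Longrightarrow> (\<And>x. f x \<noteq> 0) \<Longrightarrow> (\<lambda>x. inverse (f x)) \<in> elementary"

lemma elementary_deriv:
  "f \<in> elementary \<Longrightarrow> \<exists>f'\<in>elementary. \<forall>x. (f has_real_derivative f' x) (at x)"
proof (induction rule: elementary.induct)
  case (const c)
  then show ?case by (intro bexI[of _ "\<lambda>x. 0"] elementary.const) auto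
next
  case ident
  then show ?case by (intro bexI[of _ "\<lambda>x. 1"] elementary.const) auto
next
  case (add f g)
  then obtain f' g' where "f' \<in> elementary" "g' \<in> elementary"
    "\<forall>x. (f has_real_derivative f' x) (at x)" "\<forall>x. (g has_real_derivative g' x) (at x)" by blast
  then show ?case
    by (intro bexI[of _ "\<lambda>x. f' x + g' x"] elementary.add) (auto intro: DERIV_add)
next
  case (mult f g)
  then obtain f' g' where "f' \<in> elementary" "g' \<in> elementary"
    "\<forall>x. (f has_real_derivative f' x) (at x)" "\<forall>x. (g has_real_derivative g' x) (at x)" by blast
  then show ?case using mult
    by (intro bexI[of _ "\<lambda>x. f' x * g x + g' x * f x"] elementary.add elementary.mult) (auto intro: DERIV_mult)
next
  case (exp f)
  then obtain f' where "f' \<in> elementary" "\<forall>x. (f has_real_derivative f' x) (at x)" by blast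
  then show ?case using exp
    by (intro bexI[of _ "\<lambda>x. exp (f x) * f' x"] elementary.mult elementary.exp)
      (auto intro!: derivative_eq_intros)
next
  case (inv f)
  then obtain f' where "f' \<in> elementary" "\<forall>x. (f has_real_derivative f' x) (at x)" by blast
  then show ?case using inv
    by (intro bexI[of _ "\<lambda>x. (- 1) * (inverse (f x) * f' x * inverse (f x))"] elementary.mult elementary.inv elementary.const)
      (auto intro!: derivative_eq_intros)
qed

lemma elementary_smooth: "f \<in> elementary \<Longrightarrow> smooth_real f"
  unfolding smooth_real_def using elementary_deriv by blast

lemma elementary_power: "f \<in> elementary \<Longrightarrow> (\<lambda>x. f x ^ n) \<in> elementary"
  by (induction n) (simp_all add: elementary.const elementary.mult)

text \<open>The derivatives of the flat function exp (- c / x), continued by 0 to x \<le> 0, all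
  have this form with some polynomial p in 1 / x.\<close>

definition flat :: "real poly \<Rightarrow> real \<Rightarrow> real \<Rightarrow> real" where
  "flat p c x = (if x > 0 then poly p (1 / x) * exp (- (c / x)) else 0)"

lemma flat_0: "flat p c 0 = 0"
  by (simp add: flat_def)

lemma poly_exp_tendsto_0:
  fixes c :: real
  assumes "c > 0" shows "((\<lambda>y. poly p y * exp (- (c * y))) \<longlongrightarrow> 0) at_top"
proof -
  have "((\<lambda>y. y ^ k * exp (- (c * y))) \<longlongrightarrow> 0) at_top" for k :: nat
  proof -
    have "((\<lambda>y. (c * y) ^ k / exp (c * y)) \<longlongrightarrow> 0) at_top"
      by (rule filterlim_compose[OF tendsto_power_div_exp_0])
        (rule filterlim_tendsto_pos_mult_at_top[OF tendsto_const assms filterlim_ident])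
    then have "((\<lambda>y. (1 / c ^ k) * ((c * y) ^ k / exp (c * y))) \<longlongrightarrow> (1 / c ^ k) * 0) at_top"
      by (rule tendsto_mult[OF tendsto_const])
    then show ?thesis using assms by (simp add: power_mult_distrib exp_minus field_simps)
  qed
  then have "((\<lambda>y. \<Sum>i\<le>degree p. coeff p i * (y ^ i * exp (- (c * y)))) \<longlongrightarrow> (\<Sum>i\<le>degree p. coeff p i * 0)) at_top"
    by (intro tendsto_sum tendsto_mult tendsto_const)
  then show ?thesis by (simp add: poly_altdef sum_distrib_right mult.assoc)
qed

text \<open>In the variable y = 1 / x differentiation is - y^2 d/dy, which sends p(y) exp (- c y) to
  y^2 (c p - p') exp (- c y). At 0 the difference quotient from the right is y p(y) exp (- c y) with
  y tending to infinity.\<close>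

lemma flat_deriv:
  assumes c: "c > 0"
  shows "(flat p c has_real_derivative flat (monom 1 2 * (smult c p - pderiv p)) c x) (at x)"
proof (cases "x = 0")
  case False
  then consider "x > 0" | "x < 0" by linarith
  then show ?thesis
  proof cases
    case 1
    have inv: "((\<lambda>x. 1 / x) has_real_derivative - (1 / x ^ 2)) (at x)"
      using 1 by (auto intro!: derivative_eq_intros simp: power2_eq_square)
    have "((\<lambda>x. poly p (1 / x) * exp (- c * (1 / x))) has_real_derivative
        poly (pderiv p) (1 / x) * - (1 / x ^ 2) * exp (- c * (1 / x))
        + exp (- c * (1 / x)) * (- c * - (1 / x ^ 2)) * poly p (1 / x)) (at x)"
      by (rule DERIV_mult[OF DERIV_chain2[OF poly_DERIV inv] DERIV_chain2[OF DERIV_exp DERIV_cmult[OF inv]]])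
    also have "poly (pderiv p) (1 / x) * - (1 / x ^ 2) * exp (- c * (1 / x))
        + exp (- c * (1 / x)) * (- c * - (1 / x ^ 2)) * poly p (1 / x)
        = flat (monom 1 2 * (smult c p - pderiv p)) c x"
      using 1 by (simp add: flat_def poly_monom power_divide algebra_simps)
    finally have "((\<lambda>x. poly p (1 / x) * exp (- (c / x))) has_real_derivative
        flat (monom 1 2 * (smult c p - pderiv p)) c x) (at x)" by simp
    then show ?thesis
      by (rule DERIV_cong_ev[THEN iffD1, rotated -1])
        (use 1 in \<open>auto simp: flat_def intro!: eventually_mono[OF eventually_nhds_in_open[of "{0<..}"]]\<close>)
  next
    case 2
    have "((\<lambda>x. 0) has_real_derivative 0) (at x)" by simp
    then show ?thesis
      by (rule DERIV_cong_ev[THEN iffD1, rotated -1])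
        (use 2 in \<open>auto simp: flat_def intro!: eventually_mono[OF eventually_nhds_in_open[of "{..<0}"]]\<close>)
  qed
next
  case True
  have "((\<lambda>h. (flat p c (0 + h) - flat p c 0) / h) \<longlongrightarrow> 0) (at 0)"
  proof (rule filterlim_split_at)
    show "((\<lambda>h. (flat p c (0 + h) - flat p c 0) / h) \<longlongrightarrow> 0) (at_left 0)"
    proof (rule Lim_transform_eventually[OF tendsto_const])
      show "\<forall>\<^sub>F h in at_left 0. 0 = (flat p c (0 + h) - flat p c 0) / h"
        by (rule eventually_mono[OF eventually_at_leftI[of "-1" 0 "\<lambda>h. h < 0"]]) (simp_all add: flat_def)
    qed
    have "((\<lambda>h. poly (pCons 0 p) (inverse h) * exp (- (c * inverse h))) \<longlongrightarrow> 0) (at_right 0)"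
      by (rule filterlim_compose[OF poly_exp_tendsto_0[OF c] filterlim_inverse_at_top_right])
    then show "((\<lambda>h. (flat p c (0 + h) - flat p c 0) / h) \<longlongrightarrow> 0) (at_right 0)"
    proof (rule Lim_transform_eventually)
      show "\<forall>\<^sub>F h in at_right 0. poly (pCons 0 p) (inverse h) * exp (- (c * inverse h)) = (flat p c (0 + h) - flat p c 0) / h"
        by (rule eventually_mono[OF eventually_at_right_less]) (simp add: flat_def divide_inverse)
    qed
  qed
  moreover have "flat (monom 1 2 * (smult c p - pderiv p)) c 0 = 0" by (rule flat_0)
  ultimately show ?thesis unfolding True DERIV_def by (simp only:)
qed

definition ramp :: "real \<Rightarrow> real \<Rightarrow> real" where
  "ramp c = flat 1 c"

lemma ramp_eq: "ramp c x = (if x > 0 then exp (- (c / x)) else 0)"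
  by (simp add: ramp_def flat_def)

lemma ramp_smooth: "c > 0 \<Longrightarrow> smooth_real (ramp c)"
  unfolding smooth_real_def ramp_def
  by (rule exI[of _ "range (\<lambda>p. flat p c)"]) (use flat_deriv in blast)


section \<open>Multiplication operators\<close>

definition bmeas :: "('a::euclidean_space \<Rightarrow> real) \<Rightarrow> bool" where
  "bmeas m \<longleftrightarrow> m \<in> borel_measurable borel \<and> (\<exists>B. \<forall>x. \<bar>m x\<bar> \<le> B)"

lemma bmeas_measurable [measurable_dest]: "bmeas m \<Longrightarrow> m \<in> borel_measurable borel"
  by (simp add: bmeas_def)

lemma bmeasI: "m \<in> borel_measurable borel \<Longrightarrow> (\<And>x. \<bar>m x\<bar> \<le> B) \<Longrightarrow> bmeas m"
  by (auto simp: bmeas_def)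

lemma bmeas_mult: "bmeas m \<Longrightarrow> bmeas n \<Longrightarrow> bmeas (\<lambda>x. m x * n x)"
proof -
  assume m: "bmeas m" and n: "bmeas n"
  then obtain B C where "\<And>x. \<bar>m x\<bar> \<le> B" "\<And>x. \<bar>n x\<bar> \<le> C" by (auto simp: bmeas_def)
  then have "\<bar>m x * n x\<bar> \<le> B * C" for x
    unfolding abs_mult by (meson abs_ge_zero mult_mono order_trans)
  with m n show ?thesis by (intro bmeasI[where B="B * C"]) (auto simp: bmeas_def)
qed

lemma bmeas_indicator: "A \<in> sets borel \<Longrightarrow> bmeas (indicator A)"
  by (rule bmeasI[where B=1]) (auto simp: indicator_def)

lemma sq_int_mul: "bmeas m \<Longrightarrow> sq_int f \<Longrightarrow> sq_int (\<lambda>x. m x *\<^sub>R f x)"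
proof -
  assume m: "bmeas m" and f: "sq_int f"
  then obtain B where "\<And>x. \<bar>m x\<bar> \<le> B" by (auto simp: bmeas_def)
  then have le: "AE x in lborel. norm (m x *\<^sub>R f x) \<le> B * norm (f x)" by (auto intro!: mult_right_mono)
  have [measurable]: "m \<in> borel_measurable borel" "f \<in> borel_measurable borel"
    using m f by (auto simp: bmeas_def sq_int_def)
  show ?thesis by (rule sq_int_bound[OF f _ le]) simp
qed

text \<open>Multiplication through a representative, total in m; it is the expected operator on
  classes once m is bounded and measurable (\<open>mul_cls\<close>).\<close>

definition mul :: "('a::euclidean_space \<Rightarrow> real) \<Rightarrow> 'a l2 \<Rightarrow> 'a l2" where
  "mul m F = cls (\<lambda>x. m x *\<^sub>R rep_l2 F x)"

lemma mul_cls: "bmeas m \<Longrightarrow> sq_int f \<Longrightarrow> mul m (cls f) = cls (\<lambda>x. m x *\<^sub>R f x)"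
  unfolding mul_def
  by (subst cls_eq_iff)
    (auto intro!: sq_int_mul sq_int_rep intro: eventually_mono[OF rep_cls])

lemma mul_add: "bmeas m \<Longrightarrow> mul m (F + G) = mul m F + mul m G"
proof -
  assume m: "bmeas m"
  have "mul m (cls (rep_l2 F) + cls (rep_l2 G)) = mul m (cls (rep_l2 F)) + mul m (cls (rep_l2 G))"
    unfolding cls_add[OF sq_int_rep sq_int_rep, symmetric]
    by (simp add: mul_cls[OF m] sq_int_add sq_int_rep cls_add[symmetric] sq_int_mul[OF m] scaleR_add_right del: cls_rep)
  then show ?thesis by simp
qed

lemma mul_scaleR: "bmeas m \<Longrightarrow> mul m (c *\<^sub>R F) = c *\<^sub>R mul m F"
proof -
  assume m: "bmeas m"
  have "mul m (c *\<^sub>R cls (rep_l2 F)) = c *\<^sub>R mul m (cls (rep_l2 F))"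
    unfolding cls_scaleR[OF sq_int_rep, symmetric]
    by (simp add: mul_cls[OF m] sq_int_scaleR sq_int_rep cls_scaleR[symmetric] sq_int_mul[OF m] mult.commute del: cls_rep)
  then show ?thesis by simp
qed

lemma norm_mul_le:
  assumes m: "bmeas m" and B: "\<And>x. \<bar>m x\<bar> \<le> B"
  shows "norm (mul m F) \<le> B * norm F"
proof -
  have "B \<ge> 0" using B[of undefined] by linarith
  have "norm (mul m F) \<le> norm (cls (\<lambda>x. B *\<^sub>R rep_l2 F x))"
    unfolding mul_def
    by (rule cls_norm_eq_mono[OF sq_int_mul[OF m sq_int_rep] sq_int_scaleR[OF sq_int_rep]])
      (use B \<open>B \<ge> 0\<close> in \<open>auto intro!: mult_right_mono\<close>)
  then show ?thesis using \<open>B \<ge> 0\<close> by (simp add: cls_scaleR sq_int_rep)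
qed

lemma bounded_linear_mul: "bmeas m \<Longrightarrow> bounded_linear (mul m)"
proof -
  assume m: "bmeas m"
  then obtain B where B: "\<And>x. \<bar>m x\<bar> \<le> B" by (auto simp: bmeas_def)
  show ?thesis
    by (rule bounded_linear_intro[where K=B])
      (use norm_mul_le[OF m B] in \<open>auto simp: mul_add m mul_scaleR mult.commute\<close>)
qed

lemma inner_mul: "bmeas m \<Longrightarrow> inner (mul m F) G = (LINT x|lborel. m x * inner (rep_l2 F x) (rep_l2 G x))"
proof -
  assume m: "bmeas m"
  have "inner (mul m F) (cls (rep_l2 G)) = (LINT x|lborel. m x * inner (rep_l2 F x) (rep_l2 G x))"
    unfolding mul_def by (subst inner_cls) (simp_all add: sq_int_mul m sq_int_rep del: cls_rep)
  then show ?thesis by simp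
qed

lemma inner_mul_cls: "bmeas m \<Longrightarrow> sq_int f \<Longrightarrow> sq_int g \<Longrightarrow>
   inner (mul m (cls f)) (cls g) = (LINT x|lborel. m x * inner (f x) (g x))"
  by (simp add: mul_cls inner_cls sq_int_mul)

lemma inner_mul_commute: "bmeas m \<Longrightarrow> inner (mul m F) G = inner F (mul m G)"
  unfolding inner_commute[of F "mul m G"] by (simp only: inner_mul inner_commute[of "rep_l2 G _"])

lemma integrable_mul: "bmeas m \<Longrightarrow> integrable lborel (\<lambda>x. m x * inner (rep_l2 F x) (rep_l2 G x))"
  using integrable_sq_int_inner[OF sq_int_mul[OF _ sq_int_rep] sq_int_rep, of m F G] by simp

lemma mul_mul: "bmeas m \<Longrightarrow> bmeas n \<Longrightarrow> mul m (mul n F) = mul (\<lambda>x. m x * n x) F"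
  unfolding mul_def[of n] by (subst mul_cls) (simp_all add: sq_int_mul sq_int_rep mul_def)

lemma mul_cong_fun: "(\<And>x. m x = n x) \<Longrightarrow> mul m F = mul n F"
  by (simp add: mul_def)

lemma mul_add_left: "bmeas m \<Longrightarrow> bmeas n \<Longrightarrow> mul (\<lambda>x. m x + n x) F = mul m F + mul n F"
  unfolding mul_def by (subst cls_add[symmetric]) (simp_all add: sq_int_mul sq_int_rep scaleR_add_left)

lemma bmeas_cmult: "bmeas m \<Longrightarrow> bmeas (\<lambda>x. c * m x)"
  by (rule bmeas_mult) (auto intro!: bmeasI[where B="\<bar>c\<bar>"])

lemma mul_cmult_left: "bmeas m \<Longrightarrow> mul (\<lambda>x. c * m x) F = c *\<^sub>R mul m F"
  unfolding mul_def by (subst cls_scaleR[symmetric]) (simp_all add: sq_int_mul sq_int_rep)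

lemma mul_const_1: "mul (\<lambda>x. 1) F = F"
  by (simp add: mul_def)

section \<open>Test functions\<close>

lemma test_smooth: "\<phi> \<in> test_functions \<Omega> \<Longrightarrow> smooth \<phi>"
  by (simp add: test_functions_def)

lemma testI:
  assumes "\<phi> \<in> test_functions \<Omega>" "smooth \<psi>" "\<And>x. \<psi> x \<noteq> 0 \<Longrightarrow> x \<in> closure {x. \<phi> x \<noteq> 0}"
  shows "\<psi> \<in> test_functions \<Omega>"
proof -
  have sub: "closure {x. \<psi> x \<noteq> 0} \<subseteq> closure {x. \<phi> x \<noteq> 0}"
    by (rule closure_minimal) (use assms(3) in auto)
  moreover have "compact (closure {x. \<psi> x \<noteq> 0})"
    using closed_Int_compact[OF closed_closure[of "{x. \<psi> x \<noteq> 0}"], of "closure {x. \<phi> x \<noteq> 0}"] assms(1) sub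
    by (simp add: test_functions_def Int_absorb2)
  ultimately show ?thesis using assms(1,2) by (auto simp: test_functions_def)
qed

lemma testI_compact:
  assumes "smooth \<psi>" "compact K" "K \<subseteq> \<Omega>" "\<And>x. \<psi> x \<noteq> 0 \<Longrightarrow> x \<in> K"
  shows "\<psi> \<in> test_functions \<Omega>"
proof -
  have sub: "closure {x. \<psi> x \<noteq> 0} \<subseteq> K"
    by (rule closure_minimal) (use assms in \<open>auto intro: compact_imp_closed\<close>)
  moreover have "compact (closure {x. \<psi> x \<noteq> 0})"
    using closed_Int_compact[OF closed_closure[of "{x. \<psi> x \<noteq> 0}"] assms(2)] sub by (simp add: Int_absorb2)
  ultimately show ?thesis using assms by (auto simp: test_functions_def)
qed

lemma in_support: "f x \<noteq> 0 \<Longrightarrow> x \<in> closure {x. f x \<noteq> 0}"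
  by (rule subsetD[OF closure_subset]) simp

lemma test_zero_outside: "\<phi> \<in> test_functions \<Omega> \<Longrightarrow> x \<notin> \<Omega> \<Longrightarrow> \<phi> x = 0"
  unfolding test_functions_def using in_support[of \<phi> x] by auto

lemma test_mult:
  assumes "\<phi> \<in> test_functions \<Omega>" "smooth m" shows "(\<lambda>x. m x * \<phi> x) \<in> test_functions \<Omega>"
  by (rule testI[OF assms(1) smooth_mult[OF assms(2) test_smooth[OF assms(1)]]])
    (rule in_support, simp)

lemma test_cmult: "\<phi> \<in> test_functions \<Omega> \<Longrightarrow> (\<lambda>x. c * \<phi> x) \<in> test_functions \<Omega>"
  by (rule test_mult[OF _ smooth_const])

lemma test_cnj: "\<phi> \<in> test_functions \<Omega> \<Longrightarrow> (\<lambda>x. cnj (\<phi> x)) \<in> test_functions \<Omega>"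
  by (rule testI[OF _ smooth_cnj[OF test_smooth]]) (assumption, assumption, rule in_support, simp)

text \<open>Off the closed support the function vanishes on a neighbourhood, so its derivative
  vanishes as well and the support does not grow.\<close>

lemma test_partial:
  assumes "\<phi> \<in> test_functions \<Omega>" "b \<in> Basis" shows "partial b \<phi> \<in> test_functions \<Omega>"
proof (rule testI[OF assms(1) smooth_partial[OF test_smooth[OF assms(1)] assms(2)]])
  fix x assume "partial b \<phi> x \<noteq> 0"
  then show "x \<in> closure {x. \<phi> x \<noteq> 0}"
  proof (rule contrapos_np)
    assume "x \<notin> closure {x. \<phi> x \<noteq> 0}"
    then have x: "x \<in> - closure {x. \<phi> x \<noteq> 0}" by simp
    have z: "\<phi> y = 0" if "y \<in> - closure {x. \<phi> x \<noteq> 0}" for y using that in_support[of \<phi> y] by auto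
    have "(\<phi> has_derivative (\<lambda>h. 0)) (at x)"
      by (rule has_derivative_transform_within_open[OF has_derivative_const[of 0] _ x])
        (rule open_Compl[OF closed_closure], erule z[symmetric])
    then show "partial b \<phi> x = 0" by (rule partial_eqI)
  qed
qed

lemma test_compact_support:
  assumes "\<phi> \<in> test_functions \<Omega>"
  obtains K B where "compact K" "\<And>x. x \<notin> K \<Longrightarrow> \<phi> x = 0" "\<And>x. norm (\<phi> x) \<le> B"
proof -
  define K where "K = closure {x. \<phi> x \<noteq> 0}"
  have K: "compact K" "\<And>x. x \<notin> K \<Longrightarrow> \<phi> x = 0"
    using assms closure_subset[of "{x. \<phi> x \<noteq> 0}"] by (auto simp: K_def test_functions_def)
  have "compact (\<phi> ` K)"
    by (intro compact_continuous_image smooth_continuous_on test_smooth[OF assms] K)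
  then obtain B where B: "B > 0" "\<And>y. y \<in> \<phi> ` K \<Longrightarrow> norm y \<le> B"
    using bounded_pos compact_imp_bounded by metis
  have "norm (\<phi> x) \<le> B" for x using B K(2) by (cases "x \<in> K") auto
  with K show ?thesis using that by blast
qed

lemma test_measurable: "\<phi> \<in> test_functions \<Omega> \<Longrightarrow> \<phi> \<in> borel_measurable borel"
  by (rule smooth_measurable[OF test_smooth])

lemma sq_int_bounded_support:
  assumes f: "f \<in> borel_measurable borel" and K: "emeasure lborel K < \<infinity>" "K \<in> sets borel"
    and z: "\<And>x. x \<notin> K \<Longrightarrow> f x = 0" and B: "\<And>x. norm (f x) \<le> B"
  shows "sq_int f"
proof -
  have "integrable lborel (\<lambda>x. B\<^sup>2 * indicator K x :: real)"
    using K by (intro integrable_mult_right integrable_real_indicator) auto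
  then have "integrable lborel (\<lambda>x. (norm (f x))\<^sup>2)"
  proof (rule Bochner_Integration.integrable_bound)
    show "AE x in lborel. norm ((norm (f x))\<^sup>2) \<le> norm (B\<^sup>2 * indicator K x :: real)"
      using z B by (auto simp: indicator_def intro!: AE_I2 power_mono)
  qed (use f in measurable)
  with f show ?thesis by (simp add: sq_int_def)
qed

lemma test_sq_int:
  assumes "\<phi> \<in> test_functions \<Omega>" shows "sq_int \<phi>"
proof -
  obtain K B where K: "compact K" "\<And>x. x \<notin> K \<Longrightarrow> \<phi> x = 0" "\<And>x. norm (\<phi> x) \<le> B"
    using test_compact_support[OF assms] by blast
  show ?thesis
    by (rule sq_int_bounded_support[OF test_measurable[OF assms]
          emeasure_bounded_finite[OF compact_imp_bounded[OF K(1)]] borel_compact[OF K(1)] K(2,3)])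
qed

section \<open>Integration by parts for test functions\<close>

lemma smooth_line_bound:
  assumes "smooth \<eta>" "b \<in> Basis" "\<And>y. norm (partial b \<eta> y) \<le> M" "t \<ge> 0"
  shows "norm (\<eta> (x + t *\<^sub>R b) - \<eta> x) \<le> M * t"
proof -
  have "norm (\<eta> (x + t *\<^sub>R b) - \<eta> (x + 0 *\<^sub>R b)) \<le> M * norm (t - 0)"
  proof (rule differentiable_bound[where S=UNIV and f="\<lambda>s. \<eta> (x + s *\<^sub>R b)" and f'="\<lambda>s h. frechet_derivative \<eta> (at (x + s *\<^sub>R b)) (h *\<^sub>R b)"])
    fix s :: real
    have d: "((\<lambda>s. \<eta> (x + s *\<^sub>R b)) has_derivative (\<lambda>h. frechet_derivative \<eta> (at (x + s *\<^sub>R b)) (h *\<^sub>R b))) (at s)"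
      by (rule has_derivative_compose[of "\<lambda>s. x + s *\<^sub>R b", OF _ has_derivative_frechet[OF smooth_differentiable[OF assms(1)]]])
        (auto intro!: derivative_eq_intros)
    then show "((\<lambda>s. \<eta> (x + s *\<^sub>R b)) has_derivative (\<lambda>h. frechet_derivative \<eta> (at (x + s *\<^sub>R b)) (h *\<^sub>R b))) (at s within UNIV)" by simp
    interpret bounded_linear "frechet_derivative \<eta> (at (x + s *\<^sub>R b))"
      using has_derivative_frechet[OF smooth_differentiable[OF assms(1)]] by (rule has_derivative_bounded_linear)
    show "onorm (\<lambda>h. frechet_derivative \<eta> (at (x + s *\<^sub>R b)) (h *\<^sub>R b)) \<le> M"
    proof (rule onorm_le)
      fix h :: real
      have "frechet_derivative \<eta> (at (x + s *\<^sub>R b)) (h *\<^sub>R b) = h *\<^sub>R partial b \<eta> (x + s *\<^sub>R b)"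
        by (simp add: scaleR partial_def)
      then show "norm (frechet_derivative \<eta> (at (x + s *\<^sub>R b)) (h *\<^sub>R b)) \<le> M * norm h"
        using mult_left_mono[OF assms(3)[of "x + s *\<^sub>R b"], of "\<bar>h\<bar>"] by (simp add: mult.commute)
    qed
  qed auto
  then show ?thesis using assms(4) by simp
qed

lemma smooth_line_deriv:
  assumes "smooth \<eta>"
  shows "((\<lambda>s. (\<eta> (x + s *\<^sub>R b) - \<eta> x) /\<^sub>R s) \<longlongrightarrow> partial b \<eta> x) (at 0)"
proof -
  have "((\<lambda>s. \<eta> (x + s *\<^sub>R b)) has_derivative (\<lambda>h. frechet_derivative \<eta> (at (x + 0 *\<^sub>R b)) (h *\<^sub>R b))) (at 0)"
    by (rule has_derivative_compose[of "\<lambda>s. x + s *\<^sub>R b", OF _ has_derivative_frechet[OF smooth_differentiable[OF assms]]])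
      (auto intro!: derivative_eq_intros)
  moreover have "frechet_derivative \<eta> (at x) (h *\<^sub>R b) = h *\<^sub>R partial b \<eta> x" for h
  proof -
    interpret bounded_linear "frechet_derivative \<eta> (at x)"
      using has_derivative_frechet[OF smooth_differentiable[OF assms]] by (rule has_derivative_bounded_linear)
    show ?thesis by (simp add: scaleR partial_def)
  qed
  ultimately have "((\<lambda>s. \<eta> (x + s *\<^sub>R b)) has_vector_derivative partial b \<eta> x) (at 0)"
    by (simp add: has_vector_derivative_def)
  then have "((\<lambda>s. norm (\<eta> (x + s *\<^sub>R b) - \<eta> x - s *\<^sub>R partial b \<eta> x) / norm s) \<longlongrightarrow> 0) (at 0)"
    by (simp add: has_vector_derivative_def has_derivative_iff_norm)
  then have "((\<lambda>s. norm ((\<eta> (x + s *\<^sub>R b) - \<eta> x) /\<^sub>R s - partial b \<eta> x)) \<longlongrightarrow> 0) (at 0)"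
  proof (rule Lim_transform_eventually)
    show "\<forall>\<^sub>F s in at 0. norm (\<eta> (x + s *\<^sub>R b) - \<eta> x - s *\<^sub>R partial b \<eta> x) / norm s
        = norm ((\<eta> (x + s *\<^sub>R b) - \<eta> x) /\<^sub>R s - partial b \<eta> x)"
      unfolding eventually_at_filter
    proof (rule always_eventually, intro allI impI)
      fix s :: real assume s: "s \<noteq> 0"
      have "\<eta> (x + s *\<^sub>R b) - \<eta> x - s *\<^sub>R partial b \<eta> x = s *\<^sub>R ((\<eta> (x + s *\<^sub>R b) - \<eta> x) /\<^sub>R s - partial b \<eta> x)"
        using s by (simp add: scaleR_diff_right)
      then show "norm (\<eta> (x + s *\<^sub>R b) - \<eta> x - s *\<^sub>R partial b \<eta> x) / norm s
        = norm ((\<eta> (x + s *\<^sub>R b) - \<eta> x) /\<^sub>R s - partial b \<eta> x)" using s by simp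
    qed
  qed
  then show ?thesis by (simp add: tendsto_norm_zero_iff LIM_zero_iff)
qed

lemma integral_translate:
  fixes f :: "'a::euclidean_space \<Rightarrow> complex"
  assumes "f \<in> borel_measurable borel"
  shows "(LINT x|lborel. f (x + c)) = (LINT x|lborel. f x)"
proof -
  have "(LINT x|lborel. f x) = (LINT x|distr lborel borel ((+) c). f x)" by (simp add: lborel_distr_plus)
  also have "\<dots> = (LINT x|lborel. f (c + x))" by (rule integral_distr) (use assms in auto)
  finally show ?thesis by (simp add: add.commute)
qed

text \<open>By translation invariance the integral of each difference quotient is 0. The quotients
  inherit the bound \<open>M\<close> of the partial derivative and, for steps of length at most 1,
  vanish outside the ball of radius \<open>R + 1\<close>, so dominated convergence applies.\<close>

lemma integral_partial_test:
  assumes \<eta>: "\<eta> \<in> test_functions \<Omega>" and b: "b \<in> Basis"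
  shows "(LINT x|lborel. partial b \<eta> x) = 0"
proof -
  obtain K B where K: "compact K" "\<And>x. x \<notin> K \<Longrightarrow> \<eta> x = 0" "\<And>x. norm (\<eta> x) \<le> B"
    using test_compact_support[OF \<eta>] by blast
  obtain K' M where M: "\<And>x. norm (partial b \<eta> x) \<le> M"
    using test_compact_support[OF test_partial[OF \<eta> b]] by metis
  obtain R where R: "R > 0" "\<And>x. x \<in> K \<Longrightarrow> norm x \<le> R" using K(1) bounded_pos compact_imp_bounded by metis
  have [measurable]: "\<eta> \<in> borel_measurable borel" "partial b \<eta> \<in> borel_measurable borel"
    using test_measurable \<eta> test_partial[OF \<eta> b] by auto
  have ich: "integrable lborel \<eta>"
  proof (rule Bochner_Integration.integrable_bound)
    show "integrable lborel (\<lambda>x. B * indicator K x :: real)"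
      by (rule integrable_mult_right, rule integrable_real_indicator)
        (simp_all add: borel_compact[OF K(1)] emeasure_bounded_finite[OF compact_imp_bounded[OF K(1)], simplified])
    show "AE x in lborel. norm (\<eta> x) \<le> norm (B * indicator K x :: real)"
      using K(2,3) by (auto simp: indicator_def intro!: AE_I2) (meson abs_ge_self order_trans)
  qed simp
  define s where "s n = inverse (real (Suc n))" for n
  define g where "g n x = (\<eta> (x + s n *\<^sub>R b) - \<eta> x) /\<^sub>R s n" for n x
  have s: "s n > 0" "s n \<le> 1" for n by (auto simp: s_def field_simps)
  have int0: "(LINT x|lborel. g n x) = 0" for n
  proof -
    have "integrable lborel (\<lambda>x. \<eta> (x + s n *\<^sub>R b))"
    proof -
      have "integrable (distr lborel borel ((+) (s n *\<^sub>R b))) \<eta>" using ich by (simp add: lborel_distr_plus)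
      then show ?thesis by (subst (asm) integrable_distr_eq) (auto simp: add.commute)
    qed
    then show ?thesis using ich unfolding g_def by (simp add: integral_translate)
  qed
  have "(\<lambda>n. LINT x|lborel. g n x) \<longlonglongrightarrow> (LINT x|lborel. partial b \<eta> x)"
  proof (rule integral_dominated_convergence[where w="\<lambda>x. M * indicator (cball 0 (R + 1)) x"])
    show "integrable lborel (\<lambda>x::'a. M * indicator (cball 0 (R + 1)) x :: real)"
      by (rule integrable_mult_right, rule integrable_real_indicator)
        (simp_all add: emeasure_bounded_finite[OF bounded_cball, simplified])
    show "AE x in lborel. (\<lambda>n. g n x) \<longlonglongrightarrow> partial b \<eta> x"
    proof (rule AE_I2)
      fix x
      have "filterlim s (at 0) sequentially"
        unfolding filterlim_at s_def
        by (intro conjI LIMSEQ_inverse_real_of_nat) (simp add: always_eventually)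
      then show "(\<lambda>n. g n x) \<longlonglongrightarrow> partial b \<eta> x" unfolding g_def
        by (rule filterlim_compose[OF smooth_line_deriv[OF test_smooth[OF \<eta>]]])
    qed
    fix n
    show "AE x in lborel. norm (g n x) \<le> M * indicator (cball 0 (R + 1)) x"
    proof (rule AE_I2)
      fix x
      show "norm (g n x) \<le> M * indicator (cball 0 (R + 1)) x"
      proof (cases "x \<in> cball 0 (R + 1)")
        case True
        have "norm (\<eta> (x + s n *\<^sub>R b) - \<eta> x) \<le> M * s n"
          by (rule smooth_line_bound[OF test_smooth[OF \<eta>] b M]) (use s[of n] in simp)
        moreover have "norm (g n x) = norm (\<eta> (x + s n *\<^sub>R b) - \<eta> x) / s n"
          using s[of n] by (simp add: g_def divide_inverse mult.commute)
        ultimately show ?thesis using True s[of n] by (simp add: pos_divide_le_eq)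
      next
        case False
        then have nx: "norm x > R + 1" by simp
        have "norm x \<le> norm (x + s n *\<^sub>R b) + norm (s n *\<^sub>R b)" by (metis add_diff_cancel norm_triangle_ineq4)
        then have "norm (x + s n *\<^sub>R b) > R" using nx s[of n] b by simp
        then have "x + s n *\<^sub>R b \<notin> K" using R(2) not_le by blast
        moreover have "x \<notin> K" using R(2)[of x] nx by force
        ultimately show ?thesis using False K(2) by (simp add: g_def)
      qed
    qed
  qed (auto simp: g_def)
  then show ?thesis using int0 by (simp add: LIMSEQ_const_iff)
qed

text \<open>The conjugate of \<phi> times \<psi> is a test function; its partial derivative
  integrates to 0, and the real part of the product rule is the claim.\<close>

lemma test_ibp:
  assumes "\<phi> \<in> test_functions \<Omega>" "\<psi> \<in> test_functions \<Omega>" "b \<in> Basis"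
  shows "inner (cls \<phi>) (cls (partial b \<psi>)) = - inner (cls (partial b \<phi>)) (cls \<psi>)"
proof -
  have sq: "sq_int \<phi>" "sq_int \<psi>" "sq_int (partial b \<phi>)" "sq_int (partial b \<psi>)"
    using assms by (auto intro: test_sq_int test_partial)
  define \<eta> where "\<eta> x = cnj (\<phi> x) * \<psi> x" for x
  have \<eta>: "\<eta> \<in> test_functions \<Omega>"
    unfolding \<eta>_def[abs_def] by (rule test_mult[OF assms(2) smooth_cnj[OF test_smooth[OF assms(1)]]])
  have pe: "partial b \<eta> x = cnj (\<phi> x) * partial b \<psi> x + cnj (partial b \<phi> x) * \<psi> x" for x
    unfolding \<eta>_def[abs_def]
    by (simp add: partial_mult[OF smooth_differentiable[OF smooth_cnj[OF test_smooth[OF assms(1)]]]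
          smooth_differentiable[OF test_smooth[OF assms(2)]]] partial_cnj[OF smooth_differentiable[OF test_smooth[OF assms(1)]]])
  have i: "integrable lborel (\<lambda>x. cnj (\<phi> x) * partial b \<psi> x)" "integrable lborel (\<lambda>x. cnj (partial b \<phi> x) * \<psi> x)"
    by (intro integrable_sq_int_mult sq_int_cnj sq)+
  have "0 = Re (LINT x|lborel. partial b \<eta> x)" by (simp add: integral_partial_test[OF \<eta> assms(3)])
  also have "\<dots> = Re (LINT x|lborel. cnj (\<phi> x) * partial b \<psi> x) + Re (LINT x|lborel. cnj (partial b \<phi> x) * \<psi> x)"
    unfolding pe using i by simp
  also have "\<dots> = inner (cls \<phi>) (cls (partial b \<psi>)) + inner (cls (partial b \<phi>)) (cls \<psi>)"
    by (simp only: inner_cls sq inner_complex_Re integral_Re[OF i(1)] integral_Re[OF i(2)])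
  finally show ?thesis by simp
qed


section \<open>Weak derivatives in terms of the Hilbert space\<close>

text \<open>Extension by zero: L2(\<Omega>) becomes the subspace of \<open>l2\<close> that is fixed
  by multiplication with the indicator of \<Omega>.\<close>

definition emb :: "'a::euclidean_space set \<Rightarrow> ('a \<Rightarrow> complex) \<Rightarrow> 'a l2" where
  "emb \<Omega> f = cls (\<lambda>x. indicator \<Omega> x *\<^sub>R f x)"

lemma norm_indicator_sq: "(norm (indicator A x *\<^sub>R (z::complex)))\<^sup>2 = indicator A x *\<^sub>R (norm z)\<^sup>2"
  by (simp add: indicator_def)

lemma L2_iff: "f \<in> L2 \<Omega> \<longleftrightarrow> sq_int (\<lambda>x. indicator \<Omega> x *\<^sub>R f x)"
  unfolding L2_def sq_int_def set_borel_measurable_def set_integrable_def norm_indicator_sq by simp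

lemma L2_norm_emb: "f \<in> L2 \<Omega> \<Longrightarrow> L2_norm \<Omega> f = norm (emb \<Omega> f)"
  unfolding L2_iff L2_norm_def set_lebesgue_integral_def norm_indicator_sq[symmetric] emb_def
  by (simp only: norm_cls[symmetric] real_sqrt_abs abs_norm_cancel)

lemma L2_integral_emb:
  "f \<in> L2 \<Omega> \<Longrightarrow> (LINT x:\<Omega>|lborel. (norm (f x))\<^sup>2) = (norm (emb \<Omega> f))\<^sup>2"
  unfolding L2_iff set_lebesgue_integral_def norm_indicator_sq[symmetric] emb_def
  by (simp only: norm_cls[symmetric])

lemma L2_add: "f \<in> L2 \<Omega> \<Longrightarrow> g \<in> L2 \<Omega> \<Longrightarrow> (\<lambda>x. f x + g x) \<in> L2 \<Omega>"
  unfolding L2_iff scaleR_add_right by (rule sq_int_add)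

lemma L2_diff: "f \<in> L2 \<Omega> \<Longrightarrow> g \<in> L2 \<Omega> \<Longrightarrow> (\<lambda>x. f x - g x) \<in> L2 \<Omega>"
  unfolding L2_iff scaleR_diff_right by (rule sq_int_diff)

lemma L2_cmult: "f \<in> L2 \<Omega> \<Longrightarrow> (\<lambda>x. c * f x) \<in> L2 \<Omega>"
  unfolding L2_iff mult_scaleR_right[symmetric] by (rule sq_int_cmult)

lemma emb_add: "f \<in> L2 \<Omega> \<Longrightarrow> g \<in> L2 \<Omega> \<Longrightarrow> emb \<Omega> (\<lambda>x. f x + g x) = emb \<Omega> f + emb \<Omega> g"
  unfolding L2_iff emb_def scaleR_add_right by (rule cls_add)

lemma emb_diff: "f \<in> L2 \<Omega> \<Longrightarrow> g \<in> L2 \<Omega> \<Longrightarrow> emb \<Omega> (\<lambda>x. f x - g x) = emb \<Omega> f - emb \<Omega> g"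
  unfolding L2_iff emb_def scaleR_diff_right by (rule cls_diff)

lemma emb_of_real: "f \<in> L2 \<Omega> \<Longrightarrow> emb \<Omega> (\<lambda>x. of_real c * f x) = c *\<^sub>R emb \<Omega> f"
  unfolding L2_iff emb_def
  by (subst cls_scaleR[symmetric]) (simp_all add: scaleR_conv_of_real mult.left_commute)

lemma sq_int_L2: "open \<Omega> \<Longrightarrow> sq_int f \<Longrightarrow> f \<in> L2 \<Omega>"
  unfolding L2_iff by (rule sq_int_mul[OF bmeas_indicator]) simp_all

lemma emb_sq_int: "open \<Omega> \<Longrightarrow> sq_int f \<Longrightarrow> emb \<Omega> f = mul (indicator \<Omega>) (cls f)"
  unfolding emb_def by (subst mul_cls) (simp_all add: bmeas_indicator)

lemma emb_rep: "open \<Omega> \<Longrightarrow> emb \<Omega> (rep_l2 F) = mul (indicator \<Omega>) F"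
  by (simp add: emb_sq_int sq_int_rep)

lemma mul_indicator_emb: "open \<Omega> \<Longrightarrow> f \<in> L2 \<Omega> \<Longrightarrow> mul (indicator \<Omega>) (emb \<Omega> f) = emb \<Omega> f"
  unfolding emb_def L2_iff
  by (subst mul_cls) (simp_all add: bmeas_indicator indicator_inter_arith[symmetric])

lemma emb_AE_cong:
  assumes "f \<in> L2 \<Omega>" "g \<in> L2 \<Omega>" "AE x\<in>\<Omega> in lborel. f x = g x"
  shows "emb \<Omega> f = emb \<Omega> g"
proof -
  have "AE x in lborel. indicator \<Omega> x *\<^sub>R f x = indicator \<Omega> x *\<^sub>R g x"
    using assms(3) by eventually_elim (auto simp: indicator_def)
  then show ?thesis using assms(1,2) unfolding emb_def L2_iff by (simp add: cls_eq_iff)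
qed

lemma test_indicator: "\<phi> \<in> test_functions \<Omega> \<Longrightarrow> indicator \<Omega> x *\<^sub>R \<phi> x = \<phi> x"
  using test_zero_outside[of \<phi> \<Omega> x] by (simp add: indicator_def)

lemma emb_test: "\<phi> \<in> test_functions \<Omega> \<Longrightarrow> emb \<Omega> \<phi> = cls \<phi>"
  unfolding emb_def test_indicator by (rule refl)

lemma test_L2: "\<phi> \<in> test_functions \<Omega> \<Longrightarrow> \<phi> \<in> L2 \<Omega>"
  unfolding L2_iff test_indicator by (rule test_sq_int)

lemma Re_pairing:
  assumes f: "f \<in> L2 \<Omega>" and h: "sq_int h"
  shows "Re (LINT x:\<Omega>|lborel. f x * h x) = inner (emb \<Omega> f) (cls (\<lambda>x. cnj (h x)))"
proof -
  have sf: "sq_int (\<lambda>x. indicator \<Omega> x *\<^sub>R f x)" using f by (simp add: L2_iff)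
  have "(LINT x:\<Omega>|lborel. f x * h x) = (LINT x|lborel. (indicator \<Omega> x *\<^sub>R f x) * h x)"
    unfolding set_lebesgue_integral_def by simp
  then have "Re (LINT x:\<Omega>|lborel. f x * h x) = (LINT x|lborel. Re ((indicator \<Omega> x *\<^sub>R f x) * h x))"
    using integral_Re[OF integrable_sq_int_mult[OF sf h]] by (simp only:)
  also have "\<dots> = inner (emb \<Omega> f) (cls (\<lambda>x. cnj (h x)))"
    unfolding emb_def inner_cls[OF sf sq_int_cnj[OF h]]
    by (rule Bochner_Integration.integral_cong[OF refl]) (simp add: inner_complex_def algebra_simps)
  finally show ?thesis .
qed

text \<open>The real part of the defining identity of a weak derivative, written with the scalar
  product. \<open>has_weak_partial\<close> pairs without conjugation, so the test function here
  corresponds to its conjugate there.\<close>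

definition weak_l2 :: "'a::euclidean_space set \<Rightarrow> 'a \<Rightarrow> 'a l2 \<Rightarrow> 'a l2 \<Rightarrow> bool" where
  "weak_l2 \<Omega> b F G \<longleftrightarrow> (\<forall>\<psi>\<in>test_functions \<Omega>. inner F (cls (partial b \<psi>)) = - inner G (cls \<psi>))"

text \<open>Real parts suffice: the real part of the identity for - i \<phi> is the imaginary part
  of the identity for \<phi>, and test functions are stable under conjugation and complex
  multiples.\<close>

lemma has_weak_partial_iff:
  assumes b: "b \<in> Basis"
  shows "has_weak_partial \<Omega> b f g \<longleftrightarrow> f \<in> L2 \<Omega> \<and> g \<in> L2 \<Omega> \<and> weak_l2 \<Omega> b (emb \<Omega> f) (emb \<Omega> g)"
proof -
  define A where "A \<phi> = (LINT x:\<Omega>|lborel. f x * partial b \<phi> x)" for \<phi>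
  define B where "B \<phi> = (LINT x:\<Omega>|lborel. g x * \<phi> x)" for \<phi>
  have cj: "(\<lambda>x. cnj (partial b \<phi> x)) = partial b (\<lambda>x. cnj (\<phi> x))" if "\<phi> \<in> test_functions \<Omega>" for \<phi> :: "'a \<Rightarrow> complex"
    by (rule ext) (simp add: partial_cnj smooth_differentiable test_smooth[OF that])
  have RA: "Re (A \<phi>) = inner (emb \<Omega> f) (cls (partial b (\<lambda>x. cnj (\<phi> x))))"
    if "f \<in> L2 \<Omega>" "\<phi> \<in> test_functions \<Omega>" for \<phi>
    unfolding A_def Re_pairing[OF that(1) test_sq_int[OF test_partial[OF that(2) b]]] cj[OF that(2)] by (rule refl)
  have RB: "Re (B \<phi>) = inner (emb \<Omega> g) (cls (\<lambda>x. cnj (\<phi> x)))"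
    if "g \<in> L2 \<Omega>" "\<phi> \<in> test_functions \<Omega>" for \<phi>
    unfolding B_def Re_pairing[OF that(1) test_sq_int[OF that(2)]] by (rule refl)
  show ?thesis
  proof (intro iffI conjI)
    assume h: "has_weak_partial \<Omega> b f g"
    then show f: "f \<in> L2 \<Omega>" and g: "g \<in> L2 \<Omega>" by (auto simp: has_weak_partial_def)
    show "weak_l2 \<Omega> b (emb \<Omega> f) (emb \<Omega> g)"
      unfolding weak_l2_def
    proof
      fix \<psi> assume p: "\<psi> \<in> test_functions \<Omega>"
      have "A (\<lambda>x. cnj (\<psi> x)) = - B (\<lambda>x. cnj (\<psi> x))"
        using h test_cnj[OF p] unfolding has_weak_partial_def A_def B_def by blast
      then have "Re (A (\<lambda>x. cnj (\<psi> x))) = - Re (B (\<lambda>x. cnj (\<psi> x)))" by simp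
      then show "inner (emb \<Omega> f) (cls (partial b \<psi>)) = - inner (emb \<Omega> g) (cls \<psi>)"
        by (simp add: RA[OF f test_cnj[OF p]] RB[OF g test_cnj[OF p]])
    qed
  next
    assume h: "f \<in> L2 \<Omega> \<and> g \<in> L2 \<Omega> \<and> weak_l2 \<Omega> b (emb \<Omega> f) (emb \<Omega> g)"
    then have f: "f \<in> L2 \<Omega>" and g: "g \<in> L2 \<Omega>" by auto
    have R: "Re (A \<phi>) = - Re (B \<phi>)" if "\<phi> \<in> test_functions \<Omega>" for \<phi>
      using h test_cnj[OF that] unfolding weak_l2_def RA[OF f that] RB[OF g that] by blast
    have "A \<phi> = - B \<phi>" if p: "\<phi> \<in> test_functions \<Omega>" for \<phi>
    proof (rule complex_eqI)
      show "Re (A \<phi>) = Re (- B \<phi>)" using R[OF p] by simp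
      have pe: "partial b (\<lambda>x. - \<i> * \<phi> x) x = - \<i> * partial b \<phi> x" for x
        by (rule partial_cmult[OF smooth_differentiable[OF test_smooth[OF p]]])
      have "A (\<lambda>x. - \<i> * \<phi> x) = - \<i> * A \<phi>"
      proof -
        have "A (\<lambda>x. - \<i> * \<phi> x) = (LINT x:\<Omega>|lborel. - \<i> * (f x * partial b \<phi> x))"
          unfolding A_def pe by (simp only: mult.left_commute)
        then show ?thesis unfolding A_def by (simp only: set_integral_mult_right)
      qed
      moreover have "B (\<lambda>x. - \<i> * \<phi> x) = - \<i> * B \<phi>"
      proof -
        have "B (\<lambda>x. - \<i> * \<phi> x) = (LINT x:\<Omega>|lborel. - \<i> * (g x * \<phi> x))"
          unfolding B_def by (simp only: mult.left_commute)
        then show ?thesis unfolding B_def by (simp only: set_integral_mult_right)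
      qed
      ultimately show "Im (A \<phi>) = Im (- B \<phi>)"
        using R[OF test_cmult[OF p, of "- \<i>"]] by simp
    qed
    then show "has_weak_partial \<Omega> b f g"
      using f g unfolding has_weak_partial_def A_def B_def by blast
  qed
qed

subsection \<open>The fundamental lemma of the calculus of variations\<close>

text \<open>For c > 0 smooth, with values in [0, 1] and zero exactly off the open box from l to u;
  as c decreases to 0 it tends to the indicator of that box. This takes the place of
  mollification.\<close>

definition bump :: "real \<Rightarrow> 'a::euclidean_space \<Rightarrow> 'a \<Rightarrow> 'a \<Rightarrow> real" where
  "bump c l u x = (\<Prod>i\<in>Basis. ramp c ((x - l) \<bullet> i) * ramp c ((u - x) \<bullet> i))"

lemma ramp_bounds: "c > 0 \<Longrightarrow> 0 \<le> ramp c x \<and> ramp c x \<le> 1"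
  by (simp add: ramp_eq)

lemma bump_bounds: "c > 0 \<Longrightarrow> 0 \<le> bump c l u x \<and> bump c l u x \<le> 1"
  unfolding bump_def
  by (intro conjI prod_nonneg prod_le_1 ballI) (auto simp: ramp_bounds intro!: mult_nonneg_nonneg mult_le_one)

lemma bump_outside: "x \<notin> box l u \<Longrightarrow> bump c l u x = 0"
  unfolding bump_def
  by (rule prod_zero) (auto simp: mem_box ramp_eq inner_diff_left)

lemma smooth_ridge_affine:
  fixes v w :: "'a::euclidean_space"
  assumes "smooth_real \<phi>" shows "smooth (\<lambda>x. of_real (\<phi> ((x - w) \<bullet> v)))" "smooth (\<lambda>x. of_real (\<phi> ((w - x) \<bullet> v)))"
proof -
  have "smooth (\<lambda>x. complex_of_real (\<phi> ((id x + (- w)) \<bullet> v)))"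
    by (rule smooth_affine[OF smooth_ridge[OF assms]]) (simp add: linear_id[unfolded id_def])
  then show "smooth (\<lambda>x. of_real (\<phi> ((x - w) \<bullet> v)))" by simp
  have "smooth (\<lambda>x. complex_of_real (\<phi> ((- x + w) \<bullet> v)))"
    by (rule smooth_affine[OF smooth_ridge[OF assms]]) (simp add: linear_uminus)
  then show "smooth (\<lambda>x. of_real (\<phi> ((w - x) \<bullet> v)))" by simp
qed

lemma smooth_bump: "c > 0 \<Longrightarrow> smooth (\<lambda>x. complex_of_real (bump c l u x))"
  unfolding bump_def of_real_prod of_real_mult
  by (rule smooth_prod[OF finite_Basis], rule smooth_mult) (rule smooth_ridge_affine[OF ramp_smooth], assumption)+

lemma test_bump:
  assumes "c > 0" "cbox l u \<subseteq> \<Omega>"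
  shows "(\<lambda>x. complex_of_real (bump c l u x)) \<in> test_functions \<Omega>"
proof (rule testI_compact[OF smooth_bump[OF assms(1)] compact_cbox assms(2)])
  fix x assume "complex_of_real (bump c l u x) \<noteq> 0"
  then have "x \<in> box l u" using bump_outside by force
  then show "x \<in> cbox l u" using box_subset_cbox by blast
qed

lemma ramp_tendsto: "x > 0 \<Longrightarrow> (\<lambda>n. ramp (inverse (real (Suc n))) x) \<longlonglongrightarrow> 1"
proof -
  assume x: "x > 0"
  have "(\<lambda>n. exp (- (inverse (real (Suc n)) / x))) \<longlonglongrightarrow> exp (- (0 / x))"
    by (intro tendsto_exp tendsto_minus tendsto_divide LIMSEQ_inverse_real_of_nat tendsto_const) (use x in simp)
  then show ?thesis using x by (simp add: ramp_eq)
qed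

lemma bump_tendsto: "(\<lambda>n. bump (inverse (real (Suc n))) l u x) \<longlonglongrightarrow> indicator (box l u) x"
proof (cases "x \<in> box l u")
  case True
  have "(\<lambda>n. bump (inverse (real (Suc n))) l u x) \<longlonglongrightarrow> (\<Prod>i\<in>(Basis::'a set). 1 * 1)"
    unfolding bump_def
    by (rule tendsto_prod, rule tendsto_mult) (rule ramp_tendsto, use True in \<open>simp add: mem_box inner_diff_left\<close>)+
  with True show ?thesis by simp
next
  case False
  then show ?thesis by (simp add: bump_outside)
qed

text \<open>Bumps times an arbitrary complex constant \<open>w\<close> are admissible because the
  closed box lies in \<Omega>. They converge to the indicator times \<open>w\<close>, and since
  \<open>w\<close> is free the real scalar products determine the complex integral.\<close>

lemma box_integral_zero:
  assumes g: "sq_int g" and z: "\<And>\<psi>. \<psi> \<in> test_functions \<Omega> \<Longrightarrow> inner (cls g) (cls \<psi>) = 0"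
    and sub: "cbox l u \<subseteq> \<Omega>"
  shows "(LINT x|lborel. indicator (box l u) x *\<^sub>R g x) = 0"
proof -
  have [measurable]: "g \<in> borel_measurable borel" using g by (simp add: sq_int_def)
  define d where "d n = inverse (real (Suc n))" for n
  have d: "d n > 0" for n by (simp add: d_def)
  have fin: "emeasure lborel (box l u) < \<infinity>" by (rule emeasure_bounded_finite) simp
  have sqb: "sq_int (\<lambda>x. complex_of_real (indicator (box l u) x))"
    by (rule sq_int_bounded_support[OF _ fin, where B=1]) (auto simp: indicator_def)
  have ibox: "integrable lborel (\<lambda>x. indicator (box l u) x *\<^sub>R g x)"
    using integrable_sq_int_mult[OF sqb g] by (simp add: scaleR_conv_of_real)
  have "inner (LINT x|lborel. indicator (box l u) x *\<^sub>R g x) w = 0" for w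
  proof -
    have "(\<lambda>n. LINT x|lborel. inner (g x) (w * complex_of_real (bump (d n) l u x)))
        \<longlonglongrightarrow> (LINT x|lborel. inner (g x) (w * complex_of_real (indicator (box l u) x)))"
    proof (rule integral_dominated_convergence[where w="\<lambda>x. norm w * norm (indicator (box l u) x *\<^sub>R g x)"])
      show "integrable lborel (\<lambda>x. norm w * norm (indicator (box l u) x *\<^sub>R g x))"
        by (rule integrable_mult_right[OF integrable_norm[OF ibox]])
      show "AE x in lborel. (\<lambda>n. inner (g x) (w * complex_of_real (bump (d n) l u x)))
          \<longlonglongrightarrow> inner (g x) (w * complex_of_real (indicator (box l u) x))"
        unfolding d_def
        by (rule AE_I2, rule tendsto_inner[OF tendsto_const], rule tendsto_mult[OF tendsto_const],
            rule tendsto_of_real[OF bump_tendsto])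
      fix n
      have [measurable]: "(\<lambda>x. complex_of_real (bump (d n) l u x)) \<in> borel_measurable borel"
        by (rule smooth_measurable[OF smooth_bump[OF d]])
      show "(\<lambda>x. inner (g x) (w * complex_of_real (bump (d n) l u x))) \<in> borel_measurable lborel" by measurable
      show "AE x in lborel. norm (inner (g x) (w * complex_of_real (bump (d n) l u x)))
          \<le> norm w * norm (indicator (box l u) x *\<^sub>R g x)"
      proof (rule AE_I2)
        fix x
        show "norm (inner (g x) (w * complex_of_real (bump (d n) l u x)))
          \<le> norm w * norm (indicator (box l u) x *\<^sub>R g x)"
        proof (cases "x \<in> box l u")
          case True
          have "\<bar>inner (g x) (w * complex_of_real (bump (d n) l u x))\<bar>
              \<le> norm (g x) * norm (w * complex_of_real (bump (d n) l u x))"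
            by (rule Cauchy_Schwarz_ineq2)
          also have "\<dots> = norm w * norm (g x) * bump (d n) l u x"
            using bump_bounds[OF d[of n], of l u x] by (simp add: norm_mult)
          also have "\<dots> \<le> norm w * norm (g x) * 1"
            by (rule mult_left_mono) (use bump_bounds[OF d[of n], of l u x] in auto)
          finally show ?thesis using True by simp
        qed (simp add: bump_outside)
      qed
    qed measurable
    moreover have "(LINT x|lborel. inner (g x) (w * complex_of_real (bump (d n) l u x))) = 0" for n
      using z[OF test_cmult[OF test_bump[OF d[of n] sub], of w]]
      by (subst (asm) inner_cls[OF g test_sq_int[OF test_cmult[OF test_bump[OF d[of n] sub]]]])
    ultimately have "(LINT x|lborel. inner (g x) (w * complex_of_real (indicator (box l u) x))) = 0"
      by (simp add: LIMSEQ_const_iff)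
    moreover have "inner (g x) (w * complex_of_real (indicator (box l u) x)) = inner (indicator (box l u) x *\<^sub>R g x) w" for x
      by (simp add: indicator_def)
    ultimately show ?thesis using integral_inner_left[OF ibox] by simp
  qed
  then show ?thesis by (metis inner_eq_zero_iff)
qed

text \<open>Dynkin's argument: open boxes are stable under intersection and generate the Borel sets.
  The integral over the whole space enters for complements.\<close>

lemma AE_zero_of_box_integrals:
  fixes h :: "'a::euclidean_space \<Rightarrow> complex"
  assumes h: "integrable lborel h" and z: "\<And>l u. (LINT x|lborel. indicator (box l u) x *\<^sub>R h x) = 0"
    and tot: "(LINT x|lborel. h x) = 0"
  shows "AE x in lborel. h x = 0"
proof (rule sigma_finite_measure.density_zero[OF lborel.sigma_finite_measure_axioms h])
  have [measurable]: "h \<in> borel_measurable borel" using h by (simp add: borel_measurable_integrable)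
  fix A :: "'a set" assume "A \<in> sets lborel"
  then have A: "A \<in> sigma_sets UNIV (range (\<lambda>(l, u). box l u :: 'a set))"
    by (simp add: borel_eq_box)
  have si: "set_integrable lborel B h" if "B \<in> sets borel" for B
    unfolding set_integrable_def by (rule integrable_mult_indicator) (use that h in auto)
  have stable: "Int_stable (range (\<lambda>(l, u). box l u :: 'a set))"
    by (auto simp: Int_stable_def box_Int_box)
  have meas: "B \<in> sets borel" if "B \<in> sigma_sets UNIV (range (\<lambda>(l, u). box l u :: 'a set))" for B :: "'a set"
    using that by (simp add: borel_eq_box)
  have pw: "range (\<lambda>(l, u). box l u :: 'a set) \<subseteq> Pow UNIV" by simp
  from stable pw A show "set_lebesgue_integral lborel A h = 0"
  proof (induction rule: sigma_sets_induct_disjoint)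
    case (basic B)
    then show ?case using z by (auto simp: set_lebesgue_integral_def)
  next
    case empty
    show ?case by (simp add: set_lebesgue_integral_def)
  next
    case (compl B)
    have "(LINT x|lborel. h x) = set_lebesgue_integral lborel (B \<union> (UNIV - B)) h"
      by (simp add: set_lebesgue_integral_def)
    also have "\<dots> = set_lebesgue_integral lborel B h + set_lebesgue_integral lborel (UNIV - B) h"
      by (rule set_integral_Un) (use compl.hyps in \<open>auto intro!: si meas sigma_sets.Compl\<close>)
    finally show ?case using tot compl by simp
  next
    case (union B)
    have "set_lebesgue_integral lborel (\<Union>i. B i) h = (\<Sum>i. set_lebesgue_integral lborel (B i) h)"
    proof (rule lebesgue_integral_countable_add)
      show "B i \<in> sets lborel" for i using meas union.hyps by auto
      show "B i \<inter> B j = {}" if "i \<noteq> j" for i j using union.hyps that by (auto simp: disjoint_family_on_def)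
      have "(\<Union>i. B i) \<in> sets borel" using meas union.hyps by (intro sets.countable_UN) auto
      then show "set_integrable lborel (\<Union>i. B i) h" by (rule si)
    qed
    then show ?case using union by simp
  qed
qed

text \<open>A local argument over a countable cover of \<Omega> by closed boxes: cutting
  \<open>g\<close> off to the open box makes it integrable with vanishing box integrals, and the
  boundary of a box is a null set.\<close>

lemma fundamental_lemma:
  fixes g :: "'a::euclidean_space \<Rightarrow> complex"
  assumes op: "open \<Omega>" and g: "sq_int g"
    and z: "\<And>\<psi>. \<psi> \<in> test_functions \<Omega> \<Longrightarrow> inner (cls g) (cls \<psi>) = 0"
  shows "AE x\<in>\<Omega> in lborel. g x = 0"
proof -
  obtain D where D: "countable D" "\<And>X. X \<in> D \<Longrightarrow> X \<subseteq> \<Omega>" "\<And>X. X \<in> D \<Longrightarrow> \<exists>a b. X = cbox a b" "\<Union>D = \<Omega>"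
    using open_countable_Union_open_cbox[OF op] by (metis Pow_iff subsetD)
  have "AE x in lborel. x \<in> X \<longrightarrow> g x = 0" if X: "X \<in> D" for X
  proof -
    obtain l u where lu: "X = cbox l u" using D(3)[OF X] by blast
    have sub: "cbox l u \<subseteq> \<Omega>" using D(2)[OF X] lu by simp
    define h where "h x = indicator (box l u) x *\<^sub>R g x" for x
    have fin: "emeasure lborel (box l u) < \<infinity>" by (rule emeasure_bounded_finite) simp
    have sqb: "sq_int (\<lambda>x. complex_of_real (indicator (box l u) x))"
      by (rule sq_int_bounded_support[OF _ fin, where B=1]) (auto simp: indicator_def)
    have ih: "integrable lborel h"
      using integrable_sq_int_mult[OF sqb g] by (simp add: scaleR_conv_of_real h_def[abs_def])
    have "AE x in lborel. h x = 0"
    proof (rule AE_zero_of_box_integrals[OF ih])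
      show "(LINT x|lborel. h x) = 0"
        unfolding h_def by (rule box_integral_zero[OF g z sub])
      fix l' u' :: 'a
      obtain a b where ab: "box l' u' \<inter> box l u = box a b" unfolding box_Int_box by blast
      \<comment> \<open>When the open box is empty the closed one may be a degenerate box that
        leaves \<Omega>, so this case is set apart.\<close>
      have "(LINT x|lborel. indicator (box a b) x *\<^sub>R g x) = 0"
      proof (cases "box a b = {}")
        case False
        have "cbox a b = closure (box a b)" using False by (simp add: closure_box)
        also have "\<dots> \<subseteq> closure (box l u)" using ab by (intro closure_mono) blast
        also have "\<dots> \<subseteq> cbox l u" by (rule closure_minimal[OF box_subset_cbox closed_cbox])
        also note sub
        finally show ?thesis by (intro box_integral_zero[OF g z])
      qed simp
      moreover have "indicator (box l' u') x *\<^sub>R h x = indicator (box a b) x *\<^sub>R g x" for x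
        unfolding h_def ab[symmetric] by (simp add: indicator_def)
      ultimately show "(LINT x|lborel. indicator (box l' u') x *\<^sub>R h x) = 0" by simp
    qed
    moreover have "AE x in lborel. x \<notin> cbox l u - box l u"
    proof (rule AE_not_in)
      have "emeasure lborel (cbox l u - box l u) = emeasure lborel (cbox l u) - emeasure lborel (box l u)"
        by (rule emeasure_Diff) (use fin box_subset_cbox in auto)
      also have "\<dots> = 0"
        using fin by (simp add: emeasure_lborel_cbox_eq emeasure_lborel_box_eq)
      finally show "cbox l u - box l u \<in> null_sets lborel" by (simp add: null_sets_def)
    qed
    ultimately show ?thesis
      by eventually_elim (auto simp: h_def lu indicator_def)
  qed
  then have "AE x in lborel. \<forall>X\<in>D. x \<in> X \<longrightarrow> g x = 0"
    unfolding AE_ball_countable[OF D(1)] by blast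
  then show ?thesis by eventually_elim (use D(4) in blast)
qed

lemma weak_l2_unique:
  assumes op: "open \<Omega>" and f: "f \<in> L2 \<Omega>" "g \<in> L2 \<Omega>"
    and w: "weak_l2 \<Omega> b F (emb \<Omega> f)" "weak_l2 \<Omega> b F (emb \<Omega> g)"
  shows "emb \<Omega> f = emb \<Omega> g"
proof -
  define h where "h x = indicator \<Omega> x *\<^sub>R (f x - g x)" for x
  have sq: "sq_int h" using L2_diff[OF f] unfolding L2_iff h_def[abs_def] .
  have ch: "cls h = emb \<Omega> f - emb \<Omega> g" using emb_diff[OF f] by (simp add: emb_def h_def[abs_def])
  have "AE x\<in>\<Omega> in lborel. h x = 0"
  proof (rule fundamental_lemma[OF op sq])
    fix \<psi> assume "\<psi> \<in> test_functions \<Omega>"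
    then have "- inner (emb \<Omega> f) (cls \<psi>) = - inner (emb \<Omega> g) (cls \<psi>)"
      using w unfolding weak_l2_def by metis
    then show "inner (cls h) (cls \<psi>) = 0" unfolding ch by (simp add: inner_diff_left)
  qed
  then have "AE x\<in>\<Omega> in lborel. f x = g x"
    by eventually_elim (simp add: h_def)
  then show ?thesis by (rule emb_AE_cong[OF f])
qed

subsection \<open>The form domain\<close>

text \<open>The form domain as the closure of the graph of the gradient on test functions: F carries
  its gradient G along, which avoids the choice hidden in \<open>weak_partial\<close>. Identities
  for test functions pass to such pairs by taking limits.\<close>

definition h10 :: "'a::euclidean_space set \<Rightarrow> 'a l2 \<Rightarrow> ('a \<Rightarrow> 'a l2) \<Rightarrow> bool" where
  "h10 \<Omega> F G \<longleftrightarrow> (\<exists>\<phi>. (\<forall>n. \<phi> n \<in> test_functions \<Omega>) \<and> (\<lambda>n. cls (\<phi> n)) \<longlonglongrightarrow> F \<and>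
     (\<forall>b\<in>Basis. (\<lambda>n. cls (partial b (\<phi> n))) \<longlonglongrightarrow> G b))"

lemma h10_test: "\<phi> \<in> test_functions \<Omega> \<Longrightarrow> h10 \<Omega> (cls \<phi>) (\<lambda>b. cls (partial b \<phi>))"
  unfolding h10_def by (rule exI[of _ "\<lambda>n. \<phi>"]) simp

lemma weak_l2_test: "\<phi> \<in> test_functions \<Omega> \<Longrightarrow> b \<in> Basis \<Longrightarrow> weak_l2 \<Omega> b (cls \<phi>) (cls (partial b \<phi>))"
  unfolding weak_l2_def using test_ibp by blast

lemma weak_l2_diff: "weak_l2 \<Omega> b F G \<Longrightarrow> weak_l2 \<Omega> b F' G' \<Longrightarrow> weak_l2 \<Omega> b (F - F') (G - G')"
  unfolding weak_l2_def by (simp add: inner_diff_left)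

lemma H1_weak_partial:
  assumes "u \<in> H1 \<Omega>" "b \<in> Basis"
  shows "weak_partial \<Omega> b u \<in> L2 \<Omega>" "weak_l2 \<Omega> b (emb \<Omega> u) (emb \<Omega> (weak_partial \<Omega> b u))"
proof -
  have "\<exists>g. has_weak_partial \<Omega> b u g" using assms by (simp add: H1_def)
  then have "has_weak_partial \<Omega> b u (weak_partial \<Omega> b u)" unfolding weak_partial_def by (rule someI_ex)
  then show "weak_partial \<Omega> b u \<in> L2 \<Omega>" "weak_l2 \<Omega> b (emb \<Omega> u) (emb \<Omega> (weak_partial \<Omega> b u))"
    using has_weak_partial_iff[OF assms(2)] by blast+
qed

text \<open>By uniqueness of weak derivatives any candidate is the chosen one. The condition on the
  support fits the candidate to \<open>emb\<close>: the defining identity only sees values on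
  \<Omega>, whereas \<open>emb\<close> is zero outside.\<close>

lemma H1I:
  assumes op: "open \<Omega>" and u: "u \<in> L2 \<Omega>"
    and G: "\<And>b. b \<in> Basis \<Longrightarrow> weak_l2 \<Omega> b (emb \<Omega> u) (G b)"
    and S: "\<And>b. b \<in> Basis \<Longrightarrow> mul (indicator \<Omega>) (G b) = G b"
  shows "u \<in> H1 \<Omega>" "\<And>b. b \<in> Basis \<Longrightarrow> emb \<Omega> (weak_partial \<Omega> b u) = G b"
proof -
  have e: "emb \<Omega> (rep_l2 (G b)) = G b" if "b \<in> Basis" for b using S[OF that] emb_rep[OF op] by metis
  have L: "rep_l2 (G b) \<in> L2 \<Omega>" for b by (rule sq_int_L2[OF op sq_int_rep])
  have "has_weak_partial \<Omega> b u (rep_l2 (G b))" if "b \<in> Basis" for b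
    using has_weak_partial_iff[OF that] u L G[OF that] e[OF that] by metis
  then show u1: "u \<in> H1 \<Omega>" using u by (auto simp: H1_def)
  fix b :: 'a assume b: "b \<in> Basis"
  have "emb \<Omega> (weak_partial \<Omega> b u) = emb \<Omega> (rep_l2 (G b))"
    by (rule weak_l2_unique[OF op H1_weak_partial(1)[OF u1 b] L H1_weak_partial(2)[OF u1 b]])
      (use G[OF b] e[OF b] in simp)
  then show "emb \<Omega> (weak_partial \<Omega> b u) = G b" using e[OF b] by simp
qed

lemma grad_norm_emb:
  assumes "u \<in> H1 \<Omega>"
  shows "(grad_norm \<Omega> u)\<^sup>2 = (\<Sum>b\<in>Basis. (norm (emb \<Omega> (weak_partial \<Omega> b u)))\<^sup>2)"
proof -
  have L: "weak_partial \<Omega> b u \<in> L2 \<Omega>" if "b \<in> Basis" for b by (rule H1_weak_partial(1)[OF assms that])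
  have i: "integrable lborel (\<lambda>x. indicator \<Omega> x *\<^sub>R (norm (weak_partial \<Omega> b u x))\<^sup>2)" if "b \<in> Basis" for b
    using L[OF that] by (simp add: L2_def set_integrable_def)
  have "(LINT x:\<Omega>|lborel. (\<Sum>b\<in>Basis. (norm (weak_partial \<Omega> b u x))\<^sup>2))
      = (\<Sum>b\<in>Basis. (LINT x:\<Omega>|lborel. (norm (weak_partial \<Omega> b u x))\<^sup>2))"
    unfolding set_lebesgue_integral_def scaleR_sum_right by (rule Bochner_Integration.integral_sum[OF i])
  also have "\<dots> = (\<Sum>b\<in>Basis. (norm (emb \<Omega> (weak_partial \<Omega> b u)))\<^sup>2)"
    by (rule sum.cong[OF refl]) (rule L2_integral_emb[OF L])
  finally show ?thesis unfolding grad_norm_def by (simp add: sum_nonneg)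
qed

lemma H1_norm_sq:
  assumes "u \<in> H1 \<Omega>"
  shows "(H1_norm \<Omega> u)\<^sup>2 = (norm (emb \<Omega> u))\<^sup>2 + (\<Sum>b\<in>Basis. (norm (emb \<Omega> (weak_partial \<Omega> b u)))\<^sup>2)"
proof -
  have "u \<in> L2 \<Omega>" using assms by (simp add: H1_def)
  then show ?thesis unfolding H1_norm_def grad_norm_emb[OF assms] L2_norm_emb[OF \<open>u \<in> L2 \<Omega>\<close>]
    by (simp add: sum_nonneg)
qed

lemma H1_diff_test:
  assumes op: "open \<Omega>" and u: "u \<in> H1 \<Omega>" and \<phi>: "\<phi> \<in> test_functions \<Omega>"
  shows "(\<lambda>x. \<phi> x - u x) \<in> H1 \<Omega>"
    and "emb \<Omega> (\<lambda>x. \<phi> x - u x) = cls \<phi> - emb \<Omega> u"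
    and "\<And>b. b \<in> Basis \<Longrightarrow> emb \<Omega> (weak_partial \<Omega> b (\<lambda>x. \<phi> x - u x)) = cls (partial b \<phi>) - emb \<Omega> (weak_partial \<Omega> b u)"
proof -
  have uL: "u \<in> L2 \<Omega>" using u by (simp add: H1_def)
  show e: "emb \<Omega> (\<lambda>x. \<phi> x - u x) = cls \<phi> - emb \<Omega> u"
    by (simp add: emb_diff[OF test_L2[OF \<phi>] uL] emb_test[OF \<phi>])
  define G where "G b = cls (partial b \<phi>) - emb \<Omega> (weak_partial \<Omega> b u)" for b
  have w: "weak_l2 \<Omega> b (emb \<Omega> (\<lambda>x. \<phi> x - u x)) (G b)" if "b \<in> Basis" for b
    unfolding e G_def by (rule weak_l2_diff[OF weak_l2_test[OF \<phi> that] H1_weak_partial(2)[OF u that]])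
  have s: "mul (indicator \<Omega>) (G b) = G b" if "b \<in> Basis" for b
  proof -
    have "G b = emb \<Omega> (\<lambda>x. partial b \<phi> x - weak_partial \<Omega> b u x)"
      unfolding G_def
      by (simp add: emb_diff[OF test_L2[OF test_partial[OF \<phi> that]] H1_weak_partial(1)[OF u that]] emb_test[OF test_partial[OF \<phi> that]])
    then show ?thesis
      using mul_indicator_emb[OF op L2_diff[OF test_L2[OF test_partial[OF \<phi> that]] H1_weak_partial(1)[OF u that]]] by simp
  qed
  note H = H1I[OF op L2_diff[OF test_L2[OF \<phi>] uL] w s]
  show "(\<lambda>x. \<phi> x - u x) \<in> H1 \<Omega>" by (rule H(1))
  show "\<And>b. b \<in> Basis \<Longrightarrow> emb \<Omega> (weak_partial \<Omega> b (\<lambda>x. \<phi> x - u x)) = cls (partial b \<phi>) - emb \<Omega> (weak_partial \<Omega> b u)"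
    using H(2) unfolding G_def .
qed

lemma norm_sq_le_sum: "b \<in> Basis \<Longrightarrow> (norm (f b))\<^sup>2 \<le> (\<Sum>b\<in>Basis. (norm (f b :: 'b::real_normed_vector))\<^sup>2)"
  by (rule member_le_sum) auto

lemma h10_of_H10:
  assumes op: "open \<Omega>" and u: "u \<in> H10 \<Omega>"
  shows "h10 \<Omega> (emb \<Omega> u) (\<lambda>b. emb \<Omega> (weak_partial \<Omega> b u))"
proof -
  have u1: "u \<in> H1 \<Omega>" using u by (simp add: H10_def)
  obtain \<phi> where \<phi>: "\<And>n. \<phi> n \<in> test_functions \<Omega>" and lim: "(\<lambda>n. H1_norm \<Omega> (\<lambda>x. \<phi> n x - u x)) \<longlonglongrightarrow> 0"
    using u unfolding H10_def by blast
  note D = H1_diff_test[OF op u1 \<phi>]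
  have nn: "0 \<le> H1_norm \<Omega> v" for v unfolding H1_norm_def by simp
  have sq: "(H1_norm \<Omega> (\<lambda>x. \<phi> n x - u x))\<^sup>2 = (norm (cls (\<phi> n) - emb \<Omega> u))\<^sup>2 +
     (\<Sum>b\<in>Basis. (norm (cls (partial b (\<phi> n)) - emb \<Omega> (weak_partial \<Omega> b u)))\<^sup>2)" for n
    unfolding H1_norm_sq[OF D(1)] D(2) by (simp add: D(3))
  have "norm (cls (\<phi> n) - emb \<Omega> u) \<le> H1_norm \<Omega> (\<lambda>x. \<phi> n x - u x)" for n
    by (rule power2_le_imp_le[OF _ nn]) (simp add: sq sum_nonneg)
  then have "(\<lambda>n. cls (\<phi> n) - emb \<Omega> u) \<longlonglongrightarrow> 0"
    by (intro Lim_null_comparison[OF always_eventually lim]) simp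
  then have 1: "(\<lambda>n. cls (\<phi> n)) \<longlonglongrightarrow> emb \<Omega> u" by (rule LIM_zero_cancel)
  have 2: "(\<lambda>n. cls (partial b (\<phi> n))) \<longlonglongrightarrow> emb \<Omega> (weak_partial \<Omega> b u)" if b: "b \<in> Basis" for b
  proof -
    have "norm (cls (partial b (\<phi> n)) - emb \<Omega> (weak_partial \<Omega> b u)) \<le> H1_norm \<Omega> (\<lambda>x. \<phi> n x - u x)" for n
    proof (rule power2_le_imp_le[OF _ nn])
      have "(norm (cls (partial b (\<phi> n)) - emb \<Omega> (weak_partial \<Omega> b u)))\<^sup>2
          \<le> (\<Sum>b\<in>Basis. (norm (cls (partial b (\<phi> n)) - emb \<Omega> (weak_partial \<Omega> b u)))\<^sup>2)"
        using norm_sq_le_sum[OF b, of "\<lambda>b. cls (partial b (\<phi> n)) - emb \<Omega> (weak_partial \<Omega> b u)"] .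
      then show "(norm (cls (partial b (\<phi> n)) - emb \<Omega> (weak_partial \<Omega> b u)))\<^sup>2 \<le> (H1_norm \<Omega> (\<lambda>x. \<phi> n x - u x))\<^sup>2"
        unfolding sq by (simp add: add_increasing)
    qed
    then have "(\<lambda>n. cls (partial b (\<phi> n)) - emb \<Omega> (weak_partial \<Omega> b u)) \<longlonglongrightarrow> 0"
      by (intro Lim_null_comparison[OF always_eventually lim]) simp
    then show ?thesis by (rule LIM_zero_cancel)
  qed
  show ?thesis unfolding h10_def using \<phi> 1 2 by blast
qed

lemma h10_supported:
  assumes op: "open \<Omega>" and h: "h10 \<Omega> F G"
  shows "mul (indicator \<Omega>) F = F" "\<And>b. b \<in> Basis \<Longrightarrow> mul (indicator \<Omega>) (G b) = G b"
proof -
  obtain \<phi> where \<phi>: "\<And>n. \<phi> n \<in> test_functions \<Omega>" and 1: "(\<lambda>n. cls (\<phi> n)) \<longlonglongrightarrow> F"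
    and 2: "\<And>b. b \<in> Basis \<Longrightarrow> (\<lambda>n. cls (partial b (\<phi> n))) \<longlonglongrightarrow> G b" using h unfolding h10_def by blast
  have bm: "bmeas (indicator \<Omega> :: 'a \<Rightarrow> real)" using op by (simp add: bmeas_indicator)
  have fixed: "mul (indicator \<Omega>) (cls \<psi>) = cls \<psi>" if "\<psi> \<in> test_functions \<Omega>" for \<psi>
    using mul_indicator_emb[OF op test_L2[OF that]] emb_test[OF that] by simp
  have "(\<lambda>n. mul (indicator \<Omega>) (cls (\<phi> n))) \<longlonglongrightarrow> mul (indicator \<Omega>) F"
    by (rule bounded_linear.tendsto[OF bounded_linear_mul[OF bm] 1])
  then show "mul (indicator \<Omega>) F = F" using 1 LIMSEQ_unique unfolding fixed[OF \<phi>] by blast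
  fix b :: 'a assume b: "b \<in> Basis"
  have "(\<lambda>n. mul (indicator \<Omega>) (cls (partial b (\<phi> n)))) \<longlonglongrightarrow> mul (indicator \<Omega>) (G b)"
    by (rule bounded_linear.tendsto[OF bounded_linear_mul[OF bm] 2[OF b]])
  then show "mul (indicator \<Omega>) (G b) = G b" using 2[OF b] LIMSEQ_unique unfolding fixed[OF test_partial[OF \<phi> b]] by blast
qed

text \<open>Integration by parts with a fixed test function passes to the limit, so the limit of the
  gradients is the weak gradient; the \<open>H1_norm\<close> of the differences is then computed
  from the same limits.\<close>

lemma H10_of_h10:
  assumes op: "open \<Omega>" and h: "h10 \<Omega> F G" and u: "sq_int u" "cls u = F"
  shows "u \<in> H10 \<Omega>" "u \<in> H1 \<Omega>" "emb \<Omega> u = F" "\<And>b. b \<in> Basis \<Longrightarrow> emb \<Omega> (weak_partial \<Omega> b u) = G b"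
proof -
  obtain \<phi> where \<phi>: "\<And>n. \<phi> n \<in> test_functions \<Omega>" and 1: "(\<lambda>n. cls (\<phi> n)) \<longlonglongrightarrow> F"
    and 2: "\<And>b. b \<in> Basis \<Longrightarrow> (\<lambda>n. cls (partial b (\<phi> n))) \<longlonglongrightarrow> G b" using h unfolding h10_def by blast
  note S = h10_supported[OF op h]
  show e: "emb \<Omega> u = F" using emb_sq_int[OF op u(1)] u(2) S(1) by simp
  have uL: "u \<in> L2 \<Omega>" by (rule sq_int_L2[OF op u(1)])
  have w: "weak_l2 \<Omega> b (emb \<Omega> u) (G b)" if b: "b \<in> Basis" for b
    unfolding e weak_l2_def
  proof
    fix \<psi> assume p: "\<psi> \<in> test_functions \<Omega>"
    have "(\<lambda>n. inner (cls (\<phi> n)) (cls (partial b \<psi>))) \<longlonglongrightarrow> inner F (cls (partial b \<psi>))"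
      by (rule tendsto_inner[OF 1 tendsto_const])
    moreover have "(\<lambda>n. - inner (cls (partial b (\<phi> n))) (cls \<psi>)) \<longlonglongrightarrow> - inner (G b) (cls \<psi>)"
      by (rule tendsto_minus[OF tendsto_inner[OF 2[OF b] tendsto_const]])
    ultimately show "inner F (cls (partial b \<psi>)) = - inner (G b) (cls \<psi>)"
      unfolding test_ibp[OF \<phi> p b] by (rule LIMSEQ_unique)
  qed
  note H = H1I[OF op uL w S(2)]
  show u1: "u \<in> H1 \<Omega>" by (rule H(1))
  show wp: "\<And>b. b \<in> Basis \<Longrightarrow> emb \<Omega> (weak_partial \<Omega> b u) = G b" by (rule H(2))
  note D = H1_diff_test[OF op u1 \<phi>]
  have "(H1_norm \<Omega> (\<lambda>x. \<phi> n x - u x))\<^sup>2 = (norm (cls (\<phi> n) - F))\<^sup>2 +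
     (\<Sum>b\<in>Basis. (norm (cls (partial b (\<phi> n)) - G b))\<^sup>2)" for n
    unfolding H1_norm_sq[OF D(1)] D(2) by (simp add: D(3) wp e)
  moreover have "(\<lambda>n. (norm (cls (\<phi> n) - F))\<^sup>2 + (\<Sum>b\<in>Basis. (norm (cls (partial b (\<phi> n)) - G b))\<^sup>2))
      \<longlonglongrightarrow> (norm (F - F))\<^sup>2 + (\<Sum>b\<in>Basis. (norm (G b - G b))\<^sup>2)"
    by (intro tendsto_add tendsto_power tendsto_norm tendsto_diff tendsto_sum 1 2 tendsto_const)
  ultimately have "(\<lambda>n. (H1_norm \<Omega> (\<lambda>x. \<phi> n x - u x))\<^sup>2) \<longlonglongrightarrow> 0" by simp
  then have "(\<lambda>n. sqrt ((H1_norm \<Omega> (\<lambda>x. \<phi> n x - u x))\<^sup>2)) \<longlonglongrightarrow> sqrt 0" by (rule tendsto_real_sqrt)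
  moreover have "0 \<le> H1_norm \<Omega> v" for v unfolding H1_norm_def by simp
  ultimately have "(\<lambda>n. H1_norm \<Omega> (\<lambda>x. \<phi> n x - u x)) \<longlonglongrightarrow> 0" by simp
  then show "u \<in> H10 \<Omega>" using u1 \<phi> unfolding H10_def by blast
qed

text \<open>The weak form of the equation inside \<open>l2\<close>, tested with any pair from the
  form domain. Only the real part of the complex identity is kept, since the energy estimates are
  real.\<close>

lemma dirichlet_laplacian_h10:
  assumes op: "open \<Omega>" and d: "dirichlet_laplacian \<Omega> u f" and h: "h10 \<Omega> V H"
  shows "(\<Sum>b\<in>Basis. inner (H b) (emb \<Omega> (weak_partial \<Omega> b u))) = inner V (emb \<Omega> f)"
proof -
  define v where "v = rep_l2 V"
  note H = H10_of_h10[OF op h sq_int_rep cls_rep, folded v_def]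
  have u1: "u \<in> H1 \<Omega>" and fL: "f \<in> L2 \<Omega>" and vL: "v \<in> L2 \<Omega>"
    using d H(1) by (auto simp: dirichlet_laplacian_def H10_def H1_def)
  have pair: "(LINT x:\<Omega>|lborel. Re (cnj (p x) * q x)) = inner (emb \<Omega> p) (emb \<Omega> q)"
    "integrable lborel (\<lambda>x. indicator \<Omega> x *\<^sub>R (cnj (p x) * q x))"
    if "p \<in> L2 \<Omega>" "q \<in> L2 \<Omega>" for p q
  proof -
    have sp: "sq_int (\<lambda>x. indicator \<Omega> x *\<^sub>R p x)" "sq_int (\<lambda>x. indicator \<Omega> x *\<^sub>R q x)" using that by (auto simp: L2_iff)
    have eq: "cnj (indicator \<Omega> x *\<^sub>R p x) * (indicator \<Omega> x *\<^sub>R q x) = indicator \<Omega> x *\<^sub>R (cnj (p x) * q x)" for x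
      by (simp add: indicator_def)
    show "integrable lborel (\<lambda>x. indicator \<Omega> x *\<^sub>R (cnj (p x) * q x))"
      using integrable_sq_int_mult[OF sq_int_cnj[OF sp(1)] sp(2)] unfolding eq .
    have "inner (emb \<Omega> p) (emb \<Omega> q) = (LINT x|lborel. Re (indicator \<Omega> x *\<^sub>R (cnj (p x) * q x)))"
      unfolding emb_def inner_cls[OF sp] inner_complex_Re eq by (rule refl)
    then show "(LINT x:\<Omega>|lborel. Re (cnj (p x) * q x)) = inner (emb \<Omega> p) (emb \<Omega> q)"
      unfolding set_lebesgue_integral_def by simp
  qed
  have wL: "weak_partial \<Omega> b v \<in> L2 \<Omega>" "weak_partial \<Omega> b u \<in> L2 \<Omega>" if "b \<in> Basis" for b
    using H1_weak_partial(1) H(2) u1 that by blast+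
  have "Re (LINT x:\<Omega>|lborel. (\<Sum>b\<in>Basis. cnj (weak_partial \<Omega> b v x) * weak_partial \<Omega> b u x))
      = Re (LINT x:\<Omega>|lborel. cnj (v x) * f x)"
    using d H(1) unfolding dirichlet_laplacian_def by simp
  moreover have "Re (LINT x:\<Omega>|lborel. cnj (v x) * f x) = inner (emb \<Omega> v) (emb \<Omega> f)"
    unfolding pair(1)[OF vL fL, symmetric] set_lebesgue_integral_def
    by (subst integral_Re[OF pair(2)[OF vL fL], symmetric]) simp
  moreover have "Re (LINT x:\<Omega>|lborel. (\<Sum>b\<in>Basis. cnj (weak_partial \<Omega> b v x) * weak_partial \<Omega> b u x))
      = (\<Sum>b\<in>Basis. inner (emb \<Omega> (weak_partial \<Omega> b v)) (emb \<Omega> (weak_partial \<Omega> b u)))"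
  proof -
    have "(LINT x:\<Omega>|lborel. (\<Sum>b\<in>Basis. cnj (weak_partial \<Omega> b v x) * weak_partial \<Omega> b u x))
      = (\<Sum>b\<in>Basis. (LINT x|lborel. indicator \<Omega> x *\<^sub>R (cnj (weak_partial \<Omega> b v x) * weak_partial \<Omega> b u x)))"
      unfolding set_lebesgue_integral_def scaleR_sum_right
      by (rule Bochner_Integration.integral_sum[OF pair(2)[OF wL]])
    moreover have "Re (LINT x|lborel. indicator \<Omega> x *\<^sub>R (cnj (weak_partial \<Omega> b v x) * weak_partial \<Omega> b u x))
        = inner (emb \<Omega> (weak_partial \<Omega> b v)) (emb \<Omega> (weak_partial \<Omega> b u))" if b: "b \<in> Basis" for b
      unfolding pair(1)[OF wL[OF b], symmetric] set_lebesgue_integral_def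
      by (subst integral_Re[OF pair(2)[OF wL[OF b]], symmetric]) simp
    ultimately show ?thesis by simp
  qed
  ultimately show ?thesis using H(3,4) by simp
qed


section \<open>Strongly continuous semigroups on a Banach space\<close>

lemma has_vector_derivative_iff_tendsto:
  "(f has_vector_derivative v) (at x within S) \<longleftrightarrow>
     ((\<lambda>s. (f s - f x) /\<^sub>R (s - x)) \<longlongrightarrow> v) (at x within S)"
proof -
  have eq: "norm ((f s - f x) - (s - x) *\<^sub>R v) / norm (s - x) = norm ((f s - f x) /\<^sub>R (s - x) - v)"
    if "s \<noteq> x" for s
  proof -
    have "(f s - f x) - (s - x) *\<^sub>R v = (s - x) *\<^sub>R ((f s - f x) /\<^sub>R (s - x) - v)"
      using that by (simp add: scaleR_diff_right)
    then show ?thesis using that by simp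
  qed
  have "(f has_vector_derivative v) (at x within S) \<longleftrightarrow>
      ((\<lambda>s. norm ((f s - f x) - (s - x) *\<^sub>R v) / norm (s - x)) \<longlongrightarrow> 0) (at x within S)"
    unfolding has_vector_derivative_def has_derivative_iff_norm
    by (simp add: bounded_linear_scaleR_left)
  also have "\<dots> \<longleftrightarrow> ((\<lambda>s. norm ((f s - f x) /\<^sub>R (s - x) - v)) \<longlongrightarrow> 0) (at x within S)"
    by (rule Lim_cong_within) (use eq in auto)
  also have "\<dots> \<longleftrightarrow> ((\<lambda>s. (f s - f x) /\<^sub>R (s - x)) \<longlongrightarrow> v) (at x within S)"
    by (simp add: tendsto_norm_zero_iff LIM_zero_iff)
  finally show ?thesis .
qed

locale strongly_continuous_semigroup =
  fixes T :: "real \<Rightarrow> 'h::banach \<Rightarrow> 'h"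
  assumes bounded_linear_T: "t \<ge> 0 \<Longrightarrow> bounded_linear (T t)"
    and T_0: "T 0 f = f"
    and T_add: "s \<ge> 0 \<Longrightarrow> t \<ge> 0 \<Longrightarrow> T (s + t) f = T s (T t f)"
    and tendsto_T_0: "((\<lambda>t. T t f) \<longlongrightarrow> f) (at_right 0)"
begin

definition gen :: "'h \<Rightarrow> 'h \<Rightarrow> bool" where
  "gen f y \<longleftrightarrow> ((\<lambda>h. (T h f - f) /\<^sub>R h) \<longlongrightarrow> y) (at_right 0)"

lemma ev_norm_le: "\<forall>\<^sub>F t in at_right 0. norm (T t f) < norm f + 1"
  using tendsto_norm[OF tendsto_T_0[of f]] by (rule order_tendstoD) simp

text \<open>Uniform boundedness by Baire. Strong continuity at 0 puts every f into some
  \<open>C n\<close>, where n governs both the length of the time interval and the bound; these sets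
  are closed, so one of them contains a ball.\<close>

lemma bounded_near_0: "\<exists>\<delta>>0. \<exists>N\<ge>1. \<forall>t\<in>{0..\<delta>}. \<forall>f. norm (T t f) \<le> N * norm f"
proof -
  define C where "C n = {f. \<forall>t\<in>{0..1/(real n + 1)}. norm (T t f) \<le> real n}" for n
  have cl: "closed (C n)" for n
  proof -
    have "closed {f. norm (T t f) \<le> real n}" if "t \<ge> 0" for t
      by (intro closed_Collect_le continuous_intros bounded_linear.continuous_on[OF bounded_linear_T[OF that]])
    moreover have "C n = (\<Inter>t\<in>{0..1/(real n + 1)}. {f. norm (T t f) \<le> real n})"
      by (auto simp: C_def)
    ultimately show ?thesis by (auto intro!: closed_INT)
  qed
  have "(\<Union>n. C n) = UNIV"
  proof -
    have "\<exists>n. f \<in> C n" for f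
    proof -
      obtain b where b: "b > 0" "\<And>t. 0 < t \<Longrightarrow> t < b \<Longrightarrow> norm (T t f) < norm f + 1"
        using ev_norm_le[of f] unfolding eventually_at_right_field by auto
      obtain n where n: "real n > max (norm f + 1) (1/b)" using reals_Archimedean2 by blast
      then have nn: "real n > norm f + 1" "real n > 1/b" by auto
      from nn(2) b(1) have "1 < real n * b" by (simp add: field_simps)
      then have "1 / (real n + 1) < b" using b(1) by (simp add: field_simps)
      then have "norm (T t f) \<le> real n" if "t \<in> {0..1/(real n + 1)}" for t
        using b(2)[of t] that nn(1) T_0 by (cases "t = 0") (auto simp: less_imp_le)
      then show ?thesis unfolding C_def by blast
    qed
    then show ?thesis by blast
  qed
  have "\<exists>n. interior (C n) \<noteq> {}"
  proof (rule ccontr)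
    assume "\<nexists>n. interior (C n) \<noteq> {}"
    then have "Met_TC.mtopology interior_of \<Union>(range C) = {}"
      by (intro Met_TC.metric_Baire_category_alt) (auto simp: cl mcomplete_iff_complete complete_UNIV)
    with \<open>(\<Union>n. C n) = UNIV\<close> show False by simp
  qed
  then obtain n a r where r: "r > 0" "ball a r \<subseteq> C n"
    by (metis (no_types) ex_in_conv mem_interior)
  \<comment> \<open>A vector of norm \<open>r / 2\<close> is a difference of two points of
    \<open>C n\<close>, so its image has norm at most 2 n; rescaling gives 4 n / r.\<close>
  define N where "N = max 1 (4 * real n / r)"
  have main: "norm (T t f) \<le> N * norm f" if t: "t \<in> {0..1/(real n + 1)}" for t f
  proof (cases "f = 0")
    case True
    then show ?thesis using linear_0[OF bounded_linear.linear[OF bounded_linear_T[of t]]] t by simp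
  next
    case False
    interpret bounded_linear "T t" using bounded_linear_T t by simp
    define g where "g = (r / (2 * norm f)) *\<^sub>R f"
    have ng: "norm g = r / 2" using False r(1) by (simp add: g_def)
    have "a + g \<in> C n" "a \<in> C n" using r ng by (auto simp: dist_norm intro!: subsetD[OF r(2)])
    then have "norm (T t (a + g)) \<le> real n" "norm (T t a) \<le> real n" using t by (auto simp: C_def)
    moreover have "T t g = T t (a + g) - T t a" by (simp add: add)
    ultimately have "norm (T t g) \<le> 2 * real n" using norm_triangle_ineq4[of "T t (a+g)" "T t a"] by simp
    then have "r / (2 * norm f) * norm (T t f) \<le> 2 * real n"
      using r(1) by (simp add: g_def scaleR)
    then have "norm (T t f) \<le> 4 * real n / r * norm f" using r(1) False by (simp add: field_simps)
    also have "\<dots> \<le> N * norm f" by (intro mult_right_mono) (auto simp: N_def)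
    finally show ?thesis .
  qed
  show ?thesis
    by (rule exI[of _ "1/(real n + 1)"]) (use main in \<open>auto simp: N_def intro!: exI[of _ N]\<close>)
qed

text \<open>Every time up to b is reached in k steps of equal length at most \<delta>, which costs
  the power \<open>N ^ k\<close>.\<close>

lemma bounded_on_interval: "\<exists>M\<ge>1. \<forall>t\<in>{0..b}. \<forall>f. norm (T t f) \<le> M * norm f"
proof -
  obtain \<delta> N where \<delta>: "\<delta> > 0" and N: "N \<ge> 1"
    and le: "\<And>t f. t \<in> {0..\<delta>} \<Longrightarrow> norm (T t f) \<le> N * norm f" using bounded_near_0 by blast
  have pow: "norm (T (real k * s) f) \<le> N ^ k * norm f" if "s \<in> {0..\<delta>}" for k s f
  proof (induction k)
    case (Suc k)
    have "T (real (Suc k) * s) f = T s (T (real k * s) f)"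
      using T_add[of s "real k * s" f] that by (simp add: algebra_simps)
    then have "norm (T (real (Suc k) * s) f) \<le> N * norm (T (real k * s) f)" using le[OF that] by simp
    also have "\<dots> \<le> N * (N ^ k * norm f)" using Suc N by (intro mult_left_mono) auto
    finally show ?case by simp
  qed (simp add: T_0)
  obtain k :: nat where k: "real k > max 1 (b / \<delta>)" using reals_Archimedean2 by blast
  then have k1: "real k > 1" "real k > b / \<delta>" by auto
  then have k2: "b \<le> \<delta> * real k" using \<delta> by (simp add: field_simps)
  show ?thesis
  proof (intro exI conjI ballI allI)
    show "N ^ k \<ge> 1" using N by simp
    fix t f assume t: "t \<in> {0..b}"
    have "t / real k \<in> {0..\<delta>}" using t k1 k2 by (auto simp: field_simps)
    from pow[OF this, of k f] k1 show "norm (T t f) \<le> N ^ k * norm f" by simp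
  qed
qed

lemma T_diff_le:
  assumes M: "\<And>t f. t \<in> {0..b} \<Longrightarrow> norm (T t f) \<le> M * norm f" and s: "s \<in> {0..b}" "t \<in> {0..b}"
  shows "norm (T s f - T t f) \<le> M * norm (T \<bar>s - t\<bar> f - f)"
proof -
  have main: "norm (T v f - T u f) \<le> M * norm (T (v - u) f - f)" if "u \<in> {0..b}" "u \<le> v" for u v
  proof -
    interpret bounded_linear "T u" using bounded_linear_T that by simp
    have "T v f - T u f = T u (T (v - u) f - f)"
      using T_add[of u "v - u" f] that by (simp add: diff)
    with M that show ?thesis by simp
  qed
  show ?thesis
    using main[of t s] main[of s t] s by (cases "t \<le> s") (auto simp: norm_minus_commute)
qed

lemma tendsto_T_abs: "((\<lambda>s. T \<bar>s - t\<bar> f) \<longlongrightarrow> f) (at t within A)"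
proof -
  have "((\<lambda>h. T \<bar>h\<bar> f) \<longlongrightarrow> f) (at 0)"
  proof (rule filterlim_split_at)
    show "((\<lambda>h. T \<bar>h\<bar> f) \<longlongrightarrow> f) (at_right 0)"
      by (rule Lim_transform_eventually[OF tendsto_T_0])
        (auto simp: eventually_at_right_field intro!: exI[of _ 1])
    have "((\<lambda>h. T (- h) f) \<longlongrightarrow> f) (at_left 0)"
      using tendsto_T_0[of f] by (simp add: filterlim_at_left_to_right)
    then show "((\<lambda>h. T \<bar>h\<bar> f) \<longlongrightarrow> f) (at_left 0)"
      by (rule Lim_transform_eventually)
        (auto simp: eventually_at_left_field intro!: exI[of _ "-1"])
  qed
  moreover have "filterlim (\<lambda>s. s - t) (at 0) (at t)"
    by (rule filterlim_atI) (auto simp: eventually_at_filter LIM_zero_iff)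
  ultimately have "((\<lambda>s. T \<bar>s - t\<bar> f) \<longlongrightarrow> f) (at t)" by (rule filterlim_compose)
  then show ?thesis by (rule filterlim_mono) (auto simp: at_le)
qed

text \<open>Continuity from the left rests on a bound for T that is uniform near t: the difference
  is T at the smaller time, applied to a short-time difference.\<close>

lemma continuous_on_T: "continuous_on {0..} (\<lambda>t. T t f)"
  unfolding continuous_on_def
proof
  fix t :: real assume t: "t \<in> {0..}"
  obtain M where M: "\<And>s f. s \<in> {0..t+1} \<Longrightarrow> norm (T s f) \<le> M * norm f"
    using bounded_on_interval by blast
  have "((\<lambda>s. M * norm (T \<bar>s - t\<bar> f - f)) \<longlongrightarrow> M * norm (f - f)) (at t within {0..})"
    by (intro tendsto_intros tendsto_T_abs)
  then have "((\<lambda>s. M * norm (T \<bar>s - t\<bar> f - f)) \<longlongrightarrow> 0) (at t within {0..})" by simp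
  then have "((\<lambda>s. T s f - T t f) \<longlongrightarrow> 0) (at t within {0..})"
  proof (rule Lim_null_comparison[rotated])
    have "\<forall>\<^sub>F s in at t within {0..}. s < t + 1" by (rule order_tendstoD[OF tendsto_ident_at]) simp
    moreover have "\<forall>\<^sub>F s in at t within {0..}. s \<in> {0..}" by (simp add: eventually_at_filter)
    ultimately show "\<forall>\<^sub>F s in at t within {0..}. norm (T s f - T t f) \<le> M * norm (T \<bar>s - t\<bar> f - f)"
      by eventually_elim (use t in \<open>auto intro!: T_diff_le[where b="t+1"] M\<close>)
  qed
  then show "((\<lambda>t. T t f) \<longlongrightarrow> T t f) (at t within {0..})" by (simp add: LIM_zero_iff)
qed

text \<open>On both sides of t the difference quotient is \<open>T (min s t)\<close> applied to the
  quotient \<open>q\<close> at 0 for the elapsed time. The local bound on T absorbs the moving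
  operator, so both sides are treated alike.\<close>

lemma gen_has_vector_derivative:
  assumes g: "gen f y" and t: "t \<ge> 0"
  shows "((\<lambda>s. T s f) has_vector_derivative T t y) (at t within {0..})"
proof -
  define q where "q h = (T h f - f) /\<^sub>R h" for h
  obtain M where M1: "M \<ge> 1" and M: "\<And>s f. s \<in> {0..t+1} \<Longrightarrow> norm (T s f) \<le> M * norm f"
    using bounded_on_interval by blast
  have q0: "(q \<longlongrightarrow> y) (at_right 0)" using g unfolding gen_def q_def[abs_def] .
  have "((\<lambda>s. q \<bar>s - t\<bar>) \<longlongrightarrow> y) (at t within {0..})"
  proof -
    have "filterlim (\<lambda>s. \<bar>s - t\<bar>) (at_right 0) (at t within {0..})"
      unfolding filterlim_at
      by (auto simp: eventually_at_filter intro!: tendsto_eq_intros)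
    with q0 show ?thesis by (rule filterlim_compose)
  qed
  moreover have "((\<lambda>s. T (min s t) y) \<longlongrightarrow> T t y) (at t within {0..})"
  proof -
    have "continuous_on {0..} (\<lambda>s. T (min s t) y)"
      by (rule continuous_on_compose2[OF continuous_on_T[of y]]) (use t in \<open>auto intro!: continuous_intros\<close>)
    then show ?thesis using t by (force simp: continuous_on_def)
  qed
  ultimately have lim: "((\<lambda>s. M * norm (q \<bar>s - t\<bar> - y) + norm (T (min s t) y - T t y)) \<longlongrightarrow>
      M * norm (y - y) + norm (T t y - T t y)) (at t within {0..})"
    by (intro tendsto_intros)
  have est: "norm ((T s f - T t f) /\<^sub>R (s - t) - T t y)
      \<le> M * norm (q \<bar>s - t\<bar> - y) + norm (T (min s t) y - T t y)"
    if s: "s \<in> {0..t+1}" "s \<noteq> t" for s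
  proof -
    define m where "m = min s t"
    have m: "m \<in> {0..t+1}" "m \<ge> 0" using s t by (auto simp: m_def)
    interpret bounded_linear "T m" using bounded_linear_T m by simp
    have eq: "(T s f - T t f) /\<^sub>R (s - t) = T m (q \<bar>s - t\<bar>)"
    proof (cases "s < t")
      case True
      then have "T t f = T m (T \<bar>s - t\<bar> f)" "T s f = T m f"
        using T_add[of s "t - s" f] s by (auto simp: m_def)
      then have "T m (q \<bar>s - t\<bar>) = (T t f - T s f) /\<^sub>R (t - s)"
        using True by (simp add: q_def scaleR diff)
      also have "\<dots> = (- (T t f - T s f)) /\<^sub>R (- (t - s))"
        by (simp only: inverse_minus_eq scaleR_minus_left scaleR_minus_right minus_minus)
      finally show ?thesis by (simp only: minus_diff_eq)
    next
      case False
      then have "T s f = T m (T \<bar>s - t\<bar> f)" "T t f = T m f"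
        using T_add[of t "s - t" f] s t by (auto simp: m_def min_def)
      then show ?thesis using False s by (simp add: q_def scaleR diff)
    qed
    have "(T s f - T t f) /\<^sub>R (s - t) - T t y = T m (q \<bar>s - t\<bar> - y) + (T m y - T t y)"
      unfolding eq by (simp add: diff)
    then have "norm ((T s f - T t f) /\<^sub>R (s - t) - T t y)
        \<le> norm (T m (q \<bar>s - t\<bar> - y)) + norm (T m y - T t y)" by (metis norm_triangle_ineq)
    also have "\<dots> \<le> M * norm (q \<bar>s - t\<bar> - y) + norm (T m y - T t y)" using M m by simp
    finally show ?thesis by (simp add: m_def)
  qed
  have lim0: "((\<lambda>s. M * norm (q \<bar>s - t\<bar> - y) + norm (T (min s t) y - T t y)) \<longlongrightarrow> 0) (at t within {0..})"
    using lim by simp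
  have "((\<lambda>s. (T s f - T t f) /\<^sub>R (s - t) - T t y) \<longlongrightarrow> 0) (at t within {0..})"
  proof (rule Lim_null_comparison[OF _ lim0])
    have "\<forall>\<^sub>F s in at t within {0..}. s < t + 1" by (rule order_tendstoD[OF tendsto_ident_at]) simp
    moreover have "\<forall>\<^sub>F s in at t within {0..}. s \<in> {0..} \<and> s \<noteq> t" by (simp add: eventually_at_filter)
    ultimately show "\<forall>\<^sub>F s in at t within {0..}. norm ((T s f - T t f) /\<^sub>R (s - t) - T t y)
      \<le> M * norm (q \<bar>s - t\<bar> - y) + norm (T (min s t) y - T t y)"
      by eventually_elim (rule est, auto)
  qed
  then show ?thesis unfolding has_vector_derivative_iff_tendsto by (simp add: LIM_zero_iff)
qed

lemma gen_T:
  assumes "gen f y" "t \<ge> 0" shows "gen (T t f) (T t y)"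
proof -
  interpret bounded_linear "T t" using bounded_linear_T assms by simp
  have "((\<lambda>h. T t ((T h f - f) /\<^sub>R h)) \<longlongrightarrow> T t y) (at_right 0)"
    using assms(1) unfolding gen_def by (rule tendsto)
  moreover have "\<forall>\<^sub>F h in at_right 0. T t ((T h f - f) /\<^sub>R h) = (T h (T t f) - T t f) /\<^sub>R h"
    unfolding eventually_at_right_field
    by (rule exI[of _ 1])
      (use assms(2) in \<open>auto simp: scaleR diff T_add[symmetric] add.commute\<close>)
  ultimately show ?thesis unfolding gen_def by (rule Lim_transform_eventually)
qed

text \<open>Time averages of an orbit lie in the domain: applying \<open>T r\<close> shifts the
  interval of integration, so the difference quotient only sees its two ends. As h tends to 0 the
  averages tend to f.\<close>

lemma gen_dense:
  assumes "e > 0" shows "\<exists>g y. gen g y \<and> norm (g - f) < e"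
proof -
  define J where "J t = integral {0..t} (\<lambda>s. T s f)" for t
  have cont: "continuous_on {a..b} (\<lambda>s. T s f)" if "a \<ge> 0" for a b
    by (rule continuous_on_subset[OF continuous_on_T]) (use that in auto)
  have J0: "J 0 = 0" by (simp add: J_def)
  have der: "((\<lambda>r. (J (h + r) - J h) /\<^sub>R r) \<longlongrightarrow> T h f) (at_right 0)" if h: "h \<ge> 0" for h
  proof -
    have "(J has_vector_derivative T h f) (at h within {0..h+1})"
      unfolding J_def by (rule integral_has_vector_derivative[OF cont]) (use h in auto)
    then have "(J has_vector_derivative T h f) (at h within {h..h+1})"
      by (rule has_vector_derivative_within_subset) (use h in auto)
    then have "((\<lambda>s. (J s - J h) /\<^sub>R (s - h)) \<longlongrightarrow> T h f) (at h within {h..h+1})"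
      unfolding has_vector_derivative_iff_tendsto .
    then have "((\<lambda>s. (J s - J h) /\<^sub>R (s - h)) \<longlongrightarrow> T h f) (at_right h)"
      by (simp add: at_within_Icc_at_right)
    then show ?thesis by (simp add: filterlim_at_right_to_0[of _ _ h] add.commute)
  qed
  have shift: "T r (J h) = J (h + r) - J r" if "r \<ge> 0" "h \<ge> 0" for r h
  proof -
    have "T r (J h) = integral {0..h} (\<lambda>s. T r (T s f))"
      unfolding J_def
      using integral_linear[OF integrable_continuous_real[OF cont[of 0 h]] bounded_linear_T[OF that(1)]]
      by (simp add: o_def)
    also have "\<dots> = integral {0..h} ((\<lambda>s. T s f) \<circ> (\<lambda>x. x + r))"
      by (rule integral_cong) (use that in \<open>auto simp: T_add[symmetric] add.commute\<close>)
    also have "\<dots> = integral {0 + r..h + r} (\<lambda>s. T s f)"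
      using integral_shift_real_ivl[where a=r and c=r and b="h + r" and f="\<lambda>s. T s f"] by (simp add: o_def)
    also have "\<dots> = J (h + r) - J r"
      using Henstock_Kurzweil_Integration.integral_combine[where a=0 and c=r and b="h + r" and f="\<lambda>s. T s f"] that
        integrable_continuous_real[OF cont[of 0 "h+r"]]
      by (simp add: J_def algebra_simps)
    finally show ?thesis .
  qed
  have genJ: "gen (J h /\<^sub>R h) ((T h f - f) /\<^sub>R h)" if h: "h > 0" for h
  proof -
    have "((\<lambda>r. ((J (h + r) - J h) /\<^sub>R r - (J (0 + r) - J 0) /\<^sub>R r) /\<^sub>R h) \<longlongrightarrow> (T h f - T 0 f) /\<^sub>R h) (at_right 0)"
      by (intro tendsto_intros der) (use h in auto)
    moreover have "\<forall>\<^sub>F r in at_right 0. ((J (h + r) - J h) /\<^sub>R r - (J (0 + r) - J 0) /\<^sub>R r) /\<^sub>R h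
         = (T r (J h /\<^sub>R h) - J h /\<^sub>R h) /\<^sub>R r"
      unfolding eventually_at_right_field
    proof (intro exI[of _ 1] conjI allI impI)
      fix r :: real assume r: "0 < r" "r < 1"
      interpret bounded_linear "T r" using bounded_linear_T r by simp
      have "T r (J h /\<^sub>R h) = (J (h + r) - J r) /\<^sub>R h" using shift[of r h] r h by (simp add: scaleR)
      then show "((J (h + r) - J h) /\<^sub>R r - (J (0 + r) - J 0) /\<^sub>R r) /\<^sub>R h = (T r (J h /\<^sub>R h) - J h /\<^sub>R h) /\<^sub>R r"
        by (simp add: J0 scaleR_diff_right mult.commute)
    qed simp
    ultimately show ?thesis unfolding gen_def T_0 by (rule Lim_transform_eventually)
  qed
  have "((\<lambda>r. J r /\<^sub>R r) \<longlongrightarrow> f) (at_right 0)" using der[of 0] by (simp add: J0 T_0)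
  then have "\<forall>\<^sub>F r in at_right 0. dist (J r /\<^sub>R r) f < e" using assms by (rule tendstoD)
  moreover have "\<forall>\<^sub>F r::real in at_right 0. r > 0" by (simp add: eventually_at_right_less)
  ultimately have "\<forall>\<^sub>F r in at_right 0. gen (J r /\<^sub>R r) ((T r f - f) /\<^sub>R r) \<and> norm (J r /\<^sub>R r - f) < e"
    by eventually_elim (auto simp: genJ dist_norm)
  then show ?thesis
    using eventually_happens trivial_limit_at_right_real by blast
qed

end


section \<open>Weights depending on one coordinate\<close>

abbreviation wt :: "'a::euclidean_space \<Rightarrow> (real \<Rightarrow> real) \<Rightarrow> 'a \<Rightarrow> real" where
  "wt e f \<equiv> \<lambda>x. f (x \<bullet> e)"

definition bfun :: "(real \<Rightarrow> real) \<Rightarrow> bool" where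
  "bfun f \<longleftrightarrow> f \<in> borel_measurable borel \<and> (\<exists>B. \<forall>x. \<bar>f x\<bar> \<le> B)"

lemma bfunI: "f \<in> borel_measurable borel \<Longrightarrow> (\<And>x. \<bar>f x\<bar> \<le> B) \<Longrightarrow> bfun f"
  by (auto simp: bfun_def)

lemma bmeas_wt: "bfun f \<Longrightarrow> bmeas (wt e f)"
proof -
  assume f: "bfun f"
  then obtain B where B: "\<And>x. \<bar>f x\<bar> \<le> B" by (auto simp: bfun_def)
  have [measurable]: "f \<in> borel_measurable borel" using f by (simp add: bfun_def)
  show ?thesis by (rule bmeasI[where B=B]) (simp_all add: B)
qed

lemma bmeas_add: "bmeas m \<Longrightarrow> bmeas n \<Longrightarrow> bmeas (\<lambda>x. m x + n x)"
proof -
  assume m: "bmeas m" and n: "bmeas n"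
  then obtain B C where BC: "\<And>x. \<bar>m x\<bar> \<le> B" "\<And>x. \<bar>n x\<bar> \<le> C" by (auto simp: bmeas_def)
  have "\<bar>m x + n x\<bar> \<le> B + C" for x using BC(1)[of x] BC(2)[of x] by linarith
  with m n show ?thesis by (intro bmeasI[where B="B + C"]) (auto simp: bmeas_def)
qed

lemma bfun_mult: "bfun f \<Longrightarrow> bfun g \<Longrightarrow> bfun (\<lambda>x. f x * g x)"
proof -
  assume f: "bfun f" and g: "bfun g"
  then obtain B C where "\<And>x. \<bar>f x\<bar> \<le> B" "\<And>x. \<bar>g x\<bar> \<le> C" by (auto simp: bfun_def)
  then have "\<bar>f x * g x\<bar> \<le> B * C" for x
    unfolding abs_mult by (meson abs_ge_zero mult_mono order_trans)
  moreover have "(\<lambda>x. f x * g x) \<in> borel_measurable borel" using f g by (auto simp: bfun_def)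
  ultimately show ?thesis by (rule bfunI[rotated])
qed

lemma bfun_const: "bfun (\<lambda>x. c)"
  by (rule bfunI[where B="\<bar>c\<bar>"]) auto

lemma bfun_add: "bfun f \<Longrightarrow> bfun g \<Longrightarrow> bfun (\<lambda>x. f x + g x)"
proof -
  assume f: "bfun f" and g: "bfun g"
  then obtain B C where BC: "\<And>x. \<bar>f x\<bar> \<le> B" "\<And>x. \<bar>g x\<bar> \<le> C" by (auto simp: bfun_def)
  have "\<bar>f x + g x\<bar> \<le> B + C" for x using BC(1)[of x] BC(2)[of x] by linarith
  moreover have "(\<lambda>x. f x + g x) \<in> borel_measurable borel" using f g by (auto simp: bfun_def)
  ultimately show ?thesis by (rule bfunI[rotated])
qed

lemma bfun_cmult: "bfun f \<Longrightarrow> bfun (\<lambda>x. c * f x)"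
  by (rule bfun_mult[OF bfun_const])

lemma bfun_power: "bfun f \<Longrightarrow> bfun (\<lambda>x. f x ^ n)"
  by (induction n) (simp_all add: bfun_const bfun_mult)

text \<open>The product rule. Boundedness of both f and f' lets it pass from test functions to
  limits, so a weighted solution is again admissible in the weak equation.\<close>

lemma h10_mul:
  fixes e :: "'a::euclidean_space"
  assumes h: "h10 \<Omega> F G" and f: "smooth_real f" "\<And>x. (f has_real_derivative f' x) (at x)"
    and b: "bfun f" "bfun f'"
  shows "h10 \<Omega> (mul (wt e f) F) (\<lambda>i. mul (wt e f) (G i) + (i \<bullet> e) *\<^sub>R mul (wt e f') F)"
proof -
  obtain \<phi> where \<phi>: "\<And>n. \<phi> n \<in> test_functions \<Omega>" and 1: "(\<lambda>n. cls (\<phi> n)) \<longlonglongrightarrow> F"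
    and 2: "\<And>i. i \<in> Basis \<Longrightarrow> (\<lambda>n. cls (partial i (\<phi> n))) \<longlonglongrightarrow> G i" using h unfolding h10_def by blast
  note B = bmeas_wt[OF b(1), of e] bmeas_wt[OF b(2), of e]
  define \<psi> where "\<psi> n x = complex_of_real (f (x \<bullet> e)) * \<phi> n x" for n x
  have t: "\<psi> n \<in> test_functions \<Omega>" for n
    unfolding \<psi>_def[abs_def] by (rule test_mult[OF \<phi> smooth_ridge[OF f(1)]])
  have c: "cls (\<psi> n) = mul (wt e f) (cls (\<phi> n))" for n
    by (simp add: mul_cls[OF B(1) test_sq_int[OF \<phi>]] \<psi>_def[abs_def] scaleR_conv_of_real)
  have p: "cls (partial i (\<psi> n)) = mul (wt e f) (cls (partial i (\<phi> n))) + (i \<bullet> e) *\<^sub>R mul (wt e f') (cls (\<phi> n))"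
    if i: "i \<in> Basis" for i n
  proof -
    have "partial i (\<psi> n) x = f (x \<bullet> e) *\<^sub>R partial i (\<phi> n) x + (i \<bullet> e) *\<^sub>R (f' (x \<bullet> e) *\<^sub>R \<phi> n x)" for x
      unfolding \<psi>_def[abs_def]
      by (subst partial_mult[OF smooth_differentiable[OF smooth_ridge[OF f(1)]] smooth_differentiable[OF test_smooth[OF \<phi>]]])
        (simp add: partial_ridge[OF f(2)] scaleR_conv_of_real mult.assoc)
    then have "cls (partial i (\<psi> n)) = cls (\<lambda>x. f (x \<bullet> e) *\<^sub>R partial i (\<phi> n) x + (i \<bullet> e) *\<^sub>R (f' (x \<bullet> e) *\<^sub>R \<phi> n x))"
      by (metis (no_types, lifting) ext)
    then show ?thesis
      by (simp add: cls_add sq_int_mul[OF B(1) test_sq_int[OF test_partial[OF \<phi> i]]] sq_int_scaleR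
          sq_int_mul[OF B(2) test_sq_int[OF \<phi>]] cls_scaleR mul_cls[OF B(1) test_sq_int[OF test_partial[OF \<phi> i]]]
          mul_cls[OF B(2) test_sq_int[OF \<phi>]] del: scaleR_scaleR)
  qed
  have "(\<lambda>n. cls (\<psi> n)) \<longlonglongrightarrow> mul (wt e f) F"
    unfolding c by (rule bounded_linear.tendsto[OF bounded_linear_mul[OF B(1)] 1])
  moreover have "(\<lambda>n. cls (partial i (\<psi> n))) \<longlonglongrightarrow> mul (wt e f) (G i) + (i \<bullet> e) *\<^sub>R mul (wt e f') F"
    if i: "i \<in> Basis" for i
    unfolding p[OF i]
    by (rule tendsto_add[OF bounded_linear.tendsto[OF bounded_linear_mul[OF B(1)] 2[OF i]]
          tendsto_scaleR[OF tendsto_const bounded_linear.tendsto[OF bounded_linear_mul[OF B(2)] 1]]])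
  ultimately show ?thesis unfolding h10_def using t by blast
qed

lemma h10_ibp:
  assumes "h10 \<Omega> F G" "h10 \<Omega> F' G'" "i \<in> Basis"
  shows "inner F (G' i) = - inner (G i) F'"
proof -
  obtain \<phi> where \<phi>: "\<And>n. \<phi> n \<in> test_functions \<Omega>" "(\<lambda>n. cls (\<phi> n)) \<longlonglongrightarrow> F"
    "(\<lambda>n. cls (partial i (\<phi> n))) \<longlonglongrightarrow> G i" using assms(1,3) unfolding h10_def by blast
  obtain \<psi> where \<psi>: "\<And>n. \<psi> n \<in> test_functions \<Omega>" "(\<lambda>n. cls (\<psi> n)) \<longlonglongrightarrow> F'"
    "(\<lambda>n. cls (partial i (\<psi> n))) \<longlonglongrightarrow> G' i" using assms(2,3) unfolding h10_def by blast
  have "(\<lambda>n. inner (cls (\<phi> n)) (cls (partial i (\<psi> n)))) \<longlonglongrightarrow> inner F (G' i)"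
    by (rule tendsto_inner[OF \<phi>(2) \<psi>(3)])
  moreover have "(\<lambda>n. - inner (cls (partial i (\<phi> n))) (cls (\<psi> n))) \<longlonglongrightarrow> - inner (G i) F'"
    by (rule tendsto_minus[OF tendsto_inner[OF \<phi>(3) \<psi>(2)]])
  ultimately show ?thesis unfolding test_ibp[OF \<phi>(1) \<psi>(1) assms(3)] by (rule LIMSEQ_unique)
qed

text \<open>The derivative of |F|^2 along e is twice the real part of the conjugate of F times
  \<open>G e\<close>; integrating it against r leaves no boundary terms in the form domain.\<close>

lemma weight_ibp:
  assumes h: "h10 \<Omega> F G" and e: "e \<in> Basis" and r: "smooth_real r" "\<And>x. (r has_real_derivative r' x) (at x)"
    and b: "bfun r" "bfun r'"
  shows "inner (mul (wt e r') F) F = - 2 * inner (mul (wt e r) F) (G e)"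
proof -
  have "inner F (mul (wt e r) (G e) + (e \<bullet> e) *\<^sub>R mul (wt e r') F) = - inner (G e) (mul (wt e r) F)"
    by (rule h10_ibp[OF h h10_mul[OF h r b] e])
  moreover have "inner F (mul (wt e r) (G e)) = inner (mul (wt e r) F) (G e)"
    by (rule inner_mul_commute[OF bmeas_wt[OF b(1)], symmetric])
  moreover have "inner F (mul (wt e r') F) = inner (mul (wt e r') F) F" by (rule inner_commute)
  moreover have "inner (G e) (mul (wt e r) F) = inner (mul (wt e r) F) (G e)" by (rule inner_commute)
  ultimately show ?thesis using e by (simp add: inner_add_right)
qed

section \<open>Energy estimates for the generator\<close>

text \<open>Weak form of \<open>\<Delta>U + E U = A\<close> with Dirichlet conditions, \<open>G\<close> being the gradient of \<open>U\<close>.\<close>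

definition weak_eq :: "'a::euclidean_space set \<Rightarrow> real \<Rightarrow> 'a l2 \<Rightarrow> ('a \<Rightarrow> 'a l2) \<Rightarrow> 'a l2 \<Rightarrow> bool" where
  "weak_eq \<Omega> E U G A \<longleftrightarrow> h10 \<Omega> U G \<and>
     (\<forall>V H. h10 \<Omega> V H \<longrightarrow> (\<Sum>b\<in>Basis. inner (H b) (G b)) = inner V (E *\<^sub>R U - A))"

text \<open>The Poincare inequality on slices, integrated against an arbitrary nonnegative weight of
  the coordinate along e. In this form it makes sense for elements of \<open>l2\<close>, which have
  no values on single slices.\<close>

definition transversal_poincare :: "'a::euclidean_space set \<Rightarrow> 'a \<Rightarrow> real \<Rightarrow> bool" where
  "transversal_poincare \<Omega> e E \<longleftrightarrow> (\<forall>F G q. h10 \<Omega> F G \<longrightarrow> bfun q \<longrightarrow> (\<forall>x. q x \<ge> 0) \<longrightarrow>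
     E * inner (mul (wt e q) F) F \<le> (\<Sum>b\<in>Basis - {e}. inner (mul (wt e q) (G b)) (G b)))"

lemma sum_Basis_coord:
  fixes f :: "'a::euclidean_space \<Rightarrow> real"
  assumes "e \<in> Basis" shows "(\<Sum>b\<in>Basis. (b \<bullet> e) * f b) = f e"
proof -
  have "(\<Sum>b\<in>Basis. (b \<bullet> e) * f b) = (\<Sum>b\<in>Basis. if b = e then f b else 0)"
    by (rule sum.cong[OF refl]) (use assms in \<open>simp add: inner_Basis\<close>)
  then show ?thesis using assms by (simp add: sum.delta)
qed

text \<open>The weak equation tested with f U; the product rule adds a single cross term with f',
  since f varies along e only.\<close>

lemma weak_eq_weight:
  assumes w: "weak_eq \<Omega> E U G A" and e: "e \<in> Basis"
    and f: "smooth_real f" "\<And>x. (f has_real_derivative f' x) (at x)" "bfun f" "bfun f'"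
  shows "inner (mul (wt e f) U) A = E * inner (mul (wt e f) U) U
     - (\<Sum>b\<in>Basis. inner (mul (wt e f) (G b)) (G b)) - inner (mul (wt e f') U) (G e)"
proof -
  have h: "h10 \<Omega> U G" using w by (simp add: weak_eq_def)
  have "(\<Sum>b\<in>Basis. inner (mul (wt e f) (G b) + (b \<bullet> e) *\<^sub>R mul (wt e f') U) (G b)) = inner (mul (wt e f) U) (E *\<^sub>R U - A)"
    using w h10_mul[OF h f] unfolding weak_eq_def by blast
  then show ?thesis
    by (simp add: inner_add_left sum.distrib sum_Basis_coord[OF e] inner_diff_right)
qed

text \<open>The transversal derivatives are absorbed by the Poincare inequality, and the remaining longitudinal terms are
  \<open>-2\<close> times the square of \<open>\<partial>\<^sub>e u - (p'/p) u\<close> integrated against \<open>1/p\<close>.\<close>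

lemma heat_weight_inequality:
  assumes w: "weak_eq \<Omega> E U G A" and e: "e \<in> Basis" and tp: "transversal_poincare \<Omega> e E"
    and p: "p \<in> elementary" "p' \<in> elementary" "p'' \<in> elementary"
      "\<And>x. (p has_real_derivative p' x) (at x)" "\<And>x. (p' has_real_derivative p'' x) (at x)"
    and b: "bfun p'" "bfun p''" and d: "\<delta> > 0" "\<And>x. p x \<ge> \<delta>"
  shows "2 * inner (mul (wt e (\<lambda>x. inverse (p x))) U) A - inner (mul (wt e (\<lambda>x. p'' x * inverse (p x)^2)) U) U \<le> 0"
proof -
  have h: "h10 \<Omega> U G" using w by (simp add: weak_eq_def)
  have pn: "p x \<noteq> 0" "p x > 0" for x using d(1) d(2)[of x] by auto
  \<comment> \<open>Here q = 1/p, r = p'/p^2 = - q' and k = p'/p, so that r' = p''/p^2 - 2 k^2 q.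
    The first summand is, up to sign, the time derivative of 1/p when p solves the heat
    equation.\<close>
  define q where "q x = inverse (p x)" for x
  define q' where "q' x = - (p' x * q x ^ 2)" for x
  define r where "r x = p' x * q x ^ 2" for x
  define k where "k x = p' x * q x" for x
  define r' where "r' x = p'' x * q x ^ 2 + (- 2) * (k x ^ 2 * q x)" for x
  have qe: "q \<in> elementary" unfolding q_def[abs_def] by (rule elementary.inv[OF p(1) pn(1)])
  have qb: "bfun q"
  proof (rule bfunI[where B="1/\<delta>"])
    have "isCont p x" for x using p(4) by (rule DERIV_isCont)
    then have "p \<in> borel_measurable borel"
      by (intro borel_measurable_continuous_onI continuous_at_imp_continuous_on) blast
    then show "q \<in> borel_measurable borel" unfolding q_def[abs_def] by measurable
    show "\<bar>q x\<bar> \<le> 1 / \<delta>" for x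
      using d(1) d(2)[of x] pn(2)[of x] by (simp add: q_def field_simps)
  qed
  have qp: "q x > 0" for x using pn(2) by (simp add: q_def)
  have q'b: "bfun q'" unfolding q'_def[abs_def] using bfun_cmult[OF bfun_mult[OF b(1) bfun_power[OF qb]], of "-1" 2] by simp
  have rb: "bfun r" unfolding r_def[abs_def] by (rule bfun_mult[OF b(1) bfun_power[OF qb]])
  have kb: "bfun k" unfolding k_def[abs_def] by (rule bfun_mult[OF b(1) qb])
  have s2: "bfun (\<lambda>x. p'' x * q x ^ 2)" by (rule bfun_mult[OF b(2) bfun_power[OF qb]])
  have s3: "bfun (\<lambda>x. k x ^ 2 * q x)" by (rule bfun_mult[OF bfun_power[OF kb] qb])
  have r'b: "bfun r'" unfolding r'_def[abs_def] by (rule bfun_add[OF s2 bfun_cmult[OF s3]])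
  have qd: "(q has_real_derivative q' x) (at x)" for x
    unfolding q_def[abs_def] q'_def
    by (rule derivative_eq_intros p(4) pn refl)+ (simp add: q_def power2_eq_square)
  have rd: "(r has_real_derivative r' x) (at x)" for x
    unfolding r_def[abs_def]
    by (rule derivative_eq_intros p(5) qd refl)+
      (simp add: r'_def q'_def k_def power2_eq_square algebra_simps)
  have rs: "smooth_real r" unfolding r_def[abs_def]
    by (rule elementary_smooth[OF elementary.mult[OF p(2) elementary_power[OF qe]]])
  note W = bmeas_wt[OF qb, of e] bmeas_wt[OF q'b, of e] bmeas_wt[OF rb, of e] bmeas_wt[OF kb, of e] bmeas_wt[OF s2, of e] bmeas_wt[OF s3, of e]
  have eq: "inner (mul (wt e q) U) A = E * inner (mul (wt e q) U) U
     - (\<Sum>b\<in>Basis. inner (mul (wt e q) (G b)) (G b)) - inner (mul (wt e q') U) (G e)"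
    by (rule weak_eq_weight[OF w e elementary_smooth[OF qe] qd qb q'b])
  have "E * inner (mul (wt e q) U) U \<le> (\<Sum>b\<in>Basis - {e}. inner (mul (wt e q) (G b)) (G b))"
    by (rule tp[unfolded transversal_poincare_def, rule_format, OF h qb]) (simp add: less_imp_le[OF qp])
  also have "\<dots> = (\<Sum>b\<in>Basis. inner (mul (wt e q) (G b)) (G b)) - inner (mul (wt e q) (G e)) (G e)"
    using e by (simp add: sum.remove)
  finally have 1: "inner (mul (wt e q) U) A \<le> - inner (mul (wt e q) (G e)) (G e) - inner (mul (wt e q') U) (G e)"
    using eq by simp
  have 2: "mul (wt e q') U = - mul (wt e r) U"
    using mul_cmult_left[OF W(3), of "-1" U] by (simp add: q'_def r_def)
  \<comment> \<open>Integration by parts with r trades the p'' term for a cross term and a k^2 term,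
    exactly those that complete the square in \<open>Z\<close>.\<close>
  have 3: "inner (mul (wt e (\<lambda>x. p'' x * q x ^ 2)) U) U - 2 * inner (mul (wt e (\<lambda>x. k x ^ 2 * q x)) U) U
      = - 2 * inner (mul (wt e r) U) (G e)"
  proof -
    have "mul (wt e r') U = mul (wt e (\<lambda>x. p'' x * q x ^ 2)) U + (-2) *\<^sub>R mul (wt e (\<lambda>x. k x ^ 2 * q x)) U"
      unfolding r'_def mul_cmult_left[OF W(6), symmetric] by (rule mul_add_left[OF W(5) bmeas_cmult[OF W(6)]])
    with weight_ibp[OF h e rs rd rb r'b] show ?thesis by (simp add: inner_add_left inner_diff_left)
  qed
  define Z where "Z = G e - mul (wt e k) U"
  have "0 \<le> inner (mul (wt e q) Z) Z"
    unfolding inner_mul[OF W(1)] by (rule integral_nonneg_AE) (simp add: qp less_imp_le)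
  also have "inner (mul (wt e q) Z) Z = inner (mul (wt e q) (G e)) (G e) - 2 * inner (mul (wt e r) U) (G e)
      + inner (mul (wt e (\<lambda>x. k x ^ 2 * q x)) U) U"
  proof -
    have m1: "mul (wt e q) (mul (wt e k) U) = mul (wt e r) U"
      unfolding mul_mul[OF W(1) W(4)] by (rule mul_cong_fun) (simp add: r_def k_def power2_eq_square)
    have m2: "inner (mul (wt e r) U) (mul (wt e k) U) = inner (mul (wt e (\<lambda>x. k x ^ 2 * q x)) U) U"
      unfolding inner_mul_commute[OF W(4), symmetric] mul_mul[OF W(4) W(3)]
      by (rule arg_cong[where f="\<lambda>V. inner V U"], rule mul_cong_fun) (simp add: r_def k_def power2_eq_square)
    have m3: "inner (mul (wt e q) (G e)) (mul (wt e k) U) = inner (mul (wt e r) U) (G e)"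
      unfolding inner_mul_commute[OF W(1)] m1 by (rule inner_commute)
    show ?thesis
      unfolding Z_def
      by (simp add: linear_diff[OF bounded_linear.linear[OF bounded_linear_mul[OF W(1)]]] m1 inner_diff_left inner_diff_right m2 m3)
  qed
  finally show ?thesis using 1 3 unfolding 2 q_def by simp
qed

text \<open>The localisation formula: testing with f^2 U and completing the square leaves the form
  of f U and an error |f' U|^2 that contains no derivative of U.\<close>

lemma cutoff_identity:
  assumes w: "weak_eq \<Omega> E U G A" and e: "e \<in> Basis"
    and f: "f \<in> elementary" "\<And>x. (f has_real_derivative f' x) (at x)" "bfun f" "bfun f'"
  defines "H \<equiv> \<lambda>b. mul (wt e f) (G b) + (b \<bullet> e) *\<^sub>R mul (wt e f') U"
  shows "h10 \<Omega> (mul (wt e f) U) H"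
    and "inner (mul (wt e (\<lambda>x. f x * f x)) U) A = E * (norm (mul (wt e f) U))\<^sup>2 - (\<Sum>b\<in>Basis. (norm (H b))\<^sup>2)
      + (norm (mul (wt e f') U))\<^sup>2"
proof -
  have h: "h10 \<Omega> U G" using w by (simp add: weak_eq_def)
  show "h10 \<Omega> (mul (wt e f) U) H"
    unfolding H_def by (rule h10_mul[OF h elementary_smooth[OF f(1)] f(2-4)])
  note W = bmeas_wt[OF f(3), of e] bmeas_wt[OF f(4), of e]
  have ff: "bfun (\<lambda>x. f x * f x)" by (rule bfun_mult[OF f(3) f(3)])
  have ff': "bfun (\<lambda>x. 2 * (f x * f' x))" by (rule bfun_cmult[OF bfun_mult[OF f(3,4)]])
  have eq: "inner (mul (wt e (\<lambda>x. f x * f x)) U) A = E * inner (mul (wt e (\<lambda>x. f x * f x)) U) U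
     - (\<Sum>b\<in>Basis. inner (mul (wt e (\<lambda>x. f x * f x)) (G b)) (G b)) - inner (mul (wt e (\<lambda>x. 2 * (f x * f' x))) U) (G e)"
    by (rule weak_eq_weight[OF w e elementary_smooth[OF elementary.mult[OF f(1) f(1)]] _ ff ff'])
      (use DERIV_mult[OF f(2) f(2)] in \<open>simp add: mult.commute\<close>)
  have sq: "inner (mul (wt e (\<lambda>x. f x * f x)) V) V = (norm (mul (wt e f) V))\<^sup>2" for V
    unfolding power2_norm_eq_inner mul_mul[OF W(1) W(1), symmetric] by (rule inner_mul_commute[OF W(1)])
  have cr: "inner (mul (wt e (\<lambda>x. 2 * (f x * f' x))) U) V = 2 * inner (mul (wt e f) V) (mul (wt e f') U)" for V
  proof -
    have "inner (mul (wt e f) V) (mul (wt e f') U) = inner V (mul (wt e f) (mul (wt e f') U))"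
      by (rule inner_mul_commute[OF W(1)])
    also have "\<dots> = inner (mul (wt e (\<lambda>x. f x * f' x)) U) V"
      unfolding mul_mul[OF W] by (rule inner_commute)
    finally show ?thesis
      using mul_cmult_left[OF bmeas_mult[OF W], of 2 U] by simp
  qed
  have nH: "(norm (H b))\<^sup>2 = (norm (mul (wt e f) (G b)))\<^sup>2 + (b \<bullet> e) * (2 * inner (mul (wt e f) (G b)) (mul (wt e f') U))
      + (b \<bullet> e) * (b \<bullet> e) * (norm (mul (wt e f') U))\<^sup>2" for b
    unfolding H_def power2_norm_eq_inner
    by (simp add: inner_add_left inner_add_right inner_commute algebra_simps)
  have "(\<Sum>b\<in>Basis. (norm (H b))\<^sup>2) = (\<Sum>b\<in>Basis. (norm (mul (wt e f) (G b)))\<^sup>2)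
      + 2 * inner (mul (wt e f) (G e)) (mul (wt e f') U) + (norm (mul (wt e f') U))\<^sup>2"
    unfolding nH sum.distrib mult.assoc sum_Basis_coord[OF e] using e by simp
  then show "inner (mul (wt e (\<lambda>x. f x * f x)) U) A = E * (norm (mul (wt e f) U))\<^sup>2 - (\<Sum>b\<in>Basis. (norm (H b))\<^sup>2)
      + (norm (mul (wt e f') U))\<^sup>2"
    unfolding eq sq cr by simp
qed

section \<open>Differential inequalities\<close>

lemma nonincreasing_of_derivative:
  fixes f :: "real \<Rightarrow> real"
  assumes d: "\<And>s. s \<ge> 0 \<Longrightarrow> (f has_real_derivative f' s) (at s within {0..})"
    and le: "\<And>s. s \<ge> 0 \<Longrightarrow> f' s \<le> 0" and t: "0 \<le> a" "a \<le> t"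
  shows "f t \<le> f a"
proof (cases "a = t")
  case False
  show ?thesis
  proof (rule DERIV_nonpos_imp_decreasing_open[where f=f and a=a and b=t])
    show "a \<le> t" using t by simp
    fix x assume x: "a < x" "x < t"
    then have "(f has_real_derivative f' x) (at x within {0<..})"
      using d[of x] t by (auto intro: DERIV_subset)
    then have "(f has_real_derivative f' x) (at x)"
      using at_within_open[of x "{0<..}"] x t by simp
    then show "\<exists>y. (f has_real_derivative y) (at x) \<and> y \<le> 0" using le[of x] x t by auto
  next
    have "continuous_on {0..} f"
      by (rule DERIV_continuous_on) (use d in simp)
    then show "continuous_on {a..t} f" by (rule continuous_on_subset) (use t in auto)
  qed
qed simp

text \<open>For z = exp (- 2 \<epsilon> t) y the linear term disappears, and z^(-2) grows at rate at
  least 4 c / M^2. The conclusion is free of reciprocals so that z t = 0 and Z = 0 are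
  covered.\<close>

lemma cubic_decay:
  fixes y y' :: "real \<Rightarrow> real"
  assumes d: "\<And>s. s \<ge> 0 \<Longrightarrow> (y has_real_derivative y' s) (at s within {0..})"
    and le: "\<And>s. s \<ge> 0 \<Longrightarrow> y s > 0 \<Longrightarrow> y' s \<le> - 2 * c * y s ^ 3 / M\<^sup>2 + 2 * \<epsilon> * y s"
    and nn: "\<And>s. s \<ge> 0 \<Longrightarrow> y s \<ge> 0" and z0: "\<And>s. s \<ge> 0 \<Longrightarrow> y s = 0 \<Longrightarrow> y' s \<le> 0"
    and c: "c > 0" and M: "M > 0" and \<epsilon>: "\<epsilon> \<ge> 0" and Z: "y 0 \<le> Z" and t: "t \<ge> 0"
  shows "(exp (- 2 * \<epsilon> * t) * y t)\<^sup>2 * (M\<^sup>2 + 4 * c * t * Z\<^sup>2) \<le> Z\<^sup>2 * M\<^sup>2"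
proof -
  define z where "z s = exp (- 2 * \<epsilon> * s) * y s" for s
  define z' where "z' s = exp (- 2 * \<epsilon> * s) * (y' s - 2 * \<epsilon> * y s)" for s
  have zd: "(z has_real_derivative z' s) (at s within {0..})" if "s \<ge> 0" for s
    unfolding z_def[abs_def]
    by (rule derivative_eq_intros d[OF that] refl)+ (simp add: z'_def algebra_simps)
  have znn: "z s \<ge> 0" if "s \<ge> 0" for s using nn[OF that] by (simp add: z_def)
  have zle: "z' s \<le> - 2 * c * z s ^ 3 / M\<^sup>2" if s: "s \<ge> 0" and pos: "z s > 0" for s
  proof -
    have ypos: "y s > 0" using pos by (simp add: z_def zero_less_mult_iff)
    have "y' s - 2 * \<epsilon> * y s \<le> - 2 * c * y s ^ 3 / M\<^sup>2" using le[OF s ypos] by simp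
    then have "z' s \<le> exp (- 2 * \<epsilon> * s) * (- 2 * c * y s ^ 3 / M\<^sup>2)"
      unfolding z'_def by (rule mult_left_mono) simp
    also have "\<dots> = - (2 * c * y s ^ 3 / M\<^sup>2) * exp (- 2 * \<epsilon> * s)" by simp
    \<comment> \<open>The exponential is at most 1, so cubing it lowers it and, with the negative
      factor in front, enlarges the right side; it then combines with y^3 to z^3.\<close>
    also have "\<dots> \<le> - (2 * c * y s ^ 3 / M\<^sup>2) * exp (- 2 * \<epsilon> * s) ^ 3"
    proof -
      have "exp (- 2 * \<epsilon> * s) ^ 3 \<le> exp (- 2 * \<epsilon> * s) ^ 1"
        by (rule power_decreasing) (use \<epsilon> s in auto)
      then have "exp (- 2 * \<epsilon> * s) ^ 3 \<le> exp (- 2 * \<epsilon> * s)" by simp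
      then show ?thesis using c M ypos by (intro mult_left_mono_neg) auto
    qed
    also have "\<dots> = - 2 * c * z s ^ 3 / M\<^sup>2" by (simp add: z_def power_mult_distrib)
    finally show ?thesis .
  qed
  have z'np: "z' s \<le> 0" if s: "s \<ge> 0" for s
  proof (cases "z s = 0")
    case True
    then have "y s = 0" by (simp add: z_def)
    then show ?thesis using z0[OF s] by (simp add: z'_def mult_nonneg_nonpos)
  next
    case False
    then have "z s > 0" using znn[OF s] by simp
    then have "- 2 * c * z s ^ 3 / M\<^sup>2 \<le> 0" using c M by (simp add: divide_nonpos_pos)
    then show ?thesis using zle[OF s \<open>z s > 0\<close>] by linarith
  qed
  have Z0: "z 0 \<le> Z" using Z by (simp add: z_def)
  show ?thesis
  proof (cases "z t = 0")
    case True
    then show ?thesis by (simp add: z_def)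
  next
    case False
    then have zt: "z t > 0" using znn[OF t] by simp
    \<comment> \<open>Since z is nonincreasing, positivity at the final time gives positivity before
      it, and z^(-2) may be differentiated.\<close>
    have zpos: "z s > 0" if "0 \<le> s" "s \<le> t" for s
      using nonincreasing_of_derivative[of z z' s t, OF zd z'np] that zt by auto
    have main: "inverse (z 0 ^ 2) + 4 * c * t / M\<^sup>2 \<le> inverse (z t ^ 2)"
    proof (cases "t = 0")
      case False
      have "4 * c * t / M\<^sup>2 - inverse (z t ^ 2) \<le> 4 * c * 0 / M\<^sup>2 - inverse (z 0 ^ 2)"
      proof (rule DERIV_nonpos_imp_decreasing_open[where f="\<lambda>s. 4 * c * s / M\<^sup>2 - inverse (z s ^ 2)" and a=0 and b=t])
        show "0 \<le> t" by (rule t)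
        fix s assume s: "0 < s" "s < t"
        have sp: "z s > 0" using zpos s by simp
        have "(z has_real_derivative z' s) (at s within {0<..})"
          using zd[of s] s by (auto intro: DERIV_subset)
        then have zds: "(z has_real_derivative z' s) (at s)"
          using at_within_open[of s "{0<..}"] s by simp
        have "((\<lambda>s. 4 * c * s / M\<^sup>2 - inverse (z s ^ 2)) has_real_derivative (4 * c / M\<^sup>2 + 2 * z' s / z s ^ 3)) (at s)"
        proof -
          have d1: "((\<lambda>s. inverse (z s ^ 2)) has_real_derivative
              - (inverse (z s ^ 2) * (real 2 * (z' s * z s ^ (2 - Suc 0))) * inverse (z s ^ 2))) (at s)"
            by (rule DERIV_inverse'[OF DERIV_power[OF zds]]) (use sp in simp)
          have d2: "((\<lambda>s. 4 * c * s / M\<^sup>2) has_real_derivative 4 * c / M\<^sup>2) (at s)"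
            by (rule DERIV_cdivide[OF DERIV_cmult_Id])
          have "inverse (z s ^ 2) * (real 2 * (z' s * z s ^ (2 - Suc 0))) * inverse (z s ^ 2) = 2 * z' s / z s ^ 3"
            using sp by (simp add: power2_eq_square power3_eq_cube divide_inverse)
          with DERIV_diff[OF d2 d1] show ?thesis by simp
        qed
        moreover have "4 * c / M\<^sup>2 + 2 * z' s / z s ^ 3 \<le> 0"
        proof -
          have "2 * z' s / z s ^ 3 \<le> 2 * (- 2 * c * z s ^ 3 / M\<^sup>2) / z s ^ 3"
            using zle[of s] s sp by (intro divide_right_mono mult_left_mono) auto
          also have "\<dots> = - (4 * c / M\<^sup>2)" using sp by simp
          finally show ?thesis by simp
        qed
        ultimately show "\<exists>y. ((\<lambda>s. 4 * c * s / M\<^sup>2 - inverse (z s ^ 2)) has_real_derivative y) (at s) \<and> y \<le> 0" by blast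
      next
        have "continuous_on {0..} z" by (rule DERIV_continuous_on) (use zd in simp)
        then have "continuous_on {0..t} z" by (rule continuous_on_subset) auto
        then show "continuous_on {0..t} (\<lambda>s. 4 * c * s / M\<^sup>2 - inverse (z s ^ 2))"
          by (intro continuous_intros) (use zpos M in force)+
      qed
      then show ?thesis by simp
    qed simp
    have z00: "z 0 > 0" using zpos t by simp
    have "inverse (Z^2) \<le> inverse (z 0 ^ 2)"
      using Z0 z00 by (intro le_imp_inverse_le power_mono) auto
    with main have m: "inverse (Z^2) + 4 * c * t / M\<^sup>2 \<le> inverse (z t ^ 2)" by linarith
    have Zp: "Z > 0" using Z0 z00 by simp
    have "z t ^ 2 * (M\<^sup>2 + 4 * c * t * Z\<^sup>2) = (inverse (Z^2) + 4 * c * t / M\<^sup>2) * (z t ^ 2 * (Z\<^sup>2 * M\<^sup>2))"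
      using Zp M by (simp add: field_simps)
    also have "\<dots> \<le> inverse (z t ^ 2) * (z t ^ 2 * (Z\<^sup>2 * M\<^sup>2))"
      by (rule mult_right_mono[OF m]) simp
    also have "\<dots> = Z\<^sup>2 * M\<^sup>2" using zt by simp
    finally show ?thesis by (simp add: z_def)
  qed
qed

text \<open>A product rule with a moving weight, n being its time derivative at t. A quadratic
  remainder that is uniform in x controls the increment of the weight in operator norm.\<close>

lemma quadratic_form_derivative:
  fixes U :: "real \<Rightarrow> 'a::euclidean_space l2"
  assumes U: "(U has_vector_derivative A) (at t within {0..})" and t: "t \<ge> 0"
    and m: "\<And>s. s \<ge> 0 \<Longrightarrow> bmeas (m s)" and n: "bmeas n"
    and C: "\<And>s x. s \<ge> 0 \<Longrightarrow> \<bar>m s x - m t x - (s - t) * n x\<bar> \<le> C * (s - t)\<^sup>2"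
  shows "((\<lambda>s. inner (mul (m s) (U s)) (U s)) has_real_derivative
      (2 * inner (mul (m t) (U t)) A + inner (mul n (U t)) (U t))) (at t within {0..})"
proof -
  define Q where "Q V = inner (mul (m t) V) V" for V
  define k where "k s x = m s x - m t x - (s - t) * n x" for s x
  have Ut: "(U \<longlongrightarrow> U t) (at t within {0..})"
    using has_vector_derivative_continuous[OF U] by (simp add: continuous_within)
  have "((\<lambda>s. inner (mul (m t) (U s)) (U s)) has_vector_derivative
      inner (mul (m t) (U t)) A + inner (mul (m t) A) (U t)) (at t within {0..})"
    by (rule bounded_bilinear.has_vector_derivative[OF bounded_bilinear_inner
          bounded_linear.has_vector_derivative[OF bounded_linear_mul[OF m[OF t]] U] U])
  moreover have "inner (mul (m t) A) (U t) = inner (mul (m t) (U t)) A"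
    by (subst inner_mul_commute[OF m[OF t]]) (rule inner_commute)
  ultimately have 3: "((\<lambda>s. (Q (U s) - Q (U t)) / (s - t)) \<longlongrightarrow> 2 * inner (mul (m t) (U t)) A) (at t within {0..})"
    unfolding has_real_derivative_iff_has_vector_derivative[symmetric] has_field_derivative_iff Q_def by simp
  have 2: "((\<lambda>s. inner (mul n (U s)) (U s)) \<longlongrightarrow> inner (mul n (U t)) (U t)) (at t within {0..})"
    by (rule tendsto_inner[OF bounded_linear.tendsto[OF bounded_linear_mul[OF n] Ut] Ut])
  have kb: "bmeas (k s)" if s: "s \<ge> 0" for s
  proof (rule bmeasI[where B="C * (s - t)\<^sup>2"])
    show "k s \<in> borel_measurable borel"
      using m[OF s] m[OF t] n unfolding k_def[abs_def] by measurable
    show "\<bar>k s x\<bar> \<le> C * (s - t)\<^sup>2" for x using C[OF s] by (simp add: k_def)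
  qed
  \<comment> \<open>The increment consists of the remainder \<open>k s\<close>, the linear part of
    the weight at the moving vector \<open>U s\<close>, and the increment of the form with the
    weight frozen at t.\<close>
  have split: "(inner (mul (m s) (U s)) (U s) - inner (mul (m t) (U t)) (U t)) / (s - t)
      = inner (mul (k s) (U s)) (U s) / (s - t) + inner (mul n (U s)) (U s) + (Q (U s) - Q (U t)) / (s - t)"
    if s: "s \<ge> 0" "s \<noteq> t" for s
  proof -
    have "mul (m s) (U s) = mul (\<lambda>x. (k s x + (s - t) * n x) + m t x) (U s)"
      by (rule mul_cong_fun) (simp add: k_def)
    also have "\<dots> = (mul (k s) (U s) + (s - t) *\<^sub>R mul n (U s)) + mul (m t) (U s)"
      unfolding mul_cmult_left[OF n, symmetric] mul_add_left[OF kb[OF s(1)] bmeas_cmult[OF n], symmetric]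
      by (rule mul_add_left[OF bmeas_add[OF kb[OF s(1)] bmeas_cmult[OF n]] m[OF t]])
    finally show ?thesis using s(2) by (simp add: Q_def inner_add_left add_divide_distrib diff_divide_distrib)
  qed
  have C0: "C \<ge> 0"
  proof -
    have "0 \<le> C * (t + 1 - t)\<^sup>2" using C[of "t + 1" undefined] t by linarith
    then show ?thesis by simp
  qed
  have "((\<lambda>s. inner (mul (k s) (U s)) (U s) / (s - t)) \<longlongrightarrow> 0) (at t within {0..})"
  proof (rule Lim_null_comparison)
    show "\<forall>\<^sub>F s in at t within {0..}. norm (inner (mul (k s) (U s)) (U s) / (s - t)) \<le> C * \<bar>s - t\<bar> * (norm (U s))\<^sup>2"
      unfolding eventually_at_filter
    proof (rule always_eventually, intro allI impI)
      fix s assume s: "s \<noteq> t" "s \<in> {0..}"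
      have "\<bar>inner (mul (k s) (U s)) (U s)\<bar> \<le> norm (mul (k s) (U s)) * norm (U s)"
        by (rule Cauchy_Schwarz_ineq2)
      also have "\<dots> \<le> (C * (s - t)\<^sup>2 * norm (U s)) * norm (U s)"
        by (rule mult_right_mono[OF norm_mul_le[OF kb]]) (use s C in \<open>auto simp: k_def\<close>)
      also have "\<dots> = C * \<bar>s - t\<bar> * (norm (U s))\<^sup>2 * \<bar>s - t\<bar>" by (simp add: power2_eq_square abs_mult_self_eq[of "s-t", symmetric] del: abs_mult_self_eq)
      finally show "norm (inner (mul (k s) (U s)) (U s) / (s - t)) \<le> C * \<bar>s - t\<bar> * (norm (U s))\<^sup>2"
        using s by (simp add: pos_divide_le_eq)
    qed
    have "((\<lambda>s. C * \<bar>s - t\<bar> * (norm (U s))\<^sup>2) \<longlongrightarrow> C * \<bar>t - t\<bar> * (norm (U t))\<^sup>2) (at t within {0..})"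
      by (intro tendsto_intros Ut)
    then show "((\<lambda>s. C * \<bar>s - t\<bar> * (norm (U s))\<^sup>2) \<longlongrightarrow> 0) (at t within {0..})" by simp
  qed
  from tendsto_add[OF tendsto_add[OF this 2] 3]
  have "((\<lambda>s. inner (mul (k s) (U s)) (U s) / (s - t) + inner (mul n (U s)) (U s) + (Q (U s) - Q (U t)) / (s - t))
      \<longlongrightarrow> 2 * inner (mul (m t) (U t)) A + inner (mul n (U t)) (U t)) (at t within {0..})"
    by (simp add: add.commute)
  then have "((\<lambda>s. (inner (mul (m s) (U s)) (U s) - inner (mul (m t) (U t)) (U t)) / (s - t))
      \<longlongrightarrow> 2 * inner (mul (m t) (U t)) A + inner (mul n (U t)) (U t)) (at t within {0..})"
  proof (rule Lim_transform_eventually)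
    show "\<forall>\<^sub>F s in at t within {0..}. inner (mul (k s) (U s)) (U s) / (s - t) + inner (mul n (U s)) (U s) + (Q (U s) - Q (U t)) / (s - t)
      = (inner (mul (m s) (U s)) (U s) - inner (mul (m t) (U t)) (U t)) / (s - t)"
      unfolding eventually_at_filter by (rule always_eventually) (simp add: split)
  qed
  then show ?thesis unfolding has_field_derivative_iff .
qed


section \<open>Solutions of the heat equation on the line\<close>

text \<open>p solves the heat equation: p1 and p2 are its first two space derivatives, and p2 is
  also its time derivative. p3 is the time derivative of p2; its bound gives the uniform second
  order estimate in time.\<close>

definition heat_profile ::
  "(real \<Rightarrow> real \<Rightarrow> real) \<Rightarrow> (real \<Rightarrow> real \<Rightarrow> real) \<Rightarrow> (real \<Rightarrow> real \<Rightarrow> real) \<Rightarrow> (real \<Rightarrow> real \<Rightarrow> real) \<Rightarrow> bool" where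
  "heat_profile p p1 p2 p3 \<longleftrightarrow>
     (\<forall>t\<ge>0. p t \<in> elementary \<and> p1 t \<in> elementary \<and> p2 t \<in> elementary \<and>
        (\<forall>x. (p t has_real_derivative p1 t x) (at x) \<and> (p1 t has_real_derivative p2 t x) (at x) \<and>
          ((\<lambda>t. p t x) has_real_derivative p2 t x) (at t) \<and> ((\<lambda>t. p2 t x) has_real_derivative p3 t x) (at t))) \<and>
     (\<exists>C. \<forall>t\<ge>0. \<forall>x. \<bar>p1 t x\<bar> \<le> C \<and> \<bar>p2 t x\<bar> \<le> C \<and> \<bar>p3 t x\<bar> \<le> C)"

lemma heat_profile_const: "heat_profile (\<lambda>t x. c) (\<lambda>t x. 0) (\<lambda>t x. 0) (\<lambda>t x. 0)"
  by (auto simp: heat_profile_def elementary.const intro!: exI[of _ 0])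

lemma heat_profile_cmult:
  assumes "heat_profile p p1 p2 p3"
  shows "heat_profile (\<lambda>t x. c * p t x) (\<lambda>t x. c * p1 t x) (\<lambda>t x. c * p2 t x) (\<lambda>t x. c * p3 t x)"
proof -
  obtain C where C: "\<And>t x. t \<ge> 0 \<Longrightarrow> \<bar>p1 t x\<bar> \<le> C \<and> \<bar>p2 t x\<bar> \<le> C \<and> \<bar>p3 t x\<bar> \<le> C"
    using assms unfolding heat_profile_def by blast
  have "\<forall>t\<ge>0. \<forall>x. \<bar>c * p1 t x\<bar> \<le> \<bar>c\<bar> * C \<and> \<bar>c * p2 t x\<bar> \<le> \<bar>c\<bar> * C \<and> \<bar>c * p3 t x\<bar> \<le> \<bar>c\<bar> * C"
    using C by (auto simp: abs_mult intro!: mult_left_mono)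
  with assms show ?thesis
    unfolding heat_profile_def
    by (auto intro!: elementary.mult elementary.const DERIV_cmult)
qed

lemma heat_profile_add:
  assumes "heat_profile p p1 p2 p3" "heat_profile q q1 q2 q3"
  shows "heat_profile (\<lambda>t x. p t x + q t x) (\<lambda>t x. p1 t x + q1 t x) (\<lambda>t x. p2 t x + q2 t x) (\<lambda>t x. p3 t x + q3 t x)"
proof -
  obtain C where C: "\<And>t x. t \<ge> 0 \<Longrightarrow> \<bar>p1 t x\<bar> \<le> C \<and> \<bar>p2 t x\<bar> \<le> C \<and> \<bar>p3 t x\<bar> \<le> C"
    using assms(1) unfolding heat_profile_def by blast
  obtain D where D: "\<And>t x. t \<ge> 0 \<Longrightarrow> \<bar>q1 t x\<bar> \<le> D \<and> \<bar>q2 t x\<bar> \<le> D \<and> \<bar>q3 t x\<bar> \<le> D"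
    using assms(2) unfolding heat_profile_def by blast
  have "\<forall>t\<ge>0. \<forall>x. \<bar>p1 t x + q1 t x\<bar> \<le> C + D \<and> \<bar>p2 t x + q2 t x\<bar> \<le> C + D \<and> \<bar>p3 t x + q3 t x\<bar> \<le> C + D"
  proof (intro allI impI)
    fix t x :: real assume t: "0 \<le> t"
    show "\<bar>p1 t x + q1 t x\<bar> \<le> C + D \<and> \<bar>p2 t x + q2 t x\<bar> \<le> C + D \<and> \<bar>p3 t x + q3 t x\<bar> \<le> C + D"
      by (intro conjI order.trans[OF abs_triangle_ineq add_mono]) (use C[OF t, of x] D[OF t, of x] in auto)
  qed
  with assms show ?thesis
    unfolding heat_profile_def
    by (auto intro!: elementary.add DERIV_add)
qed

lemma heat_profile_sum:
  assumes "finite I" "\<And>i. i \<in> I \<Longrightarrow> heat_profile (p i) (p1 i) (p2 i) (p3 i)"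
  shows "heat_profile (\<lambda>t x. \<Sum>i\<in>I. p i t x) (\<lambda>t x. \<Sum>i\<in>I. p1 i t x) (\<lambda>t x. \<Sum>i\<in>I. p2 i t x) (\<lambda>t x. \<Sum>i\<in>I. p3 i t x)"
  using assms by (induction I rule: finite_induct) (simp_all add: heat_profile_const heat_profile_add)

lemma taylor_bound:
  fixes f :: "real \<Rightarrow> real"
  assumes d: "\<And>t. t \<ge> 0 \<Longrightarrow> (f has_real_derivative f1 t) (at t)" "\<And>t. t \<ge> 0 \<Longrightarrow> (f1 has_real_derivative f2 t) (at t)"
    and C: "\<And>t. t \<ge> 0 \<Longrightarrow> \<bar>f2 t\<bar> \<le> C" and st: "s \<ge> 0" "t \<ge> 0"
  shows "\<bar>f s - f t - (s - t) * f1 t\<bar> \<le> C * (s - t)\<^sup>2"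
proof -
  have C0: "C \<ge> 0" using C[of 0] by linarith
  have lip: "\<bar>f1 z - f1 t\<bar> \<le> C * \<bar>z - t\<bar>" if "z \<ge> 0" for z
    using field_differentiable_bound[of "{0..}" f1 f2 C z t] d(2) C that st
    by (auto intro: DERIV_subset)
  define S where "S = closed_segment s t"
  have S0: "z \<ge> 0" "\<bar>z - t\<bar> \<le> \<bar>s - t\<bar>" if "z \<in> S" for z
    using that st by (auto simp: S_def closed_segment_eq_real_ivl split: if_splits)
  have "norm ((\<lambda>z. f z - z * f1 t) s - (\<lambda>z. f z - z * f1 t) t) \<le> (C * \<bar>s - t\<bar>) * norm (s - t)"
  proof (rule field_differentiable_bound[where S=S and f'="\<lambda>z. f1 z - f1 t"])
    show "convex S" by (simp add: S_def)
    fix z assume z: "z \<in> S"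
    have "((\<lambda>z. f z - z * f1 t) has_real_derivative (f1 z - f1 t)) (at z)"
      by (rule derivative_eq_intros d(1)[OF S0(1)[OF z]] refl | simp)+
    then show "((\<lambda>z. f z - z * f1 t) has_real_derivative (f1 z - f1 t)) (at z within S)"
      by (rule DERIV_subset) simp
    show "norm (f1 z - f1 t) \<le> C * \<bar>s - t\<bar>"
      using lip[OF S0(1)[OF z]] mult_left_mono[OF S0(2)[OF z] C0] by simp
  qed (simp_all add: S_def)
  moreover have "(C * \<bar>s - t\<bar>) * norm (s - t) = C * (s - t)\<^sup>2" by (simp add: power2_eq_square)
  moreover have "norm ((\<lambda>z. f z - z * f1 t) s - (\<lambda>z. f z - z * f1 t) t) = \<bar>f s - f t - (s - t) * f1 t\<bar>"
    by (simp add: algebra_simps)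
  ultimately show ?thesis by (simp only:)
qed

text \<open>The second time derivative of 1/p is - p3/p^2 + 2 p2^2/p^3, bounded because p stays
  above \<delta>. Taylor's formula then gives a remainder uniform in x, as
  \<open>quadratic_form_derivative\<close> requires.\<close>

lemma heat_profile_recip:
  assumes h: "heat_profile p p1 p2 p3" and d: "\<delta> > 0" "\<And>t x. t \<ge> 0 \<Longrightarrow> p t x \<ge> \<delta>"
  shows "\<exists>C. \<forall>s t x. s \<ge> 0 \<longrightarrow> t \<ge> 0 \<longrightarrow>
     \<bar>inverse (p s x) - inverse (p t x) - (s - t) * (- (p2 t x * inverse (p t x) ^ 2))\<bar> \<le> C * (s - t)\<^sup>2"
proof -
  obtain C where C: "\<And>t x. t \<ge> 0 \<Longrightarrow> \<bar>p1 t x\<bar> \<le> C \<and> \<bar>p2 t x\<bar> \<le> C \<and> \<bar>p3 t x\<bar> \<le> C"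
    using h unfolding heat_profile_def by blast
  have D: "((\<lambda>t. p t x) has_real_derivative p2 t x) (at t)" "((\<lambda>t. p2 t x) has_real_derivative p3 t x) (at t)"
    if "t \<ge> 0" for t x using h that unfolding heat_profile_def by blast+
  have C0: "C \<ge> 0" using C[of 0 0] by linarith
  have pn: "p t x > 0" if "t \<ge> 0" for t x using d(1) d(2)[OF that, of x] by linarith
  have iv: "0 < inverse (p t x)" "inverse (p t x) \<le> inverse \<delta>" if "t \<ge> 0" for t x
    using pn[OF that, of x] d(1) d(2)[OF that, of x] by (auto intro: le_imp_inverse_le)
  define K where "K = C * inverse \<delta> ^ 2 + 2 * (C ^ 2 * inverse \<delta> ^ 3)"
  show ?thesis
  proof (intro exI[of _ K] allI impI)
    fix s t x :: real assume st: "0 \<le> s" "0 \<le> t"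
    define f2 where "f2 t = - (p3 t x * inverse (p t x) ^ 2) + 2 * (p2 t x ^ 2 * inverse (p t x) ^ 3)" for t
    have d1: "((\<lambda>t. inverse (p t x)) has_real_derivative - (p2 t x * inverse (p t x) ^ 2)) (at t)" if t: "t \<ge> 0" for t
    proof -
      have "((\<lambda>t. inverse (p t x)) has_real_derivative - (inverse (p t x) * p2 t x * inverse (p t x))) (at t)"
        by (rule DERIV_inverse'[OF D(1)[OF t]]) (use pn[OF t, of x] in simp)
      then show ?thesis by (simp add: power2_eq_square mult_ac)
    qed
    have d2: "((\<lambda>t. - (p2 t x * inverse (p t x) ^ 2)) has_real_derivative f2 t) (at t)" if t: "t \<ge> 0" for t
    proof -
      have "((\<lambda>t. - (p2 t x * inverse (p t x) ^ 2)) has_real_derivative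
          - (p3 t x * inverse (p t x) ^ 2 + (real 2 * (- (p2 t x * inverse (p t x) ^ 2) * inverse (p t x) ^ (2 - Suc 0))) * p2 t x)) (at t)"
        by (rule DERIV_minus[OF DERIV_mult[OF D(2)[OF t] DERIV_power[OF d1[OF t]]]])
      also have "- (p3 t x * inverse (p t x) ^ 2 + (real 2 * (- (p2 t x * inverse (p t x) ^ 2) * inverse (p t x) ^ (2 - Suc 0))) * p2 t x) = f2 t"
        by (simp add: f2_def power2_eq_square power3_eq_cube)
      finally show ?thesis .
    qed
    have f2b: "\<bar>f2 t\<bar> \<le> K" if t: "t \<ge> 0" for t
    proof -
      have "\<bar>f2 t\<bar> \<le> \<bar>p3 t x\<bar> * inverse (p t x) ^ 2 + 2 * (p2 t x ^ 2 * inverse (p t x) ^ 3)"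
        unfolding f2_def using iv(1)[OF t, of x]
        by (intro order.trans[OF abs_triangle_ineq]) (simp add: abs_mult)
      also have "\<dots> \<le> K" unfolding K_def
      proof (rule add_mono)
        show "\<bar>p3 t x\<bar> * inverse (p t x) ^ 2 \<le> C * inverse \<delta> ^ 2"
          by (rule mult_mono[OF _ power_mono[OF iv(2)[OF t]]]) (use C[OF t, of x] C0 iv(1)[OF t, of x] in auto)
        have "p2 t x ^ 2 \<le> C ^ 2" using C[OF t, of x] by (metis abs_le_square_iff abs_of_nonneg C0)
        then show "2 * (p2 t x ^ 2 * inverse (p t x) ^ 3) \<le> 2 * (C ^ 2 * inverse \<delta> ^ 3)"
          by (intro mult_left_mono mult_mono[OF _ power_mono[OF iv(2)[OF t]]]) (use iv(1)[OF t, of x] in auto)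
      qed
      finally show ?thesis .
    qed
    show "\<bar>inverse (p s x) - inverse (p t x) - (s - t) * (- (p2 t x * inverse (p t x) ^ 2))\<bar> \<le> K * (s - t)\<^sup>2"
      by (rule taylor_bound[OF d1 d2 f2b st])
  qed
qed

subsection \<open>Gaussians\<close>

text \<open>The heat flow started at exp (- s x^2) is b(t) exp (- a(t) x^2) with a =
  \<open>gA s\<close> and b = \<open>gB s\<close>. These solve a' = - 4 a^2 and b' = - 2 a
  b.\<close>

definition gA :: "real \<Rightarrow> real \<Rightarrow> real" where "gA s t = s / (1 + 4 * s * t)"
definition gB :: "real \<Rightarrow> real \<Rightarrow> real" where "gB s t = 1 / sqrt (1 + 4 * s * t)"
definition gauss :: "real \<Rightarrow> real \<Rightarrow> real \<Rightarrow> real" where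
  "gauss s t x = gB s t * exp (- (gA s t * x\<^sup>2))"

lemma exp_poly_bounds:
  fixes y :: real assumes "y \<ge> 0"
  shows "exp (- y) \<le> 1" "y * exp (- y) \<le> 1" "y\<^sup>2 * exp (- y) \<le> 2"
proof -
  have e: "1 + y + y\<^sup>2 / 2 \<le> exp y" using exp_lower_Taylor_quadratic[OF assms] .
  have y2: "y\<^sup>2 \<ge> 0" by simp
  show "exp (- y) \<le> 1" using assms by simp
  have "y \<le> exp y" using e y2 assms by linarith
  then show "y * exp (- y) \<le> 1" by (simp add: exp_minus field_simps)
  have "y\<^sup>2 \<le> 2 * exp y" using e y2 assms by linarith
  then show "y\<^sup>2 * exp (- y) \<le> 2" by (simp add: exp_minus field_simps)
qed

lemma gauss_profile:
  assumes s: "s > 0"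
  defines "a \<equiv> gA s" and "b \<equiv> gB s"
  shows "heat_profile (gauss s) (\<lambda>t x. b t * (- 2 * a t * x) * exp (- (a t * x\<^sup>2)))
    (\<lambda>t x. b t * (4 * (a t)\<^sup>2 * x\<^sup>2 - 2 * a t) * exp (- (a t * x\<^sup>2)))
    (\<lambda>t x. b t * (16 * (a t)^4 * x^4 - 48 * (a t)^3 * x\<^sup>2 + 12 * (a t)\<^sup>2) * exp (- (a t * x\<^sup>2)))"
proof -
  have k: "1 + 4 * s * t \<ge> 1" if "t \<ge> 0" for t using s that by simp
  have k0: "1 + 4 * s * t > 0" if "t \<ge> 0" for t using k[OF that] by linarith
  have ad: "(a has_real_derivative (- 4 * (a t)\<^sup>2)) (at t)" if "t \<ge> 0" for t
  proof -
    have "((\<lambda>t. 1 + 4 * s * t) has_real_derivative 4 * s) (at t)" by (auto intro!: derivative_eq_intros)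
    then have "((\<lambda>t. s * inverse (1 + 4 * s * t)) has_real_derivative
        s * - (inverse (1 + 4 * s * t) * (4 * s) * inverse (1 + 4 * s * t))) (at t)"
      by (rule DERIV_cmult[OF DERIV_inverse']) (use k0[OF that] in simp)
    moreover have "a = (\<lambda>t. s * inverse (1 + 4 * s * t))" by (auto simp: a_def gA_def divide_inverse)
    moreover have "s * - (inverse (1 + 4 * s * t) * (4 * s) * inverse (1 + 4 * s * t)) = - 4 * (a t)\<^sup>2"
      by (simp add: a_def gA_def divide_inverse power2_eq_square mult_ac)
    ultimately show ?thesis by metis
  qed
  have bd: "(b has_real_derivative (- 2 * a t * b t)) (at t)" if "t \<ge> 0" for t
  proof -
    define r where "r = sqrt (1 + 4 * s * t)"
    have r: "r > 0" "r * r = 1 + 4 * s * t" using k0[OF that] by (auto simp: r_def)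
    have "((\<lambda>t. 1 + 4 * s * t) has_real_derivative 4 * s) (at t)" by (auto intro!: derivative_eq_intros)
    then have "((\<lambda>t. sqrt (1 + 4 * s * t)) has_real_derivative (inverse r / 2) * (4 * s)) (at t)"
      unfolding r_def by (rule DERIV_chain2[where f=sqrt and g="\<lambda>t. 1 + 4 * s * t", OF DERIV_real_sqrt[OF k0[OF that]]])
    then have "((\<lambda>t. inverse (sqrt (1 + 4 * s * t))) has_real_derivative
       - (inverse r * ((inverse r / 2) * (4 * s)) * inverse r)) (at t)"
      unfolding r_def by (rule DERIV_inverse') (use k0[OF that] in simp)
    moreover have "b = (\<lambda>t. inverse (sqrt (1 + 4 * s * t)))" by (auto simp: b_def gB_def divide_inverse)
    moreover have "- (inverse r * ((inverse r / 2) * (4 * s)) * inverse r) = - 2 * a t * b t"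
    proof -
      have "a t = s / (r * r)" by (simp add: a_def gA_def r(2))
      moreover have "b t = 1 / r" by (simp add: b_def gB_def r_def)
      ultimately have "- 2 * a t * b t = - 2 * (s / (r * r)) * (1 / r)" by (simp only:)
      then show ?thesis using r(1) by (simp add: field_simps)
    qed
    ultimately show ?thesis by metis
  qed
  have ab: "0 \<le> a t" "a t \<le> s" "0 \<le> b t" "b t \<le> 1" if "t \<ge> 0" for t
    using k[OF that] s by (auto simp: a_def b_def gA_def gB_def divide_le_eq_1 pos_divide_le_eq mult_left_le less_imp_le)
  have ex: "(\<lambda>x. exp (- (a t * x\<^sup>2))) \<in> elementary" for t
  proof -
    have "(\<lambda>x. exp ((- a t) * x\<^sup>2)) \<in> elementary"
      by (rule elementary.exp[OF elementary.mult[OF elementary.const elementary_power[OF elementary.ident]]])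
    then show ?thesis by simp
  qed
  have e1: "gauss s t \<in> elementary" for t
    unfolding gauss_def[abs_def] a_def[symmetric] b_def[symmetric] by (rule elementary.mult[OF elementary.const ex])
  have e2: "(\<lambda>x. b t * (- 2 * a t * x) * exp (- (a t * x\<^sup>2))) \<in> elementary" for t
    by (rule elementary.mult[OF elementary.mult[OF elementary.const elementary.mult[OF elementary.const elementary.ident]] ex])
  have e3: "(\<lambda>x. b t * (4 * (a t)\<^sup>2 * x\<^sup>2 - 2 * a t) * exp (- (a t * x\<^sup>2))) \<in> elementary" for t
  proof -
    have "(\<lambda>x. b t * (4 * (a t)\<^sup>2 * x\<^sup>2 + (- 2 * a t)) * exp (- (a t * x\<^sup>2))) \<in> elementary"
      by (rule elementary.mult[OF elementary.mult[OF elementary.const elementary.add[OF elementary.mult[OF elementary.const elementary_power[OF elementary.ident]] elementary.const]] ex])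
    then show ?thesis by simp
  qed
  have xd: "((\<lambda>x. exp (- (a t * x\<^sup>2))) has_real_derivative exp (- (a t * x\<^sup>2)) * (- 2 * a t * x)) (at x)" for t x
    by (auto intro!: derivative_eq_intros)
  have td: "((\<lambda>t. exp (- (a t * x\<^sup>2))) has_real_derivative exp (- (a t * x\<^sup>2)) * (4 * (a t)\<^sup>2 * x\<^sup>2)) (at t)"
    if "t \<ge> 0" for t x
    by (rule derivative_eq_intros ad[OF that] refl)+ simp
  have D1: "(gauss s t has_real_derivative b t * (- 2 * a t * x) * exp (- (a t * x\<^sup>2))) (at x)" for t x
    unfolding gauss_def[abs_def] a_def[symmetric] b_def[symmetric]
    by (rule derivative_eq_intros xd refl)+ simp
  have D2: "((\<lambda>x. b t * (- 2 * a t * x) * exp (- (a t * x\<^sup>2))) has_real_derivative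
      b t * (4 * (a t)\<^sup>2 * x\<^sup>2 - 2 * a t) * exp (- (a t * x\<^sup>2))) (at x)" for t x
    by (rule derivative_eq_intros xd refl)+ (simp add: algebra_simps power2_eq_square)
  have D3: "((\<lambda>t. gauss s t x) has_real_derivative b t * (4 * (a t)\<^sup>2 * x\<^sup>2 - 2 * a t) * exp (- (a t * x\<^sup>2))) (at t)"
    if "t \<ge> 0" for t x
    unfolding gauss_def a_def[symmetric] b_def[symmetric]
    by (rule derivative_eq_intros td[OF that] bd[OF that] refl)+ (simp add: algebra_simps)
  have D4: "((\<lambda>t. b t * (4 * (a t)\<^sup>2 * x\<^sup>2 - 2 * a t) * exp (- (a t * x\<^sup>2))) has_real_derivative
      b t * (16 * (a t)^4 * x^4 - 48 * (a t)^3 * x\<^sup>2 + 12 * (a t)\<^sup>2) * exp (- (a t * x\<^sup>2))) (at t)"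
    if "t \<ge> 0" for t x
    by (rule derivative_eq_intros td[OF that] bd[OF that] ad[OF that] refl)+ (simp add: algebra_simps eval_nat_numeral)
  \<comment> \<open>With y = a x^2 the last two expressions are polynomials in y times exp (- y),
    with coefficients bounded through a \<le> s. Since y^j exp (- y) is at most 1, 1, 2 for j = 0,
    1, 2, they are bounded by 4 + 2 = 6 times s and by 32 + 48 + 12 = 92 times s^2. For the first, 2
    |x| \<le> 1 + x^2 gives s + 1.\<close>
  define K where "K = 1 + s + 6 * s + 92 * s\<^sup>2"
  have B: "\<bar>b t * (- 2 * a t * x) * exp (- (a t * x\<^sup>2))\<bar> \<le> K \<and>
      \<bar>b t * (4 * (a t)\<^sup>2 * x\<^sup>2 - 2 * a t) * exp (- (a t * x\<^sup>2))\<bar> \<le> K \<and>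
      \<bar>b t * (16 * (a t)^4 * x^4 - 48 * (a t)^3 * x\<^sup>2 + 12 * (a t)\<^sup>2) * exp (- (a t * x\<^sup>2))\<bar> \<le> K" if t: "t \<ge> 0" for t x
  proof -
    define y where "y = a t * x\<^sup>2"
    define E where "E = exp (- y)"
    note ab = ab[OF t]
    have y: "y \<ge> 0" using ab by (simp add: y_def)
    have E: "E \<le> 1" "y * E \<le> 1" "y\<^sup>2 * E \<le> 2" "E > 0" using exp_poly_bounds[OF y] by (auto simp: E_def)
    have bb: "\<bar>b t * z * E\<bar> \<le> \<bar>z\<bar> * E" for z
    proof -
      have "\<bar>b t * z * E\<bar> = b t * (\<bar>z\<bar> * E)" using ab E by (simp add: abs_mult)
      also have "\<dots> \<le> 1 * (\<bar>z\<bar> * E)" by (rule mult_right_mono) (use ab E in auto)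
      finally show ?thesis by simp
    qed
    have s2: "0 \<le> s\<^sup>2" by simp
    have "\<bar>- 2 * a t * x\<bar> * E \<le> (s + y) * E"
    proof (rule mult_right_mono)
      have "2 * \<bar>x\<bar> \<le> 1 + x\<^sup>2" using sum_squares_bound[of 1 "\<bar>x\<bar>"] by simp
      then have "a t * (2 * \<bar>x\<bar>) \<le> a t * (1 + x\<^sup>2)" using ab by (intro mult_left_mono)
      then show "\<bar>- 2 * a t * x\<bar> \<le> s + y" using ab by (simp add: y_def abs_mult algebra_simps)
    qed (use E in simp)
    also have "\<dots> \<le> s * 1 + 1" using E s by (simp add: distrib_right add_mono mult_left_mono)
    also have "\<dots> \<le> K" using s s2 by (simp add: K_def)
    finally have 1: "\<bar>- 2 * a t * x\<bar> * E \<le> K" .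
    have "\<bar>4 * (a t)\<^sup>2 * x\<^sup>2 - 2 * a t\<bar> = a t * \<bar>4 * y - 2\<bar>"
    proof -
      have "4 * (a t)\<^sup>2 * x\<^sup>2 - 2 * a t = a t * (4 * y - 2)" by (simp add: y_def algebra_simps power2_eq_square)
      then show ?thesis using ab by (simp add: abs_mult)
    qed
    also have "\<dots> \<le> s * (4 * y + 2)" by (rule mult_mono) (use ab y in auto)
    finally have "\<bar>4 * (a t)\<^sup>2 * x\<^sup>2 - 2 * a t\<bar> * E \<le> s * (4 * y + 2) * E" using E by (intro mult_right_mono) auto
    also have "\<dots> = s * (4 * (y * E) + 2 * E)" by (simp add: algebra_simps)
    also have "\<dots> \<le> s * (4 * 1 + 2 * 1)" using E s by (intro mult_left_mono add_mono) auto
    also have "\<dots> \<le> K" using s s2 by (simp add: K_def)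
    finally have 2: "\<bar>4 * (a t)\<^sup>2 * x\<^sup>2 - 2 * a t\<bar> * E \<le> K" .
    have "\<bar>16 * (a t)^4 * x^4 - 48 * (a t)^3 * x\<^sup>2 + 12 * (a t)\<^sup>2\<bar> = (a t)\<^sup>2 * \<bar>16 * y\<^sup>2 - 48 * y + 12\<bar>"
    proof -
      have "16 * (a t)^4 * x^4 - 48 * (a t)^3 * x\<^sup>2 + 12 * (a t)\<^sup>2 = (a t)\<^sup>2 * (16 * y\<^sup>2 - 48 * y + 12)"
        by (simp add: y_def algebra_simps eval_nat_numeral)
      then show ?thesis by (simp add: abs_mult)
    qed
    also have "\<dots> \<le> s\<^sup>2 * (16 * y\<^sup>2 + 48 * y + 12)"
      by (rule mult_mono) (use ab y zero_le_power2[of y] in \<open>auto intro!: power_mono simp: abs_le_iff\<close>)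
    finally have "\<bar>16 * (a t)^4 * x^4 - 48 * (a t)^3 * x\<^sup>2 + 12 * (a t)\<^sup>2\<bar> * E \<le> s\<^sup>2 * (16 * y\<^sup>2 + 48 * y + 12) * E"
      using E by (intro mult_right_mono) auto
    also have "\<dots> = s\<^sup>2 * (16 * (y\<^sup>2 * E) + 48 * (y * E) + 12 * E)" by (simp add: algebra_simps)
    also have "\<dots> \<le> s\<^sup>2 * (16 * 2 + 48 * 1 + 12 * 1)" using E by (intro mult_left_mono add_mono) auto
    also have "\<dots> \<le> K" using s s2 by (simp add: K_def)
    finally have 3: "\<bar>16 * (a t)^4 * x^4 - 48 * (a t)^3 * x\<^sup>2 + 12 * (a t)\<^sup>2\<bar> * E \<le> K" .
    show ?thesis
      unfolding y_def[symmetric] E_def[symmetric]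
      using order.trans[OF bb 1] order.trans[OF bb 2] order.trans[OF bb 3] by blast
  qed
  show ?thesis
    unfolding heat_profile_def using e1 e2 e3 D1 D2 D3 D4 B by blast
qed

lemma gauss_nonneg: "s > 0 \<Longrightarrow> t \<ge> 0 \<Longrightarrow> gauss s t x \<ge> 0"
  by (simp add: gauss_def gB_def)

lemma gauss_0: "gauss s 0 x = exp (- (s * x\<^sup>2))"
  by (simp add: gauss_def gA_def gB_def)

lemma gauss_measurable [measurable]: "gauss s t \<in> borel_measurable borel"
  unfolding gauss_def by measurable

text \<open>The dilation by sqrt (1 + 4 s t) carries the Gaussian at time t to the initial one, and
  its Jacobian cancels the prefactor.\<close>

lemma gauss_mass:
  assumes "s > 0" "t \<ge> 0"
  shows "(\<integral>\<^sup>+x. ennreal (gauss s t x) \<partial>lborel) = (\<integral>\<^sup>+x. ennreal (gauss s 0 x) \<partial>lborel)"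
proof -
  define c where "c = sqrt (1 + 4 * s * t)"
  have "1 + 4 * s * t > 0" using assms by (simp add: add_pos_nonneg)
  then have c: "c > 0" "c * c = 1 + 4 * s * t" by (auto simp: c_def)
  have "(\<integral>\<^sup>+x. ennreal (gauss s t x) \<partial>lborel) = ennreal \<bar>c\<bar> * (\<integral>\<^sup>+x. ennreal (gauss s t (0 + c * x)) \<partial>lborel)"
    by (rule nn_integral_real_affine) (use c in auto)
  also have "\<dots> = (\<integral>\<^sup>+x. ennreal \<bar>c\<bar> * ennreal (gauss s t (0 + c * x)) \<partial>lborel)"
    by (rule nn_integral_cmult[symmetric]) measurable
  also have "\<dots> = (\<integral>\<^sup>+x. ennreal (gauss s 0 x) \<partial>lborel)"
  proof (rule nn_integral_cong)
    fix x :: real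
    have e: "s * (c * x)\<^sup>2 / (c * c) = s * x\<^sup>2" using c(1) by (simp add: power_mult_distrib power2_eq_square divide_simps)
    have "\<bar>c\<bar> * gauss s t (0 + c * x) = gauss s 0 x"
      using c(1) unfolding gauss_0 gauss_def gA_def gB_def c(2)[symmetric] c_def[symmetric]
      by (simp add: e)
    then show "ennreal \<bar>c\<bar> * ennreal (gauss s t (0 + c * x)) = ennreal (gauss s 0 x)"
      using gauss_nonneg[OF assms] by (simp add: ennreal_mult[symmetric])
  qed
  finally show ?thesis .
qed

section \<open>Mixtures of Gaussians below the Cauchy density\<close>

lemma cauchy_mass: "(\<integral>\<^sup>+x. ennreal (1 / (pi * (1 + x\<^sup>2))) \<partial>lborel) \<le> 1"
proof -
  define f where "f x = 1 / (pi * (1 + x\<^sup>2))" for x :: real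
  have pos: "1 + x\<^sup>2 > 0" for x :: real by (rule add_pos_nonneg) auto
  have [measurable]: "f \<in> borel_measurable borel" unfolding f_def[abs_def] by measurable
  have f0: "f x \<ge> 0" for x using pos[of x] by (simp add: f_def)
  have half: "(\<integral>\<^sup>+x. ennreal (f x) * indicator {0..} x \<partial>lborel) = ennreal (pi / 2 / pi - arctan 0 / pi)"
  proof (rule nn_integral_FTC_atLeast)
    show "DERIV (\<lambda>x. arctan x / pi) x :> f x" for x
      using DERIV_cdivide[OF DERIV_arctan, of pi x] by (simp add: f_def divide_inverse mult_ac)
    show "((\<lambda>x. arctan x / pi) \<longlongrightarrow> pi / 2 / pi) at_top"
      by (rule tendsto_divide[OF tendsto_arctan_at_top tendsto_const]) simp
  qed (auto simp: f0)
  have "(\<integral>\<^sup>+x. ennreal (f x) \<partial>lborel) \<le> (\<integral>\<^sup>+x. ennreal (f x) * indicator {0..} x + ennreal (f x) * indicator {0..} (- x) \<partial>lborel)"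
    by (rule nn_integral_mono) (auto simp: indicator_def)
  also have "\<dots> = (\<integral>\<^sup>+x. ennreal (f x) * indicator {0..} x \<partial>lborel) + (\<integral>\<^sup>+x. ennreal (f x) * indicator {0..} (- x) \<partial>lborel)"
    by (rule nn_integral_add) measurable
  also have "(\<integral>\<^sup>+x. ennreal (f x) * indicator {0..} (- x) \<partial>lborel) = (\<integral>\<^sup>+x. ennreal (f x) * indicator {0..} x \<partial>lborel)"
  proof (subst nn_integral_real_affine[where c="-1" and t=0])
    have "f (- x) = f x" for x by (simp add: f_def)
    then show "ennreal \<bar>-1\<bar> * (\<integral>\<^sup>+x. ennreal (f (0 + - 1 * x)) * indicator {0..} (- (0 + - 1 * x)) \<partial>lborel) = (\<integral>\<^sup>+x. ennreal (f x) * indicator {0..} x \<partial>lborel)"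
      by simp
  qed auto
  also have "(\<integral>\<^sup>+x. ennreal (f x) * indicator {0..} x \<partial>lborel) + (\<integral>\<^sup>+x. ennreal (f x) * indicator {0..} x \<partial>lborel) = 1"
  proof -
    have "ennreal (1 / 2) + ennreal (1 / 2) = ennreal (1 / 2 + 1 / 2)" by (rule ennreal_plus[symmetric]) auto
    also have "\<dots> = 1" by simp
    finally show ?thesis unfolding half by simp
  qed
  finally show ?thesis by (simp add: f_def)
qed

text \<open>A lower Riemann sum, in the variable \<open>exp (- s)\<close>, of \<open>1 / (1 + x\<^sup>2) = \<integral> exp (- s) exp (- s x\<^sup>2) ds\<close> over \<open>s > 0\<close>.\<close>

lemma exp_mixture_bounds:
  fixes a x :: real and m :: nat
  assumes a: "a > 0"
  defines "r \<equiv> exp (- a)"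
  defines "S \<equiv> \<Sum>k<m. (r ^ k - r ^ Suc k) * exp (- (real (Suc k) * a * x\<^sup>2))"
  shows "S \<le> 1 / (1 + x\<^sup>2)" "1 / (1 + x\<^sup>2) \<le> S + a + r ^ m"
proof -
  have pos: "1 + x\<^sup>2 > 0" by (rule add_pos_nonneg) auto
  define Y where "Y = exp (- (a * x\<^sup>2))"
  have Y: "0 < Y" "Y \<le> 1" using a by (auto simp: Y_def)
  have r: "0 < r" "r < 1" using a by (auto simp: r_def)
  have rY: "0 \<le> r * Y" "r * Y < 1" using Y r by (auto simp: mult_le_one intro: le_less_trans[OF mult_left_le[of Y r]])
  \<comment> \<open>\<open>R\<close> is the full geometric series. It lies between 1/(1 + x^2) - a
    and 1/(1 + x^2), and stopping after m terms loses at most r^m.\<close>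
  define R where "R = (1 - r) * Y / (1 - r * Y)"
  have S: "S = R * (1 - (r * Y) ^ m)"
  proof -
    have "(r ^ k - r ^ Suc k) * exp (- (real (Suc k) * a * x\<^sup>2)) = (1 - r) * Y * (r * Y) ^ k" for k
    proof -
      have "exp (- (real (Suc k) * a * x\<^sup>2)) = exp (real (Suc k) * (- (a * x\<^sup>2)))" by (simp add: algebra_simps)
      also have "\<dots> = Y ^ Suc k" by (simp only: exp_of_nat_mult Y_def)
      finally show ?thesis by (simp add: power_mult_distrib algebra_simps)
    qed
    then have "S = (1 - r) * Y * (\<Sum>k<m. (r * Y) ^ k)" by (simp add: S_def sum_distrib_left)
    also have "(\<Sum>k<m. (r * Y) ^ k) = (1 - (r * Y) ^ m) / (1 - r * Y)"
      using rY by (subst sum_gp_strict) auto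
    finally show ?thesis by (simp add: R_def)
  qed
  have R0: "R \<ge> 0" using Y r rY by (simp add: R_def)
  have R1: "R \<le> 1 / (1 + x\<^sup>2)"
  proof -
    have e1: "1 - r \<le> a" using exp_ge_add_one_self[of "- a"] by (simp add: r_def)
    have e2: "1 + a * x\<^sup>2 \<le> exp (a * x\<^sup>2)" by (rule exp_ge_add_one_self)
    have "(1 - r) * x\<^sup>2 \<le> a * x\<^sup>2" by (rule mult_right_mono[OF e1]) simp
    then have "(1 - r) * (1 + x\<^sup>2) \<le> a * x\<^sup>2 + (1 - r)" by (simp add: distrib_left)
    then have "(1 - r) * (1 + x\<^sup>2) \<le> exp (a * x\<^sup>2) - r" using e2 by linarith
    then have "(1 - r) * (1 + x\<^sup>2) * Y \<le> (exp (a * x\<^sup>2) - r) * Y" using Y by (intro mult_right_mono) auto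
    also have "\<dots> = 1 - r * Y" by (simp add: Y_def left_diff_distrib exp_minus)
    finally show ?thesis using rY pos by (simp add: R_def pos_divide_le_eq pos_le_divide_eq mult_ac)
  qed
  \<comment> \<open>The numerator is enlarged through a r \<le> 1 - r, and the denominator is
    reduced through 1 - r Y \<le> a (1 + x^2).\<close>
  have R2: "1 / (1 + x\<^sup>2) - a \<le> R"
  proof -
    have rYe: "r * Y = exp (- (a * (1 + x\<^sup>2)))" by (simp add: r_def Y_def exp_add[symmetric] algebra_simps)
    have l: "1 - a * (1 + x\<^sup>2) \<le> r * Y" unfolding rYe using exp_ge_add_one_self[of "- (a * (1 + x\<^sup>2))"] by simp
    have ar: "a * r \<le> 1 - r"
    proof -
      have "(1 + a) * r \<le> exp a * r" using exp_ge_add_one_self[of a] r by (intro mult_right_mono) auto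
      also have "exp a * r = 1" by (simp add: r_def exp_minus)
      finally show ?thesis by (simp add: algebra_simps)
    qed
    have "1 / (1 + x\<^sup>2) - a = (1 - a * (1 + x\<^sup>2)) / (1 + x\<^sup>2)" using pos by (simp add: diff_divide_distrib)
    also have "\<dots> \<le> r * Y / (1 + x\<^sup>2)" using l pos by (intro divide_right_mono) auto
    also have "\<dots> = (a * r) * Y / (a * (1 + x\<^sup>2))" using a by simp
    also have "\<dots> \<le> (1 - r) * Y / (a * (1 + x\<^sup>2))"
      using ar Y a pos by (intro divide_right_mono mult_right_mono) auto
    also have "\<dots> \<le> (1 - r) * Y / (1 - r * Y)"
      using l rY r Y by (intro divide_left_mono) (auto intro!: mult_nonneg_nonneg mult_pos_pos simp: a pos)
    finally show ?thesis by (simp add: R_def)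
  qed
  have pm: "(r * Y) ^ m \<le> r ^ m" using r Y by (intro power_mono) (auto intro: mult_left_le)
  have pm0: "0 \<le> (r * Y) ^ m" using rY by simp
  show "S \<le> 1 / (1 + x\<^sup>2)"
  proof -
    have "S \<le> R * 1" unfolding S by (rule mult_left_mono) (use pm0 R0 in auto)
    with R1 show ?thesis by simp
  qed
  have "1 / (1 + x\<^sup>2) \<le> 1" using pos by (simp add: pos_divide_le_eq)
  then have "R * (r * Y) ^ m \<le> 1 * r ^ m" using R1 R0 pm pm0 by (intro mult_mono) auto
  then show "1 / (1 + x\<^sup>2) \<le> S + a + r ^ m" using R2 unfolding S by (simp add: algebra_simps)
qed

text \<open>The added constant \<epsilon> does two jobs: it keeps p away from 0 at all times, and it
  covers the errors of the mixture, (\<epsilon> + r^m) / \<pi> \<le> 2 \<epsilon> / \<pi> \<le>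
  \<epsilon>, so that p lies above the Cauchy density at time 0. Without the constant p lies below
  that density at time 0, so the mass is at most 1, and the mass of Gaussians is conserved.\<close>

lemma cauchy_heat_profile:
  assumes e: "\<epsilon> > 0"
  obtains p p1 p2 p3 where "heat_profile p p1 p2 p3" "\<And>t x. t \<ge> 0 \<Longrightarrow> p t x \<ge> \<epsilon>"
    "\<And>x. 1 / (pi * (1 + x\<^sup>2)) \<le> p 0 x"
    "\<And>t. t \<ge> 0 \<Longrightarrow> (\<integral>\<^sup>+x. ennreal (p t x - \<epsilon>) \<partial>lborel) \<le> 1"
proof -
  define r where "r = exp (- \<epsilon>)"
  have r: "0 < r" "r < 1" using e by (auto simp: r_def)
  obtain m where m: "r ^ m < \<epsilon>" using real_arch_pow_inv[OF e r(2)] by blast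
  define c where "c k = (1 / pi) * (r ^ k - r ^ Suc k)" for k
  define s where "s k = real (Suc k) * \<epsilon>" for k
  have s: "s k > 0" for k using e by (simp add: s_def)
  have c0: "c k \<ge> 0" for k
    unfolding c_def using r by (intro mult_nonneg_nonneg) (auto intro: power_decreasing)
  define p where "p t x = \<epsilon> + (\<Sum>k<m. c k * gauss (s k) t x)" for t x
  have hk: "\<exists>p1 p2 p3. heat_profile (\<lambda>t x. c k * gauss (s k) t x) p1 p2 p3" for k
    using heat_profile_cmult[OF gauss_profile[OF s[of k]]] by blast
  then obtain q1 q2 q3 where q: "\<And>k. heat_profile (\<lambda>t x. c k * gauss (s k) t x) (q1 k) (q2 k) (q3 k)" by metis
  have hp: "heat_profile p (\<lambda>t x. 0 + (\<Sum>k<m. q1 k t x)) (\<lambda>t x. 0 + (\<Sum>k<m. q2 k t x)) (\<lambda>t x. 0 + (\<Sum>k<m. q3 k t x))"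
    unfolding p_def[abs_def] by (rule heat_profile_add[OF heat_profile_const heat_profile_sum[OF finite_lessThan q]])
  have sn: "(\<Sum>k<m. c k * gauss (s k) t x) \<ge> 0" if "t \<ge> 0" for t x
    by (intro sum_nonneg mult_nonneg_nonneg c0 gauss_nonneg s that)
  have p0: "(\<Sum>k<m. c k * gauss (s k) 0 x) = (1 / pi) * (\<Sum>k<m. (r ^ k - r ^ Suc k) * exp (- (real (Suc k) * \<epsilon> * x\<^sup>2)))" for x
    unfolding sum_distrib_left c_def s_def gauss_0 by (simp only: mult.assoc)
  note mix = exp_mixture_bounds[OF e, where m=m, folded r_def]
  show thesis
  proof (rule that[OF hp])
    show "p t x \<ge> \<epsilon>" if "t \<ge> 0" for t x using sn[OF that] by (simp add: p_def)
    show "1 / (pi * (1 + x\<^sup>2)) \<le> p 0 x" for x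
    proof -
      have "1 / (pi * (1 + x\<^sup>2)) = (1 / pi) * (1 / (1 + x\<^sup>2))" by simp
      also have "\<dots> \<le> (1 / pi) * ((\<Sum>k<m. (r ^ k - r ^ Suc k) * exp (- (real (Suc k) * \<epsilon> * x\<^sup>2))) + \<epsilon> + r ^ m)"
        by (rule mult_left_mono[OF mix(2)]) simp
      also have "\<dots> = (\<Sum>k<m. c k * gauss (s k) 0 x) + (\<epsilon> + r ^ m) / pi" unfolding p0 by (simp add: algebra_simps add_divide_distrib)
      also have "(\<epsilon> + r ^ m) / pi \<le> \<epsilon>"
      proof -
        have "\<epsilon> + r ^ m \<le> \<epsilon> * 2" using m by simp
        also have "\<dots> \<le> \<epsilon> * pi" using e pi_ge_two by (intro mult_left_mono) auto
        finally show ?thesis by (simp add: pos_divide_le_eq)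
      qed
      finally show ?thesis by (simp add: p_def)
    qed
    show "(\<integral>\<^sup>+x. ennreal (p t x - \<epsilon>) \<partial>lborel) \<le> 1" if t: "t \<ge> 0" for t
    proof -
      have mass: "(\<integral>\<^sup>+x. ennreal (p t x - \<epsilon>) \<partial>lborel) = (\<Sum>k<m. ennreal (c k) * (\<integral>\<^sup>+x. ennreal (gauss (s k) 0 x) \<partial>lborel))"
        if t: "t \<ge> 0" for t
      proof -
        have "(\<integral>\<^sup>+x. ennreal (p t x - \<epsilon>) \<partial>lborel) = (\<integral>\<^sup>+x. (\<Sum>k<m. ennreal (c k) * ennreal (gauss (s k) t x)) \<partial>lborel)"
          by (rule nn_integral_cong)
            (simp add: p_def ennreal_mult[symmetric] c0 gauss_nonneg[OF s t] sum_ennreal mult_nonneg_nonneg)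
        also have "\<dots> = (\<Sum>k<m. \<integral>\<^sup>+x. ennreal (c k) * ennreal (gauss (s k) t x) \<partial>lborel)"
          by (rule nn_integral_sum) measurable
        also have "\<dots> = (\<Sum>k<m. ennreal (c k) * (\<integral>\<^sup>+x. ennreal (gauss (s k) t x) \<partial>lborel))"
          by (rule sum.cong[OF refl], rule nn_integral_cmult) measurable
        finally show ?thesis by (simp add: gauss_mass[OF s t])
      qed
      have "(\<integral>\<^sup>+x. ennreal (p t x - \<epsilon>) \<partial>lborel) = (\<integral>\<^sup>+x. ennreal (p 0 x - \<epsilon>) \<partial>lborel)"
        unfolding mass[OF t] mass[OF order_refl] by (rule refl)
      also have "\<dots> \<le> (\<integral>\<^sup>+x. ennreal (1 / (pi * (1 + x\<^sup>2))) \<partial>lborel)"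
      proof (rule nn_integral_mono, rule ennreal_leI)
        fix x :: real
        have "p 0 x - \<epsilon> \<le> (1 / pi) * (1 / (1 + x\<^sup>2))"
        proof -
          have "p 0 x - \<epsilon> = (1 / pi) * (\<Sum>k<m. (r ^ k - r ^ Suc k) * exp (- (real (Suc k) * \<epsilon> * x\<^sup>2)))"
            unfolding p_def p0 by simp
          also have "\<dots> \<le> (1 / pi) * (1 / (1 + x\<^sup>2))" by (rule mult_left_mono[OF mix(1)]) simp
          finally show ?thesis .
        qed
        then show "p 0 x - \<epsilon> \<le> 1 / (pi * (1 + x\<^sup>2))" by simp
      qed
      also have "\<dots> \<le> 1" by (rule cauchy_mass)
      finally show ?thesis .
    qed
  qed
qed


section \<open>Rotations and twisted tubes\<close>

definition rot :: "real \<Rightarrow> real \<times> real \<Rightarrow> real \<times> real" where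
  "rot a x = (fst x * cos a + snd x * sin a, - fst x * sin a + snd x * cos a)"

lemma rot_rot: "rot a (rot b x) = rot (a + b) x"
  by (simp add: rot_def cos_add sin_add algebra_simps)

lemma rot_0: "rot 0 x = x"
  by (simp add: rot_def)

lemma twist_eq: "twist \<theta> x = (fst x, rot (\<theta> (fst x)) (snd x))"
  by (simp add: twist_def rot_def split: prod.splits)

lemma tube_iff: "x \<in> tube \<omega> \<theta> \<longleftrightarrow> rot (- \<theta> (fst x)) (snd x) \<in> \<omega>"
proof
  assume "x \<in> tube \<omega> \<theta>"
  then obtain y z where z: "z \<in> \<omega>" "x = twist \<theta> (y, z)" unfolding tube_def by force
  then show "rot (- \<theta> (fst x)) (snd x) \<in> \<omega>" by (simp add: twist_eq rot_rot rot_0)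
next
  assume "rot (- \<theta> (fst x)) (snd x) \<in> \<omega>"
  moreover have "x = twist \<theta> (fst x, rot (- \<theta> (fst x)) (snd x))"
    by (simp add: twist_eq rot_rot rot_0)
  ultimately show "x \<in> tube \<omega> \<theta>" unfolding tube_def by blast
qed

lemma continuous_on_rot:
  fixes a :: "'a::t2_space \<Rightarrow> real"
  shows "continuous_on S a \<Longrightarrow> continuous_on S f \<Longrightarrow> continuous_on S (\<lambda>x. rot (a x) (f x))"
  unfolding rot_def by (intro continuous_intros)

lemma open_tube:
  assumes "open \<omega>" "continuous_on UNIV \<theta>" shows "open (tube \<omega> \<theta>)"
proof -
  have "continuous_on UNIV (\<lambda>x::real \<times> real \<times> real. rot (- \<theta> (fst x)) (snd x))"
    by (intro continuous_on_rot continuous_intros continuous_on_compose2[OF assms(2)]) auto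
  then have "open ((\<lambda>x::real \<times> real \<times> real. rot (- \<theta> (fst x)) (snd x)) -` \<omega>)"
    by (rule open_vimage[OF assms(1)])
  moreover have "(\<lambda>x::real \<times> real \<times> real. rot (- \<theta> (fst x)) (snd x)) -` \<omega> = tube \<omega> \<theta>"
    by (auto simp: tube_iff)
  ultimately show ?thesis by simp
qed

lemma linear_rot: "linear (rot a)"
  by (rule linearI) (auto simp: rot_def algebra_simps)

lemma rot_measurable [measurable]: "rot a \<in> borel_measurable borel"
  by (rule borel_measurable_continuous_onI[OF linear_continuous_on[OF linear_conv_bounded_linear[THEN iffD1, OF linear_rot]]])

section \<open>Invariance of Lebesgue measure under rotations and under twisting\<close>

lemma nn_integral_fst_lborel:
  fixes f :: "'a::euclidean_space \<times> 'b::euclidean_space \<Rightarrow> ennreal"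
  assumes "f \<in> borel_measurable borel"
  shows "(\<integral>\<^sup>+x. \<integral>\<^sup>+y. f (x, y) \<partial>lborel \<partial>lborel) = (\<integral>\<^sup>+z. f z \<partial>lborel)"
    "(\<integral>\<^sup>+y. \<integral>\<^sup>+x. f (x, y) \<partial>lborel \<partial>lborel) = (\<integral>\<^sup>+z. f z \<partial>lborel)"
proof -
  have m: "f \<in> borel_measurable (lborel \<Otimes>\<^sub>M lborel)" using assms by (simp add: lborel_prod)
  show "(\<integral>\<^sup>+x. \<integral>\<^sup>+y. f (x, y) \<partial>lborel \<partial>lborel) = (\<integral>\<^sup>+z. f z \<partial>lborel)"
    using lborel.nn_integral_fst[OF m] by (simp add: lborel_prod)
  show "(\<integral>\<^sup>+y. \<integral>\<^sup>+x. f (x, y) \<partial>lborel \<partial>lborel) = (\<integral>\<^sup>+z. f z \<partial>lborel)"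
    using lborel_pair.nn_integral_snd[of f] m by (simp add: lborel_prod)
qed

text \<open>If cos a \<noteq> 0, two one-dimensional affine substitutions do it, first in x at fixed
  y and then in y at fixed x; their factors 1 / |cos a| and |cos a| cancel. If cos a = 0 the
  rotation swaps the coordinates up to signs.\<close>

lemma nn_integral_rot:
  fixes f :: "real \<times> real \<Rightarrow> ennreal"
  assumes f[measurable]: "f \<in> borel_measurable borel"
  shows "(\<integral>\<^sup>+x. f (rot a x) \<partial>lborel) = (\<integral>\<^sup>+x. f x \<partial>lborel)"
proof -
  define c where "c = cos a"
  define s where "s = sin a"
  have cs: "c * c + s * s = 1" using sin_cos_squared_add[of a] by (simp add: c_def s_def power2_eq_square)
  have f2[measurable]: "(\<lambda>(x, y). f (x, y)) \<in> borel_measurable borel" by simp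
  have mp: "(\<lambda>y. f (u y, w y)) \<in> borel_measurable borel"
    if "u \<in> borel_measurable borel" "w \<in> borel_measurable borel" for u w :: "real \<Rightarrow> real"
  proof -
    have "(\<lambda>y. (u y, w y)) \<in> borel_measurable borel" using that by (rule borel_measurable_Pair)
    then show ?thesis using f by (rule measurable_compose)
  qed
  have mr: "(\<lambda>x. f (rot a x)) \<in> borel_measurable borel" by measurable
  have rotE: "rot a (x, y) = (c * x + s * y, - s * x + c * y)" for x y
    by (simp add: rot_def c_def s_def mult.commute)
  show ?thesis
  proof (cases "c = 0")
    case False
    define k where "k = 1 / c"
    have kk: "ennreal \<bar>k\<bar> = ennreal \<bar>1 / c\<bar>" by (simp add: k_def)
    have k: "k \<noteq> 0" using False by (simp add: k_def)
    have "(\<integral>\<^sup>+x. f (rot a x) \<partial>lborel) = (\<integral>\<^sup>+y. \<integral>\<^sup>+x. f (c * x + s * y, - s * x + c * y) \<partial>lborel \<partial>lborel)"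
      using nn_integral_fst_lborel(2)[OF mr] by (simp add: rotE)
    also have "\<dots> = (\<integral>\<^sup>+y. ennreal \<bar>k\<bar> * (\<integral>\<^sup>+x. f (x, - (k * s * x) + k * y) \<partial>lborel) \<partial>lborel)"
    proof (rule nn_integral_cong)
      fix y :: real
      have "(\<integral>\<^sup>+x. f (c * x + s * y, - s * x + c * y) \<partial>lborel) =
        ennreal \<bar>k\<bar> * (\<integral>\<^sup>+x. f (c * (- (k * s * y) + k * x) + s * y, - s * (- (k * s * y) + k * x) + c * y) \<partial>lborel)"
        by (rule nn_integral_real_affine[OF mp k]) measurable
      also have "(\<lambda>x. f (c * (- (k * s * y) + k * x) + s * y, - s * (- (k * s * y) + k * x) + c * y))
          = (\<lambda>x. f (x, - (k * s * x) + k * y))"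
      proof
        fix x
        have "c * (- (k * s * y) + k * x) + s * y = x" using False by (simp add: k_def field_simps)
        moreover have "- s * (- (k * s * y) + k * x) + c * y = - (k * s * x) + k * y"
        proof -
          \<comment> \<open>Written this way, c y joins the s^2 term so that c^2 + s^2 = 1
            applies.\<close>
          have cy: "c * y = k * y * (c * c)" using False by (simp add: k_def)
          have "- s * (- (k * s * y) + k * x) + c * y = - (k * s * x) + k * y * (s * s) + k * y * (c * c)"
            unfolding cy by (simp add: algebra_simps)
          also have "\<dots> = - (k * s * x) + k * y * (c * c + s * s)"
            by (simp add: algebra_simps)
          also have "\<dots> = - (k * s * x) + k * y" using cs by simp
          finally show ?thesis .
        qed
        ultimately show "f (c * (- (k * s * y) + k * x) + s * y, - s * (- (k * s * y) + k * x) + c * y) = f (x, - (k * s * x) + k * y)"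
          by (simp only:)
      qed
      finally show "(\<integral>\<^sup>+x. f (c * x + s * y, - s * x + c * y) \<partial>lborel) = ennreal \<bar>k\<bar> * (\<integral>\<^sup>+x. f (x, - (k * s * x) + k * y) \<partial>lborel)" .
    qed
    also have "\<dots> = (\<integral>\<^sup>+y. \<integral>\<^sup>+x. ennreal \<bar>k\<bar> * f (x, - (k * s * x) + k * y) \<partial>lborel \<partial>lborel)"
      by (rule nn_integral_cong, rule nn_integral_cmult[symmetric]) (simp add: mp)
    also have "\<dots> = (\<integral>\<^sup>+x. \<integral>\<^sup>+y. ennreal \<bar>k\<bar> * f (x, - (k * s * x) + k * y) \<partial>lborel \<partial>lborel)"
    proof -
      define g where "g z = ennreal \<bar>k\<bar> * f (fst z, - (k * s * fst z) + k * snd z)" for z :: "real \<times> real"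
      have "(\<lambda>z::real \<times> real. (fst z, - (k * s * fst z) + k * snd z)) \<in> borel_measurable borel"
        by (rule borel_measurable_Pair) (auto intro!: borel_measurable_continuous_onI continuous_intros)
      then have "g \<in> borel_measurable borel" unfolding g_def[abs_def]
        using measurable_compose[OF _ f] by (intro borel_measurable_times_ennreal) auto
      from nn_integral_fst_lborel[OF this] show ?thesis by (simp add: g_def)
    qed
    also have "\<dots> = (\<integral>\<^sup>+x. \<integral>\<^sup>+y. f (x, y) \<partial>lborel \<partial>lborel)"
    proof (rule nn_integral_cong)
      fix x :: real
      have "(\<integral>\<^sup>+y. f (x, y) \<partial>lborel) = ennreal \<bar>k\<bar> * (\<integral>\<^sup>+y. f (x, - (k * s * x) + k * y) \<partial>lborel)"
        by (rule nn_integral_real_affine[OF mp k]) measurable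
      also have "\<dots> = (\<integral>\<^sup>+y. ennreal \<bar>k\<bar> * f (x, - (k * s * x) + k * y) \<partial>lborel)"
        by (rule nn_integral_cmult[symmetric]) (simp add: mp)
      finally show "(\<integral>\<^sup>+y. ennreal \<bar>k\<bar> * f (x, - (k * s * x) + k * y) \<partial>lborel) = (\<integral>\<^sup>+y. f (x, y) \<partial>lborel)" by simp
    qed
    also have "\<dots> = (\<integral>\<^sup>+x. f x \<partial>lborel)" by (rule nn_integral_fst_lborel(1)[OF f])
    finally show ?thesis .
  next
    case True
    then have s: "s = 1 \<or> s = -1" using cs by (simp add: square_eq_1_iff)
    then have s1: "\<bar>s\<bar> = 1" "\<bar>- s\<bar> = 1" "s \<noteq> 0" "- s \<noteq> 0" by auto
    have "(\<integral>\<^sup>+x. f (rot a x) \<partial>lborel) = (\<integral>\<^sup>+x. \<integral>\<^sup>+y. f (s * y, - s * x) \<partial>lborel \<partial>lborel)"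
      using nn_integral_fst_lborel(1)[OF mr] by (simp add: rotE True)
    also have "\<dots> = (\<integral>\<^sup>+x. \<integral>\<^sup>+y. f (y, - s * x) \<partial>lborel \<partial>lborel)"
    proof (rule nn_integral_cong)
      fix x :: real
      have "(\<integral>\<^sup>+y. f (y, - s * x) \<partial>lborel) = ennreal \<bar>s\<bar> * (\<integral>\<^sup>+y. f (0 + s * y, - s * x) \<partial>lborel)"
        by (rule nn_integral_real_affine[OF mp s1(3)]) measurable
      then show "(\<integral>\<^sup>+y. f (s * y, - s * x) \<partial>lborel) = (\<integral>\<^sup>+y. f (y, - s * x) \<partial>lborel)" by (simp add: s1)
    qed
    also have "\<dots> = (\<integral>\<^sup>+y. \<integral>\<^sup>+x. f (y, - s * x) \<partial>lborel \<partial>lborel)"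
    proof -
      define g where "g z = f (snd z, - s * fst z)" for z :: "real \<times> real"
      have "(\<lambda>z::real \<times> real. (snd z, - s * fst z)) \<in> borel_measurable borel"
        by (rule borel_measurable_Pair) (auto intro!: borel_measurable_continuous_onI continuous_intros)
      then have "g \<in> borel_measurable borel" unfolding g_def[abs_def] by (rule measurable_compose[OF _ f])
      from nn_integral_fst_lborel[OF this] show ?thesis by (simp add: g_def)
    qed
    also have "\<dots> = (\<integral>\<^sup>+y. \<integral>\<^sup>+x. f (y, x) \<partial>lborel \<partial>lborel)"
    proof (rule nn_integral_cong)
      fix y :: real
      have "(\<integral>\<^sup>+x. f (y, x) \<partial>lborel) = ennreal \<bar>- s\<bar> * (\<integral>\<^sup>+x. f (y, 0 + (- s) * x) \<partial>lborel)"
        by (rule nn_integral_real_affine[OF mp s1(4)]) measurable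
      then show "(\<integral>\<^sup>+x. f (y, - s * x) \<partial>lborel) = (\<integral>\<^sup>+x. f (y, x) \<partial>lborel)" using s1(1) by simp
    qed
    also have "\<dots> = (\<integral>\<^sup>+x. f x \<partial>lborel)" by (rule nn_integral_fst_lborel(1)[OF f])
    finally show ?thesis .
  qed
qed

lemma distr_rot: "distr lborel borel (rot a) = lborel"
proof (rule measure_eqI)
  fix A :: "(real \<times> real) set" assume "A \<in> sets (distr lborel borel (rot a))"
  then have A[measurable]: "A \<in> sets borel" by simp
  have "emeasure (distr lborel borel (rot a)) A = (\<integral>\<^sup>+x. indicator A x \<partial>distr lborel borel (rot a))" by simp
  also have "\<dots> = (\<integral>\<^sup>+x. indicator A (rot a x) \<partial>lborel)" by (rule nn_integral_distr) auto
  also have "\<dots> = (\<integral>\<^sup>+x. indicator A x \<partial>lborel)" by (rule nn_integral_rot) measurable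
  finally show "emeasure (distr lborel borel (rot a)) A = emeasure lborel A" by simp
qed simp

lemma integral_rot:
  fixes f :: "real \<times> real \<Rightarrow> real"
  assumes "f \<in> borel_measurable borel"
  shows "(LINT x|lborel. f (rot a x)) = (LINT x|lborel. f x)"
proof -
  have "(LINT x|lborel. f x) = (LINT x|distr lborel borel (rot a). f x)" by (simp add: distr_rot)
  also have "\<dots> = (LINT x|lborel. f (rot a x))" by (rule integral_distr) (use assms in auto)
  finally show ?thesis by simp
qed

lemma twist_measurable:
  assumes "continuous_on UNIV \<theta>" shows "twist \<theta> \<in> borel_measurable borel"
proof (rule borel_measurable_continuous_onI)
  show "continuous_on UNIV (twist \<theta>)"
    unfolding twist_eq[abs_def]
    by (intro continuous_intros continuous_on_rot continuous_on_compose2[OF assms]) auto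
qed

text \<open>\<open>twist\<close> fixes x1 and rotates each slice, so it preserves measure. By Fubini
  the iterated integral in straight coordinates, the shape of \<open>norm_1\<close>, becomes an
  integral over the tube.\<close>

lemma nn_integral_twist:
  assumes \<theta>: "continuous_on UNIV \<theta>" and \<omega>: "open \<omega>" and F[measurable]: "F \<in> borel_measurable borel"
  shows "(\<integral>\<^sup>+y. indicator \<omega> y * (\<integral>\<^sup>+x. F (twist \<theta> (x, y)) \<partial>lborel) \<partial>lborel)
     = (\<integral>\<^sup>+z. indicator (tube \<omega> \<theta>) z * F z \<partial>lborel)"
proof -
  have tm[measurable]: "twist \<theta> \<in> borel_measurable borel" by (rule twist_measurable[OF \<theta>])
  have [measurable]: "tube \<omega> \<theta> \<in> sets borel" using open_tube[OF \<omega> \<theta>] by simp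
  have [measurable]: "\<omega> \<in> sets borel" using \<omega> by simp
  define G where "G z = indicator (tube \<omega> \<theta>) z * F z" for z
  have Gm: "G \<in> borel_measurable borel" unfolding G_def[abs_def] by measurable
  have GT: "(\<lambda>z. G (twist \<theta> z)) \<in> borel_measurable borel" by (rule measurable_compose[OF tm Gm])
  have slice: "(\<lambda>y. H (x, y)) \<in> borel_measurable borel" if "H \<in> borel_measurable borel" for H :: "real \<times> real \<times> real \<Rightarrow> ennreal" and x
    by (rule measurable_compose[OF _ that]) (auto intro!: borel_measurable_continuous_onI continuous_intros)
  have slice2: "(\<lambda>x. H (x, y)) \<in> borel_measurable borel" if "H \<in> borel_measurable borel" for H :: "real \<times> real \<times> real \<Rightarrow> ennreal" and y
    by (rule measurable_compose[OF _ that]) (auto intro!: borel_measurable_continuous_onI continuous_intros)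
  have ind: "indicator \<omega> y = (indicator (tube \<omega> \<theta>) (twist \<theta> (x, y)) :: ennreal)" for x y
    by (simp add: indicator_def tube_iff twist_eq rot_rot rot_0)
  have "(\<integral>\<^sup>+y. indicator \<omega> y * (\<integral>\<^sup>+x. F (twist \<theta> (x, y)) \<partial>lborel) \<partial>lborel)
      = (\<integral>\<^sup>+y. \<integral>\<^sup>+x. G (twist \<theta> (x, y)) \<partial>lborel \<partial>lborel)"
  proof (rule nn_integral_cong)
    fix y
    have "indicator \<omega> y * (\<integral>\<^sup>+x. F (twist \<theta> (x, y)) \<partial>lborel) = (\<integral>\<^sup>+x. indicator \<omega> y * F (twist \<theta> (x, y)) \<partial>lborel)"
      by (rule nn_integral_cmult[symmetric]) (simp add: slice2[OF measurable_compose[OF tm F]])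
    then show "indicator \<omega> y * (\<integral>\<^sup>+x. F (twist \<theta> (x, y)) \<partial>lborel) = (\<integral>\<^sup>+x. G (twist \<theta> (x, y)) \<partial>lborel)"
      unfolding G_def ind[symmetric] .
  qed
  also have "\<dots> = (\<integral>\<^sup>+x. \<integral>\<^sup>+y. G (twist \<theta> (x, y)) \<partial>lborel \<partial>lborel)"
    unfolding nn_integral_fst_lborel[OF GT] by (rule refl)
  also have "\<dots> = (\<integral>\<^sup>+x. \<integral>\<^sup>+y. G (x, y) \<partial>lborel \<partial>lborel)"
    by (rule nn_integral_cong, unfold twist_eq fst_conv snd_conv, rule nn_integral_rot, rule slice[OF Gm])
  also have "\<dots> = (\<integral>\<^sup>+z. G z \<partial>lborel)" by (rule nn_integral_fst_lborel(1)[OF Gm])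
  finally show ?thesis by (simp add: G_def)
qed

text \<open>The second part excludes the junk value \<open>x / 0 = 0\<close> in the Sobolev hypothesis; the bound by \<open>I\<close> matters there,
  since an infinite \<open>norm_1\<close> would be \<open>0\<close> as well.\<close>

lemma norm_1_estimates:
  assumes \<theta>: "continuous_on UNIV \<theta>" and \<omega>: "open \<omega>" and v: "sq_int v"
    and K: "K \<in> borel_measurable borel" "\<And>x. K x > 0" and k: "(\<integral>\<^sup>+x. ennreal (K x) \<partial>lborel) \<le> ennreal k" "k \<ge> 0"
    and I: "(\<integral>\<^sup>+z. indicator (tube \<omega> \<theta>) z * ennreal ((norm (v z))\<^sup>2 / K (fst z)) \<partial>lborel) \<le> ennreal I" "I \<ge> 0"
  shows "(norm_1 \<omega> \<theta> v)\<^sup>2 \<le> k * I" and "norm_1 \<omega> \<theta> v = 0 \<Longrightarrow> emb (tube \<omega> \<theta>) v = 0"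
proof -
  have op: "open (tube \<omega> \<theta>)" by (rule open_tube[OF \<omega> \<theta>])
  have [measurable]: "v \<in> borel_measurable borel" using v by (simp add: sq_int_def)
  have [measurable]: "K \<in> borel_measurable borel" by (rule K(1))
  have [measurable]: "\<omega> \<in> sets borel" using \<omega> by simp
  have tm[measurable]: "twist \<theta> \<in> borel_measurable borel" by (rule twist_measurable[OF \<theta>])
  have slice2: "(\<lambda>x. H (x, y)) \<in> borel_measurable borel" if "H \<in> borel_measurable borel"
    for H :: "real \<times> real \<times> real \<Rightarrow> real" and y
    by (rule measurable_compose[OF _ that]) (auto intro!: borel_measurable_continuous_onI continuous_intros)
  define w where "w z = norm (v (twist \<theta> z))" for z
  have wm[measurable]: "w \<in> borel_measurable borel" unfolding w_def[abs_def] by measurable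
  have wy: "(\<lambda>x. w (x, y)) \<in> borel_measurable borel" for y by (rule slice2[OF wm])
  define h where "h y = (\<integral>\<^sup>+x. ennreal (w (x, y)) \<partial>lborel)" for y
  have hm[measurable]: "h \<in> borel_measurable borel"
  proof -
    have "(\<lambda>(y, x). ennreal (w (x, y))) \<in> borel_measurable (borel \<Otimes>\<^sub>M lborel)"
    proof -
      have "(\<lambda>p::(real \<times> real) \<times> real. ennreal (w (snd p, fst p))) \<in> borel_measurable borel"
        by (rule measurable_compose[OF _ measurable_compose[OF wm measurable_ennreal]])
          (auto intro!: borel_measurable_continuous_onI continuous_intros)
      then show ?thesis by (simp add: borel_prod[symmetric] split_beta')
    qed
    then show ?thesis unfolding h_def[abs_def] using lborel.borel_measurable_nn_integral by blast
  qed
  define J where "J = (\<integral>\<^sup>+y. indicator \<omega> y * (h y)\<^sup>2 \<partial>lborel)"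
  \<comment> \<open>Cauchy-Schwarz along the axis, with w split into sqrt K and w / sqrt K.\<close>
  have CS: "(h y)\<^sup>2 \<le> ennreal k * (\<integral>\<^sup>+x. ennreal ((w (x, y))\<^sup>2 / K x) \<partial>lborel)" for y
  proof -
    have "h y = (\<integral>\<^sup>+x. ennreal (sqrt (K x)) * ennreal (w (x, y) / sqrt (K x)) \<partial>lborel)"
      unfolding h_def
      by (rule nn_integral_cong) (use K(2) in \<open>simp add: ennreal_mult[symmetric] w_def less_imp_le less_imp_neq[symmetric]\<close>)
    then have "(h y)\<^sup>2 \<le> (\<integral>\<^sup>+x. (ennreal (sqrt (K x)))\<^sup>2 \<partial>lborel) * (\<integral>\<^sup>+x. (ennreal (w (x, y) / sqrt (K x)))\<^sup>2 \<partial>lborel)"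
      using Cauchy_Schwarz_nn_integral[of "\<lambda>x. ennreal (sqrt (K x))" lborel "\<lambda>x. ennreal (w (x, y) / sqrt (K x))"] wy by simp
    also have "(\<integral>\<^sup>+x. (ennreal (sqrt (K x)))\<^sup>2 \<partial>lborel) = (\<integral>\<^sup>+x. ennreal (K x) \<partial>lborel)"
      by (rule nn_integral_cong) (use K(2) in \<open>simp add: ennreal_power less_imp_le\<close>)
    also have "(\<integral>\<^sup>+x. (ennreal (w (x, y) / sqrt (K x)))\<^sup>2 \<partial>lborel) = (\<integral>\<^sup>+x. ennreal ((w (x, y))\<^sup>2 / K x) \<partial>lborel)"
      by (rule nn_integral_cong) (use K(2) in \<open>simp add: ennreal_power less_imp_le power_divide w_def\<close>)
    also have "(\<integral>\<^sup>+x. ennreal (K x) \<partial>lborel) * (\<integral>\<^sup>+x. ennreal ((w (x, y))\<^sup>2 / K x) \<partial>lborel)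
        \<le> ennreal k * (\<integral>\<^sup>+x. ennreal ((w (x, y))\<^sup>2 / K x) \<partial>lborel)"
      by (rule mult_right_mono[OF k(1)]) simp
    finally show ?thesis .
  qed
  have Jle: "J \<le> ennreal (k * I)"
  proof -
    define F where "F z = ennreal ((norm (v z))\<^sup>2 / K (fst z))" for z
    have Fm[measurable]: "F \<in> borel_measurable borel"
    proof -
      have [measurable]: "(\<lambda>z::real \<times> real \<times> real. K (fst z)) \<in> borel_measurable borel"
        by (rule measurable_compose[OF _ K(1)]) (auto intro!: borel_measurable_continuous_onI continuous_intros)
      show ?thesis unfolding F_def[abs_def] by measurable
    qed
    have inn: "(\<integral>\<^sup>+x. ennreal ((w (x, y))\<^sup>2 / K x) \<partial>lborel) = (\<integral>\<^sup>+x. F (twist \<theta> (x, y)) \<partial>lborel)" for y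
      by (simp add: F_def w_def twist_eq)
    have im: "(\<lambda>y. indicator \<omega> y * (\<integral>\<^sup>+x. F (twist \<theta> (x, y)) \<partial>lborel)) \<in> borel_measurable borel"
    proof -
      have "(\<lambda>(y, x). F (twist \<theta> (x, y))) \<in> borel_measurable (borel \<Otimes>\<^sub>M lborel)"
      proof -
        have "(\<lambda>p::(real \<times> real) \<times> real. F (twist \<theta> (snd p, fst p))) \<in> borel_measurable borel"
          by (rule measurable_compose[OF _ measurable_compose[OF tm Fm]])
            (auto intro!: borel_measurable_continuous_onI continuous_intros)
        then show ?thesis by (simp add: borel_prod[symmetric] split_beta')
      qed
      then have "(\<lambda>y. \<integral>\<^sup>+x. F (twist \<theta> (x, y)) \<partial>lborel) \<in> borel_measurable borel"
        using lborel.borel_measurable_nn_integral by blast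
      then show ?thesis by measurable
    qed
    have "J \<le> (\<integral>\<^sup>+y. ennreal k * (indicator \<omega> y * (\<integral>\<^sup>+x. F (twist \<theta> (x, y)) \<partial>lborel)) \<partial>lborel)"
      unfolding J_def by (rule nn_integral_mono) (use CS inn in \<open>auto simp: indicator_def\<close>)
    also have "\<dots> = ennreal k * (\<integral>\<^sup>+y. indicator \<omega> y * (\<integral>\<^sup>+x. F (twist \<theta> (x, y)) \<partial>lborel) \<partial>lborel)"
      by (rule nn_integral_cmult) (simp add: im)
    also have "\<dots> = ennreal k * (\<integral>\<^sup>+z. indicator (tube \<omega> \<theta>) z * F z \<partial>lborel)"
      by (simp only: nn_integral_twist[OF \<theta> \<omega> Fm])
    also have "\<dots> \<le> ennreal k * ennreal I"
      unfolding F_def by (rule mult_left_mono[OF I(1)]) simp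
    finally show ?thesis by (simp add: ennreal_mult k I)
  qed
  \<comment> \<open>Finiteness makes the passage to real integrals faithful: the inner integral is
    finite for almost every y in \<omega>, and there \<open>enn2real\<close> gives its true
    value.\<close>
  then have Jfin: "J \<noteq> \<infinity>" by (auto simp: top_unique)
  have AEfin: "AE y in lborel. indicator \<omega> y * (h y)\<^sup>2 \<noteq> \<infinity>"
    by (rule nn_integral_PInf_AE) (use Jfin in \<open>auto simp: J_def\<close>)
  have inner: "(LINT x|lborel. norm ((v \<circ> twist \<theta>) (x, y))) = enn2real (h y)" for y
  proof -
    have "(LINT x|lborel. w (x, y)) = enn2real (h y)"
      unfolding h_def by (rule integral_eq_nn_integral) (use wy in \<open>auto simp: w_def\<close>)
    then show ?thesis by (simp add: w_def)
  qed
  have n1: "(norm_1 \<omega> \<theta> v)\<^sup>2 = enn2real J"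
  proof -
    have "(LINT y:\<omega>|lborel. (LINT x|lborel. norm ((v \<circ> twist \<theta>) (x, y)))\<^sup>2) = (LINT y|lborel. indicator \<omega> y * (enn2real (h y))\<^sup>2)"
      unfolding inner set_lebesgue_integral_def by simp
    also have "\<dots> = enn2real (\<integral>\<^sup>+y. ennreal (indicator \<omega> y * (enn2real (h y))\<^sup>2) \<partial>lborel)"
      by (rule integral_eq_nn_integral) auto
    also have "(\<integral>\<^sup>+y. ennreal (indicator \<omega> y * (enn2real (h y))\<^sup>2) \<partial>lborel) = J"
      unfolding J_def
    proof (rule nn_integral_cong_AE)
      show "AE y in lborel. ennreal (indicator \<omega> y * (enn2real (h y))\<^sup>2) = indicator \<omega> y * (h y)\<^sup>2"
        using AEfin
      proof eventually_elim
        case (elim y)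
        show ?case
        proof (cases "y \<in> \<omega>")
          case True
          then have "h y \<noteq> \<infinity>" using elim by (auto simp: power2_eq_square ennreal_top_mult)
          then have "ennreal ((enn2real (h y))\<^sup>2) = (h y)\<^sup>2"
            by (simp add: ennreal_power[symmetric] ennreal_enn2real_if)
          then show ?thesis using True by simp
        qed simp
      qed
    qed
    finally have e: "(LINT y:\<omega>|lborel. (LINT x|lborel. norm ((v \<circ> twist \<theta>) (x, y)))\<^sup>2) = enn2real J" .
    show ?thesis unfolding norm_1_def e by simp
  qed
  show "(norm_1 \<omega> \<theta> v)\<^sup>2 \<le> k * I"
    unfolding n1 using Jle k(2) I(2) by (intro enn2real_leI) auto
  assume "norm_1 \<omega> \<theta> v = 0"
  then have "enn2real J = 0" using n1 by simp
  then have "J = 0" using Jfin by (simp add: enn2real_eq_0_iff)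
  then have "AE y in lborel. indicator \<omega> y * (h y)\<^sup>2 = 0"
    unfolding J_def by (subst (asm) nn_integral_0_iff_AE) auto
  then have hz: "AE y in lborel. indicator \<omega> y * h y = 0"
    by eventually_elim (auto simp: power2_eq_square)
  have "(\<integral>\<^sup>+z. indicator (tube \<omega> \<theta>) z * ennreal (norm (v z)) \<partial>lborel) = (\<integral>\<^sup>+y. indicator \<omega> y * h y \<partial>lborel)"
    unfolding h_def w_def by (rule nn_integral_twist[OF \<theta> \<omega>, symmetric]) measurable
  also have "\<dots> = (\<integral>\<^sup>+y. 0 \<partial>(lborel :: (real \<times> real) measure))" by (rule nn_integral_cong_AE[OF hz])
  finally have "(\<integral>\<^sup>+z. indicator (tube \<omega> \<theta>) z * ennreal (norm (v z)) \<partial>lborel) = 0" by simp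
  moreover have [measurable]: "tube \<omega> \<theta> \<in> sets borel" using op by simp
  ultimately have "AE z in lborel. indicator (tube \<omega> \<theta>) z * ennreal (norm (v z)) = 0"
    by (subst (asm) nn_integral_0_iff_AE) auto
  then have "AE z in lborel. indicator (tube \<omega> \<theta>) z *\<^sub>R v z = 0"
    by eventually_elim (auto simp: indicator_def)
  then have "emb (tube \<omega> \<theta>) v = cls (\<lambda>x. 0)"
    unfolding emb_def using sq_int_L2[OF op v, unfolded L2_iff] by (subst cls_eq_iff) (auto simp: sq_int_0)
  then show "emb (tube \<omega> \<theta>) v = 0" by (simp add: zero_l2_cls)
qed


section \<open>The transversal Poincare inequality in the tube\<close>

abbreviation e1 :: "real \<times> real \<times> real" where "e1 \<equiv> (1, 0, 0)"
abbreviation e2 :: "real \<times> real \<times> real" where "e2 \<equiv> (0, 1, 0)"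
abbreviation e3 :: "real \<times> real \<times> real" where "e3 \<equiv> (0, 0, 1)"

lemma Basis_3: "(Basis :: (real \<times> real \<times> real) set) = {e1, e2, e3}"
  by (auto simp: Basis_prod_def zero_prod_def)

lemma sum_Basis_3: "(\<Sum>b\<in>(Basis :: (real \<times> real \<times> real) set). f b) = f e1 + (f e2 + f e3)"
  by (simp add: Basis_3)

lemma inner_e1: "x \<bullet> e1 = fst x"
  by (simp add: inner_prod_def)

lemma integral_fst_lborel:
  fixes f :: "'a::euclidean_space \<times> 'b::euclidean_space \<Rightarrow> real"
  assumes "integrable lborel f"
  shows "(LINT x|lborel. LINT y|lborel. f (x, y)) = (LINT z|lborel. f z)"
    "integrable lborel (\<lambda>x. LINT y|lborel. f (x, y))"
  using lborel_pair.integral_fst'[of f] lborel_pair.integrable_fst'[of f] assms by (simp_all add: lborel_prod)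

lemma norm_cls_product:
  fixes \<Psi> :: "'a::euclidean_space \<times> 'b::euclidean_space \<Rightarrow> complex"
  assumes \<Psi>: "sq_int \<Psi>" and f: "\<And>x y. (norm (\<Psi> (x, y)))\<^sup>2 = f x * g y"
  shows "(norm (cls \<Psi>))\<^sup>2 = (LINT x|lborel. f x) * (LINT y|lborel. g y)"
proof -
  have "integrable lborel (\<lambda>z. (norm (\<Psi> z))\<^sup>2)" using \<Psi> by (simp add: sq_int_def)
  from integral_fst_lborel(1)[OF this] show ?thesis
    unfolding norm_cls[OF \<Psi>] f by simp
qed

section \<open>Trial functions in the straight end of the tube\<close>

lemma smooth_slice_measurable:
  assumes "smooth v" shows "(\<lambda>y. v (s, y)) \<in> borel_measurable borel"
  by (rule measurable_compose[OF _ smooth_measurable[OF assms]])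
    (auto intro!: borel_measurable_continuous_onI continuous_intros)

text \<open>The longitudinal profile, smooth and positive exactly on (0, 1). Stretched by the factor
  1/\<epsilon> and moved to R it is supported in the end x1 \<ge> R, where the tube is
  straight.\<close>

definition hat :: "real \<Rightarrow> real" where "hat x = ramp 1 x * ramp 1 (1 - x)"

lemma hat_deriv: "\<exists>d. \<forall>x. (hat has_real_derivative d x) (at x)"
proof -
  define d where "d = flat (monom 1 2 * (smult 1 1 - pderiv 1)) 1"
  have r: "(ramp 1 has_real_derivative d x) (at x)" for x
    unfolding ramp_def d_def by (rule flat_deriv) simp
  have "(hat has_real_derivative (d x * ramp 1 (1 - x) + (d (1 - x) * (- 1)) * ramp 1 x)) (at x)" for x
    unfolding hat_def[abs_def]
    by (rule DERIV_mult[OF r DERIV_chain2[OF r]]) (auto intro!: derivative_eq_intros)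
  then show ?thesis by (intro exI allI)
qed

lemma smooth_hat: "smooth (\<lambda>z::'a::euclidean_space. complex_of_real (hat ((z - w) \<bullet> v)))"
proof -
  have "smooth (\<lambda>z::'a. complex_of_real (ramp 1 ((z - w) \<bullet> v)) * complex_of_real (1 * ramp 1 (1 - (z - w) \<bullet> v)))"
  proof (rule smooth_mult)
    show "smooth (\<lambda>z::'a. complex_of_real (ramp 1 ((z - w) \<bullet> v)))"
      by (rule smooth_ridge_affine(1)[OF ramp_smooth]) simp
    show "smooth (\<lambda>z::'a. complex_of_real (1 * ramp 1 (1 - (z - w) \<bullet> v)))"
    proof (cases "v = 0")
      case True
      then show ?thesis by (simp add: smooth_const)
    next
      case False
      have "1 - (z - w) \<bullet> v = ((w + v /\<^sub>R (v \<bullet> v)) - z) \<bullet> v" for z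
        using False by (simp add: inner_diff_left inner_add_left)
      then show ?thesis using smooth_ridge_affine(2)[OF ramp_smooth[of 1], of "w + v /\<^sub>R (v \<bullet> v)" v] by simp
    qed
  qed
  then show ?thesis by (simp add: hat_def)
qed

lemma hat_pos: "0 < x \<Longrightarrow> x < 1 \<Longrightarrow> hat x > 0"
  by (simp add: hat_def ramp_eq)

lemma hat_outside: "x \<notin> {0..1} \<Longrightarrow> hat x = 0"
  by (auto simp: hat_def ramp_eq)

lemma hat_bounds: "0 \<le> hat x" "hat x \<le> 1"
  using ramp_bounds[of 1] by (auto simp: hat_def mult_le_one)

lemma hat_continuous: "continuous_on UNIV hat"
  using hat_deriv by (meson DERIV_continuous_on has_field_derivative_at_within)

lemma hat_integral_pos: "(LINT x|lborel. (hat x)\<^sup>2) > 0"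
proof -
  have m: "(\<lambda>x. (hat x)\<^sup>2) \<in> borel_measurable borel"
    by (intro borel_measurable_continuous_onI continuous_on_power hat_continuous)
  have i: "integrable lborel (\<lambda>x. (hat x)\<^sup>2)"
  proof (rule Bochner_Integration.integrable_bound[where f="indicator {0..1::real} :: real \<Rightarrow> real"])
    show "AE x in lborel. norm ((hat x)\<^sup>2) \<le> norm (indicator {0..1::real} x :: real)"
      using hat_outside hat_bounds by (auto simp: indicator_def power_le_one intro!: AE_I2)
  qed (use m in \<open>auto intro!: integrable_real_indicator\<close>)
  have "(LINT x|lborel. (hat x)\<^sup>2) \<noteq> 0"
  proof
    assume "(LINT x|lborel. (hat x)\<^sup>2) = 0"
    then have "AE x in lborel. (hat x)\<^sup>2 = 0"
      using integral_nonneg_eq_0_iff_AE[OF i] by simp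
    then have "AE x in lborel. x \<notin> {0<..<1::real}"
      by eventually_elim (use hat_pos in fastforce)
    then have "emeasure lborel {0<..<1::real} = 0"
      by (subst (asm) AE_iff_null_sets[symmetric]) auto
    then show False by simp
  qed
  moreover have "(LINT x|lborel. (hat x)\<^sup>2) \<ge> 0" by simp
  ultimately show ?thesis by linarith
qed

lemma linear_slice_rot: "linear (\<lambda>z::real \<times> real \<times> real. (0::real, rot a (snd z)))"
  by (rule linearI) (auto simp: rot_def algebra_simps)

text \<open>The two entries are the partial derivatives of a function composed with a rotation of
  the slice, where p and q are the original ones; orthogonality preserves the sum of
  squares.\<close>

lemma rot_gradient_norm:
  fixes p q :: complex
  shows "(norm (of_real (cos a) * p - of_real (sin a) * q))\<^sup>2 + (norm (of_real (sin a) * p + of_real (cos a) * q))\<^sup>2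
     = (norm p)\<^sup>2 + (norm q)\<^sup>2"
proof -
  have "(norm (of_real c * p - of_real s * q))\<^sup>2 + (norm (of_real s * p + of_real c * q))\<^sup>2
      = (c\<^sup>2 + s\<^sup>2) * ((norm p)\<^sup>2 + (norm q)\<^sup>2)" for c s
    unfolding cmod_power2 by (simp add: power2_eq_square algebra_simps)
  from this[of "cos a" "sin a"] show ?thesis by simp
qed

text \<open>Rotate the slice of \<open>v\<close> at \<open>s\<close> into the straight end of the tube and test with its product with a wide function
  of \<open>x\<^sub>1\<close>: the longitudinal derivative is negligible in the limit.\<close>

lemma slice_poincare:
  fixes \<omega> :: "(real \<times> real) set"
  assumes form: "\<And>\<phi>. \<phi> \<in> test_functions (tube \<omega> \<theta>) \<Longrightarrow> E * (norm (cls \<phi>))\<^sup>2 \<le> (\<Sum>b\<in>Basis. (norm (cls (partial b \<phi>)))\<^sup>2)"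
    and const: "\<And>x. x \<ge> R \<Longrightarrow> \<theta> x = \<theta> R" and v: "v \<in> test_functions (tube \<omega> \<theta>)"
  shows "E * (LINT y|lborel. (norm (v (s, y)))\<^sup>2)
     \<le> (LINT y|lborel. (norm (partial e2 v (s, y)))\<^sup>2) + (LINT y|lborel. (norm (partial e3 v (s, y)))\<^sup>2)"
proof -
  \<comment> \<open>The slice at s is turned by \<open>\<theta> s\<close>, those in the straight end
    by \<open>\<theta> R\<close>; rotating by the difference carries one to the other.\<close>
  define \<alpha> where "\<alpha> = \<theta> s - \<theta> R"
  define H where "H = (LINT y|lborel. (norm (v (s, y)))\<^sup>2)"
  define D where "D = (LINT y|lborel. (norm (partial e2 v (s, y)))\<^sup>2) + (LINT y|lborel. (norm (partial e3 v (s, y)))\<^sup>2)"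
  obtain d where d: "\<And>x. (hat has_real_derivative d x) (at x)" using hat_deriv by blast
  define B where "B = (LINT x|lborel. (hat x)\<^sup>2)"
  define B' where "B' = (LINT x|lborel. (d x)\<^sup>2)"
  have sv: "smooth v" by (rule test_smooth[OF v])
  \<comment> \<open>\<open>A\<close> sends every point to the slice at s, so v composed with it is
    constant in x1 and its derivative along \<open>e1\<close> is 0.\<close>
  define A where "A z = (0::real, rot \<alpha> (snd z)) + (s, 0)" for z :: "real \<times> real \<times> real"
  have Aeq: "A (x, y) = (s, rot \<alpha> y)" for x y by (simp add: A_def zero_prod_def plus_prod_def)
  note linA = linear_slice_rot[of \<alpha>]
  have pA: "partial b (\<lambda>z. v (A z)) z = (\<Sum>i\<in>Basis. of_real ((0::real, rot \<alpha> (snd b)) \<bullet> i) * partial i v (A z))" for b z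
    unfolding A_def by (rule partial_affine[OF smooth_differentiable[OF sv] linA])
  have pA1: "partial e1 (\<lambda>z. v (A z)) z = 0" for z
    unfolding pA sum_Basis_3 by (simp add: rot_def)
  have pA2: "partial e2 (\<lambda>z. v (A z)) z = of_real (cos \<alpha>) * partial e2 v (A z) - of_real (sin \<alpha>) * partial e3 v (A z)" for z
    unfolding pA sum_Basis_3 by (simp add: rot_def)
  have pA3: "partial e3 (\<lambda>z. v (A z)) z = of_real (sin \<alpha>) * partial e2 v (A z) + of_real (cos \<alpha>) * partial e3 v (A z)" for z
    unfolding pA sum_Basis_3 by (simp add: rot_def)
  have svA: "smooth (\<lambda>z. v (A z))" unfolding A_def by (rule smooth_affine[OF sv linA])
  \<comment> \<open>The trial function is hat (\<epsilon> (x1 - R)) times the rotated slice.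
    Stretching multiplies the squared L2 norm of the profile by 1/\<epsilon> and that of its
    derivative by \<epsilon>; clearing the factor 1/\<epsilon> leaves \<epsilon>^2 in front of the
    longitudinal term.\<close>
  have main: "E * (B * H) \<le> \<epsilon>\<^sup>2 * (B' * H) + B * D" if e: "\<epsilon> > 0" for \<epsilon>
  proof -
    define w where "w = R *\<^sub>R e1"
    define c where "c z = hat ((z - w) \<bullet> (\<epsilon> *\<^sub>R e1))" for z :: "real \<times> real \<times> real"
    have ceq: "c (x, y) = hat (\<epsilon> * (x - R))" for x y by (simp add: c_def w_def inner_prod_def zero_prod_def mult.commute)
    have sc: "smooth (\<lambda>z. complex_of_real (c z))" unfolding c_def by (rule smooth_hat)
    have pc: "partial b (\<lambda>z. complex_of_real (c z)) (x, y) = of_real (fst b * \<epsilon> * d (\<epsilon> * (x - R)))" for b x y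
    proof -
      have ci: "c = (\<lambda>z. (\<lambda>u. hat (u - R * \<epsilon>)) (z \<bullet> (\<epsilon> *\<^sub>R e1)))"
        by (rule ext) (simp add: c_def w_def inner_prod_def zero_prod_def algebra_simps)
      have "((\<lambda>u. hat (u - R * \<epsilon>)) has_real_derivative d (u - R * \<epsilon>) * 1) (at u)" for u
        by (rule DERIV_chain2[OF d]) (auto intro!: derivative_eq_intros)
      then have du: "((\<lambda>u. hat (u - R * \<epsilon>)) has_real_derivative d (u - R * \<epsilon>)) (at u)" for u by simp
      have a: "x * \<epsilon> - R * \<epsilon> = \<epsilon> * (x - R)" by (simp add: algebra_simps)
      show ?thesis
        unfolding ci partial_ridge[OF du] by (simp add: inner_prod_def zero_prod_def mult.commute[of \<epsilon> x] a mult.assoc)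
    qed
    define \<Psi> where "\<Psi> z = complex_of_real (c z) * v (A z)" for z
    have s\<Psi>: "smooth \<Psi>" unfolding \<Psi>_def[abs_def] by (rule smooth_mult[OF sc svA])
    have t: "\<Psi> \<in> test_functions (tube \<omega> \<theta>)"
    proof -
      obtain S where S: "compact S" "S \<subseteq> tube \<omega> \<theta>" "\<And>z. v z \<noteq> 0 \<Longrightarrow> z \<in> S"
        using v in_support[of v] unfolding test_functions_def by blast
      define g where "g p = (fst p, rot (- \<alpha>) (snd (snd p)))" for p :: "real \<times> real \<times> real \<times> real"
      \<comment> \<open>The support of the trial function is contained in an interval of the
        straight end times the slice of the support of v, rotated back; this lies in the tube
        because \<open>\<theta>\<close> equals \<open>\<theta> R\<close> on the interval.\<close>
      define K where "K = g ` ({R..R + 1/\<epsilon>} \<times> (S \<inter> {z. fst z = s}))"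
      show ?thesis
      proof (rule testI_compact[OF s\<Psi>])
        have "closed {z::real \<times> real \<times> real. fst z = s}" by (intro closed_Collect_eq continuous_intros)
        then have "compact (S \<inter> {z. fst z = s})" using S(1) by (rule compact_Int_closed[rotated])
        moreover have "continuous_on X g" for X
          unfolding g_def by (intro continuous_intros continuous_on_rot)
        ultimately show "compact K" unfolding K_def by (intro compact_continuous_image compact_Times compact_Icc)
        show "K \<subseteq> tube \<omega> \<theta>"
        proof
          fix z assume "z \<in> K"
          then obtain x p where p: "x \<ge> R" "p \<in> S" "fst p = s" "z = (x, rot (- \<alpha>) (snd p))" by (auto simp: K_def g_def)
          have "rot (- \<theta> s) (snd p) \<in> \<omega>" using S(2) p(2,3) tube_iff by blast
          moreover have "- \<theta> x + - \<alpha> = - \<theta> s" using const[OF p(1)] by (simp add: \<alpha>_def)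
          ultimately show "z \<in> tube \<omega> \<theta>" by (simp add: tube_iff p(4) rot_rot)
        qed
        fix z assume z: "\<Psi> z \<noteq> 0"
        obtain x y where xy: "z = (x, y)" by (cases z)
        have "hat (\<epsilon> * (x - R)) \<noteq> 0" and vz: "v (s, rot \<alpha> y) \<noteq> 0" using z by (auto simp: \<Psi>_def xy ceq Aeq)
        then have "\<epsilon> * (x - R) \<in> {0..1}" using hat_outside by blast
        then have "x \<in> {R..R + 1/\<epsilon>}" using e by (auto simp: zero_le_mult_iff field_simps)
        moreover have "(s, rot \<alpha> y) \<in> S \<inter> {z. fst z = s}" using S(3)[OF vz] by simp
        moreover have "z = g (x, (s, rot \<alpha> y))" by (simp add: g_def xy rot_rot rot_0)
        ultimately show "z \<in> K" unfolding K_def by blast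
      qed
    qed
    have dil: "(LINT x|lborel. f (\<epsilon> * (x - R))) = (1 / \<epsilon>) * (LINT x|lborel. f x)" for f :: "real \<Rightarrow> real"
    proof -
      have "(LINT x|lborel. f (\<epsilon> * (x - R))) = \<bar>1/\<epsilon>\<bar> *\<^sub>R (LINT x|lborel. f (\<epsilon> * ((R + (1/\<epsilon>) * x) - R)))"
        by (rule lborel_integral_real_affine) (use e in simp)
      then show ?thesis using e by simp
    qed
    have rt: "(LINT y|lborel. (norm (u (s, rot \<alpha> y)))\<^sup>2) = (LINT y|lborel. (norm (u (s, y)))\<^sup>2)" if "smooth u" for u :: "real \<times> real \<times> real \<Rightarrow> complex"
    proof -
      have [measurable]: "(\<lambda>y. u (s, y)) \<in> borel_measurable borel" by (rule smooth_slice_measurable[OF that])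
      have "(\<lambda>y. (norm (u (s, y)))\<^sup>2) \<in> borel_measurable borel" by measurable
      from integral_rot[OF this, of \<alpha>] show ?thesis .
    qed
    note sqt = test_sq_int[OF t] test_sq_int[OF test_partial[OF t]]
    have n0: "(norm (cls \<Psi>))\<^sup>2 = (1 / \<epsilon>) * (B * H)"
    proof -
      have "(norm (cls \<Psi>))\<^sup>2 = (LINT x|lborel. (hat (\<epsilon> * (x - R)))\<^sup>2) * (LINT y|lborel. (norm (v (s, rot \<alpha> y)))\<^sup>2)"
        by (rule norm_cls_product[OF sqt(1)]) (simp add: \<Psi>_def ceq Aeq norm_mult power_mult_distrib)
      then show ?thesis by (simp add: dil[of "\<lambda>x. (hat x)\<^sup>2"] rt[OF sv] B_def H_def)
    qed
    have pP: "partial b \<Psi> z = complex_of_real (c z) * partial b (\<lambda>z. v (A z)) z + partial b (\<lambda>z. complex_of_real (c z)) z * v (A z)" for b z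
      unfolding \<Psi>_def[abs_def] by (rule partial_mult[OF smooth_differentiable[OF sc] smooth_differentiable[OF svA]])
    have n1: "(norm (cls (partial e1 \<Psi>)))\<^sup>2 = \<epsilon> * (B' * H)"
    proof -
      have b: "e1 \<in> Basis" by (simp add: Basis_3)
      have "(norm (cls (partial e1 \<Psi>)))\<^sup>2 = (LINT x|lborel. (\<epsilon> * d (\<epsilon> * (x - R)))\<^sup>2) * (LINT y|lborel. (norm (v (s, rot \<alpha> y)))\<^sup>2)"
        by (rule norm_cls_product[OF sqt(2)[OF b]]) (simp add: pP pA1 pc Aeq norm_mult power_mult_distrib)
      also have "(LINT x|lborel. (\<epsilon> * d (\<epsilon> * (x - R)))\<^sup>2) = \<epsilon>\<^sup>2 * ((1 / \<epsilon>) * B')"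
        unfolding power_mult_distrib B'_def dil[of "\<lambda>x. (d x)\<^sup>2", symmetric] by simp
      finally show ?thesis using e unfolding rt[OF sv] H_def[symmetric] by (simp add: power2_eq_square[of \<epsilon>])
    qed
    have n23: "(norm (cls (partial e2 \<Psi>)))\<^sup>2 + (norm (cls (partial e3 \<Psi>)))\<^sup>2 = (1 / \<epsilon>) * (B * D)"
    proof -
      have b: "e2 \<in> Basis" "e3 \<in> Basis" by (auto simp: Basis_3)
      define q2 where "q2 y = (norm (of_real (cos \<alpha>) * partial e2 v (s, rot \<alpha> y) - of_real (sin \<alpha>) * partial e3 v (s, rot \<alpha> y)))\<^sup>2" for y
      define q3 where "q3 y = (norm (of_real (sin \<alpha>) * partial e2 v (s, rot \<alpha> y) + of_real (cos \<alpha>) * partial e3 v (s, rot \<alpha> y)))\<^sup>2" for y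
      have N2: "(norm (cls (partial e2 \<Psi>)))\<^sup>2 = (LINT x|lborel. (hat (\<epsilon> * (x - R)))\<^sup>2) * (LINT y|lborel. q2 y)"
        by (rule norm_cls_product[OF sqt(2)[OF b(1)]]) (simp add: pP pA2 pc Aeq ceq norm_mult power_mult_distrib q2_def)
      have N3: "(norm (cls (partial e3 \<Psi>)))\<^sup>2 = (LINT x|lborel. (hat (\<epsilon> * (x - R)))\<^sup>2) * (LINT y|lborel. q3 y)"
        by (rule norm_cls_product[OF sqt(2)[OF b(2)]]) (simp add: pP pA3 pc Aeq ceq norm_mult power_mult_distrib q3_def)
      have sl: "integrable lborel (\<lambda>y. (norm (u (s, rot a y)))\<^sup>2)" if u: "u \<in> test_functions (tube \<omega> \<theta>)" for u a
      proof -
        obtain S M where S: "compact S" "\<And>x. x \<notin> S \<Longrightarrow> u x = 0" "\<And>x. norm (u x) \<le> M"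
          using test_compact_support[OF u] by blast
        have K: "compact ((\<lambda>p. rot (- a) (snd p)) ` S)"
          by (intro compact_continuous_image continuous_on_rot continuous_intros S(1))
        have m: "(\<lambda>y. u (s, rot a y)) \<in> borel_measurable borel"
          by (rule measurable_compose[OF rot_measurable smooth_slice_measurable[OF test_smooth[OF u]]])
        have z: "u (s, rot a y) = 0" if "y \<notin> (\<lambda>p. rot (- a) (snd p)) ` S" for y
        proof (rule S(2), rule notI)
          assume "(s, rot a y) \<in> S"
          then have "rot (- a) (snd (s, rot a y)) \<in> (\<lambda>p. rot (- a) (snd p)) ` S" by (rule imageI)
          then show False using that by (simp add: rot_rot rot_0)
        qed
        have "sq_int (\<lambda>y. u (s, rot a y))"
          by (rule sq_int_bounded_support[OF m emeasure_bounded_finite[OF compact_imp_bounded[OF K]] borel_compact[OF K] z S(3)])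
        then show ?thesis by (simp add: sq_int_def)
      qed
      have lin: "sq_int (\<lambda>y. partial i v (s, rot \<alpha> y))" if "i \<in> Basis" for i
        using sl[OF test_partial[OF v that], of \<alpha>]
          measurable_compose[OF rot_measurable smooth_slice_measurable[OF test_smooth[OF test_partial[OF v that]]], of s \<alpha>]
        by (simp add: sq_int_def)
      have i2: "integrable lborel q2" unfolding q2_def[abs_def]
        using sq_int_diff[OF sq_int_cmult[OF lin[OF b(1)]] sq_int_cmult[OF lin[OF b(2)]]] by (simp add: sq_int_def)
      have i3: "integrable lborel q3" unfolding q3_def[abs_def]
        using sq_int_add[OF sq_int_cmult[OF lin[OF b(1)]] sq_int_cmult[OF lin[OF b(2)]]] by (simp add: sq_int_def)
      have "(LINT y|lborel. q2 y) + (LINT y|lborel. q3 y) = (LINT y|lborel. q2 y + q3 y)"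
        using i2 i3 by simp
      also have "\<dots> = (LINT y|lborel. (norm (partial e2 v (s, rot \<alpha> y)))\<^sup>2 + (norm (partial e3 v (s, rot \<alpha> y)))\<^sup>2)"
        unfolding q2_def q3_def rot_gradient_norm by (rule refl)
      also have "\<dots> = D"
        unfolding D_def
        by (subst Bochner_Integration.integral_add[OF sl[OF test_partial[OF v b(1)]] sl[OF test_partial[OF v b(2)]]])
          (simp add: rt[OF smooth_partial[OF sv b(1)]] rt[OF smooth_partial[OF sv b(2)]])
      finally have "(LINT y|lborel. q2 y) + (LINT y|lborel. q3 y) = D" .
      moreover have "(LINT x|lborel. (hat (\<epsilon> * (x - R)))\<^sup>2) = (1 / \<epsilon>) * B"
        by (simp add: dil[of "\<lambda>x. (hat x)\<^sup>2"] B_def)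
      ultimately show ?thesis unfolding N2 N3 distrib_left[symmetric] by (simp only: mult.assoc)
    qed
    have "E * ((1 / \<epsilon>) * (B * H)) \<le> \<epsilon> * (B' * H) + (1 / \<epsilon>) * (B * D)"
      using form[OF t] unfolding n0 sum_Basis_3 n1 n23 .
    then have "\<epsilon> * (E * ((1 / \<epsilon>) * (B * H))) \<le> \<epsilon> * (\<epsilon> * (B' * H) + (1 / \<epsilon>) * (B * D))"
      using e by (intro mult_left_mono) auto
    then show ?thesis using e by (simp add: distrib_left power2_eq_square mult.assoc)
  qed
  have "((\<lambda>\<epsilon>. \<epsilon>\<^sup>2 * (B' * H) + B * D) \<longlongrightarrow> 0\<^sup>2 * (B' * H) + B * D) (at_right 0)"
    by (intro tendsto_intros)
  then have "E * (B * H) \<le> 0\<^sup>2 * (B' * H) + B * D"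
    by (rule tendsto_lowerbound)
      (auto intro!: eventually_mono[OF eventually_at_right_less[of 0]] main)
  then have "B * (E * H) \<le> B * D" by (simp add: mult.left_commute)
  then show ?thesis using hat_integral_pos unfolding B_def[symmetric] H_def D_def by simp
qed

text \<open>For test functions the slice inequality is multiplied by the weight q and integrated
  over x1 by Fubini. Both sides are continuous in \<open>l2\<close>, so the result extends to the
  form domain.\<close>

lemma transversal_poincare_tube:
  assumes form: "\<And>\<phi>. \<phi> \<in> test_functions (tube \<omega> \<theta>) \<Longrightarrow> E * (norm (cls \<phi>))\<^sup>2 \<le> (\<Sum>b\<in>Basis. (norm (cls (partial b \<phi>)))\<^sup>2)"
    and const: "\<And>x. x \<ge> R \<Longrightarrow> \<theta> x = \<theta> R"
  shows "transversal_poincare (tube \<omega> \<theta>) e1 E"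
  unfolding transversal_poincare_def
proof (intro allI impI)
  fix F G q
  assume h: "h10 (tube \<omega> \<theta>) F G" and q: "bfun q" and q0: "\<forall>x. 0 \<le> q x"
  have W: "bmeas (wt e1 q)" by (rule bmeas_wt[OF q])
  have b: "e2 \<in> Basis" "e3 \<in> Basis" by (auto simp: Basis_3)
  have dif: "(Basis :: (real \<times> real \<times> real) set) - {e1} = {e2, e3}" by (auto simp: Basis_3)
  obtain \<phi> where \<phi>: "\<And>n. \<phi> n \<in> test_functions (tube \<omega> \<theta>)" and 1: "(\<lambda>n. cls (\<phi> n)) \<longlonglongrightarrow> F"
    and 2: "\<And>i. i \<in> Basis \<Longrightarrow> (\<lambda>n. cls (partial i (\<phi> n))) \<longlonglongrightarrow> G i" using h unfolding h10_def by blast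
  have slice: "inner (mul (wt e1 q) (cls u)) (cls u) = (LINT x|lborel. q x * (LINT y|lborel. (norm (u (x, y)))\<^sup>2))"
    "integrable lborel (\<lambda>x. q x * (LINT y|lborel. (norm (u (x, y)))\<^sup>2))"
    if u: "sq_int u" for u :: "real \<times> real \<times> real \<Rightarrow> complex"
  proof -
    have i: "integrable lborel (\<lambda>z. q (fst z) * (norm (u z))\<^sup>2)"
      using integrable_sq_int_inner[OF sq_int_mul[OF W u] u] by (simp add: inner_e1 power2_norm_eq_inner)
    have "inner (mul (wt e1 q) (cls u)) (cls u) = (LINT z|lborel. q (fst z) * (norm (u z))\<^sup>2)"
      unfolding inner_mul_cls[OF W u u] by (simp add: inner_e1 power2_norm_eq_inner)
    then show "inner (mul (wt e1 q) (cls u)) (cls u) = (LINT x|lborel. q x * (LINT y|lborel. (norm (u (x, y)))\<^sup>2))"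
      using integral_fst_lborel(1)[OF i] by simp
    show "integrable lborel (\<lambda>x. q x * (LINT y|lborel. (norm (u (x, y)))\<^sup>2))"
      using integral_fst_lborel(2)[OF i] by simp
  qed
  have fin: "E * inner (mul (wt e1 q) (cls (\<phi> n))) (cls (\<phi> n))
      \<le> inner (mul (wt e1 q) (cls (partial e2 (\<phi> n)))) (cls (partial e2 (\<phi> n)))
        + inner (mul (wt e1 q) (cls (partial e3 (\<phi> n)))) (cls (partial e3 (\<phi> n)))" for n
  proof -
    note s0 = test_sq_int[OF \<phi>[of n]] and s2 = test_sq_int[OF test_partial[OF \<phi>[of n] b(1)]]
      and s3 = test_sq_int[OF test_partial[OF \<phi>[of n] b(2)]]
    have "E * inner (mul (wt e1 q) (cls (\<phi> n))) (cls (\<phi> n)) = (LINT x|lborel. E * (q x * (LINT y|lborel. (norm (\<phi> n (x, y)))\<^sup>2)))"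
      unfolding slice(1)[OF s0] by simp
    also have "\<dots> \<le> (LINT x|lborel. q x * (LINT y|lborel. (norm (partial e2 (\<phi> n) (x, y)))\<^sup>2)
        + q x * (LINT y|lborel. (norm (partial e3 (\<phi> n) (x, y)))\<^sup>2))"
    proof (rule integral_mono)
      fix x
      have "q x * (E * (LINT y|lborel. (norm (\<phi> n (x, y)))\<^sup>2)) \<le> q x * ((LINT y|lborel. (norm (partial e2 (\<phi> n) (x, y)))\<^sup>2)
        + (LINT y|lborel. (norm (partial e3 (\<phi> n) (x, y)))\<^sup>2))"
        by (rule mult_left_mono[OF slice_poincare[OF form const \<phi>]]) (use q0 in auto)
      then show "E * (q x * (LINT y|lborel. (norm (\<phi> n (x, y)))\<^sup>2)) \<le> q x * (LINT y|lborel. (norm (partial e2 (\<phi> n) (x, y)))\<^sup>2)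
        + q x * (LINT y|lborel. (norm (partial e3 (\<phi> n) (x, y)))\<^sup>2)"
        by (simp add: distrib_left mult.left_commute)
    qed (intro integrable_mult_right Bochner_Integration.integrable_add slice(2) s0 s2 s3)+
    also have "\<dots> = inner (mul (wt e1 q) (cls (partial e2 (\<phi> n)))) (cls (partial e2 (\<phi> n)))
        + inner (mul (wt e1 q) (cls (partial e3 (\<phi> n)))) (cls (partial e3 (\<phi> n)))"
      unfolding slice(1)[OF s2] slice(1)[OF s3]
      by (rule Bochner_Integration.integral_add[OF slice(2)[OF s2] slice(2)[OF s3]])
    finally show ?thesis .
  qed
  have tl: "(\<lambda>n. inner (mul (wt e1 q) (X n)) (X n)) \<longlonglongrightarrow> inner (mul (wt e1 q) Y) Y" if "X \<longlonglongrightarrow> Y" for X Y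
    by (rule tendsto_inner[OF bounded_linear.tendsto[OF bounded_linear_mul[OF W] that] that])
  have "E * inner (mul (wt e1 q) F) F \<le> inner (mul (wt e1 q) (G e2)) (G e2) + inner (mul (wt e1 q) (G e3)) (G e3)"
    by (rule LIMSEQ_le[OF tendsto_mult_left[OF tl[OF 1]] tendsto_add[OF tl[OF 2[OF b(1)]] tl[OF 2[OF b(2)]]]])
      (use fin in blast)
  then show "E * inner (mul (wt e1 q) F) F \<le> (\<Sum>b\<in>Basis - {e1}. inner (mul (wt e1 q) (G b)) (G b))"
    unfolding dif by simp
qed


section \<open>The semigroup on the Hilbert space\<close>

lemma mul_indicator_split:
  fixes F :: "'a::euclidean_space l2"
  assumes "open \<Omega>"
  shows "mul (indicator \<Omega>) F + mul (indicator (- \<Omega>)) F = F"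
proof -
  have "mul (indicator \<Omega>) F + mul (indicator (- \<Omega>)) F = mul (\<lambda>x. indicator \<Omega> x + indicator (- \<Omega>) x) F"
    by (rule mul_add_left[symmetric]) (use assms in \<open>auto intro: bmeas_indicator\<close>)
  also have "\<dots> = mul (\<lambda>x. 1) F" by (rule mul_cong_fun) (simp add: indicator_def)
  finally show ?thesis by (simp add: mul_const_1)
qed

lemma mul_indicator_mul_indicator:
  assumes "A \<in> sets borel" "B \<in> sets borel"
  shows "mul (indicator A) (mul (indicator B) F) = mul (indicator (A \<inter> B)) F"
  unfolding mul_mul[OF bmeas_indicator[OF assms(1)] bmeas_indicator[OF assms(2)]]
  by (rule mul_cong_fun) (simp add: indicator_inter_arith)

lemma mul_indicator_empty: "mul (indicator {}) F = 0"
  by (simp add: mul_def zero_l2_cls)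

text \<open>An operator on functions that is bounded, and linear up to null sets, acts on classes:
  two functions of the same class differ by one of norm 0, which the bound sends to 0.\<close>

lemma L2_bounded_operator_emb:
  assumes op: "open \<Omega>" and T: "L2_bounded_operator \<Omega> T"
  shows "f \<in> L2 \<Omega> \<Longrightarrow> T f \<in> L2 \<Omega>"
    and "f \<in> L2 \<Omega> \<Longrightarrow> g \<in> L2 \<Omega> \<Longrightarrow> emb \<Omega> (T (\<lambda>x. f x + g x)) = emb \<Omega> (T f) + emb \<Omega> (T g)"
    and "f \<in> L2 \<Omega> \<Longrightarrow> emb \<Omega> (T (\<lambda>x. of_real c * f x)) = c *\<^sub>R emb \<Omega> (T f)"
    and "f \<in> L2 \<Omega> \<Longrightarrow> g \<in> L2 \<Omega> \<Longrightarrow> emb \<Omega> f = emb \<Omega> g \<Longrightarrow> emb \<Omega> (T f) = emb \<Omega> (T g)"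
    and "\<exists>K\<ge>0. \<forall>f\<in>L2 \<Omega>. norm (emb \<Omega> (T f)) \<le> K * norm (emb \<Omega> f)"
proof -
  show TL: "T f \<in> L2 \<Omega>" if "f \<in> L2 \<Omega>" for f using T that unfolding L2_bounded_operator_def by blast
  show add: "emb \<Omega> (T (\<lambda>x. f x + g x)) = emb \<Omega> (T f) + emb \<Omega> (T g)" if "f \<in> L2 \<Omega>" "g \<in> L2 \<Omega>" for f g
  proof -
    have "AE x\<in>\<Omega> in lborel. T (\<lambda>y. f y + g y) x = T f x + T g x"
      using T that unfolding L2_bounded_operator_def by blast
    then have "emb \<Omega> (T (\<lambda>x. f x + g x)) = emb \<Omega> (\<lambda>x. T f x + T g x)"
      by (rule emb_AE_cong[OF TL[OF L2_add[OF that]] L2_add[OF TL[OF that(1)] TL[OF that(2)]]])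
    then show ?thesis by (simp add: emb_add TL that)
  qed
  show sc: "emb \<Omega> (T (\<lambda>x. of_real c * f x)) = c *\<^sub>R emb \<Omega> (T f)" if "f \<in> L2 \<Omega>" for f c
  proof -
    have "AE x\<in>\<Omega> in lborel. T (\<lambda>y. of_real c * f y) x = of_real c * T f x"
      using T that unfolding L2_bounded_operator_def by blast
    then have "emb \<Omega> (T (\<lambda>x. of_real c * f x)) = emb \<Omega> (\<lambda>x. of_real c * T f x)"
      by (rule emb_AE_cong[OF TL[OF L2_cmult[OF that]] L2_cmult[OF TL[OF that]]])
    then show ?thesis by (simp add: emb_of_real TL that)
  qed
  obtain K where K: "\<And>f. f \<in> L2 \<Omega> \<Longrightarrow> L2_norm \<Omega> (T f) \<le> K * L2_norm \<Omega> f"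
    using T unfolding L2_bounded_operator_def by blast
  have bd: "norm (emb \<Omega> (T f)) \<le> \<bar>K\<bar> * norm (emb \<Omega> f)" if "f \<in> L2 \<Omega>" for f
  proof -
    have "norm (emb \<Omega> (T f)) \<le> K * norm (emb \<Omega> f)" using K[OF that] by (simp add: L2_norm_emb TL that)
    also have "\<dots> \<le> \<bar>K\<bar> * norm (emb \<Omega> f)" by (rule mult_right_mono) auto
    finally show ?thesis .
  qed
  then show "\<exists>K\<ge>0. \<forall>f\<in>L2 \<Omega>. norm (emb \<Omega> (T f)) \<le> K * norm (emb \<Omega> f)"
    by (intro exI[of _ "\<bar>K\<bar>"]) auto
  show "emb \<Omega> (T f) = emb \<Omega> (T g)" if f: "f \<in> L2 \<Omega>" and g: "g \<in> L2 \<Omega>" and e: "emb \<Omega> f = emb \<Omega> g" for f g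
  proof -
    define h where "h x = f x + of_real (- 1) * g x" for x
    have hL: "h \<in> L2 \<Omega>" unfolding h_def[abs_def] by (rule L2_add[OF f L2_cmult[OF g]])
    have "emb \<Omega> h = emb \<Omega> f + (- 1) *\<^sub>R emb \<Omega> g"
      unfolding h_def[abs_def] emb_add[OF f L2_cmult[OF g]] emb_of_real[OF g] by (rule refl)
    then have "emb \<Omega> h = 0" using e by simp
    then have "emb \<Omega> (T h) = 0" using bd[OF hL] by simp
    moreover have "emb \<Omega> (T h) = emb \<Omega> (T f) + (- 1) *\<^sub>R emb \<Omega> (T g)"
      unfolding h_def[abs_def] add[OF f L2_cmult[OF g]] sc[OF g] by (rule refl)
    ultimately show ?thesis by simp
  qed
qed

text \<open>Acting as the identity outside \<open>\<Omega>\<close> makes this a strongly continuous semigroup on the whole space \<open>L\<^sup>2(\<real>\<^sup>n)\<close>, so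
  that no separate Hilbert space is needed for each \<open>\<Omega>\<close>.\<close>

definition extend :: "'a::euclidean_space set \<Rightarrow> (real \<Rightarrow> ('a \<Rightarrow> complex) \<Rightarrow> ('a \<Rightarrow> complex)) \<Rightarrow> real \<Rightarrow> 'a l2 \<Rightarrow> 'a l2" where
  "extend \<Omega> S t F = emb \<Omega> (S t (rep_l2 F)) + mul (indicator (- \<Omega>)) F"

lemma indicator_extend:
  assumes op: "open \<Omega>" and C: "C0_semigroup \<Omega> S" and t: "t \<ge> 0"
  shows "mul (indicator \<Omega>) (extend \<Omega> S t F) = emb \<Omega> (S t (rep_l2 F))"
    and "mul (indicator (- \<Omega>)) (extend \<Omega> S t F) = mul (indicator (- \<Omega>)) F"
proof -
  have m: "\<Omega> \<in> sets borel" "- \<Omega> \<in> sets borel" using op by auto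
  note BL = bounded_linear_mul[OF bmeas_indicator[OF m(1)]] bounded_linear_mul[OF bmeas_indicator[OF m(2)]]
  have "L2_bounded_operator \<Omega> (S t)" using C t unfolding C0_semigroup_def by blast
  then have L: "S t (rep_l2 F) \<in> L2 \<Omega>" by (rule L2_bounded_operator_emb(1)[OF op _ sq_int_L2[OF op sq_int_rep]])
  note P = mul_indicator_emb[OF op L]
  have N: "mul (indicator (- \<Omega>)) (emb \<Omega> (S t (rep_l2 F))) = 0"
    by (subst P[symmetric]) (simp add: mul_indicator_mul_indicator[OF m(2,1)] mul_indicator_empty)
  have N': "mul (indicator \<Omega>) (mul (indicator (- \<Omega>)) F) = 0"
    by (simp add: mul_indicator_mul_indicator[OF m] mul_indicator_empty)
  show "mul (indicator \<Omega>) (extend \<Omega> S t F) = emb \<Omega> (S t (rep_l2 F))"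
    unfolding extend_def mul_add[OF bmeas_indicator[OF m(1)]] P N' by simp
  show "mul (indicator (- \<Omega>)) (extend \<Omega> S t F) = mul (indicator (- \<Omega>)) F"
    unfolding extend_def mul_add[OF bmeas_indicator[OF m(2)]] N
    by (simp add: mul_indicator_mul_indicator[OF m(2,2)])
qed

text \<open>On \<Omega> each law is inherited from S because S respects classes; on the complement
  the operator is the identity, and the two parts do not interact.\<close>

lemma extend_semigroup:
  assumes op: "open \<Omega>" and C: "C0_semigroup \<Omega> S"
  shows "strongly_continuous_semigroup (extend \<Omega> S)"
proof (rule strongly_continuous_semigroup.intro)
  have m: "\<Omega> \<in> sets borel" "- \<Omega> \<in> sets borel" using op by auto
  note bm = bmeas_indicator[OF m(1)] bmeas_indicator[OF m(2)]
  have rL: "rep_l2 F \<in> L2 \<Omega>" for F :: "'a l2" by (rule sq_int_L2[OF op sq_int_rep])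
  have B: "L2_bounded_operator \<Omega> (S t)" if "t \<ge> 0" for t using C that unfolding C0_semigroup_def by blast
  note O = L2_bounded_operator_emb[OF op B]
  show "bounded_linear (extend \<Omega> S t)" if t: "t \<ge> 0" for t
  proof -
    obtain K where K: "K \<ge> 0" "\<And>f. f \<in> L2 \<Omega> \<Longrightarrow> norm (emb \<Omega> (S t f)) \<le> K * norm (emb \<Omega> f)"
      using O(5)[OF t] by blast
    have 1: "bounded_linear (\<lambda>F. emb \<Omega> (S t (rep_l2 F)))"
    proof (rule bounded_linear_intro)
      fix F G :: "'a l2" and c :: real
      have "emb \<Omega> (rep_l2 (F + G)) = emb \<Omega> (\<lambda>x. rep_l2 F x + rep_l2 G x)"
        by (simp add: emb_rep[OF op] emb_add[OF rL rL] mul_add[OF bm(1)])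
      then have "emb \<Omega> (S t (rep_l2 (F + G))) = emb \<Omega> (S t (\<lambda>x. rep_l2 F x + rep_l2 G x))"
        by (rule O(4)[OF t rL L2_add[OF rL rL]])
      then show "emb \<Omega> (S t (rep_l2 (F + G))) = emb \<Omega> (S t (rep_l2 F)) + emb \<Omega> (S t (rep_l2 G))"
        by (simp only: O(2)[OF t rL rL])
      have "emb \<Omega> (rep_l2 (c *\<^sub>R F)) = emb \<Omega> (\<lambda>x. of_real c * rep_l2 F x)"
        by (simp add: emb_rep[OF op] emb_of_real[OF rL] mul_scaleR[OF bm(1)])
      then have "emb \<Omega> (S t (rep_l2 (c *\<^sub>R F))) = emb \<Omega> (S t (\<lambda>x. of_real c * rep_l2 F x))"
        by (rule O(4)[OF t rL L2_cmult[OF rL]])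
      then show "emb \<Omega> (S t (rep_l2 (c *\<^sub>R F))) = c *\<^sub>R emb \<Omega> (S t (rep_l2 F))"
        by (simp only: O(3)[OF t rL])
      have "norm (emb \<Omega> (S t (rep_l2 F))) \<le> K * norm (mul (indicator \<Omega>) F)"
        using K(2)[OF rL[of F]] by (simp add: emb_rep[OF op])
      also have "\<dots> \<le> K * (1 * norm F)"
        by (rule mult_left_mono[OF norm_mul_le[OF bm(1)] K(1)]) (simp add: indicator_def)
      finally show "norm (emb \<Omega> (S t (rep_l2 F))) \<le> norm F * K" by (simp add: mult.commute)
    qed
    show ?thesis
      unfolding extend_def[abs_def] by (rule bounded_linear_add[OF 1 bounded_linear_mul[OF bm(2)]])
  qed
  show "extend \<Omega> S 0 F = F" for F
  proof -
    have "AE x\<in>\<Omega> in lborel. S 0 (rep_l2 F) x = rep_l2 F x" using C rL unfolding C0_semigroup_def by blast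
    then have "emb \<Omega> (S 0 (rep_l2 F)) = emb \<Omega> (rep_l2 F)" by (rule emb_AE_cong[OF O(1)[OF order_refl rL] rL])
    then show ?thesis by (simp add: extend_def emb_rep[OF op] mul_indicator_split[OF op])
  qed
  show "extend \<Omega> S (s + t) F = extend \<Omega> S s (extend \<Omega> S t F)" if st: "s \<ge> 0" "t \<ge> 0" for s t F
  proof -
    have SL: "S t (rep_l2 F) \<in> L2 \<Omega>" by (rule O(1)[OF st(2) rL])
    have "emb \<Omega> (rep_l2 (extend \<Omega> S t F)) = emb \<Omega> (S t (rep_l2 F))"
      by (simp add: emb_rep[OF op] indicator_extend(1)[OF op C st(2)])
    then have 1: "emb \<Omega> (S s (rep_l2 (extend \<Omega> S t F))) = emb \<Omega> (S s (S t (rep_l2 F)))"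
      by (rule O(4)[OF st(1) rL SL])
    have "AE x\<in>\<Omega> in lborel. S (s + t) (rep_l2 F) x = S s (S t (rep_l2 F)) x"
      using C st rL unfolding C0_semigroup_def by blast
    then have 2: "emb \<Omega> (S (s + t) (rep_l2 F)) = emb \<Omega> (S s (S t (rep_l2 F)))"
      by (rule emb_AE_cong[OF O(1)[OF add_nonneg_nonneg[OF st] rL] O(1)[OF st(1) SL]])
    show ?thesis
      unfolding extend_def[of \<Omega> S s] extend_def[of \<Omega> S "s + t"] 1 2 indicator_extend(2)[OF op C st(2)] by (rule refl)
  qed
  show "((\<lambda>t. extend \<Omega> S t F) \<longlongrightarrow> F) (at_right 0)" for F
  proof -
    have "((\<lambda>t. L2_norm \<Omega> (\<lambda>x. S t (rep_l2 F) x - rep_l2 F x)) \<longlongrightarrow> 0) (at_right 0)"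
      using C rL unfolding C0_semigroup_def by blast
    then have "((\<lambda>t. norm (extend \<Omega> S t F - F)) \<longlongrightarrow> 0) (at_right 0)"
    proof (rule Lim_transform_eventually)
      show "\<forall>\<^sub>F t in at_right 0. L2_norm \<Omega> (\<lambda>x. S t (rep_l2 F) x - rep_l2 F x) = norm (extend \<Omega> S t F - F)"
      proof (rule eventually_mono[OF eventually_at_right_less])
        fix t :: real assume t: "0 < t"
        have SL: "S t (rep_l2 F) \<in> L2 \<Omega>" using t by (intro O(1)[OF _ rL]) simp
        have "emb \<Omega> (\<lambda>x. S t (rep_l2 F) x - rep_l2 F x) = emb \<Omega> (S t (rep_l2 F)) - mul (indicator \<Omega>) F"
          by (simp add: emb_diff[OF SL rL] emb_rep[OF op])
        also have "\<dots> = extend \<Omega> S t F - F"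
          by (subst (2) mul_indicator_split[OF op, of F, symmetric]) (simp add: extend_def)
        finally show "L2_norm \<Omega> (\<lambda>x. S t (rep_l2 F) x - rep_l2 F x) = norm (extend \<Omega> S t F - F)"
          by (simp add: L2_norm_emb[OF L2_diff[OF SL rL]])
      qed
    qed
    then show ?thesis by (simp add: tendsto_norm_zero_iff LIM_zero_iff)
  qed
qed

text \<open>The difference quotient of the extended semigroup restricts on \<Omega> to that of S. So
  the restriction of a pair in the abstract generator lies in the generator of S, hence in the graph
  of the shifted Laplacian, and domain elements solve the weak equation.\<close>

lemma generator_weak_eq:
  assumes op: "open \<Omega>" and gs: "generates \<Omega> (shifted_laplacian \<Omega> E) S"
    and g: "strongly_continuous_semigroup.gen (extend \<Omega> S) g y"
  shows "\<exists>G. weak_eq \<Omega> E (mul (indicator \<Omega>) g) G (mul (indicator \<Omega>) y)"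
proof -
  have C: "C0_semigroup \<Omega> S" using gs by (simp add: generates_def)
  interpret strongly_continuous_semigroup "extend \<Omega> S" by (rule extend_semigroup[OF op C])
  have m: "\<Omega> \<in> sets borel" using op by auto
  note bm = bmeas_indicator[OF m]
  have rL: "rep_l2 F \<in> L2 \<Omega>" for F :: "'a l2" by (rule sq_int_L2[OF op sq_int_rep])
  define f where "f = rep_l2 g"
  define z where "z = rep_l2 y"
  have fL: "f \<in> L2 \<Omega>" and zL: "z \<in> L2 \<Omega>" by (simp_all add: f_def z_def rL)
  have ef: "emb \<Omega> f = mul (indicator \<Omega>) g" and ez: "emb \<Omega> z = mul (indicator \<Omega>) y"
    by (simp_all add: f_def z_def emb_rep[OF op])
  have lim: "((\<lambda>h. (extend \<Omega> S h g - g) /\<^sub>R h) \<longlongrightarrow> y) (at_right 0)" using g by (simp add: gen_def)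
  have "((\<lambda>h. norm (mul (indicator \<Omega>) ((extend \<Omega> S h g - g) /\<^sub>R h) - mul (indicator \<Omega>) y)) \<longlongrightarrow> norm (mul (indicator \<Omega>) y - mul (indicator \<Omega>) y)) (at_right 0)"
    by (intro tendsto_norm tendsto_diff bounded_linear.tendsto[OF bounded_linear_mul[OF bm] lim] tendsto_const)
  then have lim0: "((\<lambda>h. norm (mul (indicator \<Omega>) ((extend \<Omega> S h g - g) /\<^sub>R h) - mul (indicator \<Omega>) y)) \<longlongrightarrow> 0) (at_right 0)" by simp
  have "generator \<Omega> S f z"
    unfolding generator_def
  proof (intro conjI fL zL Lim_transform_eventually[OF lim0])
    show "\<forall>\<^sub>F h in at_right 0. norm (mul (indicator \<Omega>) ((extend \<Omega> S h g - g) /\<^sub>R h) - mul (indicator \<Omega>) y)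
        = L2_norm \<Omega> (\<lambda>x. (S h f x - f x) / of_real h - z x)"
    proof (rule eventually_mono[OF eventually_at_right_less])
      fix h :: real assume h: "0 < h"
      have SL: "S h f \<in> L2 \<Omega>"
        using C h fL L2_bounded_operator_emb(1)[OF op] unfolding C0_semigroup_def by (meson less_imp_le)
      have eq: "(\<lambda>x. (S h f x - f x) / of_real h - z x) = (\<lambda>x. of_real (inverse h) * (S h f x - f x) - z x)"
        by (simp add: divide_inverse mult.commute)
      have "emb \<Omega> (\<lambda>x. of_real (inverse h) * (S h f x - f x) - z x)
          = inverse h *\<^sub>R (emb \<Omega> (S h f) - emb \<Omega> f) - emb \<Omega> z"
        by (simp only: emb_diff[OF L2_cmult[OF L2_diff[OF SL fL]] zL] emb_of_real[OF L2_diff[OF SL fL]] emb_diff[OF SL fL])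
      also have "emb \<Omega> (S h f) = mul (indicator \<Omega>) (extend \<Omega> S h g)"
        using indicator_extend(1)[OF op C] h by (simp add: f_def)
      also have "inverse h *\<^sub>R (mul (indicator \<Omega>) (extend \<Omega> S h g) - emb \<Omega> f) - emb \<Omega> z
          = mul (indicator \<Omega>) ((extend \<Omega> S h g - g) /\<^sub>R h) - mul (indicator \<Omega>) y"
        unfolding ef ez mul_scaleR[OF bm]
        by (simp add: linear_diff[OF bounded_linear.linear[OF bounded_linear_mul[OF bm]]])
      finally show "norm (mul (indicator \<Omega>) ((extend \<Omega> S h g - g) /\<^sub>R h) - mul (indicator \<Omega>) y)
        = L2_norm \<Omega> (\<lambda>x. (S h f x - f x) / of_real h - z x)"
        unfolding eq by (simp add: L2_norm_emb[OF L2_diff[OF L2_cmult[OF L2_diff[OF SL fL]] zL]])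
    qed
  qed
  then have "shifted_laplacian \<Omega> E f z" using gs by (simp add: generates_def)
  then have d: "dirichlet_laplacian \<Omega> f (\<lambda>x. of_real E * f x - z x)" by (simp add: shifted_laplacian_def)
  then have fH: "f \<in> H10 \<Omega>" by (simp add: dirichlet_laplacian_def)
  have "weak_eq \<Omega> E (emb \<Omega> f) (\<lambda>b. emb \<Omega> (weak_partial \<Omega> b f)) (emb \<Omega> z)"
    unfolding weak_eq_def
  proof (intro conjI allI impI)
    show "h10 \<Omega> (emb \<Omega> f) (\<lambda>b. emb \<Omega> (weak_partial \<Omega> b f))" by (rule h10_of_H10[OF op fH])
    fix V H assume "h10 \<Omega> V H"
    from dirichlet_laplacian_h10[OF op d this]
    show "(\<Sum>b\<in>Basis. inner (H b) (emb \<Omega> (weak_partial \<Omega> b f))) = inner V (E *\<^sub>R emb \<Omega> f - emb \<Omega> z)"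
      by (simp add: emb_diff[OF L2_cmult[OF fL] zL] emb_of_real[OF fL])
  qed
  then show ?thesis unfolding ef ez by blast
qed

section \<open>Weighted decay for initial data in the generator domain\<close>

lemma elementary_measurable:
  assumes "f \<in> elementary" shows "f \<in> borel_measurable borel"
proof -
  obtain f' where "\<And>x. (f has_real_derivative f' x) (at x)" using elementary_deriv[OF assms] by blast
  then have "isCont f x" for x by (rule DERIV_isCont)
  then show ?thesis by (intro borel_measurable_continuous_onI continuous_at_imp_continuous_on) blast
qed

text \<open>Three properties govern the choice: its product with sqrt (1 + x^2) is bounded, so cut
  off elements have finite weighted norm; for \<eta> > 0 its logarithmic derivative is at most
  \<eta> in modulus; and it is rational without poles, hence elementary. \<open>cutoff'\<close> is
  written as logarithmic derivative times \<open>cutoff\<close>, the form in which it is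
  estimated.\<close>

definition cutoff :: "real \<Rightarrow> real \<Rightarrow> real" where "cutoff \<eta> x = inverse (1 + \<eta>\<^sup>2 * x\<^sup>2)"
definition cutoff' :: "real \<Rightarrow> real \<Rightarrow> real" where "cutoff' \<eta> x = (- 2 * \<eta>\<^sup>2 * x * cutoff \<eta> x) * cutoff \<eta> x"

lemma cutoff_den: "1 + \<eta>\<^sup>2 * x\<^sup>2 \<ge> (1::real)"
  by simp

lemma cutoff_bounds: "0 < cutoff \<eta> x" "cutoff \<eta> x \<le> 1"
proof -
  have "0 < 1 + \<eta>\<^sup>2 * x\<^sup>2" using cutoff_den[of \<eta> x] by linarith
  then show "0 < cutoff \<eta> x" unfolding cutoff_def by (rule positive_imp_inverse_positive)
  show "cutoff \<eta> x \<le> 1" unfolding cutoff_def using le_imp_inverse_le[OF cutoff_den[of \<eta> x]] by simp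
qed

lemma cutoff_deriv: "(cutoff \<eta> has_real_derivative cutoff' \<eta> x) (at x)"
proof -
  have n: "1 + \<eta>\<^sup>2 * x\<^sup>2 \<noteq> 0" using cutoff_den[of \<eta> x] by linarith
  have "((\<lambda>x. 1 + \<eta>\<^sup>2 * x\<^sup>2) has_real_derivative 2 * \<eta>\<^sup>2 * x) (at x)" by (auto intro!: derivative_eq_intros)
  from DERIV_inverse'[OF this n] show ?thesis
    unfolding cutoff_def[abs_def] cutoff'_def by (simp add: mult_ac)
qed

lemma cutoff_elementary: "cutoff \<eta> \<in> elementary"
  unfolding cutoff_def[abs_def]
proof (rule elementary.inv)
  show "(\<lambda>x. 1 + \<eta>\<^sup>2 * x\<^sup>2) \<in> elementary"
    by (rule elementary.add[OF elementary.const elementary.mult[OF elementary.const elementary_power[OF elementary.ident]]])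
  show "1 + \<eta>\<^sup>2 * x\<^sup>2 \<noteq> 0" for x using cutoff_den[of \<eta> x] by linarith
qed

lemma cutoff_log_deriv: "\<eta> > 0 \<Longrightarrow> \<bar>- 2 * \<eta>\<^sup>2 * x * cutoff \<eta> x\<bar> \<le> \<eta>"
proof -
  assume e: "\<eta> > 0"
  have p: "0 < 1 + \<eta>\<^sup>2 * x\<^sup>2" using cutoff_den[of \<eta> x] by linarith
  have "2 * (\<eta> * \<bar>x\<bar>) \<le> 1 + \<eta>\<^sup>2 * x\<^sup>2"
    using sum_squares_bound[of 1 "\<eta> * \<bar>x\<bar>"] by (simp add: power_mult_distrib)
  then have "\<eta> * (2 * (\<eta> * \<bar>x\<bar>)) \<le> \<eta> * (1 + \<eta>\<^sup>2 * x\<^sup>2)" using e by (intro mult_left_mono) auto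
  then have "\<eta> * (2 * (\<eta> * \<bar>x\<bar>)) * cutoff \<eta> x \<le> \<eta>"
    using p by (simp add: cutoff_def divide_inverse[symmetric] pos_divide_le_eq)
  moreover have "\<bar>- 2 * \<eta>\<^sup>2 * x * cutoff \<eta> x\<bar> = \<eta> * (2 * (\<eta> * \<bar>x\<bar>)) * cutoff \<eta> x"
    using e cutoff_bounds(1)[of \<eta> x] by (simp add: abs_mult power2_eq_square)
  ultimately show ?thesis by simp
qed

lemma cutoff_measurable [measurable]: "cutoff \<eta> \<in> borel_measurable borel"
  unfolding cutoff_def by measurable

lemma bfun_cutoff: "bfun (cutoff \<eta>)"
  by (rule bfunI[where B=1]) (simp_all add: abs_of_pos[OF cutoff_bounds(1)] cutoff_bounds(2))

lemma bfun_cutoff_log_deriv: "\<eta> > 0 \<Longrightarrow> bfun (\<lambda>x. - 2 * \<eta>\<^sup>2 * x * cutoff \<eta> x)"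
  by (rule bfunI[where B=\<eta>]) (use cutoff_log_deriv in auto)

lemma bfun_cutoff': "\<eta> > 0 \<Longrightarrow> bfun (cutoff' \<eta>)"
  unfolding cutoff'_def[abs_def] by (rule bfun_mult[OF bfun_cutoff_log_deriv bfun_cutoff])

text \<open>The cutoff is at most 1, so the mass of its square is at most that of the cutoff, a
  rescaled Cauchy density. This is the price of the additive constant in the heat profile.\<close>

lemma cutoff_mass:
  assumes e: "\<eta> > 0"
  shows "(\<integral>\<^sup>+x. ennreal ((cutoff \<eta> x)\<^sup>2) \<partial>lborel) \<le> ennreal (pi / \<eta>)"
proof -
  have "(\<integral>\<^sup>+x. ennreal ((cutoff \<eta> x)\<^sup>2) \<partial>lborel) \<le> (\<integral>\<^sup>+x. ennreal (cutoff \<eta> x) \<partial>lborel)"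
  proof (rule nn_integral_mono, rule ennreal_leI)
    fix x show "(cutoff \<eta> x)\<^sup>2 \<le> cutoff \<eta> x"
      using cutoff_bounds[of \<eta> x] by (simp add: power2_eq_square mult_left_le)
  qed
  also have "\<dots> = ennreal \<bar>1 / \<eta>\<bar> * (\<integral>\<^sup>+x. ennreal (cutoff \<eta> (0 + (1 / \<eta>) * x)) \<partial>lborel)"
    by (rule nn_integral_real_affine) (use e in auto)
  also have "(\<integral>\<^sup>+x. ennreal (cutoff \<eta> (0 + (1 / \<eta>) * x)) \<partial>lborel) = (\<integral>\<^sup>+x. ennreal pi * ennreal (1 / (pi * (1 + x\<^sup>2))) \<partial>lborel)"
  proof (rule nn_integral_cong)
    fix x :: real
    have "\<eta>\<^sup>2 * ((1 / \<eta>) * x)\<^sup>2 = x\<^sup>2" using e by (simp add: power_divide)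
    then have "cutoff \<eta> (0 + (1 / \<eta>) * x) = inverse (1 + x\<^sup>2)" unfolding cutoff_def by (simp only: add_0)
    then have "cutoff \<eta> (0 + (1 / \<eta>) * x) = pi * (1 / (pi * (1 + x\<^sup>2)))" by (simp add: inverse_eq_divide)
    then show "ennreal (cutoff \<eta> (0 + (1 / \<eta>) * x)) = ennreal pi * ennreal (1 / (pi * (1 + x\<^sup>2)))"
      by (simp only: ennreal_mult'[OF pi_ge_zero])
  qed
  also have "\<dots> = ennreal pi * (\<integral>\<^sup>+x. ennreal (1 / (pi * (1 + x\<^sup>2))) \<partial>lborel)"
    by (rule nn_integral_cmult) measurable
  also have "ennreal \<bar>1 / \<eta>\<bar> * \<dots> \<le> ennreal \<bar>1 / \<eta>\<bar> * (ennreal pi * 1)"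
    by (intro mult_left_mono cauchy_mass) auto
  also have "\<dots> = ennreal (pi / \<eta>)" using e by (simp add: ennreal_mult'[symmetric])
  finally show ?thesis .
qed

section \<open>The Sobolev inequality for elements of the form domain\<close>

definition l2_sobolev :: "(real \<times> real) set \<Rightarrow> (real \<Rightarrow> real) \<Rightarrow> real \<Rightarrow> real \<Rightarrow> bool" where
  "l2_sobolev \<omega> \<theta> E c \<longleftrightarrow> (\<forall>\<Psi> \<in> H10 (tube \<omega> \<theta>) \<inter> L2_weighted (tube \<omega> \<theta>). \<not> zero_ae (tube \<omega> \<theta>) \<Psi> \<longrightarrow>
     (grad_norm (tube \<omega> \<theta>) \<Psi>)\<^sup>2 - E * (L2_norm (tube \<omega> \<theta>) \<Psi>)\<^sup>2
       \<ge> c * (L2_norm (tube \<omega> \<theta>) \<Psi> ^ 6 / norm_1 \<omega> \<theta> \<Psi> ^ 4))"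

text \<open>\<open>norm_1\<close> and the weighted space are defined on functions, so a
  representative v accompanies the class F.\<close>

lemma sobolev_h10:
  assumes \<omega>: "open \<omega>" and \<theta>: "continuous_on UNIV \<theta>" and sob: "l2_sobolev \<omega> \<theta> E c"
    and h: "h10 (tube \<omega> \<theta>) F G" and v: "sq_int v" "cls v = F" "v \<in> L2_weighted (tube \<omega> \<theta>)" and F: "F \<noteq> 0"
  shows "(\<Sum>b\<in>Basis. (norm (G b))\<^sup>2) - E * (norm F)\<^sup>2 \<ge> c * ((norm F) ^ 6 / norm_1 \<omega> \<theta> v ^ 4)"
proof -
  have op: "open (tube \<omega> \<theta>)" by (rule open_tube[OF \<omega> \<theta>])
  note H = H10_of_h10[OF op h v(1,2)]
  have vL: "v \<in> L2 (tube \<omega> \<theta>)" by (rule sq_int_L2[OF op v(1)])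
  have nz: "\<not> zero_ae (tube \<omega> \<theta>) v"
  proof
    assume "zero_ae (tube \<omega> \<theta>) v"
    then have "emb (tube \<omega> \<theta>) v = emb (tube \<omega> \<theta>) (\<lambda>x. 0)"
      by (rule emb_AE_cong[OF vL sq_int_L2[OF op sq_int_0]])
    then show False using F H(3) by (simp add: emb_def zero_l2_cls)
  qed
  have "(grad_norm (tube \<omega> \<theta>) v)\<^sup>2 = (\<Sum>b\<in>Basis. (norm (G b))\<^sup>2)"
    unfolding grad_norm_emb[OF H(2)] by (rule sum.cong[OF refl]) (simp add: H(4))
  moreover have "L2_norm (tube \<omega> \<theta>) v = norm F" by (simp add: L2_norm_emb[OF vL] H(3))
  ultimately show ?thesis using sob[unfolded l2_sobolev_def, rule_format, of v] H(1) v(3) nz by simp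
qed

lemma rho_inverse: "inverse (rho x) = sqrt (1 + (fst x)\<^sup>2)"
  by (simp add: rho_def)

lemma rho_measurable [measurable]: "rho \<in> borel_measurable borel"
proof -
  have [measurable]: "(fst :: real \<times> real \<times> real \<Rightarrow> real) \<in> borel_measurable borel"
    by (intro borel_measurable_continuous_onI continuous_intros)
  show ?thesis unfolding rho_def by measurable
qed

lemma test_L2_weighted:
  assumes op: "open \<Omega>" and \<phi>: "\<phi> \<in> test_functions \<Omega>"
  shows "\<phi> \<in> L2_weighted \<Omega>"
proof -
  obtain K B where K: "compact K" "\<And>x. x \<notin> K \<Longrightarrow> \<phi> x = 0" "\<And>x. norm (\<phi> x) \<le> B"
    using test_compact_support[OF \<phi>] by blast
  obtain r where r: "r > 0" "\<And>x. x \<in> K \<Longrightarrow> norm x \<le> r" using K(1) bounded_pos compact_imp_bounded by metis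
  have [measurable]: "\<phi> \<in> borel_measurable borel" by (rule test_measurable[OF \<phi>])
  have "sq_int (\<lambda>x. of_real (inverse (rho x)) * \<phi> x)"
  proof (rule sq_int_bounded_support[OF _ emeasure_bounded_finite[OF compact_imp_bounded[OF K(1)]] borel_compact[OF K(1)]])
    show "(\<lambda>x. of_real (inverse (rho x)) * \<phi> x) \<in> borel_measurable borel" by measurable
    show "of_real (inverse (rho x)) * \<phi> x = 0" if "x \<notin> K" for x using K(2)[OF that] by simp
    show "norm (of_real (inverse (rho x)) * \<phi> x) \<le> sqrt (1 + r\<^sup>2) * B" for x
    proof (cases "x \<in> K")
      case True
      have "\<bar>fst x\<bar> \<le> norm x" using norm_fst_le[of "fst x" "snd x"] by simp
      then have "\<bar>fst x\<bar> \<le> r" using r(2)[OF True] by linarith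
      then have "(fst x)\<^sup>2 \<le> r\<^sup>2" using r(1) abs_le_square_iff[of "fst x" r] by simp
      then have "sqrt (1 + (fst x)\<^sup>2) * norm (\<phi> x) \<le> sqrt (1 + r\<^sup>2) * B"
        by (intro mult_mono K(3)) auto
      then show ?thesis by (simp add: rho_inverse norm_mult)
    next
      case False
      have "0 \<le> B" using K(3)[of x] norm_ge_zero order_trans by blast
      then show ?thesis using K(2)[OF False] by simp
    qed
  qed
  then show ?thesis unfolding L2_weighted_def using sq_int_L2[OF op] by blast
qed

text \<open>The right side of the Sobolev inequality is nonnegative whatever the value of
  \<open>norm_1\<close>, so the shifted form is nonnegative on test functions. This is the input for
  the transversal Poincare inequality.\<close>

lemma form_nonneg:
  assumes \<omega>: "open \<omega>" and \<theta>: "continuous_on UNIV \<theta>" and sob: "l2_sobolev \<omega> \<theta> E c" and c: "c > 0"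
    and \<phi>: "\<phi> \<in> test_functions (tube \<omega> \<theta>)"
  shows "E * (norm (cls \<phi>))\<^sup>2 \<le> (\<Sum>b\<in>Basis. (norm (cls (partial b \<phi>)))\<^sup>2)"
proof (cases "cls \<phi> = 0")
  case True
  then show ?thesis by (simp add: sum_nonneg)
next
  case False
  have op: "open (tube \<omega> \<theta>)" by (rule open_tube[OF \<omega> \<theta>])
  have "0 \<le> c * ((norm (cls \<phi>)) ^ 6 / norm_1 \<omega> \<theta> \<phi> ^ 4)" using c by simp
  also have "\<dots> \<le> (\<Sum>b\<in>Basis. (norm (cls (partial b \<phi>)))\<^sup>2) - E * (norm (cls \<phi>))\<^sup>2"
    by (rule sobolev_h10[OF \<omega> \<theta> sob h10_test[OF \<phi>] test_sq_int[OF \<phi>] refl test_L2_weighted[OF op \<phi>] False])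
  finally show ?thesis by simp
qed

text \<open>\<open>norm_1\<close> of the cut off element is estimated with the kernel K = cutoff^2
  p. The quotient |cutoff U|^2 / K is |U|^2 / p, so the functional of the uncut solution appears,
  while the mass of K is at most 1 + \<delta> \<pi> / \<eta>: the constant \<delta>, not integrable
  by itself, is damped by cutoff^2.\<close>

lemma sobolev_cutoff:
  assumes \<omega>: "open \<omega>" and \<theta>: "continuous_on UNIV \<theta>" and sob: "l2_sobolev \<omega> \<theta> E c" and c: "c > 0"
    and \<eta>: "\<eta> > 0" and h: "h10 (tube \<omega> \<theta>) (mul (wt e1 (cutoff \<eta>)) U) H"
    and F: "mul (wt e1 (cutoff \<eta>)) U \<noteq> 0"
    and p: "p \<in> borel_measurable borel" "\<delta> > 0" "\<And>x. p x \<ge> \<delta>" "(\<integral>\<^sup>+x. ennreal (p x - \<delta>) \<partial>lborel) \<le> 1"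
    and I: "inner (mul (wt e1 (\<lambda>x. inverse (p x))) U) U \<le> I"
  defines "M \<equiv> (1 + \<delta> * (pi / \<eta>)) * I"
  shows "c * (norm (mul (wt e1 (cutoff \<eta>)) U)) ^ 6 / M\<^sup>2
     \<le> (\<Sum>b\<in>Basis. (norm (H b))\<^sup>2) - E * (norm (mul (wt e1 (cutoff \<eta>)) U))\<^sup>2"
proof -
  have op: "open (tube \<omega> \<theta>)" by (rule open_tube[OF \<omega> \<theta>])
  have pp: "p x > 0" for x using p(2) p(3)[of x] by linarith
  have [measurable]: "p \<in> borel_measurable borel" by (rule p(1))
  have qb: "bfun (\<lambda>x. inverse (p x))"
  proof (rule bfunI[where B="inverse \<delta>"])
    show "\<bar>inverse (p x)\<bar> \<le> inverse \<delta>" for x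
      using p(2) p(3)[of x] pp[of x] by (simp add: le_imp_inverse_le)
  qed simp
  note W = bmeas_wt[OF bfun_cutoff[of \<eta>], where e=e1] bmeas_wt[OF qb, where e=e1]
  define F where "F = mul (wt e1 (cutoff \<eta>)) U"
  define v where "v = rep_l2 F"
  have vs: "sq_int v" and vF: "cls v = F" by (simp_all add: v_def sq_int_rep)
  have vae: "AE x in lborel. v x = cutoff \<eta> (fst x) *\<^sub>R rep_l2 U x"
  proof -
    have "F = cls (\<lambda>x. cutoff \<eta> (x \<bullet> e1) *\<^sub>R rep_l2 U x)" by (simp add: F_def mul_def)
    then show ?thesis unfolding v_def using rep_cls[OF sq_int_mul[OF W(1) sq_int_rep[of U]]] by (simp add: inner_e1)
  qed
  have vm[measurable]: "v \<in> borel_measurable borel" using vs by (simp add: sq_int_def)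
  have Um[measurable]: "rep_l2 U \<in> borel_measurable borel" using sq_int_rep[of U] by (simp add: sq_int_def)
  have fm[measurable]: "(fst :: real \<times> real \<times> real \<Rightarrow> real) \<in> borel_measurable borel"
    by (intro borel_measurable_continuous_onI continuous_intros)
  have vw: "v \<in> L2_weighted (tube \<omega> \<theta>)"
  proof -
    have "sq_int (\<lambda>x. of_real (inverse (rho x)) * v x)"
    proof (rule sq_int_bound[OF sq_int_rep[of U], where C="1 + 1 / \<eta>"])
      show "(\<lambda>x. of_real (inverse (rho x)) * v x) \<in> borel_measurable lborel" by measurable
      \<comment> \<open>sqrt (1 + x^2) is at most 1 + |x|, and |x| is at most (1 + \<eta>^2 x^2) /
        \<eta> by the arithmetic-geometric mean inequality.\<close>
      have b: "sqrt (1 + x\<^sup>2) * cutoff \<eta> x \<le> 1 + 1 / \<eta>" for x :: real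
      proof -
        have q: "0 < 1 + \<eta>\<^sup>2 * x\<^sup>2" using cutoff_den[of \<eta> x] by linarith
        have "sqrt (1 + x\<^sup>2) \<le> sqrt 1 + sqrt (x\<^sup>2)" by (rule sqrt_add_le_add_sqrt) auto
        then have s: "sqrt (1 + x\<^sup>2) \<le> 1 + \<bar>x\<bar>" by simp
        have "2 * (\<eta> * \<bar>x\<bar>) \<le> 1 + \<eta>\<^sup>2 * x\<^sup>2"
          using sum_squares_bound[of 1 "\<eta> * \<bar>x\<bar>"] by (simp add: power_mult_distrib)
        then have "\<eta> * \<bar>x\<bar> \<le> 1 + \<eta>\<^sup>2 * x\<^sup>2" using q by linarith
        then have "\<bar>x\<bar> \<le> (1 / \<eta>) * (1 + \<eta>\<^sup>2 * x\<^sup>2)" using \<eta> by (simp add: pos_le_divide_eq mult.commute)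
        moreover have "1 \<le> 1 * (1 + \<eta>\<^sup>2 * x\<^sup>2)" using cutoff_den[of \<eta> x] by simp
        ultimately have "1 + \<bar>x\<bar> \<le> (1 + 1 / \<eta>) * (1 + \<eta>\<^sup>2 * x\<^sup>2)" unfolding distrib_right by linarith
        with s have "sqrt (1 + x\<^sup>2) \<le> (1 + 1 / \<eta>) * (1 + \<eta>\<^sup>2 * x\<^sup>2)" by linarith
        then show ?thesis using q by (simp add: cutoff_def divide_inverse[symmetric] pos_divide_le_eq)
      qed
      show "AE x in lborel. norm (of_real (inverse (rho x)) * v x) \<le> (1 + 1 / \<eta>) * norm (rep_l2 U x)"
        using vae
      proof eventually_elim
        case (elim x)
        have "norm (of_real (inverse (rho x)) * v x) = (sqrt (1 + (fst x)\<^sup>2) * cutoff \<eta> (fst x)) * norm (rep_l2 U x)"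
          using cutoff_bounds(1)[of \<eta> "fst x"] by (simp add: elim rho_inverse norm_mult)
        also have "\<dots> \<le> (1 + 1 / \<eta>) * norm (rep_l2 U x)" by (rule mult_right_mono[OF b]) simp
        finally show ?case .
      qed
    qed
    then show ?thesis unfolding L2_weighted_def using sq_int_L2[OF op] by blast
  qed
  define k where "k = 1 + \<delta> * (pi / \<eta>)"
  have k1: "k \<ge> 1" using p(2) \<eta> by (simp add: k_def)
  define K where "K x = (cutoff \<eta> x)\<^sup>2 * p x" for x
  have Km[measurable]: "K \<in> borel_measurable borel" unfolding K_def[abs_def] by measurable
  have Kp: "K x > 0" for x using cutoff_bounds(1)[of \<eta> x] pp[of x] by (simp add: K_def)
  have Kmass: "(\<integral>\<^sup>+x. ennreal (K x) \<partial>lborel) \<le> ennreal k"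
  proof -
    have "(\<integral>\<^sup>+x. ennreal (K x) \<partial>lborel) \<le> (\<integral>\<^sup>+x. ennreal (p x - \<delta>) + ennreal \<delta> * ennreal ((cutoff \<eta> x)\<^sup>2) \<partial>lborel)"
    proof (rule nn_integral_mono)
      fix x
      have "(cutoff \<eta> x)\<^sup>2 \<le> 1" using cutoff_bounds[of \<eta> x] by (simp add: power_le_one)
      then have "(cutoff \<eta> x)\<^sup>2 * (p x - \<delta>) \<le> 1 * (p x - \<delta>)" by (rule mult_right_mono) (use p(3)[of x] in simp)
      then have "K x \<le> (p x - \<delta>) + \<delta> * (cutoff \<eta> x)\<^sup>2" by (simp add: K_def algebra_simps)
      then have "ennreal (K x) \<le> ennreal ((p x - \<delta>) + \<delta> * (cutoff \<eta> x)\<^sup>2)" by (rule ennreal_leI)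
      also have "\<dots> = ennreal (p x - \<delta>) + ennreal (\<delta> * (cutoff \<eta> x)\<^sup>2)"
        by (rule ennreal_plus) (use p(2) p(3)[of x] in auto)
      finally show "ennreal (K x) \<le> ennreal (p x - \<delta>) + ennreal \<delta> * ennreal ((cutoff \<eta> x)\<^sup>2)"
        using p(2) by (simp add: ennreal_mult)
    qed
    also have "\<dots> = (\<integral>\<^sup>+x. ennreal (p x - \<delta>) \<partial>lborel) + ennreal \<delta> * (\<integral>\<^sup>+x. ennreal ((cutoff \<eta> x)\<^sup>2) \<partial>lborel)"
      by (subst nn_integral_add) (auto simp: nn_integral_cmult)
    also have "\<dots> \<le> 1 + ennreal \<delta> * ennreal (pi / \<eta>)"
      by (intro add_mono p(4) mult_left_mono cutoff_mass \<eta>) auto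
    also have "\<dots> = ennreal k"
      using p(2) \<eta> by (simp add: k_def ennreal_mult[symmetric] ennreal_plus[symmetric] ennreal_1[symmetric] del: ennreal_plus ennreal_1)
    finally show ?thesis .
  qed
  have Iint: "(\<integral>\<^sup>+z. indicator (tube \<omega> \<theta>) z * ennreal ((norm (v z))\<^sup>2 / K (fst z)) \<partial>lborel) \<le> ennreal I"
  proof -
    have "(\<integral>\<^sup>+z. indicator (tube \<omega> \<theta>) z * ennreal ((norm (v z))\<^sup>2 / K (fst z)) \<partial>lborel)
       \<le> (\<integral>\<^sup>+z. ennreal (inverse (p (z \<bullet> e1)) * inner (rep_l2 U z) (rep_l2 U z)) \<partial>lborel)"
    proof (rule nn_integral_mono_AE)
      show "AE z in lborel. indicator (tube \<omega> \<theta>) z * ennreal ((norm (v z))\<^sup>2 / K (fst z))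
          \<le> ennreal (inverse (p (z \<bullet> e1)) * inner (rep_l2 U z) (rep_l2 U z))"
        using vae
      proof eventually_elim
        case (elim z)
        have "(norm (v z))\<^sup>2 / K (fst z) = inverse (p (z \<bullet> e1)) * inner (rep_l2 U z) (rep_l2 U z)"
          using cutoff_bounds(1)[of \<eta> "fst z"] pp[of "fst z"]
          by (simp add: elim K_def inner_e1 power_mult_distrib power2_norm_eq_inner[symmetric] field_simps)
        then show ?case by (simp add: indicator_def)
      qed
    qed
    also have "\<dots> = ennreal (inner (mul (wt e1 (\<lambda>x. inverse (p x))) U) U)"
      unfolding inner_mul[OF W(2)]
      by (rule nn_integral_eq_integral[OF integrable_mul[OF W(2)]]) (simp add: less_imp_le[OF pp])
    also have "\<dots> \<le> ennreal I" by (rule ennreal_leI[OF I])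
    finally show ?thesis .
  qed
  have I0: "I \<ge> 0"
  proof -
    have "0 \<le> inner (mul (wt e1 (\<lambda>x. inverse (p x))) U) U"
      unfolding inner_mul[OF W(2)] by (rule integral_nonneg_AE) (simp add: less_imp_le[OF pp])
    with I show ?thesis by linarith
  qed
  have k0: "k \<ge> 0" using k1 by linarith
  note N = norm_1_estimates[OF \<theta> \<omega> vs Km Kp Kmass k0 Iint I0]
  have F0: "F \<noteq> 0" using F by (simp add: F_def)
  have eF: "emb (tube \<omega> \<theta>) v = F"
    using H10_of_h10(3)[OF op h[folded F_def] vs vF] .
  \<comment> \<open>The division by \<open>norm_1\<close> is genuine, so its upper bound may replace
    it in the denominator; the default value x / 0 = 0 would break this step.\<close>
  have n1: "norm_1 \<omega> \<theta> v \<noteq> 0" using N(2) eF F0 by auto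
  have n4: "norm_1 \<omega> \<theta> v ^ 4 \<le> M\<^sup>2"
  proof -
    have "norm_1 \<omega> \<theta> v ^ 4 = ((norm_1 \<omega> \<theta> v)\<^sup>2)\<^sup>2" by simp
    also have "\<dots> \<le> (k * I)\<^sup>2" by (rule power_mono[OF N(1)]) simp
    finally show ?thesis by (simp add: M_def k_def)
  qed
  have "c * (norm F) ^ 6 / M\<^sup>2 \<le> c * (norm F) ^ 6 / norm_1 \<omega> \<theta> v ^ 4"
  proof -
    have p4: "0 < norm_1 \<omega> \<theta> v ^ 4" using n1 by (simp add: zero_less_power_eq)
    have pM: "0 < M\<^sup>2" by (rule less_le_trans[OF p4 n4])
    show ?thesis by (rule divide_left_mono[OF n4 _ mult_pos_pos[OF pM p4]]) (use c in simp)
  qed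
  also have "\<dots> = c * ((norm F) ^ 6 / norm_1 \<omega> \<theta> v ^ 4)" by simp
  also have "\<dots> \<le> (\<Sum>b\<in>Basis. (norm (H b))\<^sup>2) - E * (norm F)\<^sup>2"
    by (rule sobolev_h10[OF \<omega> \<theta> sob h[folded F_def] vs vF vw F0])
  finally show ?thesis by (simp add: F_def)
qed

text \<open>Data in the generator domain make the orbit differentiable and each of its restrictions
  to the tube a solution of the weak equation, so the weighted functional and the cut off norm can
  be differentiated in time. The summand \<eta> in \<open>M\<close> keeps it positive when the
  functional starts at 0.\<close>

lemma domain_decay:
  assumes \<omega>: "open \<omega>" and \<theta>: "continuous_on UNIV \<theta>" "\<And>x. x \<ge> R \<Longrightarrow> \<theta> x = \<theta> R"
    and sob: "l2_sobolev \<omega> \<theta> E c" and c: "c > 0"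
    and gs: "generates (tube \<omega> \<theta>) (shifted_laplacian (tube \<omega> \<theta>) E) S"
    and g: "strongly_continuous_semigroup.gen (extend (tube \<omega> \<theta>) S) g y"
    and hp: "heat_profile p p1 p2 p3" and p: "\<delta> > 0" "\<And>t x. t \<ge> 0 \<Longrightarrow> p t x \<ge> \<delta>"
      "\<And>t. t \<ge> 0 \<Longrightarrow> (\<integral>\<^sup>+x. ennreal (p t x - \<delta>) \<partial>lborel) \<le> 1"
    and \<eta>: "\<eta> > 0" and t: "t \<ge> 0"
  defines "V \<equiv> \<lambda>t. mul (indicator (tube \<omega> \<theta>)) (extend (tube \<omega> \<theta>) S t g)"
  defines "M \<equiv> (1 + \<delta> * (pi / \<eta>)) * (inner (mul (wt e1 (\<lambda>x. inverse (p 0 x))) (V 0)) (V 0) + \<eta>)"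
  shows "(exp (- 2 * \<eta>\<^sup>2 * t) * (norm (mul (wt e1 (cutoff \<eta>)) (V t)))\<^sup>2)\<^sup>2 * (M\<^sup>2 + 4 * c * t * ((norm (V 0))\<^sup>2)\<^sup>2)
     \<le> ((norm (V 0))\<^sup>2)\<^sup>2 * M\<^sup>2"
proof -
  define \<Omega> where "\<Omega> = tube \<omega> \<theta>"
  have op: "open \<Omega>" unfolding \<Omega>_def by (rule open_tube[OF \<omega> \<theta>(1)])
  have C: "C0_semigroup \<Omega> S" using gs by (simp add: generates_def \<Omega>_def)
  interpret strongly_continuous_semigroup "extend \<Omega> S" by (rule extend_semigroup[OF op C])
  have g': "gen g y" using g by (simp add: \<Omega>_def)
  have bmi: "bmeas (indicator \<Omega> :: _ \<Rightarrow> real)" using op by (simp add: bmeas_indicator)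
  define A where "A s = mul (indicator \<Omega>) (extend \<Omega> S s y)" for s
  have V: "V s = mul (indicator \<Omega>) (extend \<Omega> S s g)" for s by (simp add: V_def \<Omega>_def)
  have dV: "(V has_vector_derivative A s) (at s within {0..})" if "s \<ge> 0" for s
    unfolding V[abs_def] A_def
    by (rule bounded_linear.has_vector_derivative[OF bounded_linear_mul[OF bmi] gen_has_vector_derivative[OF g' that]])
  have weq: "\<exists>G. weak_eq \<Omega> E (V s) G (A s)" if "s \<ge> 0" for s
    unfolding V A_def by (rule generator_weak_eq[OF op gs[folded \<Omega>_def] gen_T[OF g' that]])
  have tp: "transversal_poincare \<Omega> e1 E"
    unfolding \<Omega>_def
    by (rule transversal_poincare_tube[where R=R]) (erule form_nonneg[OF \<omega> \<theta>(1) sob c], erule \<theta>(2))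
  have b1: "e1 \<in> Basis" by (simp add: Basis_3)
  have hpD: "p s \<in> elementary" "p1 s \<in> elementary" "p2 s \<in> elementary"
    "\<And>x. (p s has_real_derivative p1 s x) (at x)" "\<And>x. (p1 s has_real_derivative p2 s x) (at x)" if "s \<ge> 0" for s
    using hp that unfolding heat_profile_def by blast+
  note elm = elementary_measurable
  obtain B where B: "\<And>s x. s \<ge> 0 \<Longrightarrow> \<bar>p1 s x\<bar> \<le> B \<and> \<bar>p2 s x\<bar> \<le> B \<and> \<bar>p3 s x\<bar> \<le> B"
    using hp unfolding heat_profile_def by blast
  have bp1: "bfun (p1 s)" and bp2: "bfun (p2 s)" if "s \<ge> 0" for s
    using B[OF that] by (auto intro!: bfunI[where B=B] elm hpD that)
  have bq: "bfun (\<lambda>x. inverse (p s x))" if "s \<ge> 0" for s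
  proof (rule bfunI[where B="inverse \<delta>"])
    have [measurable]: "p s \<in> borel_measurable borel" by (rule elm[OF hpD(1)[OF that]])
    show "(\<lambda>x. inverse (p s x)) \<in> borel_measurable borel" by measurable
    show "\<bar>inverse (p s x)\<bar> \<le> inverse \<delta>" for x
      using p(1) p(2)[OF that, of x] by (simp add: le_imp_inverse_le)
  qed
  define n where "n s x = - (p2 s x * inverse (p s x) ^ 2)" for s x
  have bn: "bfun (n s)" if "s \<ge> 0" for s
    using bfun_cmult[OF bfun_mult[OF bp2[OF that] bfun_power[OF bq[OF that]]], of "-1" 2] by (simp add: n_def[abs_def])
  define I where "I s = inner (mul (wt e1 (\<lambda>x. inverse (p s x))) (V s)) (V s)" for s
  obtain Cq where Cq: "\<And>s t x. s \<ge> 0 \<Longrightarrow> t \<ge> 0 \<Longrightarrow>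
     \<bar>inverse (p s x) - inverse (p t x) - (s - t) * (- (p2 t x * inverse (p t x) ^ 2))\<bar> \<le> Cq * (s - t)\<^sup>2"
    using heat_profile_recip[OF hp p(1,2)] by blast
  have dI: "(I has_real_derivative (2 * inner (mul (wt e1 (\<lambda>x. inverse (p s x))) (V s)) (A s)
      + inner (mul (wt e1 (n s)) (V s)) (V s))) (at s within {0..})" if s: "s \<ge> 0" for s
    unfolding I_def[abs_def]
    by (rule quadratic_form_derivative[OF dV[OF s] s bmeas_wt[OF bq] bmeas_wt[OF bn[OF s]]])
      (use Cq s in \<open>auto simp: n_def\<close>)
  \<comment> \<open>By the heat equation the time derivative of 1/p is - p2/p^2, so the derivative
    of the functional is the left side of \<open>heat_weight_inequality\<close>.\<close>
  have dI0: "2 * inner (mul (wt e1 (\<lambda>x. inverse (p s x))) (V s)) (A s) + inner (mul (wt e1 (n s)) (V s)) (V s) \<le> 0"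
    if s: "s \<ge> 0" for s
  proof -
    obtain G where G: "weak_eq \<Omega> E (V s) G (A s)" using weq[OF s] by blast
    have "2 * inner (mul (wt e1 (\<lambda>x. inverse (p s x))) (V s)) (A s)
        - inner (mul (wt e1 (\<lambda>x. p2 s x * inverse (p s x) ^ 2)) (V s)) (V s) \<le> 0"
      by (rule heat_weight_inequality[OF G b1 tp hpD[OF s] bp1[OF s] bp2[OF s] p(1) p(2)[OF s]])
    moreover have "mul (wt e1 (n s)) (V s) = - mul (wt e1 (\<lambda>x. p2 s x * inverse (p s x) ^ 2)) (V s)"
      using mul_cmult_left[OF bmeas_wt[OF bfun_mult[OF bp2[OF s] bfun_power[OF bq[OF s]]]], of "-1" e1 2 "V s"]
      by (simp add: n_def)
    ultimately show ?thesis by simp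
  qed
  have Ile: "I s \<le> I 0" if "s \<ge> 0" for s
    by (rule nonincreasing_of_derivative[OF dI dI0]) (use that in auto)
  have I0: "I 0 \<ge> 0"
    unfolding I_def inner_mul[OF bmeas_wt[OF bq[OF order_refl]]]
    by (rule integral_nonneg_AE) (use p(1) p(2)[OF order_refl] in \<open>simp add: order_trans[OF less_imp_le]\<close>)
  have M: "M = (1 + \<delta> * (pi / \<eta>)) * (I 0 + \<eta>)" by (simp add: M_def I_def)
  have Mp: "M > 0"
  proof -
    have "0 < 1 + \<delta> * (pi / \<eta>)" using \<eta> p(1) by (intro add_pos_nonneg) auto
    moreover have "0 < I 0 + \<eta>" using I0 \<eta> by linarith
    ultimately show ?thesis unfolding M by (rule mult_pos_pos)
  qed
  define w where "w = wt e1 (cutoff \<eta>)"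
  have bw: "bmeas w" unfolding w_def by (rule bmeas_wt[OF bfun_cutoff])
  have b2: "bfun (\<lambda>x. cutoff \<eta> x * cutoff \<eta> x)" by (rule bfun_mult[OF bfun_cutoff bfun_cutoff])
  define Y where "Y s = (norm (mul w (V s)))\<^sup>2" for s
  define Y' where "Y' s = 2 * inner (mul (wt e1 (\<lambda>x. cutoff \<eta> x * cutoff \<eta> x)) (V s)) (A s)" for s
  have Yeq: "Y s = inner (mul (wt e1 (\<lambda>x. cutoff \<eta> x * cutoff \<eta> x)) (V s)) (V s)" for s
    unfolding Y_def power2_norm_eq_inner mul_mul[OF bw bw, symmetric, unfolded w_def, folded w_def]
    using inner_mul_commute[OF bw, of "V s" "mul w (V s)"] inner_commute[of "V s"]
    by (simp add: w_def mul_mul[OF bw bw, unfolded w_def])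
  have dY: "(Y has_real_derivative Y' s) (at s within {0..})" if s: "s \<ge> 0" for s
  proof -
    have "((\<lambda>s. inner (mul (wt e1 (\<lambda>x. cutoff \<eta> x * cutoff \<eta> x)) (V s)) (V s)) has_real_derivative
        (2 * inner (mul (wt e1 (\<lambda>x. cutoff \<eta> x * cutoff \<eta> x)) (V s)) (A s) + inner (mul (\<lambda>x. 0) (V s)) (V s))) (at s within {0..})"
      by (rule quadratic_form_derivative[OF dV[OF s] s bmeas_wt[OF b2], where C=0]) (auto intro: bmeasI[where B=0])
    moreover have "mul (\<lambda>x. 0) (V s) = 0" by (simp add: mul_def zero_l2_cls)
    ultimately show ?thesis unfolding Yeq[abs_def] Y'_def by simp
  qed
  have Ynn: "Y s \<ge> 0" for s by (simp add: Y_def)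
  have Yz: "Y' s \<le> 0" if "s \<ge> 0" "Y s = 0" for s
  proof -
    have "mul w (V s) = 0" using that by (simp add: Y_def)
    then have "mul w (mul w (V s)) = 0"
      using linear_0[OF bounded_linear.linear[OF bounded_linear_mul[OF bw]]] by simp
    then have "mul (wt e1 (\<lambda>x. cutoff \<eta> x * cutoff \<eta> x)) (V s) = 0"
      unfolding mul_mul[OF bw bw] by (simp add: w_def)
    then show ?thesis by (simp add: Y'_def)
  qed
  \<comment> \<open>The Sobolev inequality for the cut off solution bounds the form from below; the
    localisation error is at most \<eta>^2 Y because the logarithmic derivative of the cutoff is at
    most \<eta>.\<close>
  have Yle: "Y' s \<le> - 2 * c * Y s ^ 3 / M\<^sup>2 + 2 * \<eta>\<^sup>2 * Y s" if s: "s \<ge> 0" and pos: "Y s > 0" for s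
  proof -
    obtain G where G: "weak_eq \<Omega> E (V s) G (A s)" using weq[OF s] by blast
    define H where "H b = mul (wt e1 (cutoff \<eta>)) (G b) + (b \<bullet> e1) *\<^sub>R mul (wt e1 (cutoff' \<eta>)) (V s)" for b
    note ci = cutoff_identity[OF G b1 cutoff_elementary cutoff_deriv bfun_cutoff bfun_cutoff'[OF \<eta>], folded H_def]
    have nz: "mul (wt e1 (cutoff \<eta>)) (V s) \<noteq> 0" using pos by (auto simp: Y_def w_def)
    have "I s \<le> I 0 + \<eta>" using Ile[OF s] \<eta> by simp
    then have Is: "inner (mul (wt e1 (\<lambda>x. inverse (p s x))) (V s)) (V s) \<le> I 0 + \<eta>" by (simp add: I_def)
    have "c * (norm (mul (wt e1 (cutoff \<eta>)) (V s))) ^ 6 / M\<^sup>2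
        \<le> (\<Sum>b\<in>Basis. (norm (H b))\<^sup>2) - E * (norm (mul (wt e1 (cutoff \<eta>)) (V s)))\<^sup>2"
      unfolding M
      by (rule sobolev_cutoff[OF \<omega> \<theta>(1) sob c \<eta> ci(1)[unfolded \<Omega>_def] nz elm[OF hpD(1)[OF s]] p(1) p(2)[OF s] p(3)[OF s] Is])
    moreover have "(norm (mul (wt e1 (cutoff \<eta>)) (V s))) ^ 6 = Y s ^ 3"
      by (simp add: Y_def w_def power_mult[symmetric])
    moreover have "(norm (mul (wt e1 (cutoff' \<eta>)) (V s)))\<^sup>2 \<le> \<eta>\<^sup>2 * Y s"
    proof -
      have bl: "bmeas (wt e1 (\<lambda>x. - 2 * \<eta>\<^sup>2 * x * cutoff \<eta> x))" by (rule bmeas_wt[OF bfun_cutoff_log_deriv[OF \<eta>]])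
      have "mul (wt e1 (cutoff' \<eta>)) (V s) = mul (wt e1 (\<lambda>x. - 2 * \<eta>\<^sup>2 * x * cutoff \<eta> x)) (mul w (V s))"
        unfolding mul_mul[OF bl bw] by (rule mul_cong_fun) (simp add: cutoff'_def w_def)
      then have "norm (mul (wt e1 (cutoff' \<eta>)) (V s)) \<le> \<eta> * norm (mul w (V s))"
        using norm_mul_le[OF bl, of \<eta>] cutoff_log_deriv[OF \<eta>] by simp
      then have "(norm (mul (wt e1 (cutoff' \<eta>)) (V s)))\<^sup>2 \<le> (\<eta> * norm (mul w (V s)))\<^sup>2" by (rule power_mono) simp
      then show ?thesis by (simp add: Y_def power_mult_distrib)
    qed
    moreover have "(norm (mul (wt e1 (cutoff \<eta>)) (V s)))\<^sup>2 = Y s" by (simp only: Y_def w_def)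
    ultimately have 1: "c * Y s ^ 3 / M\<^sup>2 \<le> (\<Sum>b\<in>Basis. (norm (H b))\<^sup>2) - E * Y s"
      and 2: "(norm (mul (wt e1 (cutoff' \<eta>)) (V s)))\<^sup>2 \<le> \<eta>\<^sup>2 * Y s"
      and 3: "Y' s = 2 * (E * Y s - (\<Sum>b\<in>Basis. (norm (H b))\<^sup>2) + (norm (mul (wt e1 (cutoff' \<eta>)) (V s)))\<^sup>2)"
      unfolding Y'_def ci(2) by (simp_all only:)
    have "- 2 * c * Y s ^ 3 / M\<^sup>2 + 2 * \<eta>\<^sup>2 * Y s = 2 * (\<eta>\<^sup>2 * Y s) - 2 * (c * Y s ^ 3 / M\<^sup>2)" by simp
    with 1 2 3 show ?thesis by argo
  qed
  have "Y 0 \<le> (norm (V 0))\<^sup>2"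
  proof -
    have "norm (mul w (V 0)) \<le> 1 * norm (V 0)"
      by (rule norm_mul_le[OF bw]) (simp add: w_def abs_of_pos[OF cutoff_bounds(1)] cutoff_bounds(2))
    then show ?thesis unfolding Y_def by (intro power_mono) auto
  qed
  from cubic_decay[OF dY Yle Ynn Yz c Mp zero_le_power2 this t]
  show ?thesis by (simp only: Y_def w_def mult.assoc)
qed


section \<open>Removal of the regularisations\<close>

text \<open>For positive quantities the bound reads 1/X \<ge> 1/Z^2 + a/M^2, which weakens as Z and
  M grow. The argument is multiplied out because Z0 and X may be 0.\<close>

lemma decay_bound_mono:
  fixes X :: real
  assumes "X * (M0\<^sup>2 + a * Z0\<^sup>2) \<le> Z0\<^sup>2 * M0\<^sup>2" "a \<ge> 0" "X \<ge> 0" "0 < M0" "M0 \<le> M" "0 \<le> Z0" "Z0 \<le> Z"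
  shows "X * (M\<^sup>2 + a * Z\<^sup>2) \<le> Z\<^sup>2 * M\<^sup>2"
proof -
  define m where "m = M0\<^sup>2"
  define m' where "m' = M\<^sup>2"
  define z where "z = Z0\<^sup>2"
  define z' where "z' = Z\<^sup>2"
  have m: "0 < m" "m \<le> m'" using assms by (auto simp: m_def m'_def intro: power_mono)
  have z: "0 \<le> z" "z \<le> z'" using assms by (auto simp: z_def z'_def intro: power_mono)
  have 0: "X * m + X * (a * z) \<le> z * m" using assms(1) by (simp add: m_def z_def distrib_left)
  have "0 \<le> X * (a * z)" using assms z by simp
  then have "X * m \<le> z * m" using 0 by linarith
  then have Xz: "X \<le> z" using m by simp
  then have "X * (m' - m) \<le> z * (m' - m)" using m by (intro mult_right_mono) auto
  then have 1: "X * m' + X * (a * z) \<le> z * m'" using 0 by (simp add: right_diff_distrib)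
  have "X * m' + X * (a * z') \<le> z' * m'"
  proof (cases "z = 0")
    case True
    then have "X = 0" using Xz assms(3) by simp
    then show ?thesis using z m by simp
  next
    case False
    then have zp: "z > 0" using z by simp
    have "z * (X * m' + X * (a * z')) = z * (X * m') + z' * (X * (a * z))" by (simp add: algebra_simps)
    also have "\<dots> \<le> z' * (X * m') + z' * (X * (a * z))"
      using z m assms(3) by (intro add_right_mono mult_right_mono) auto
    also have "\<dots> = z' * (X * m' + X * (a * z))" by (simp add: algebra_simps)
    also have "\<dots> \<le> z' * (z * m')" using 1 z by (intro mult_left_mono) auto
    also have "\<dots> = z * (z' * m')" by (simp add: mult.left_commute)
    finally show ?thesis using zp by simp
  qed
  then show ?thesis by (simp add: m'_def z'_def distrib_left)
qed

text \<open>Everything follows from \<rho>^(-2) = 1 + x1^2 \<ge> 1. The third part bounds the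
  functional at time 0: there q will be 1/p, which is at most \<pi> (1 + x1^2) because p lies above
  the Cauchy density.\<close>

lemma L2_weighted_L2:
  assumes op: "open \<Omega>" and \<Psi>: "\<Psi> \<in> L2_weighted \<Omega>"
  shows "\<Psi> \<in> L2 \<Omega>" and "norm (emb \<Omega> \<Psi>) \<le> L2_weighted_norm \<Omega> \<Psi>"
    and "\<lbrakk>bfun q; \<And>x. 0 \<le> q x; \<And>x. q x \<le> pi * (1 + x\<^sup>2)\<rbrakk> \<Longrightarrow>
      inner (mul (wt e1 q) (emb \<Omega> \<Psi>)) (emb \<Omega> \<Psi>) \<le> pi * (L2_weighted_norm \<Omega> \<Psi>)\<^sup>2"
proof -
  define r where "r x = inverse (rho x)" for x
  define f where "f x = indicator \<Omega> x *\<^sub>R \<Psi> x" for x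
  define h where "h x = indicator \<Omega> x *\<^sub>R (of_real (r x) * \<Psi> x)" for x
  have wL: "(\<lambda>x. of_real (r x) * \<Psi> x) \<in> L2 \<Omega>" using \<Psi> by (simp add: L2_weighted_def r_def)
  then have hs: "sq_int h" unfolding L2_iff h_def[abs_def] .
  have r1: "r x \<ge> 1" and r2: "(r x)\<^sup>2 = 1 + (fst x)\<^sup>2" for x
    by (simp_all add: r_def rho_inverse)
  have rp: "r x > 0" for x using r1[of x] by linarith
  have [measurable]: "h \<in> borel_measurable borel" using hs by (simp add: sq_int_def)
  have fh: "f x = of_real (rho x) * h x" for x
  proof -
    have "rho x * r x = 1" using rp[of x] by (simp add: r_def)
    then show ?thesis by (simp add: f_def h_def indicator_def mult.assoc[symmetric] of_real_mult[symmetric] del: of_real_mult)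
  qed
  have fm[measurable]: "f \<in> borel_measurable borel" unfolding fh[abs_def] by measurable
  have nh: "norm (h x) = r x * norm (f x)" for x using rp[of x] by (simp add: f_def h_def norm_mult indicator_def)
  have le: "norm (f x) \<le> norm (h x)" for x
    unfolding nh using mult_right_mono[OF r1[of x], of "norm (f x)"] by simp
  have fs: "sq_int f" by (rule sq_int_bound[OF hs, where C=1]) (use le in simp_all)
  then show L: "\<Psi> \<in> L2 \<Omega>" unfolding L2_iff f_def[abs_def] .
  have wn: "L2_weighted_norm \<Omega> \<Psi> = norm (cls h)"
    unfolding L2_weighted_norm_def r_def[symmetric] L2_norm_emb[OF wL] by (simp add: emb_def h_def[abs_def])
  have ef: "emb \<Omega> \<Psi> = cls f" by (simp add: emb_def f_def[abs_def])
  show "norm (emb \<Omega> \<Psi>) \<le> L2_weighted_norm \<Omega> \<Psi>"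
    unfolding wn ef by (rule cls_norm_eq_mono[OF fs hs]) (simp add: le)
  assume q: "bfun q" and q0: "\<And>x. 0 \<le> q x" and q1: "\<And>x. q x \<le> pi * (1 + x\<^sup>2)"
  have W: "bmeas (wt e1 q)" by (rule bmeas_wt[OF q])
  have "inner (mul (wt e1 q) (cls f)) (cls f) = (LINT x|lborel. q (x \<bullet> e1) * inner (f x) (f x))"
    by (rule inner_mul_cls[OF W fs fs])
  also have "\<dots> \<le> (LINT x|lborel. pi * (norm (h x))\<^sup>2)"
  proof (rule integral_mono)
    show "integrable lborel (\<lambda>x. q (x \<bullet> e1) * inner (f x) (f x))"
      using integrable_sq_int_inner[OF sq_int_mul[OF W fs] fs] by simp
    show "integrable lborel (\<lambda>x. pi * (norm (h x))\<^sup>2)" using hs by (simp add: sq_int_def)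
    fix x
    have "q (fst x) * (norm (f x))\<^sup>2 \<le> pi * (1 + (fst x)\<^sup>2) * (norm (f x))\<^sup>2" by (rule mult_right_mono[OF q1]) simp
    also have "\<dots> = pi * (norm (h x))\<^sup>2" unfolding nh power_mult_distrib r2 by simp
    finally show "q (x \<bullet> e1) * inner (f x) (f x) \<le> pi * (norm (h x))\<^sup>2" by (simp add: inner_e1 power2_norm_eq_inner)
  qed
  also have "\<dots> = pi * (norm (cls h))\<^sup>2" unfolding norm_cls[OF hs] by simp
  finally show "inner (mul (wt e1 q) (emb \<Omega> \<Psi>)) (emb \<Omega> \<Psi>) \<le> pi * (L2_weighted_norm \<Omega> \<Psi>)\<^sup>2"
    unfolding wn ef .
qed

text \<open>With the profile constant \<delta> = \<eta>^2 the mass factor 1 + \<delta> \<pi> /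
  \<eta> becomes 1 + \<eta> \<pi>, which tends to 1 with \<eta>. For fixed \<eta> all quantities are
  continuous in \<open>l2\<close>, so density of the domain gives general data.\<close>

lemma cutoff_decay:
  assumes \<omega>: "open \<omega>" and \<theta>: "continuous_on UNIV \<theta>" "\<And>x. x \<ge> R \<Longrightarrow> \<theta> x = \<theta> R"
    and sob: "l2_sobolev \<omega> \<theta> E c" and c: "c > 0"
    and gs: "generates (tube \<omega> \<theta>) (shifted_laplacian (tube \<omega> \<theta>) E) S"
    and \<Psi>: "\<Psi> \<in> L2_weighted (tube \<omega> \<theta>)" and \<eta>: "\<eta> > 0" and t: "t \<ge> 0"
  defines "w \<equiv> L2_weighted_norm (tube \<omega> \<theta>) \<Psi>"
  defines "M \<equiv> (1 + \<eta> * pi) * (pi * w\<^sup>2 + \<eta>)"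
  shows "(exp (- 2 * \<eta>\<^sup>2 * t) * (norm (mul (wt e1 (cutoff \<eta>)) (emb (tube \<omega> \<theta>) (S t \<Psi>))))\<^sup>2)\<^sup>2 * (M\<^sup>2 + 4 * c * t * (w\<^sup>2)\<^sup>2)
     \<le> (w\<^sup>2)\<^sup>2 * M\<^sup>2"
proof -
  define \<Omega> where "\<Omega> = tube \<omega> \<theta>"
  have op: "open \<Omega>" unfolding \<Omega>_def by (rule open_tube[OF \<omega> \<theta>(1)])
  have C: "C0_semigroup \<Omega> S" using gs by (simp add: generates_def \<Omega>_def)
  interpret strongly_continuous_semigroup "extend \<Omega> S" by (rule extend_semigroup[OF op C])
  note LW = L2_weighted_L2[OF op \<Psi>[folded \<Omega>_def], folded w_def[folded \<Omega>_def]]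
  have bmi: "bmeas (indicator \<Omega> :: _ \<Rightarrow> real)" using op by (simp add: bmeas_indicator)
  define F where "F = emb \<Omega> \<Psi>"
  define P where "P = (mul (indicator \<Omega>) :: (real \<times> real \<times> real) l2 \<Rightarrow> _)"
  have PF: "P F = F" unfolding P_def F_def by (rule mul_indicator_emb[OF op LW(1)])
  have PT: "P (extend \<Omega> S t F) = emb \<Omega> (S t \<Psi>)"
  proof -
    have "L2_bounded_operator \<Omega> (S t)" using C t unfolding C0_semigroup_def by blast
    then have "emb \<Omega> (S t (rep_l2 F)) = emb \<Omega> (S t \<Psi>)"
      by (rule L2_bounded_operator_emb(4)[OF op _ sq_int_L2[OF op sq_int_rep] LW(1)])
        (use PF in \<open>simp add: emb_rep[OF op] P_def F_def\<close>)
    then show ?thesis unfolding P_def indicator_extend(1)[OF op C t] .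
  qed
  have "\<eta>\<^sup>2 > 0" using \<eta> by simp
  then obtain p p1 p2 p3 where hp: "heat_profile p p1 p2 p3" and p: "\<And>t x. t \<ge> 0 \<Longrightarrow> p t x \<ge> \<eta>\<^sup>2"
    "\<And>x. 1 / (pi * (1 + x\<^sup>2)) \<le> p 0 x" "\<And>t. t \<ge> 0 \<Longrightarrow> (\<integral>\<^sup>+x. ennreal (p t x - \<eta>\<^sup>2) \<partial>lborel) \<le> 1"
    by (rule cauchy_heat_profile) blast
  have "\<exists>g y. gen g y \<and> norm (g - F) < inverse (real (Suc n))" for n by (rule gen_dense) simp
  then obtain g y where g: "\<And>n. gen (g n) (y n)" "\<And>n. norm (g n - F) < inverse (real (Suc n))" by metis
  have gF: "g \<longlonglongrightarrow> F"
  proof (rule LIM_zero_cancel, rule Lim_null_comparison[OF always_eventually LIMSEQ_inverse_real_of_nat])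
    show "\<forall>n. norm (g n - F) \<le> inverse (real (Suc n))" using g(2) less_imp_le by blast
  qed
  define V where "V n s = P (extend \<Omega> S s (g n))" for n s
  have VP: "(\<lambda>n. V n s) \<longlonglongrightarrow> P (extend \<Omega> S s F)" if "s \<ge> 0" for s
    unfolding V_def P_def
    by (rule bounded_linear.tendsto[OF bounded_linear_mul[OF bmi] bounded_linear.tendsto[OF bounded_linear_T[OF that] gF]])
  have V0: "(\<lambda>n. V n 0) \<longlonglongrightarrow> F" using VP[of 0] by (simp add: T_0 PF)
  have Vt: "(\<lambda>n. V n t) \<longlonglongrightarrow> emb \<Omega> (S t \<Psi>)" using VP[OF t] by (simp add: PT)
  have pm: "p 0 \<in> borel_measurable borel"
    using hp elementary_measurable unfolding heat_profile_def by blast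
  have pp: "p 0 x > 0" for x using p(1)[of 0 x] \<open>\<eta>\<^sup>2 > 0\<close> by linarith
  have qb: "bfun (\<lambda>x. inverse (p 0 x))"
  proof (rule bfunI[where B="inverse (\<eta>\<^sup>2)"])
    show "(\<lambda>x. inverse (p 0 x)) \<in> borel_measurable borel" using pm by measurable
    show "\<bar>inverse (p 0 x)\<bar> \<le> inverse (\<eta>\<^sup>2)" for x
      using pp[of x] le_imp_inverse_le[OF p(1)[of 0 x]] \<open>\<eta>\<^sup>2 > 0\<close> by simp
  qed
  note W = bmeas_wt[OF qb, where e=e1] bmeas_wt[OF bfun_cutoff[of \<eta>], where e=e1]
  define I where "I G = inner (mul (wt e1 (\<lambda>x. inverse (p 0 x))) G) G" for G
  have Ilim: "(\<lambda>n. I (V n 0)) \<longlonglongrightarrow> I F"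
    unfolding I_def by (rule tendsto_inner[OF bounded_linear.tendsto[OF bounded_linear_mul[OF W(1)] V0] V0])
  have I0: "I F \<ge> 0"
    unfolding I_def inner_mul[OF W(1)] by (rule integral_nonneg_AE) (simp add: less_imp_le[OF pp])
  have Iw: "I F \<le> pi * w\<^sup>2"
    unfolding I_def F_def
  proof (rule LW(3)[OF qb])
    fix x :: real
    show "0 \<le> inverse (p 0 x)" using pp[of x] by simp
    have pos: "0 < 1 + x\<^sup>2" by (rule add_pos_nonneg) auto
    have "inverse (p 0 x) \<le> inverse (1 / (pi * (1 + x\<^sup>2)))"
      by (rule le_imp_inverse_le[OF p(2)]) (use pos in simp)
    then show "inverse (p 0 x) \<le> pi * (1 + x\<^sup>2)" by simp
  qed
  define k where "k = 1 + \<eta> * pi"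
  have k: "k > 0" using \<eta> by (simp add: k_def add_pos_pos)
  have kk: "1 + \<eta>\<^sup>2 * (pi / \<eta>) = k" using \<eta> by (simp add: k_def power2_eq_square)
  define X where "X G = (exp (- 2 * \<eta>\<^sup>2 * t) * (norm (mul (wt e1 (cutoff \<eta>)) G))\<^sup>2)\<^sup>2" for G
  have each: "X (V n t) * ((k * (I (V n 0) + \<eta>))\<^sup>2 + 4 * c * t * ((norm (V n 0))\<^sup>2)\<^sup>2) \<le> ((norm (V n 0))\<^sup>2)\<^sup>2 * (k * (I (V n 0) + \<eta>))\<^sup>2" for n
    using domain_decay[OF \<omega> \<theta> sob c gs g(1)[of n, unfolded \<Omega>_def] hp \<open>\<eta>\<^sup>2 > 0\<close> p(1) p(3) \<eta> t]
    unfolding kk by (simp add: X_def V_def P_def \<Omega>_def I_def)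
  have Xlim: "(\<lambda>n. X (V n t)) \<longlonglongrightarrow> X (emb \<Omega> (S t \<Psi>))"
    unfolding X_def
    by (intro tendsto_power tendsto_mult tendsto_const tendsto_norm bounded_linear.tendsto[OF bounded_linear_mul[OF W(2)] Vt])
  have "X (emb \<Omega> (S t \<Psi>)) * ((k * (I F + \<eta>))\<^sup>2 + 4 * c * t * ((norm F)\<^sup>2)\<^sup>2) \<le> ((norm F)\<^sup>2)\<^sup>2 * (k * (I F + \<eta>))\<^sup>2"
  proof (rule LIMSEQ_le)
    show "(\<lambda>n. X (V n t) * ((k * (I (V n 0) + \<eta>))\<^sup>2 + 4 * c * t * ((norm (V n 0))\<^sup>2)\<^sup>2))
        \<longlonglongrightarrow> X (emb \<Omega> (S t \<Psi>)) * ((k * (I F + \<eta>))\<^sup>2 + 4 * c * t * ((norm F)\<^sup>2)\<^sup>2)"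
      by (intro tendsto_intros Xlim Ilim V0)
    show "(\<lambda>n. ((norm (V n 0))\<^sup>2)\<^sup>2 * (k * (I (V n 0) + \<eta>))\<^sup>2) \<longlonglongrightarrow> ((norm F)\<^sup>2)\<^sup>2 * (k * (I F + \<eta>))\<^sup>2"
      by (intro tendsto_intros Ilim V0)
  qed (use each in blast)
  \<comment> \<open>The functional and the norm of the datum are replaced by their bounds in terms
    of the weighted norm w, as the monotonicity of the estimate permits.\<close>
  then have "X (emb \<Omega> (S t \<Psi>)) * (M\<^sup>2 + 4 * c * t * (w\<^sup>2)\<^sup>2) \<le> (w\<^sup>2)\<^sup>2 * M\<^sup>2"
  proof (rule decay_bound_mono)
    show "0 \<le> 4 * c * t" using c t by simp
    show "0 \<le> X (emb \<Omega> (S t \<Psi>))" by (simp add: X_def)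
    show "0 < k * (I F + \<eta>)" using k I0 \<eta> by (intro mult_pos_pos) auto
    show "k * (I F + \<eta>) \<le> M" unfolding M_def k_def[symmetric] using k Iw by (intro mult_left_mono) auto
    show "(norm F)\<^sup>2 \<le> w\<^sup>2" unfolding F_def by (rule power_mono[OF LW(2)]) simp
  qed simp
  then show ?thesis by (simp add: X_def \<Omega>_def)
qed

lemma cutoff_tendsto:
  fixes U :: "(real \<times> real \<times> real) l2"
  shows "(\<lambda>n. (norm (mul (wt e1 (cutoff (inverse (real (Suc n))))) U))\<^sup>2) \<longlonglongrightarrow> (norm U)\<^sup>2"
proof -
  define u where "u = rep_l2 U"
  have us: "sq_int u" by (simp add: u_def sq_int_rep)
  have [measurable]: "u \<in> borel_measurable borel" using us by (simp add: sq_int_def)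
  have W: "bmeas (wt e1 (cutoff \<eta>))" for \<eta> by (rule bmeas_wt[OF bfun_cutoff])
  have eq: "(norm (mul (wt e1 (cutoff \<eta>)) U))\<^sup>2 = (LINT x|lborel. (cutoff \<eta> (x \<bullet> e1))\<^sup>2 * (norm (u x))\<^sup>2)" for \<eta>
    unfolding mul_def u_def[symmetric] norm_cls[OF sq_int_mul[OF W us]] by (simp add: power_mult_distrib)
  have U: "(norm U)\<^sup>2 = (LINT x|lborel. (norm (u x))\<^sup>2)"
    using norm_cls[OF us] by (simp add: u_def)
  show ?thesis
    unfolding eq U
  proof (rule integral_dominated_convergence[where w="\<lambda>x. (norm (u x))\<^sup>2"])
    show "integrable lborel (\<lambda>x. (norm (u x))\<^sup>2)" using us by (simp add: sq_int_def)
    show "AE x in lborel. (\<lambda>n. (cutoff (inverse (real (Suc n))) (x \<bullet> e1))\<^sup>2 * (norm (u x))\<^sup>2) \<longlonglongrightarrow> (norm (u x))\<^sup>2"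
    proof (rule AE_I2)
      fix x
      have "(\<lambda>n. (cutoff (inverse (real (Suc n))) (x \<bullet> e1))\<^sup>2 * (norm (u x))\<^sup>2)
          \<longlonglongrightarrow> (inverse (1 + 0\<^sup>2 * (x \<bullet> e1)\<^sup>2))\<^sup>2 * (norm (u x))\<^sup>2"
        unfolding cutoff_def
        by (intro tendsto_mult tendsto_power tendsto_inverse tendsto_add tendsto_const LIMSEQ_inverse_real_of_nat) simp
      then show "(\<lambda>n. (cutoff (inverse (real (Suc n))) (x \<bullet> e1))\<^sup>2 * (norm (u x))\<^sup>2) \<longlonglongrightarrow> (norm (u x))\<^sup>2" by simp
    qed
    fix n
    show "AE x in lborel. norm ((cutoff (inverse (real (Suc n))) (x \<bullet> e1))\<^sup>2 * (norm (u x))\<^sup>2) \<le> (norm (u x))\<^sup>2"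
    proof (rule AE_I2)
      fix x
      have "(cutoff (inverse (real (Suc n))) (x \<bullet> e1))\<^sup>2 \<le> 1"
        using cutoff_bounds[of "inverse (real (Suc n))" "x \<bullet> e1"] by (simp add: power_le_one)
      then have "(cutoff (inverse (real (Suc n))) (x \<bullet> e1))\<^sup>2 * (norm (u x))\<^sup>2 \<le> 1 * (norm (u x))\<^sup>2" by (rule mult_right_mono) simp
      then show "norm ((cutoff (inverse (real (Suc n))) (x \<bullet> e1))\<^sup>2 * (norm (u x))\<^sup>2) \<le> (norm (u x))\<^sup>2" by simp
    qed
    have [measurable]: "wt e1 (cutoff (inverse (real (Suc n)))) \<in> borel_measurable borel" using W by (simp add: bmeas_def)
    show "(\<lambda>x. (cutoff (inverse (real (Suc n))) (x \<bullet> e1))\<^sup>2 * (norm (u x))\<^sup>2) \<in> borel_measurable lborel" by measurable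
  qed measurable
qed

text \<open>As \<eta> tends to 0 the constant \<open>M\<close> tends to \<pi> w^2 and the cutoff to
  1. Both summands on the left then carry w^4 as the right side does; it cancels, and the fourth
  root is taken.\<close>

lemma semigroup_decay:
  assumes \<omega>: "open \<omega>" and \<theta>: "continuous_on UNIV \<theta>" "\<And>x. x \<ge> R \<Longrightarrow> \<theta> x = \<theta> R"
    and sob: "l2_sobolev \<omega> \<theta> E c" and c: "c > 0"
    and gs: "generates (tube \<omega> \<theta>) (shifted_laplacian (tube \<omega> \<theta>) E) S"
    and \<Psi>: "\<Psi> \<in> L2_weighted (tube \<omega> \<theta>)" and t: "t \<ge> 0"
  defines "w \<equiv> L2_weighted_norm (tube \<omega> \<theta>) \<Psi>"
  shows "L2_norm (tube \<omega> \<theta>) (S t \<Psi>) / w \<le> (1 + 4 * c / pi\<^sup>2 * t) powr (- 1 / 4)"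
proof -
  define U where "U = emb (tube \<omega> \<theta>) (S t \<Psi>)"
  define \<eta> where "\<eta> n = inverse (real (Suc n))" for n
  have \<eta>: "\<eta> n > 0" for n by (simp add: \<eta>_def)
  have \<eta>0: "\<eta> \<longlonglongrightarrow> 0" unfolding \<eta>_def by (rule LIMSEQ_inverse_real_of_nat)
  define M where "M n = (1 + \<eta> n * pi) * (pi * w\<^sup>2 + \<eta> n)" for n
  have Mlim: "M \<longlonglongrightarrow> (1 + 0 * pi) * (pi * w\<^sup>2 + 0)"
    unfolding M_def by (intro tendsto_intros \<eta>0)
  have ct: "(\<lambda>n. (norm (mul (wt e1 (cutoff (\<eta> n))) U))\<^sup>2) \<longlonglongrightarrow> (norm U)\<^sup>2"
    unfolding \<eta>_def by (rule cutoff_tendsto)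
  have "(exp (- 2 * 0\<^sup>2 * t) * (norm U)\<^sup>2)\<^sup>2 * (((1 + 0 * pi) * (pi * w\<^sup>2 + 0))\<^sup>2 + 4 * c * t * (w\<^sup>2)\<^sup>2)
      \<le> (w\<^sup>2)\<^sup>2 * ((1 + 0 * pi) * (pi * w\<^sup>2 + 0))\<^sup>2"
  proof (rule LIMSEQ_le)
    show "(\<lambda>n. (exp (- 2 * (\<eta> n)\<^sup>2 * t) * (norm (mul (wt e1 (cutoff (\<eta> n))) U))\<^sup>2)\<^sup>2 * ((M n)\<^sup>2 + 4 * c * t * (w\<^sup>2)\<^sup>2))
       \<longlonglongrightarrow> (exp (- 2 * 0\<^sup>2 * t) * (norm U)\<^sup>2)\<^sup>2 * (((1 + 0 * pi) * (pi * w\<^sup>2 + 0))\<^sup>2 + 4 * c * t * (w\<^sup>2)\<^sup>2)"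
      by (intro tendsto_intros ct \<eta>0 Mlim)
    show "(\<lambda>n. (w\<^sup>2)\<^sup>2 * (M n)\<^sup>2) \<longlonglongrightarrow> (w\<^sup>2)\<^sup>2 * ((1 + 0 * pi) * (pi * w\<^sup>2 + 0))\<^sup>2"
      by (intro tendsto_mult tendsto_const tendsto_power Mlim)
    show "\<exists>N. \<forall>n\<ge>N. (exp (- 2 * (\<eta> n)\<^sup>2 * t) * (norm (mul (wt e1 (cutoff (\<eta> n))) U))\<^sup>2)\<^sup>2 * ((M n)\<^sup>2 + 4 * c * t * (w\<^sup>2)\<^sup>2)
        \<le> (w\<^sup>2)\<^sup>2 * (M n)\<^sup>2"
      using cutoff_decay[OF \<omega> \<theta> sob c gs \<Psi> \<eta> t] unfolding U_def M_def w_def by blast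
  qed
  then have main: "(norm U) ^ 4 * (pi\<^sup>2 * w ^ 4 + 4 * c * t * w ^ 4) \<le> w ^ 4 * (pi\<^sup>2 * w ^ 4)"
    by (simp add: power_mult_distrib power_mult[symmetric])
  have op: "open (tube \<omega> \<theta>)" by (rule open_tube[OF \<omega> \<theta>(1)])
  have "L2_bounded_operator (tube \<omega> \<theta>) (S t)" using gs t unfolding generates_def C0_semigroup_def by blast
  then have SL: "S t \<Psi> \<in> L2 (tube \<omega> \<theta>)"
    by (rule L2_bounded_operator_emb(1)[OF op _ L2_weighted_L2(1)[OF op \<Psi>]])
  have nU: "L2_norm (tube \<omega> \<theta>) (S t \<Psi>) = norm U" by (simp add: U_def L2_norm_emb[OF SL])
  define a where "a = 1 + 4 * c / pi\<^sup>2 * t"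
  have a: "a \<ge> 1" using c t by (simp add: a_def)
  show ?thesis
  \<comment> \<open>For w = 0 the quotient is 0 by the convention x / 0 = 0, so only w > 0 calls for
    an argument.\<close>
  proof (cases "w = 0")
    case False
    have "0 \<le> w" using L2_weighted_L2(2)[OF op \<Psi>] norm_ge_zero order_trans unfolding w_def by blast
    with False have w: "w > 0" by simp
    have "(norm U) ^ 4 * (pi\<^sup>2 * w ^ 4 + 4 * c * t * w ^ 4) = (pi\<^sup>2 * w ^ 4) * ((norm U) ^ 4 * a)"
      by (simp add: a_def field_simps)
    with main have "(pi\<^sup>2 * w ^ 4) * ((norm U) ^ 4 * a) \<le> (pi\<^sup>2 * w ^ 4) * w ^ 4" by (metis mult.commute)
    then have "(norm U) ^ 4 * a \<le> w ^ 4" by (rule mult_left_le_imp_le) (use w in simp)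
    then have "(norm U / w) ^ 4 \<le> 1 / a" using w a by (simp add: power_divide divide_le_eq le_divide_eq)
    also have "1 / a = (a powr (- 1 / 4)) ^ 4"
    proof -
      have "(a powr (- 1 / 4)) ^ 4 = a powr (real 4 * (- 1 / 4))"
        using a by (simp add: powr_power)
      then show ?thesis using a by (simp add: powr_minus_divide)
    qed
    finally have "norm U / w \<le> a powr (- 1 / 4)"
      by (rule power_le_imp_le_base[where n=3, simplified]) simp
    then show ?thesis by (simp add: nU a_def)
  qed simp
qed

theorem theorem4p1:
  fixes \<omega> :: "(real \<times> real) set"
    and \<theta> :: "real \<Rightarrow> real"
    and c\<^sub>S E\<^sub>1 :: real
    and S :: "real \<Rightarrow> (real \<times> real \<times> real \<Rightarrow> complex) \<Rightarrow> (real \<times> real \<times> real \<Rightarrow> complex)"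
  defines "E\<^sub>1 \<equiv> first_dirichlet_eigenvalue \<omega>"
  assumes "\<omega> \<noteq> {}" "bounded \<omega>" "open \<omega>" "connected \<omega>"
    and "\<theta> C1_differentiable_on UNIV"
    and "compact (closure {s. deriv \<theta> s \<noteq> 0})"
    and "c\<^sub>S > 0"
    and sobolev: "\<forall>\<Psi> \<in> H10 (tube \<omega> \<theta>) \<inter> L2_weighted (tube \<omega> \<theta>). \<not> zero_ae (tube \<omega> \<theta>) \<Psi> \<longrightarrow>
        (grad_norm (tube \<omega> \<theta>) \<Psi>)\<^sup>2 - E\<^sub>1 * (L2_norm (tube \<omega> \<theta>) \<Psi>)\<^sup>2
          \<ge> c\<^sub>S * (L2_norm (tube \<omega> \<theta>) \<Psi> ^ 6 / norm_1 \<omega> \<theta> \<Psi> ^ 4)"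
    and semigroup: "generates (tube \<omega> \<theta>) (shifted_laplacian (tube \<omega> \<theta>) E\<^sub>1) S"
  shows "\<forall>t\<ge>0. weighted_operator_norm (tube \<omega> \<theta>) (S t)
           \<le> ennreal ((1 + 4 * c\<^sub>S / pi\<^sup>2 * t) powr (- 1 / 4))"
proof (intro allI impI)
  fix t :: real assume t: "0 \<le> t"
  obtain D where D: "\<And>x. (\<theta> has_vector_derivative D x) (at x)"
    using \<open>\<theta> C1_differentiable_on UNIV\<close> unfolding C1_differentiable_on_def by auto
  have der: "(\<theta> has_real_derivative D x) (at x)" for x
    using D by (simp add: has_real_derivative_iff_has_vector_derivative)
  have cont: "continuous_on UNIV \<theta>"
    using der by (meson DERIV_isCont continuous_at_imp_continuous_on)
  have "bounded {s. deriv \<theta> s \<noteq> 0}"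
    using compact_imp_bounded[OF \<open>compact (closure {s. deriv \<theta> s \<noteq> 0})\<close>] bounded_subset closure_subset by blast
  then obtain R where R: "\<And>s. deriv \<theta> s \<noteq> 0 \<Longrightarrow> \<bar>s\<bar> \<le> R"
    unfolding bounded_iff by auto
  \<comment> \<open>The support of the derivative lies in |s| \<le> R, so \<open>R + 1\<close> is
    strictly beyond it (for negative R the support is empty); from there on \<open>\<theta>\<close>
    is constant and the tube is straight.\<close>
  have zero: "D s = 0" if "s \<in> {R + 1..}" for s
    using R[of s] that DERIV_imp_deriv[OF der[of s]] by force
  have "\<exists>k. \<forall>x\<in>{R + 1..}. \<theta> x = k"
  proof (rule has_field_derivative_zero_constant)
    show "(\<theta> has_real_derivative 0) (at x within {R + 1..})" if "x \<in> {R + 1..}" for x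
      using has_field_derivative_at_within[OF der[of x], of "{R + 1..}"] zero[OF that] by simp
  qed simp
  then have const: "\<theta> x = \<theta> (R + 1)" if "x \<ge> R + 1" for x
    using that by (metis atLeast_iff order_refl)
  have sob: "l2_sobolev \<omega> \<theta> E\<^sub>1 c\<^sub>S" unfolding l2_sobolev_def by (rule sobolev)
  show "weighted_operator_norm (tube \<omega> \<theta>) (S t) \<le> ennreal ((1 + 4 * c\<^sub>S / pi\<^sup>2 * t) powr (- 1 / 4))"
    unfolding weighted_operator_norm_def
  proof (rule SUP_least, rule ennreal_leI)
    fix \<Psi> assume "\<Psi> \<in> {\<Psi> \<in> L2_weighted (tube \<omega> \<theta>). \<not> zero_ae (tube \<omega> \<theta>) \<Psi>}"
    then have "\<Psi> \<in> L2_weighted (tube \<omega> \<theta>)" by simp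
    from semigroup_decay[OF \<open>open \<omega>\<close> cont const sob \<open>c\<^sub>S > 0\<close> semigroup this t]
    show "L2_norm (tube \<omega> \<theta>) (S t \<Psi>) / L2_weighted_norm (tube \<omega> \<theta>) \<Psi> \<le> (1 + 4 * c\<^sub>S / pi\<^sup>2 * t) powr (- 1 / 4)" .
  qed
qed

end
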